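(* Let $n\ge3$, $1\le k\le n-1$ and $0<a\le\frac12$. Let $g=(g_1,\dots,g_n)$ be given by $g_j=0$ for $j\ne k$ and $g_k(y',s)=g_k^{\mathcal S}(y')\,g_k^{\mathcal T}(s)$, where $g_k^{\mathcal S}\ge0$, $g_k^{\mathcal T}\ge0$, $g_k^{\mathcal S}\in C_c^3(B_1')$, $g_k^{\mathcal T}\in C_c(\mathbb{R})\cap C^1(0,1)$, $\operatorname{supp}(g_k^{\mathcal T})\subset[\tfrac14,1]$ and $g_k^{\mathcal T}(s)=(1-s)^a$ for $s\in[\tfrac12,1]$. Suppose moreover that $$g_k^{\mathcal S}(y')=\prod_{j=1}^{n-1}\mathcal G(y_j),$$ where $\mathcal G:\mathbb{R}\to\mathbb{R}$ is smooth, even, supported in $(-r,r)$ with $r:=\frac4{5\sqrt{n-1}}$, $\mathcal G(x)=1$ for $|x|<p:=\frac1{2\sqrt{n-1}}$, and $\mathcal G'(x)\le0$ for $x>0$. Let $u$ be the solution of the Stokes system in $\mathbb{R}^n_+\times(0,\infty)$ with zero initial data and boundary data $g$ defined by the Golovkin representation formula. Then the following hold. 1) Let $i<n$, $i\ne k$. There are positive constants $C_1,C_2$ such that for any $\alpha,\beta>0$ and any $x\in\mathbb{R}^n_+$ with $|x'|\ge3$, $x_i\ge\alpha$, $x_k\ge\beta$, $x_n\le1$, $$|\partial_{x_n}^2u_i(x,1)|\ge\begin{cases}\dfrac{C_1\alpha\beta}{|x'|^{n+2}}\log\dfrac2{x_n}-\dfrac{C_2}{|x'|^{n-2}}&\text{if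 }a=\frac12,\\[2mm]\dfrac{C_1\alpha\beta}{|x'|^{n+2}x_n^{1-2a}}-\dfrac{C_2}{|x'|^{n-2}}&\text{if }0<a<\frac12,\end{cases}$$ where $C_1,C_2$ are independent of $x$, $\alpha$ and $\beta$. 2) Let $i=k$, and assume further that, with $q:=\frac{13}{20\sqrt{n-1}}$, $\mathcal G''(q)=0$, $\mathcal G''(2q-x)=-\mathcal G''(x)$ for $p\le x\le r$, and $\mathcal G''(x)=0$ on $\big(p,\,p+\frac1{20\sqrt{n-1}}\big)\cup\big(q-\frac1{20\sqrt{n-1}},\,q\big)$. There are positive constants $C_1,C_2$ independent of $x$ such that for any $x\in\mathbb{R}^n_+$ with $|x'|\ge3$ and either $|x_k|<p$, or $|x_k|>r$ and $\big(\sum_{l\ne k,n}x_l^2\big)^{1/2}<\frac32$, $$|\partial_{x_n}^2u_k(x,1)|\ge\begin{cases}\dfrac{C_1}{|x'|^{n+2}}\log\dfrac2{x_n}-\dfrac{C_2}{|x'|^{n-2}}&\text{if }a=\frac12,\\[2mm]\dfrac{C_1}{|x'|^{n+2}x_n^{1-2a}}-\dfrac{C_2}{|x'|^{n-2}}&\text{if }0<a<\frac12.\end{cases}$$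
   Context: Notation: $x=(x',x_n)$, $\mathbb{R}^n_+=\{x\in\mathbb{R}^n : x_n>0\}$, $\Sigma=\mathbb{R}^{n-1}$; a point $y'\in\Sigma$ is identified with $(y',0)\in\mathbb{R}^n$; $B_1'$ is the unit ball of $\mathbb{R}^{n-1}$ centered at $0$. Stokes system: $\partial_t u-\Delta u+\nabla \pi=0$, $\operatorname{div}u=0$ in $\mathbb{R}^n_+\times(0,\infty)$, $u|_{t=0}=0$, $u|_{x_n=0}=g$. Kernels ($n\ge3$): $\Gamma(x,t)=(4\pi t)^{-n/2}e^{-|x|^2/(4t)}$ for $t>0$ and $\Gamma(x,t)=0$ for $t\le0$; $E(x)=\frac{1}{n(n-2)|B_1|}|x|^{2-n}$ ($|B_1|$ is the volume of the unit ball of $\mathbb{R}^n$); $$C_i(x,t)=\int_0^{x_n}\int_\Sigma \partial_n\Gamma(x-z,t)\,\partial_iE(z)\,dz'\,dz_n.$$ Golovkin tensor and representation formula: with $\delta_{ij}$ the Kronecker delta and $\delta(t)$ the Dirac delta in time, $$K_{ij}(x,t)=-2\delta_{ij}\partial_n\Gamma(x,t)-4\partial_jC_i(x,t)-2\delta_{nj}\,\partial_iE(x)\,\delta(t),\qquad u_i(x,t)=\sum_{j=1}^n\int_{-\infty}^\infty\int_\Sigma K_{ij}(x-y',t-s)\,g_j(y',s)\,dy'\,ds,$$ where $g_j(y',s)=0$ for $s<0$ (the $\delta(t)$ term plays no role here since $g_n=0$). *)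

theory Defs
  imports "HOL-Analysis.Analysis"
begin

text \<open>
  Points of \<open>\<real>\<^sup>n\<close> are pairs \<open>x = (x', x\<^sub>n)\<close> of type \<open>real ^ 'm \<times> real\<close> with \<open>n = CARD('m) + 1\<close>.
  A coordinate index \<open>i \<in> {1..n}\<close> is represented by the corresponding standard basis vector;
  \<open>i < n\<close> corresponds to \<open>e_tan i\<close> with \<open>i :: 'm\<close>, and \<open>i = n\<close> to \<open>e_nrm\<close>.
\<close>

definition e_tan :: "'m::finite \<Rightarrow> (real ^ 'm) \<times> real" where
  "e_tan k = (axis k 1, 0)"

definition e_nrm :: "(real ^ 'm::finite) \<times> real" where
  "e_nrm = (0, 1)"

definition pd :: "'a::euclidean_space \<Rightarrow> ('a \<Rightarrow> real) \<Rightarrow> 'a \<Rightarrow> real" where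
  "pd b f x = deriv (\<lambda>h. f (x + h *\<^sub>R b)) 0"

text \<open>Since \<^const>\<open>deriv\<close> is total, the following records that the iterated partial derivative
  \<open>pd b (pd b f) x\<close> genuinely exists.\<close>

definition pd2_exists :: "'a::euclidean_space \<Rightarrow> ('a \<Rightarrow> real) \<Rightarrow> 'a \<Rightarrow> bool" where
  "pd2_exists b f x \<longleftrightarrow>
     (\<forall>\<^sub>F h in nhds 0. (\<lambda>\<tau>. f (x + \<tau> *\<^sub>R b)) differentiable (at h)) \<and>
     (\<lambda>h. pd b f (x + h *\<^sub>R b)) differentiable (at 0)"

definition supp :: "('a::topological_space \<Rightarrow> real) \<Rightarrow> 'a set" where
  "supp f = closure {x. f x \<noteq> 0}"

primrec C_k :: "nat \<Rightarrow> ('a::euclidean_space \<Rightarrow> real) \<Rightarrow> bool" where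
  "C_k 0 f \<longleftrightarrow> continuous_on UNIV f"
| "C_k (Suc m) f \<longleftrightarrow> f differentiable_on UNIV \<and> (\<forall>b\<in>Basis. C_k m (pd b f))"

definition heat_kernel :: "'a::euclidean_space \<Rightarrow> real \<Rightarrow> real" where
  "heat_kernel x t =
     (if t > 0 then (4 * pi * t) powr (- real DIM('a) / 2) * exp (- (norm x)\<^sup>2 / (4 * t)) else 0)"

definition laplace_kernel :: "'a::euclidean_space \<Rightarrow> real" where
  "laplace_kernel x =
     1 / (real DIM('a) * (real DIM('a) - 2) * measure lborel (ball (0::'a) 1))
       * norm x powi (2 - int DIM('a))"

definition C_fun ::
    "(real ^ 'm::finite) \<times> real \<Rightarrow> (real ^ 'm) \<times> real \<Rightarrow> real \<Rightarrow> real" where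
  "C_fun i x t =
     (LBINT zn=0..snd x. (LBINT z'.
        pd e_nrm (\<lambda>w. heat_kernel w t) (x - (z', zn)) * pd i laplace_kernel (z', zn)))"

text \<open>The Golovkin tensor is \<open>K\<^sub>i\<^sub>j(x,t) = golovkin_reg i j x t + golovkin_sing i j x * \<delta>(t)\<close>
  with \<open>\<delta>\<close> the Dirac delta in time; the two parts are kept separate, and integrating the second one
  against \<open>g\<^sub>j\<close> in time evaluates \<open>g\<^sub>j\<close> at time \<open>t\<close>.\<close>

definition golovkin_reg ::
    "(real ^ 'm::finite) \<times> real \<Rightarrow> (real ^ 'm) \<times> real \<Rightarrow> (real ^ 'm) \<times> real \<Rightarrow> real \<Rightarrow> real" where
  "golovkin_reg i j x t =
     - 2 * (if i = j then 1 else 0) * pd e_nrm (\<lambda>w. heat_kernel w t) x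
     - 4 * pd j (\<lambda>w. C_fun i w t) x"

definition golovkin_sing ::
    "(real ^ 'm::finite) \<times> real \<Rightarrow> (real ^ 'm) \<times> real \<Rightarrow> (real ^ 'm) \<times> real \<Rightarrow> real" where
  "golovkin_sing i j x = - 2 * (if j = e_nrm then 1 else 0) * pd i laplace_kernel x"

definition golovkin_solution ::
    "(real ^ 'm::finite \<Rightarrow> real \<Rightarrow> (real ^ 'm) \<times> real) \<Rightarrow>
     (real ^ 'm) \<times> real \<Rightarrow> (real ^ 'm) \<times> real \<Rightarrow> real \<Rightarrow> real" where
  "golovkin_solution g i x t =
     (\<Sum>j\<in>Basis.
        (LBINT s. (LBINT y'. golovkin_reg i j (x - (y', 0)) (t - s) * (g y' s \<bullet> j)))
      + (LBINT y'. golovkin_sing i j (x - (y', 0)) * (g y' t \<bullet> j)))"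

end

theory Submission
  imports Defs
begin

text \<open>
  Write \<open>k\<^sub>t\<close> for the one-dimensional heat kernel and \<open>\<phi>(t) = gT (1 - t)\<close>, so that \<open>\<phi>(t) = t\<^sup>a\<close> near \<open>0\<close>.
  After moving all tangential derivatives onto the datum, the representation formula at time \<open>1\<close> becomes
  \<open>u\<^sub>i(x', x\<^sub>n, 1) = \<integral> \<phi>(t) (- 2 \<delta>\<^sub>i\<^sub>k k\<^sub>t'(x\<^sub>n) Q(t) - 4 \<integral>\<^sub>0\<^bsup>x\<^sub>n\<^esup> k\<^sub>t'(z) h(x\<^sub>n - z, t) dz) dt\<close>, where \<open>Q\<close> is the
  tangential heat flow of \<open>gS\<close> at \<open>x'\<close>, of order \<open>t\<^sup>2\<close> for \<open>|x'| \<ge> 3\<close>, and \<open>h(z, t)\<close> is the tangential heat flow of the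
  potential \<open>F(\<cdot>, z)\<close> of \<open>\<partial>\<^sub>i\<partial>\<^sub>k gS\<close>. As \<open>F\<close> is harmonic for \<open>z > 0\<close>, the derivatives \<open>\<partial>\<^sub>z\<^sup>2 h\<close> are bounded, and two
  derivatives in \<open>x\<^sub>n\<close> leave \<open>- 4 k\<^sub>t''(x\<^sub>n) h(0, t)\<close> plus a bounded remainder of size \<open>|x'|\<^bsup>2-n\<^esup>\<close>. Moreover
  \<open>h(0, t) = \<kappa> F(x', 0) + O(t\<^bsup>1/2\<^esup>)\<close> with \<open>\<kappa> > 0\<close>, so the singular part is \<open>- 4 \<kappa> F(x', 0) \<integral> \<phi> k\<^sub>t''(x\<^sub>n) dt\<close>.
  By the heat equation \<open>k\<^sub>t'' = \<partial>\<^sub>t k\<^sub>t\<close>, and integrating by parts in time this integral is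
  \<open>- a \<integral> t\<^bsup>a-1\<^esup> k\<^sub>t(x\<^sub>n) dt + O(1)\<close>, which produces the logarithm and the power \<open>x\<^sub>n\<^bsup>2a-1\<^esup>\<close>.

  It remains to bound \<open>|F(x', 0)|\<close> from below. For \<open>i \<noteq> k\<close> the integrand is symmetrised under \<open>y\<^sub>i \<mapsto> - y\<^sub>i\<close> and
  \<open>y\<^sub>k \<mapsto> - y\<^sub>k\<close>; since \<open>\<G>'\<close> is odd and nonpositive on the half-line, the mixed second difference of the Laplace kernel
  contributes with a fixed sign. For \<open>i = k\<close> both derivatives are moved back to the Laplace kernel, whose second derivative
  has a constant sign on the support of the datum.
\<close>

text \<open>The delicate point is the budget of powers of t. \<open>hk2\<close> costs t^(-3/2) while
  the profile supplies only t^a with a \<le> 1/2, so its product with h(0,t) cannot be bounded by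
  absolute values uniformly as x_n tends to 0. Replacing h(0,t) by its limit at t = 0 gains t^(1/2),
  and every remainder of the potential part is then at most a multiple of t^(a-1), which is
  integrable. The heat part costs t^(-2), exactly what the t^2 in Q pays for. A second obstacle: on
  the hyperplane, of dimension m = n-1, E behaves like |w|^(1-m), which is locally integrable while
  its tangential gradient is not. Hence integrations by parts take place at heights z > 0, with all
  derivatives ending on the datum, and z = 0 is reached by continuity. Decay in x' is carried by the
  submultiplicative weight 1 + |v|, which turns convolutions into polynomial moments of the heat
  kernel. The exponent n+2 arises from the second derivative of \<rho>^(-(n-2)/2) in the squared
  distance \<rho> if i and k differ, and from the denominator of the second derivative of E if i =
  k.\<close>

section \<open>Affine changes of variables for Lebesgue measure\<close>

lemma nn_integral_lborel_affine:
  fixes f :: "'a::euclidean_space \<Rightarrow> ennreal"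
  assumes [measurable]: "f \<in> borel_measurable borel" and c: "c \<noteq> (0::real)"
  shows "(\<integral>\<^sup>+x. f x \<partial>lborel) = ennreal (\<bar>c\<bar> ^ DIM('a)) * (\<integral>\<^sup>+x. f (t + c *\<^sub>R x) \<partial>lborel)"
  by (subst lborel_affine[OF c, of t])
     (simp add: nn_integral_density nn_integral_distr nn_integral_cmult)

lemma integrable_lborel_affine:
  fixes f :: "'a::euclidean_space \<Rightarrow> real"
  assumes f: "integrable lborel f" and c: "c \<noteq> (0::real)"
  shows "integrable lborel (\<lambda>x. f (t + c *\<^sub>R x))"
  using f f[THEN borel_measurable_integrable] c unfolding integrable_iff_bounded
  by (subst (asm) nn_integral_lborel_affine[where c=c and t=t]) (auto simp: ennreal_mult_less_top)

lemma integral_lborel_affine: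
  fixes f :: "'a::euclidean_space \<Rightarrow> real"
  assumes f: "integrable lborel f" and c: "c \<noteq> (0::real)"
  shows "(\<integral>x. f x \<partial>lborel) = \<bar>c\<bar> ^ DIM('a) * (\<integral>x. f (t + c *\<^sub>R x) \<partial>lborel)"
  using c f f[THEN borel_measurable_integrable] integrable_lborel_affine[OF f c, of t]
  by (subst lborel_affine[OF c, of t]) (simp add: integral_density integral_distr)

lemma integrable_lborel_translate:
  fixes f :: "'a::euclidean_space \<Rightarrow> real"
  assumes f: "integrable lborel f"
  shows "integrable lborel (\<lambda>x. f (x + t))" "integrable lborel (\<lambda>x. f (t - x))"
  using integrable_lborel_affine[OF f, of 1 t] integrable_lborel_affine[OF f, of "-1" t]
  by (auto simp: add.commute)

lemma integral_lborel_translate: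
  fixes f :: "'a::euclidean_space \<Rightarrow> real"
  assumes f: "integrable lborel f"
  shows "(\<integral>x. f (x + t) \<partial>lborel) = (\<integral>x. f x \<partial>lborel)"
        "(\<integral>x. f (t - x) \<partial>lborel) = (\<integral>x. f x \<partial>lborel)"
  using integral_lborel_affine[OF f, of 1 t] integral_lborel_affine[OF f, of "-1" t]
  by (auto simp: add.commute)

lemma integrable_reflect_iff:
  fixes f :: "'a::euclidean_space \<Rightarrow> real"
  shows "integrable lborel (\<lambda>x. f (t - x)) \<longleftrightarrow> integrable lborel f"
  using integrable_lborel_translate(2)[of f t] integrable_lborel_translate(2)[of "\<lambda>x. f (t - x)" t]
  by auto

text \<open>If f is not integrable, both sides are 0 by convention. Time and height variables can
  therefore be reversed before any integrability is known.\<close>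

lemma integral_reflect:
  fixes f :: "'a::euclidean_space \<Rightarrow> real"
  shows "(\<integral>x. f (t - x) \<partial>lborel) = (\<integral>x. f x \<partial>lborel)"
proof (cases "integrable lborel f")
  case True
  then show ?thesis by (rule integral_lborel_translate)
next
  case False
  then show ?thesis
    using integrable_reflect_iff[of f t] by (simp add: not_integrable_integral_eq)
qed

section \<open>Differentiation under the integral, Fubini, and integration by parts\<close>

text \<open>Dominated convergence along sequences: by the mean value theorem every difference
  quotient with increment below d is bounded by the majorant \<open>g\<close>. Measurability of
  \<open>f' x\<close> comes for free, as a pointwise limit of difference quotients.\<close>

lemma has_real_derivative_lebesgue_integral:
  fixes f f' :: "real \<Rightarrow> 'a \<Rightarrow> real"
  assumes d: "d > 0"
    and int: "\<And>t. \<bar>t - x\<bar> < d \<Longrightarrow> integrable M (f t)"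
    and der: "\<And>t y. \<bar>t - x\<bar> < d \<Longrightarrow> y \<in> space M \<Longrightarrow> ((\<lambda>s. f s y) has_real_derivative f' t y) (at t)"
    and bnd: "\<And>t y. \<bar>t - x\<bar> < d \<Longrightarrow> y \<in> space M \<Longrightarrow> \<bar>f' t y\<bar> \<le> g y"
    and g: "integrable M g"
  shows "integrable M (f' x)"
    and "((\<lambda>t. \<integral>y. f t y \<partial>M) has_real_derivative (\<integral>y. f' x y \<partial>M)) (at x)"
proof -
  have quot: "\<bar>(f t y - f x y) / (t - x)\<bar> \<le> g y" if t: "\<bar>t - x\<bar> < d" "t \<noteq> x" and y: "y \<in> space M" for t y
  proof -
    have "\<exists>\<xi>. min x t < \<xi> \<and> \<xi> < max x t \<and> f t y - f x y = (t - x) * f' \<xi> y"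
    proof (cases "x < t")
      case True
      have "\<exists>\<xi>. x < \<xi> \<and> \<xi> < t \<and> f t y - f x y = (t - x) * f' \<xi> y"
        by (rule MVT2[OF True]) (use t y in \<open>auto intro!: der\<close>)
      with True show ?thesis by auto
    next
      case False
      then have lt: "t < x" using t by auto
      have "\<exists>\<xi>. t < \<xi> \<and> \<xi> < x \<and> f x y - f t y = (x - t) * f' \<xi> y"
        by (rule MVT2[OF lt]) (use t y in \<open>auto intro!: der\<close>)
      with lt show ?thesis by (auto simp: algebra_simps)
    qed
    then obtain \<xi> where \<xi>: "min x t < \<xi>" "\<xi> < max x t" "f t y - f x y = (t - x) * f' \<xi> y" by blast
    then have "\<bar>\<xi> - x\<bar> < d" using t by auto
    then have "\<bar>f' \<xi> y\<bar> \<le> g y" using bnd y by auto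
    with \<xi> t show ?thesis by simp
  qed
  have lim: "((\<lambda>t. (f t y - f x y) / (t - x)) \<longlongrightarrow> f' x y) (at x)" if "y \<in> space M" for y
    using der[of x y] that d by (simp add: has_field_derivative_iff)
  have meas: "f' x \<in> borel_measurable M"
  proof (rule borel_measurable_LIMSEQ_real)
    \<comment> \<open>The offset 2 keeps every increment strictly below d, where \<open>f\<close> is
      known to be integrable.\<close>
    have sq: "filterlim (\<lambda>i. x + d / real (i + 2)) (at x) sequentially"
    proof -
      have "(\<lambda>i. x + d / real (i + 2)) \<longlonglongrightarrow> x + 0"
        by (intro tendsto_add tendsto_const real_tendsto_divide_at_top[OF tendsto_const]
            filterlim_compose[OF filterlim_real_sequentially] filterlim_add_const_nat_at_top)
      then show ?thesis using d by (auto simp: filterlim_at)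
    qed
    show "(\<lambda>i. (f (x + d / real (i + 2)) y - f x y) / (x + d / real (i + 2) - x)) \<longlonglongrightarrow> f' x y"
      if "y \<in> space M" for y
      using filterlim_compose[OF lim[OF that] sq] by simp
    show "(\<lambda>y. (f (x + d / real (i + 2)) y - f x y) / (x + d / real (i + 2) - x)) \<in> borel_measurable M" for i
    proof -
      have "integrable M (f x)" using int[of x] d by simp
      moreover have "integrable M (f (x + d / real (i + 2)))"
        using d by (intro int) (auto simp: field_simps intro!: add_pos_nonneg)
      ultimately show ?thesis by measurable
    qed
  qed
  show I: "integrable M (f' x)"
    by (rule Bochner_Integration.integrable_bound[OF g meas]) (use bnd[of x] d in \<open>auto intro!: AE_I2 order_trans[OF _ abs_ge_self]\<close>)
  show "((\<lambda>t. \<integral>y. f t y \<partial>M) has_real_derivative (\<integral>y. f' x y \<partial>M)) (at x)"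
    unfolding has_field_derivative_iff
  proof (rule tendsto_at_iff_sequentially[THEN iffD2])
    show "\<forall>X. (\<forall>i. X i \<in> UNIV - {x}) \<longrightarrow> X \<longlonglongrightarrow> x \<longrightarrow>
      ((\<lambda>t. ((\<integral>y. f t y \<partial>M) - (\<integral>y. f x y \<partial>M)) / (t - x)) \<circ> X) \<longlonglongrightarrow> (\<integral>y. f' x y \<partial>M)"
    proof (intro allI impI)
      fix X :: "nat \<Rightarrow> real" assume X: "\<forall>i. X i \<in> UNIV - {x}" "X \<longlonglongrightarrow> x"
      have "eventually (\<lambda>i. \<bar>X i - x\<bar> < d) sequentially"
        using X(2) d by (auto simp: tendsto_iff dist_real_def)
      then obtain N where N: "\<And>i. i \<ge> N \<Longrightarrow> \<bar>X i - x\<bar> < d" by (auto simp: eventually_sequentially)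
      have X': "filterlim X (at x) sequentially"
        using X by (auto simp: filterlim_at)
      have "(\<lambda>i. \<integral>y. (f (X (i + N)) y - f x y) / (X (i + N) - x) \<partial>M) \<longlonglongrightarrow> (\<integral>y. f' x y \<partial>M)"
      proof (rule integral_dominated_convergence[where w=g])
        show "f' x \<in> borel_measurable M" "integrable M g" by fact+
        show "(\<lambda>y. (f (X (i + N)) y - f x y) / (X (i + N) - x)) \<in> borel_measurable M" for i
        proof -
          have "integrable M (f x)" using int[of x] d by simp
          moreover have "integrable M (f (X (i + N)))"
            by (intro int N) auto
          ultimately show ?thesis by measurable
        qed
        show "AE y in M. (\<lambda>i. (f (X (i + N)) y - f x y) / (X (i + N) - x)) \<longlonglongrightarrow> f' x y"
          using filterlim_compose[OF lim X', THEN LIMSEQ_ignore_initial_segment[where k=N]]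
          by (auto intro!: AE_I2)
        show "AE y in M. norm ((f (X (i + N)) y - f x y) / (X (i + N) - x)) \<le> g y" for i
          using quot[of "X (i+N)"] N[of "i+N"] X by (auto intro!: AE_I2)
      qed
      moreover have eq: "(\<integral>y. (f (X (i + N)) y - f x y) / (X (i + N) - x) \<partial>M) =
          ((\<integral>y. f (X (i + N)) y \<partial>M) - (\<integral>y. f x y \<partial>M)) / (X (i + N) - x)" for i
        using int[OF N, of "i+N"] int[of x] d by simp
      ultimately have "(\<lambda>i. ((\<integral>y. f (X (i + N)) y \<partial>M) - (\<integral>y. f x y \<partial>M)) / (X (i + N) - x)) \<longlonglongrightarrow> (\<integral>y. f' x y \<partial>M)"
        by (simp only: eq)
      from LIMSEQ_offset[OF this]
      show "((\<lambda>t. ((\<integral>y. f t y \<partial>M) - (\<integral>y. f x y \<partial>M)) / (t - x)) \<circ> X) \<longlonglongrightarrow> (\<integral>y. f' x y \<partial>M)"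
        by (simp add: o_def)
    qed
  qed
qed

text \<open>Continuity and bound are required almost everywhere only, because at height 0 the
  Laplace kernel is singular at one value of the integration variable.\<close>

lemma continuous_on_lebesgue_integral:
  fixes f :: "'b::metric_space \<Rightarrow> 'a \<Rightarrow> real"
  assumes meas: "\<And>z. z \<in> S \<Longrightarrow> f z \<in> borel_measurable M"
    and ae: "AE y in M. continuous_on S (\<lambda>z. f z y) \<and> (\<forall>z\<in>S. \<bar>f z y\<bar> \<le> g y)"
    and g: "integrable M g"
  shows "continuous_on S (\<lambda>z. \<integral>y. f z y \<partial>M)"
  unfolding continuous_on_sequentially
proof (intro allI ballI impI)
  fix X a assume a: "a \<in> S" and X: "(\<forall>n. X n \<in> S) \<and> X \<longlonglongrightarrow> a"
  show "((\<lambda>z. \<integral>y. f z y \<partial>M) \<circ> X) \<longlonglongrightarrow> (\<integral>y. f a y \<partial>M)"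
    unfolding o_def
  proof (rule integral_dominated_convergence[where w=g])
    show "AE y in M. (\<lambda>i. f (X i) y) \<longlonglongrightarrow> f a y"
      using ae by eventually_elim (use a X in \<open>auto simp: continuous_on_sequentially o_def\<close>)
    show "AE y in M. norm (f (X i) y) \<le> g y" for i
      using ae by eventually_elim (use a X in auto)
  qed (use meas a X g in auto)
qed

lemma integrable_prod_bound:
  fixes f :: "'a::euclidean_space \<Rightarrow> 'b::euclidean_space \<Rightarrow> real"
  assumes [measurable]: "case_prod f \<in> borel_measurable (lborel \<Otimes>\<^sub>M lborel)"
    and g1: "integrable lborel g1" and g2: "integrable lborel g2"
    and bnd: "\<And>x y. \<bar>f x y\<bar> \<le> g1 x * g2 y"
  shows "integrable (lborel \<Otimes>\<^sub>M lborel) (case_prod f)"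
proof -
  have [measurable]: "g1 \<in> borel_measurable borel" "g2 \<in> borel_measurable borel" using g1 g2 by auto
  have I: "integrable (lborel \<Otimes>\<^sub>M lborel) (\<lambda>(x,y). g1 x * g2 y)"
  proof (rule lborel_pair.Fubini_integrable)
    show "AE x in lborel. integrable lborel (\<lambda>y. case (x, y) of (x, y) \<Rightarrow> g1 x * g2 y)"
      using g2 by (auto intro!: AE_I2)
    show "integrable lborel (\<lambda>x. LBINT y. norm (case (x, y) of (x, y) \<Rightarrow> g1 x * g2 y))"
      using g1 by (simp add: abs_mult)
  qed measurable
  show ?thesis
    by (rule Bochner_Integration.integrable_bound[OF I]) (auto intro!: AE_I2 order_trans[OF bnd])
qed

lemma Fubini_bound:
  fixes f :: "'a::euclidean_space \<Rightarrow> 'b::euclidean_space \<Rightarrow> real"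
  assumes "case_prod f \<in> borel_measurable (lborel \<Otimes>\<^sub>M lborel)"
    and "integrable lborel g1" and "integrable lborel g2"
    and "\<And>x y. \<bar>f x y\<bar> \<le> g1 x * g2 y"
  shows "(LBINT x. LBINT y. f x y) = (LBINT y. LBINT x. f x y)"
  by (rule lborel_pair.Fubini_integral[OF integrable_prod_bound[OF assms], symmetric])

text \<open>Translation invariance gives that h(y+b) - h(y) integrates to 0. Writing this difference
  as the integral of dh(y+sb) over s in [0,1] and exchanging the order returns the integral of dh.
  No boundary term or decay at infinity has to be discussed, integrability of h and dh is
  enough.\<close>

lemma integral_directional_derivative_eq_0:
  fixes h dh :: "'a::euclidean_space \<Rightarrow> real"
  assumes h: "integrable lborel h" and dh: "integrable lborel dh"
    and der: "\<And>y. ((\<lambda>s. h (y + s *\<^sub>R b)) has_real_derivative dh y) (at 0)"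
    and cont: "\<And>y. continuous_on UNIV (\<lambda>s. dh (y + s *\<^sub>R b))"
  shows "(LBINT y. dh y) = 0"
proof -
  have [measurable]: "dh \<in> borel_measurable borel" using dh by auto
  have der': "((\<lambda>s. h (y + s *\<^sub>R b)) has_real_derivative dh (y + t *\<^sub>R b)) (at t)" for y t
  proof -
    have "((\<lambda>s. h (y + t *\<^sub>R b + s *\<^sub>R b)) has_real_derivative dh (y + t *\<^sub>R b)) (at (0::real))"
      by (rule der)
    then have "((\<lambda>s. h (y + (t + s) *\<^sub>R b)) has_real_derivative dh (y + t *\<^sub>R b)) (at (0::real))"
      by (simp add: algebra_simps)
    then show ?thesis
      using DERIV_shift[of "\<lambda>s. h (y + s *\<^sub>R b)" "dh (y + t *\<^sub>R b)" 0 t] by (simp add: add.commute)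
  qed
  have ftc: "(LBINT s. indicator {0..1} s * dh (y + s *\<^sub>R b)) = h (y + b) - h y" for y
  proof -
    have "(LBINT s. indicator {0..1} s *\<^sub>R dh (y + s *\<^sub>R b)) = h (y + 1 *\<^sub>R b) - h (y + 0 *\<^sub>R b)"
      by (rule integral_FTC_Icc)
         (auto intro!: DERIV_subset[OF der'] continuous_on_subset[OF cont]
            simp: has_real_derivative_iff_has_vector_derivative[symmetric])
    then show ?thesis by simp
  qed
  have I: "integrable (lborel \<Otimes>\<^sub>M lborel) (\<lambda>(s,y). indicator {0..1::real} s * dh (y + s *\<^sub>R b))"
  proof (rule lborel_pair.Fubini_integrable)
    show "(\<lambda>(s, y). indicator {0..1} s * dh (y + s *\<^sub>R b)) \<in> borel_measurable (lborel \<Otimes>\<^sub>M lborel)"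
      by measurable
    show "AE s in lborel. integrable lborel (\<lambda>y. case (s, y) of (s, y) \<Rightarrow> indicator {0..1} s * dh (y + s *\<^sub>R b))"
      using integrable_lborel_translate(1)[OF dh] by auto
    have "(LBINT y. \<bar>dh (y + s *\<^sub>R b)\<bar>) = (LBINT y. \<bar>dh y\<bar>)" for s
      by (rule integral_lborel_translate) (use dh in auto)
    then show "integrable lborel (\<lambda>s. LBINT y. norm (case (s, y) of (s, y) \<Rightarrow> indicator {0..1} s * dh (y + s *\<^sub>R b)))"
      by (simp add: abs_mult)
  qed
  have "0 = (LBINT y. h (y + b) - h y)"
    using h integrable_lborel_translate(1)[OF h, of b] integral_lborel_translate(1)[OF h, of b] by simp
  also have "\<dots> = (LBINT y. LBINT s. indicator {0..1} s * dh (y + s *\<^sub>R b))"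
    by (simp add: ftc)
  also have "\<dots> = (LBINT s. LBINT y. indicator {0..1} s * dh (y + s *\<^sub>R b))"
    by (rule lborel_pair.Fubini_integral[OF I])
  also have "\<dots> = (LBINT s. indicator {0..1::real} s * (LBINT y. dh y))"
    by (intro Bochner_Integration.integral_cong) (simp_all add: integral_lborel_translate(1)[OF dh])
  also have "\<dots> = (LBINT y. dh y)" by simp
  finally show ?thesis by simp
qed

lemma integral_by_parts_directional:
  fixes f g df dg :: "'a::euclidean_space \<Rightarrow> real"
  assumes "integrable lborel (\<lambda>y. f y * g y)"
    and i1: "integrable lborel (\<lambda>y. df y * g y)" and i2: "integrable lborel (\<lambda>y. f y * dg y)"
    and df: "\<And>y. ((\<lambda>s. f (y + s *\<^sub>R b)) has_real_derivative df y) (at 0)"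
    and dg: "\<And>y. ((\<lambda>s. g (y + s *\<^sub>R b)) has_real_derivative dg y) (at 0)"
    and cont: "continuous_on UNIV f" "continuous_on UNIV g" "continuous_on UNIV df" "continuous_on UNIV dg"
  shows "(LBINT y. df y * g y) = - (LBINT y. f y * dg y)"
proof -
  have "(LBINT y. df y * g y + f y * dg y) = 0"
  proof (rule integral_directional_derivative_eq_0[where h="\<lambda>y. f y * g y" and b=b])
    show "((\<lambda>s. f (y + s *\<^sub>R b) * g (y + s *\<^sub>R b)) has_real_derivative df y * g y + f y * dg y) (at 0)" for y
      using DERIV_mult[OF df[of y] dg[of y]] by (simp add: algebra_simps)
    show "continuous_on UNIV (\<lambda>s. df (y + s *\<^sub>R b) * g (y + s *\<^sub>R b) + f (y + s *\<^sub>R b) * dg (y + s *\<^sub>R b))" for y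
      by (intro continuous_intros cont[THEN continuous_on_compose2]) auto
  qed (use assms in auto)
  then show ?thesis using i1 i2 by simp
qed

section \<open>Polynomial weights and the integrability of the two model kernels\<close>

text \<open>The weight is submultiplicative under addition of vectors and never vanishes, so
  negative powers of it can be moved through translations and serve as global majorants.\<close>

definition wt :: "'a::real_normed_vector \<Rightarrow> real" where
  "wt v = 1 + norm v"

lemma wt_ge_1: "1 \<le> wt v" and wt_pos: "0 < wt v" and wt_nonneg: "0 \<le> wt v"
  and wt_minus [simp]: "wt (- v) = wt v" and norm_le_wt: "norm v \<le> wt v"
  by (auto simp: wt_def add_pos_nonneg)

lemma wt_add: "wt (x + y) \<le> wt x * wt y"
proof -
  have "1 + norm (x + y) \<le> 1 + (norm x + norm y)" using norm_triangle_ineq by simp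
  also have "\<dots> \<le> (1 + norm x) * (1 + norm y)" by (simp add: algebra_simps)
  finally show ?thesis by (simp add: wt_def)
qed

lemma wt_diff: "wt x \<le> wt (x - y) * wt y"
  using wt_add[of "x - y" y] by simp

text \<open>Peetre's inequality. It is the device by which decay at x - y becomes decay at x, at the
  price of a polynomial factor in y which the heat kernel absorbs.\<close>

lemma wt_inverse_power_shift: "1 / wt (x - y) ^ N \<le> wt y ^ N * (1 / wt x ^ N)"
proof -
  have "wt x ^ N \<le> (wt (x - y) * wt y) ^ N"
    by (intro power_mono wt_diff wt_nonneg)
  then show ?thesis
    using wt_pos[of x] wt_pos[of "x - y"] by (simp add: field_simps power_mult_distrib)
qed

lemma borel_measurable_wt [measurable]: "(wt :: 'a::euclidean_space \<Rightarrow> real) \<in> borel_measurable borel"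
  unfolding wt_def by measurable

text \<open>Tonelli on the set where norm v \<le> s. It replaces polar coordinates: a radial
  decreasing function is written as a superposition of indicators of balls, whose volumes are
  known.\<close>

lemma nn_integral_layer_cake:
  fixes w :: "real \<Rightarrow> ennreal"
  assumes [measurable]: "w \<in> borel_measurable borel"
  shows "(\<integral>\<^sup>+(v::'a::euclidean_space). (\<integral>\<^sup>+s. w s * indicator {norm v..} s \<partial>lborel) \<partial>lborel)
     = (\<integral>\<^sup>+s. w s * indicator {0..} s * ennreal (unit_ball_vol (real DIM('a)) * s ^ DIM('a)) \<partial>lborel)"
proof -
  have "(\<integral>\<^sup>+(v::'a). (\<integral>\<^sup>+s. w s * indicator {norm v..} s \<partial>lborel) \<partial>lborel)
      = (\<integral>\<^sup>+s. (\<integral>\<^sup>+(v::'a). w s * indicator {(v,s). norm v \<le> s} (v, s) \<partial>lborel) \<partial>lborel)"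
    by (subst lborel_pair.Fubini') (auto simp: indicator_def intro!: nn_integral_cong)
  also have "\<dots> = (\<integral>\<^sup>+s. w s * emeasure lborel (cball (0::'a) s) \<partial>lborel)"
  proof (intro nn_integral_cong)
    fix s :: real
    have "(\<integral>\<^sup>+(v::'a). w s * indicator {(v,s). norm v \<le> s} (v, s) \<partial>lborel)
       = (\<integral>\<^sup>+(v::'a). w s * indicator (cball 0 s) v \<partial>lborel)"
      by (intro nn_integral_cong) (auto simp: indicator_def)
    then show "(\<integral>\<^sup>+(v::'a). w s * indicator {(v,s). norm v \<le> s} (v, s) \<partial>lborel) = w s * emeasure lborel (cball (0::'a) s)"
      by (simp add: nn_integral_cmult_indicator)
  qed
  also have "\<dots> = (\<integral>\<^sup>+s. w s * indicator {0..} s * ennreal (unit_ball_vol (real DIM('a)) * s ^ DIM('a)) \<partial>lborel)"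
    by (intro nn_integral_cong) (auto simp: indicator_def emeasure_cball)
  finally show ?thesis .
qed

text \<open>The layers of (1+\<rho>)^(-N) have density N (1+s)^(-N-1). With N = d+1 in dimension d,
  multiplication by the ball volume, of order s^d, leaves (1+s)^(-2). The auxiliary fact
  \<open>tl\<close> is used twice, for the layers and for this last integral.\<close>

lemma integrable_wt:
  "integrable lborel (\<lambda>v::'a::euclidean_space. 1 / wt v ^ (DIM('a) + 1))"
proof (rule integrableI_nonneg)
  let ?N = "DIM('a) + 1" and ?V = "unit_ball_vol (real DIM('a))"
  have tl: "(\<integral>\<^sup>+s. ennreal (real k / (1 + s) ^ (k + 1)) * indicator {\<rho>..} s \<partial>lborel) = ennreal (1 / (1 + \<rho>) ^ k)"
    if "\<rho> \<ge> 0" "k > 0" for \<rho> :: real and k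
  proof -
    have "(\<integral>\<^sup>+s. ennreal (real k / (1 + s) ^ (k + 1)) * indicator {\<rho>..} s \<partial>lborel) = ennreal (0 - (- 1 / (1 + \<rho>) ^ k))"
    proof (rule nn_integral_FTC_atLeast)
      show "((\<lambda>s. - 1 / (1 + s) ^ k) has_real_derivative real k / (1 + s) ^ (k + 1)) (at s)" if "\<rho> \<le> s" for s
      proof -
        have p: "1 + s > 0" using that \<open>\<rho> \<ge> 0\<close> by simp
        obtain j where j: "k = Suc j" using \<open>k > 0\<close> by (cases k) auto
        have "((\<lambda>s. - 1 / (1 + s) ^ Suc j) has_real_derivative
            (0 * (1 + s) ^ Suc j - (- 1) * (real (Suc j) * (1 + s) ^ j)) / ((1 + s) ^ Suc j * (1 + s) ^ Suc j)) (at s)"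
          using p by (intro DERIV_divide DERIV_const DERIV_cong[OF DERIV_power[OF DERIV_add[OF DERIV_const DERIV_ident]]]) auto
        moreover have "(0 * (1 + s) ^ Suc j - (- 1) * (real (Suc j) * (1 + s) ^ j)) / ((1 + s) ^ Suc j * (1 + s) ^ Suc j)
            = real (Suc j) / (1 + s) ^ (Suc j + 1)"
          using p by simp
        ultimately show ?thesis unfolding j by simp
      qed
      show "((\<lambda>s. - 1 / (1 + s) ^ k) \<longlongrightarrow> (0::real)) at_top"
        by (rule tendsto_divide_0[OF tendsto_const filterlim_at_top_imp_at_infinity[OF
            filterlim_pow_at_top[OF \<open>k > 0\<close> filterlim_tendsto_add_at_top[OF tendsto_const filterlim_ident]]]])
    qed (use that in auto)
    then show ?thesis by simp
  qed
  have "(\<integral>\<^sup>+v. ennreal (1 / wt (v::'a) ^ ?N) \<partial>lborel)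
     = (\<integral>\<^sup>+(v::'a). (\<integral>\<^sup>+s. ennreal (real ?N / (1 + s) ^ (?N + 1)) * indicator {norm v..} s \<partial>lborel) \<partial>lborel)"
    unfolding wt_def by (intro nn_integral_cong tl[symmetric]) auto
  also have "\<dots> = (\<integral>\<^sup>+s. ennreal (real ?N / (1 + s) ^ (?N + 1)) * indicator {0..} s * ennreal (?V * s ^ DIM('a)) \<partial>lborel)"
    by (rule nn_integral_layer_cake) measurable
  also have "\<dots> \<le> (\<integral>\<^sup>+s. ennreal (real ?N * ?V) * (ennreal (real 1 / (1 + s) ^ (1 + 1)) * indicator {0..} s) \<partial>lborel)"
  proof (intro nn_integral_mono)
    fix s :: real
    show "ennreal (real ?N / (1 + s) ^ (?N + 1)) * indicator {0..} s * ennreal (?V * s ^ DIM('a))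
      \<le> ennreal (real ?N * ?V) * (ennreal (real 1 / (1 + s) ^ (1 + 1)) * indicator {0..} s)"
    proof (cases "s \<ge> 0")
      case True
      have "s ^ DIM('a) \<le> (1 + s) ^ DIM('a)" using True by (intro power_mono) auto
      then have "real ?N / (1 + s) ^ (?N + 1) * (?V * s ^ DIM('a)) \<le> real ?N / (1 + s) ^ (?N + 1) * (?V * (1 + s) ^ DIM('a))"
        using True by (intro mult_left_mono) auto
      also have "\<dots> = (real ?N * ?V) * (1 / (1 + s) ^ 2)"
      proof -
        have *: "K / q ^ (l + 1 + 1) * (V * q ^ l) = (K * V) * (1 / q ^ 2)" if "q > 0" for q K V :: real and l
          using that by (simp add: power_add power2_eq_square)
        show ?thesis by (rule *) (use True in simp)
      qed
      finally show ?thesis using True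
        by (simp add: ennreal_mult[symmetric] power2_eq_square del: of_nat_add)
    qed simp
  qed
  also have "\<dots> = ennreal (real ?N * ?V) * (\<integral>\<^sup>+s. (ennreal (real 1 / (1 + s) ^ (1 + 1)) * indicator {0..} s) \<partial>lborel)"
    by (rule nn_integral_cmult) measurable
  also have "\<dots> < \<infinity>"
    unfolding tl[of 0 1, simplified] by (subst tl) (auto simp: ennreal_mult_less_top)
  finally show "(\<integral>\<^sup>+v. ennreal (1 / wt (v::'a) ^ ?N) \<partial>lborel) < \<infinity>" .
qed (auto simp: wt_nonneg)

text \<open>The layer density is of order s^(-d), so the ball volume makes it constant on (0,2].
  Cutting off at 2 loses the term 2 / 2^(d-1) \<le> 1, and the factor 2 in the density compensates
  for it, because norm v^(1-d) \<ge> 1 inside the unit ball.\<close>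

lemma integrable_inverse_norm_power:
  assumes "DIM('a::euclidean_space) \<ge> 2"
  shows "integrable lborel (\<lambda>v::'a. indicator (ball 0 1) v * (1 / norm v ^ (DIM('a) - 1)))"
proof (rule integrableI_nonneg)
  let ?V = "unit_ball_vol (real DIM('a))"
  obtain j where j: "DIM('a) = Suc (Suc j)"
    using assms by (metis add_2_eq_Suc le_Suc_ex)
  let ?w = "\<lambda>s. ennreal (2 * real (Suc j) / s ^ Suc (Suc j)) * indicator {0<..2} s"
  have tl: "ennreal (indicator (ball 0 1) v * (1 / norm v ^ (DIM('a) - 1))) \<le> (\<integral>\<^sup>+s. ?w s * indicator {norm v..} s \<partial>lborel)" for v :: 'a
  proof (cases "v \<noteq> 0 \<and> norm v < 1")
    case True
    then have v: "0 < norm v" "norm v < 1" by auto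
    have "(\<integral>\<^sup>+s. ?w s * indicator {norm v..} s \<partial>lborel) = (\<integral>\<^sup>+s. ennreal (2 * real (Suc j) / s ^ Suc (Suc j)) * indicator {norm v..2} s \<partial>lborel)"
      by (intro nn_integral_cong) (use v in \<open>auto simp: indicator_def dest: order_less_le_trans[OF v(1)]\<close>)
    also have "\<dots> = ennreal (- 2 / 2 ^ Suc j - (- 2 / norm v ^ Suc j))"
    proof (rule nn_integral_FTC_Icc)
      show "((\<lambda>s. - 2 / s ^ Suc j) has_real_derivative 2 * real (Suc j) / s ^ Suc (Suc j)) (at s)" if "s \<in> {norm v..2}" for s
      proof -
        have p: "s > 0" using that v(1) by (meson atLeastAtMost_iff less_le_trans)
        have "((\<lambda>s. - 2 / s ^ Suc j) has_real_derivative
            (0 * s ^ Suc j - (- 2) * (real (Suc j) * s ^ j)) / (s ^ Suc j * s ^ Suc j)) (at s)"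
          using p by (intro DERIV_divide DERIV_const DERIV_cong[OF DERIV_power[OF DERIV_ident]]) auto
        moreover have "(0 * s ^ Suc j - (- 2) * (real (Suc j) * s ^ j)) / (s ^ Suc j * s ^ Suc j) = 2 * real (Suc j) / s ^ Suc (Suc j)"
          using p by simp
        ultimately show ?thesis by simp
      qed
      show "0 \<le> 2 * real (Suc j) / s ^ Suc (Suc j)" if "s \<in> {norm v..2}" for s
        using that order_trans[OF norm_ge_zero[of v], of s] by simp
    qed (use v in auto)
    finally have eq: "(\<integral>\<^sup>+s. ?w s * indicator {norm v..} s \<partial>lborel) = ennreal (- 2 / 2 ^ Suc j - (- 2 / norm v ^ Suc j))" .
    have "norm v ^ Suc j \<le> 1" using v by (intro power_le_one) auto
    then have "1 \<le> 1 / norm v ^ Suc j" using v by (simp add: field_simps)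
    moreover have "(2::real) / 2 ^ Suc j \<le> 1" by simp
    moreover have "2 / norm v ^ Suc j = 2 * (1 / norm v ^ Suc j)" by simp
    ultimately have "1 / norm v ^ Suc j \<le> - 2 / 2 ^ Suc j - (- 2 / norm v ^ Suc j)"
      unfolding minus_divide_left[symmetric] by linarith
    then show ?thesis unfolding eq using True j by (auto intro!: ennreal_leI)
  next
    \<comment> \<open>At v = 0 the function is 1 / 0 = 0, and outside the ball the indicator
      vanishes.\<close>
    case False
    then show ?thesis using j by (auto simp: indicator_def)
  qed
  have "(\<integral>\<^sup>+v. ennreal (indicator (ball 0 1) (v::'a) * (1 / norm v ^ (DIM('a) - 1))) \<partial>lborel)
     \<le> (\<integral>\<^sup>+(v::'a). (\<integral>\<^sup>+s. ?w s * indicator {norm v..} s \<partial>lborel) \<partial>lborel)"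
    by (intro nn_integral_mono tl)
  also have "\<dots> = (\<integral>\<^sup>+s. ?w s * indicator {0..} s * ennreal (?V * s ^ DIM('a)) \<partial>lborel)"
    by (rule nn_integral_layer_cake) measurable
  also have "\<dots> = (\<integral>\<^sup>+s. ennreal (2 * real (Suc j) * ?V) * indicator {0<..2::real} s \<partial>lborel)"
    by (intro nn_integral_cong) (auto simp: indicator_def j ennreal_mult[symmetric])
  also have "\<dots> < \<infinity>"
    by (subst nn_integral_cmult_indicator) (auto simp: ennreal_mult_less_top)
  finally show "(\<integral>\<^sup>+v. ennreal (indicator (ball 0 1) (v::'a) * (1 / norm v ^ (DIM('a) - 1))) \<partial>lborel) < \<infinity>" .
  show "(\<lambda>v::'a. indicator (ball 0 1) v * (1 / norm v ^ (DIM('a) - 1))) \<in> borel_measurable lborel"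
  proof -
    have [measurable]: "ball (0::'a) 1 \<in> sets borel" by simp
    show ?thesis by measurable
  qed
qed auto

text \<open>Inside the unit ball the weight is at most 1, outside it the singular factor is. The
  first summand does not involve x and the second is a translate in it, hence the resulting integral
  is bounded uniformly in x.\<close>

lemma wt_norm_power_split:
  fixes x w :: "'a::euclidean_space"
  shows "1 / wt (x - w) ^ (DIM('a) + 1) * (1 / norm w ^ (DIM('a) - 1))
     \<le> indicator (ball 0 1) w * (1 / norm w ^ (DIM('a) - 1)) + 1 / wt (x - w) ^ (DIM('a) + 1)"
proof -
  have 1: "1 / wt (x - w) ^ (DIM('a) + 1) \<le> 1" using wt_ge_1[of "x - w"] by (simp add: divide_le_eq_1 one_le_power del: power_Suc)
  have 0: "0 \<le> 1 / wt (x - w) ^ (DIM('a) + 1)" using wt_nonneg[of "x - w"] by simp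
  show ?thesis
  proof (cases "norm w < 1")
    case True
    have "1 / wt (x - w) ^ (DIM('a) + 1) * (1 / norm w ^ (DIM('a) - 1)) \<le> 1 * (1 / norm w ^ (DIM('a) - 1))"
      by (intro mult_right_mono 1) auto
    moreover have ind: "indicator (ball 0 1) w = (1::real)" using True by simp
    ultimately show ?thesis unfolding ind using 0 by linarith
  next
    case False
    then have "1 \<le> norm w ^ (DIM('a) - 1)" by (intro one_le_power) auto
    then have "1 / norm w ^ (DIM('a) - 1) \<le> 1" unfolding divide_le_eq_1 by linarith
    then have "1 / wt (x - w) ^ (DIM('a) + 1) * (1 / norm w ^ (DIM('a) - 1)) \<le> 1 / wt (x - w) ^ (DIM('a) + 1) * 1"
      by (intro mult_left_mono 0)
    then show ?thesis using False by simp
  qed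
qed

lemma integrable_wt_norm:
  assumes "DIM('a::euclidean_space) \<ge> 2"
  shows "integrable lborel (\<lambda>w::'a. 1 / wt (x - w) ^ (DIM('a) + 1) * (1 / norm w ^ (DIM('a) - 1)))"
proof (rule Bochner_Integration.integrable_bound)
  show "integrable lborel (\<lambda>w::'a. indicator (ball 0 1) w * (1 / norm w ^ (DIM('a) - 1)) + 1 / wt (x - w) ^ (DIM('a) + 1))"
    by (intro Bochner_Integration.integrable_add integrable_inverse_norm_power assms
        integrable_lborel_translate(2)[OF integrable_wt])
  show "AE w::'a in lborel. norm (1 / wt (x - w) ^ (DIM('a) + 1) * (1 / norm w ^ (DIM('a) - 1)))
      \<le> norm (indicator (ball 0 1) w * (1 / norm w ^ (DIM('a) - 1)) + 1 / wt (x - w) ^ (DIM('a) + 1))"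
  proof (rule AE_I2)
    fix w :: 'a
    have "0 \<le> 1 / wt (x - w) ^ (DIM('a) + 1) * (1 / norm w ^ (DIM('a) - 1))"
      using wt_nonneg[of "x - w"] by simp
    then show "norm (1 / wt (x - w) ^ (DIM('a) + 1) * (1 / norm w ^ (DIM('a) - 1)))
      \<le> norm (indicator (ball 0 1) w * (1 / norm w ^ (DIM('a) - 1)) + 1 / wt (x - w) ^ (DIM('a) + 1))"
      unfolding real_norm_def using wt_norm_power_split[of x w] by linarith
  qed
qed measurable

lemma integral_wt_norm_bound:
  assumes "DIM('a::euclidean_space) \<ge> 2"
  shows "\<exists>C>0. \<forall>x. (LBINT w::'a. 1 / wt (x - w) ^ (DIM('a) + 1) * (1 / norm w ^ (DIM('a) - 1))) \<le> C"
proof -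
  let ?A = "LBINT w::'a. indicator (ball 0 1) w * (1 / norm w ^ (DIM('a) - 1))"
  let ?B = "LBINT w::'a. 1 / wt w ^ (DIM('a) + 1)"
  have "(LBINT w::'a. 1 / wt (x - w) ^ (DIM('a) + 1) * (1 / norm w ^ (DIM('a) - 1))) \<le> max 1 (?A + ?B)" for x
  proof -
    have "(LBINT w::'a. 1 / wt (x - w) ^ (DIM('a) + 1) * (1 / norm w ^ (DIM('a) - 1)))
      \<le> (LBINT w::'a. indicator (ball 0 1) w * (1 / norm w ^ (DIM('a) - 1)) + 1 / wt (x - w) ^ (DIM('a) + 1))"
      by (intro integral_mono integrable_wt_norm Bochner_Integration.integrable_add integrable_inverse_norm_power assms
        integrable_lborel_translate(2)[OF integrable_wt] wt_norm_power_split)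
    also have "\<dots> = ?A + (LBINT w::'a. 1 / wt (x - w) ^ (DIM('a) + 1))"
      by (intro Bochner_Integration.integral_add integrable_inverse_norm_power assms
        integrable_lborel_translate(2)[OF integrable_wt])
    also have "\<dots> = ?A + ?B"
      using integral_lborel_translate(2)[OF integrable_wt, of x] by simp
    finally show ?thesis by simp
  qed
  then show ?thesis by (intro exI[of _ "max 1 (?A + ?B)"]) auto
qed

subsection \<open>The heat kernel\<close>

lemma heat_kernel_pos: "t > 0 \<Longrightarrow> heat_kernel x t = (4 * pi * t) powr (- real DIM('a) / 2) * exp (- (norm x)\<^sup>2 / (4 * t))"
  for x :: "'a::euclidean_space"
  by (simp add: heat_kernel_def)

lemma heat_kernel_nonneg: "0 \<le> heat_kernel x t"
  by (simp add: heat_kernel_def)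

lemma heat_kernel_minus: "heat_kernel (- x) t = heat_kernel x t"
  by (simp add: heat_kernel_def)

lemma heat_kernel_Pair:
  "heat_kernel (v :: 'a::euclidean_space, z :: 'b::euclidean_space) t = heat_kernel v t * heat_kernel z t"
proof (cases "t > 0")
  case True
  have "- (real DIM('a) + real DIM('b)) / 2 = - real DIM('a) / 2 + - real DIM('b) / 2" by (simp add: field_simps)
  then have "(4 * pi * t) powr (- (real DIM('a) + real DIM('b)) / 2)
      = (4 * pi * t) powr (- real DIM('a) / 2) * (4 * pi * t) powr (- real DIM('b) / 2)"
    by (metis powr_add)
  moreover have "exp (- (norm (v, z))\<^sup>2 / (4 * t)) = exp (- (norm v)\<^sup>2 / (4 * t)) * exp (- (norm z)\<^sup>2 / (4 * t))"
    by (simp add: norm_Pair exp_add[symmetric] diff_divide_distrib)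
  ultimately show ?thesis using True by (simp add: heat_kernel_pos)
qed (simp add: heat_kernel_def)

lemma borel_measurable_heat_kernel [measurable]:
  fixes f :: "'b \<Rightarrow> 'a::euclidean_space"
  assumes [measurable]: "f \<in> borel_measurable M" "g \<in> borel_measurable M"
  shows "(\<lambda>x. heat_kernel (f x) (g x)) \<in> borel_measurable M"
  unfolding heat_kernel_def by measurable

lemma continuous_on_heat_kernel [continuous_intros]:
  fixes f :: "'b::topological_space \<Rightarrow> 'a::euclidean_space"
  assumes "continuous_on S f"
  shows "continuous_on S (\<lambda>x. heat_kernel (f x) t)"
  unfolding heat_kernel_def by (cases "t > 0") (auto intro!: continuous_intros assms)

lemma has_real_derivative_heat_kernel:
  fixes v b :: "'a::euclidean_space"
  shows "((\<lambda>s. heat_kernel (v + s *\<^sub>R b) t) has_real_derivative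
      - ((v + s *\<^sub>R b) \<bullet> b) / (2 * t) * heat_kernel (v + s *\<^sub>R b) t) (at s)"
proof (cases "t > 0")
  case True
  have e: "(norm (v + s *\<^sub>R b))\<^sup>2 = v \<bullet> v + 2 * s * (v \<bullet> b) + s\<^sup>2 * (b \<bullet> b)" for s
    unfolding power2_norm_eq_inner by (simp add: inner_simps inner_commute power2_eq_square algebra_simps)
  show ?thesis
    unfolding heat_kernel_pos[OF True] e
    by (rule derivative_eq_intros refl | use True in \<open>simp add: field_simps inner_simps\<close>)+
qed (simp add: heat_kernel_def)

text \<open>From 1 + \<rho> \<le> exp \<rho> the weight is at most exp(N \<rho>), and completing the
  square gives N \<rho> - \<rho>^2/(4t) \<le> N^2 t.\<close>

lemma exp_norm_sq_le:
  assumes "t > 0"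
  shows "exp (- (norm v)\<^sup>2 / (4 * t)) \<le> exp (real N ^ 2 * t) / wt v ^ N"
proof -
  have "wt v ^ N \<le> exp (norm v) ^ N"
    unfolding wt_def by (intro power_mono) auto
  also have "\<dots> = exp (real N * norm v)" by (simp add: exp_of_nat_mult)
  finally have 1: "wt v ^ N \<le> exp (real N * norm v)" .
  have "0 \<le> (norm v - 2 * real N * t)\<^sup>2" by simp
  then have "real N * norm v * (4 * t) \<le> (norm v)\<^sup>2 + real N ^ 2 * t * (4 * t)"
    by (simp add: power2_eq_square algebra_simps)
  then have "real N * norm v + - (norm v)\<^sup>2 / (4 * t) \<le> real N ^ 2 * t"
    using assms by (simp add: field_simps)
  then have "exp (real N * norm v) * exp (- (norm v)\<^sup>2 / (4 * t)) \<le> exp (real N ^ 2 * t)"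
    by (simp add: exp_add[symmetric])
  moreover have "wt v ^ N * exp (- (norm v)\<^sup>2 / (4 * t)) \<le> exp (real N * norm v) * exp (- (norm v)\<^sup>2 / (4 * t))"
    using 1 by (intro mult_right_mono) auto
  ultimately have "wt v ^ N * exp (- (norm v)\<^sup>2 / (4 * t)) \<le> exp (real N ^ 2 * t)" by linarith
  then show ?thesis using wt_pos[of v] by (simp add: pos_le_divide_eq mult.commute)
qed

lemma heat_kernel_le_wt:
  assumes "t > 0"
  shows "\<exists>C>0. \<forall>v::'a::euclidean_space. heat_kernel v t \<le> C / wt v ^ N"
proof -
  have "heat_kernel v t \<le> ((4 * pi * t) powr (- real DIM('a) / 2) * exp (real N ^ 2 * t)) / wt v ^ N" for v :: 'a
    unfolding heat_kernel_pos[OF assms]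
    using mult_left_mono[OF exp_norm_sq_le[OF assms, of v N], of "(4 * pi * t) powr (- real DIM('a) / 2)"]
    by simp
  moreover have "0 < (4 * pi * t) powr (- real DIM('a) / 2) * exp (real N ^ 2 * t)" using assms by simp
  ultimately show ?thesis by blast
qed

lemma heat_kernel_le_wt_mult:
  assumes "t > 0"
  shows "\<exists>C>0. \<forall>v::'a::euclidean_space. wt v ^ j * heat_kernel v t \<le> C / wt v ^ N"
proof -
  obtain C where C: "C > 0" "\<And>v::'a. heat_kernel v t \<le> C / wt v ^ (j + N)"
    using heat_kernel_le_wt[OF assms] by blast
  have "wt v ^ j * heat_kernel v t \<le> C / wt v ^ N" for v :: 'a
    using C(2)[of v] wt_pos[of v] by (simp add: field_simps power_add)
  with C(1) show ?thesis by blast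
qed

lemma integrable_heat_kernel_wt:
  assumes "t > 0"
  shows "integrable lborel (\<lambda>v::'a::euclidean_space. heat_kernel v t * wt v ^ j)"
proof -
  obtain C where C: "C > 0" "\<And>v::'a. wt v ^ j * heat_kernel v t \<le> C / wt v ^ (DIM('a) + 1)"
    using heat_kernel_le_wt_mult[OF assms] by blast
  show ?thesis
  proof (rule Bochner_Integration.integrable_bound)
    show "integrable lborel (\<lambda>v::'a. C * (1 / wt v ^ (DIM('a) + 1)))"
      by (intro Bochner_Integration.integrable_mult_right integrable_wt)
    show "AE v in lborel. norm (heat_kernel (v::'a) t * wt v ^ j) \<le> norm (C * (1 / wt v ^ (DIM('a) + 1)))"
      using C by (auto intro!: AE_I2 simp: abs_mult heat_kernel_nonneg wt_nonneg mult.commute simp del: power_Suc)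
  qed measurable
qed

lemma integrable_heat_kernel: "t > 0 \<Longrightarrow> integrable lborel (\<lambda>v::'a::euclidean_space. heat_kernel v t)"
  using integrable_heat_kernel_wt[of t 0] by simp

lemma heat_kernel_scale:
  fixes v :: "'a::euclidean_space"
  assumes "t > 0"
  shows "sqrt t ^ DIM('a) * heat_kernel (sqrt t *\<^sub>R v) t = heat_kernel v 1"
proof -
  have "sqrt t ^ DIM('a) * (4 * pi * t) powr (- real DIM('a) / 2) = (4 * pi) powr (- real DIM('a) / 2)"
  proof -
    have "sqrt t ^ DIM('a) = t powr (real DIM('a) / 2)"
      using assms by (simp add: powr_realpow[symmetric] powr_half_sqrt[symmetric] powr_powr)
    then show ?thesis using assms by (simp add: powr_mult powr_add[symmetric])
  qed
  moreover have "(norm (sqrt t *\<^sub>R v))\<^sup>2 / (4 * t) = (norm v)\<^sup>2 / 4"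
    using assms by (simp add: power_mult_distrib)
  ultimately show ?thesis using assms
    by (simp add: heat_kernel_pos mult.assoc[symmetric])
qed

lemma integral_heat_kernel_scale:
  fixes f :: "'a::euclidean_space \<Rightarrow> real"
  assumes t: "t > 0" and int: "integrable lborel (\<lambda>v. heat_kernel v t * f v)"
  shows "(LBINT v. heat_kernel v t * f v) = (LBINT v. heat_kernel v 1 * f (sqrt t *\<^sub>R v))"
proof -
  have "(LBINT v. heat_kernel v t * f v) = \<bar>sqrt t\<bar> ^ DIM('a) * (LBINT v. heat_kernel (0 + sqrt t *\<^sub>R v) t * f (0 + sqrt t *\<^sub>R v))"
    by (rule integral_lborel_affine[OF int]) (use t in auto)
  also have "\<dots> = (LBINT v. \<bar>sqrt t\<bar> ^ DIM('a) * (heat_kernel (0 + sqrt t *\<^sub>R v) t * f (0 + sqrt t *\<^sub>R v)))"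
    by simp
  also have "\<dots> = (LBINT v. heat_kernel v 1 * f (sqrt t *\<^sub>R v))"
  proof -
    have "\<bar>sqrt t\<bar> ^ DIM('a) * (heat_kernel (0 + sqrt t *\<^sub>R v) t * f (0 + sqrt t *\<^sub>R v)) = heat_kernel v 1 * f (sqrt t *\<^sub>R v)" for v
      using heat_kernel_scale[OF t, of v] t by (simp add: mult.assoc[symmetric])
    then show ?thesis by (intro Bochner_Integration.integral_cong refl)
  qed
  finally show ?thesis .
qed

lemma integral_heat_kernel: "t > 0 \<Longrightarrow> (LBINT v::'a::euclidean_space. heat_kernel v t) = (LBINT v::'a. heat_kernel v 1)"
  using integral_heat_kernel_scale[of t "\<lambda>_. 1"] integrable_heat_kernel[of t] by simp

text \<open>This integral is the constant \<kappa> of the overview; it is carried along as a symbol.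
  On the unit ball the kernel is at least its value on the unit sphere.\<close>

lemma integral_heat_kernel_pos: "0 < (LBINT v::'a::euclidean_space. heat_kernel v 1)"
proof -
  let ?c = "(4 * pi) powr (- real DIM('a) / 2) * exp (- 1 / 4)"
  have "0 < (LBINT v::'a. indicator (ball 0 1) v * ?c)"
    using content_ball_pos[of 1 "0::'a"] by (simp del: content_ball_pos)
  also have "\<dots> \<le> (LBINT v::'a. heat_kernel v 1)"
  proof (rule integral_mono)
    show "indicator (ball 0 1) v * ?c \<le> heat_kernel v 1" for v :: 'a
      by (auto simp: indicator_def heat_kernel_nonneg heat_kernel_pos power_le_one intro!: mult_left_mono)
  qed (use emeasure_lborel_ball_finite[of "0::'a" 1] in \<open>auto intro!: integrable_heat_kernel Bochner_Integration.integrable_mult_left integrable_real_indicator\<close>)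
  finally show ?thesis .
qed

text \<open>After the substitution v = sqrt t * v' the kernel is taken at time 1, and for t \<le> 1
  the rescaled weight does not exceed the original one. The additional factor norm v contributes
  sqrt t, which is the gain behind the rate at which the heat flow approaches its initial
  value.\<close>

lemma heat_moment_bound:
  "\<exists>C>0. \<forall>t. 0 < t \<and> t \<le> 1 \<longrightarrow> (LBINT v::'a::euclidean_space. heat_kernel v t * wt v ^ j) \<le> C \<and>
     (LBINT v::'a. heat_kernel v t * (norm v * wt v ^ j)) \<le> C * sqrt t"
proof -
  let ?C = "LBINT v::'a. heat_kernel v 1 * wt v ^ Suc j"
  have pos: "0 \<le> ?C" by (intro integral_nonneg_AE) (auto simp: heat_kernel_nonneg wt_nonneg)
  have s: "wt (sqrt t *\<^sub>R v) \<le> wt v" if "0 < t" "t \<le> 1" for t and v :: 'a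
    using that by (auto simp: wt_def mult_left_le_one_le real_sqrt_le_1_iff)
  have i2: "integrable lborel (\<lambda>v::'a. heat_kernel v t * (norm v * wt v ^ j))" if "t > 0" for t
    by (rule Bochner_Integration.integrable_bound[OF integrable_heat_kernel_wt[OF that, of "Suc j"]])
       (auto intro!: AE_I2 mult_left_mono mult_right_mono norm_le_wt simp: abs_mult heat_kernel_nonneg wt_nonneg)
  have 1: "(LBINT v::'a. heat_kernel v t * wt v ^ j) \<le> ?C" if t: "0 < t" "t \<le> 1" for t
  proof -
    have "(LBINT v::'a. heat_kernel v t * wt v ^ j) = (LBINT v::'a. heat_kernel v 1 * wt (sqrt t *\<^sub>R v) ^ j)"
      by (rule integral_heat_kernel_scale[OF t(1) integrable_heat_kernel_wt[OF t(1)]])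
    also have "\<dots> \<le> ?C"
    proof (rule integral_mono_AE')
      show "AE v::'a in lborel. heat_kernel v 1 * wt (sqrt t *\<^sub>R v) ^ j \<le> heat_kernel v 1 * wt v ^ Suc j"
      proof (intro AE_I2 mult_left_mono heat_kernel_nonneg)
        fix v :: 'a
        have "wt (sqrt t *\<^sub>R v) ^ j \<le> wt v ^ j" by (intro power_mono s t wt_nonneg)
        also have "\<dots> \<le> wt v ^ Suc j" by (intro power_increasing wt_ge_1) auto
        finally show "wt (sqrt t *\<^sub>R v) ^ j \<le> wt v ^ Suc j" .
      qed
    qed (auto intro!: AE_I2 integrable_heat_kernel_wt simp: heat_kernel_nonneg wt_nonneg simp del: power_Suc)
    finally show ?thesis .
  qed
  have 2: "(LBINT v::'a. heat_kernel v t * (norm v * wt v ^ j)) \<le> ?C * sqrt t" if t: "0 < t" "t \<le> 1" for t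
  proof -
    have "(LBINT v::'a. heat_kernel v t * (norm v * wt v ^ j)) = (LBINT v::'a. heat_kernel v 1 * (norm (sqrt t *\<^sub>R v) * wt (sqrt t *\<^sub>R v) ^ j))"
      by (rule integral_heat_kernel_scale[OF t(1) i2[OF t(1)]])
    also have "\<dots> \<le> (LBINT v::'a. (heat_kernel v 1 * wt v ^ Suc j) * sqrt t)"
    proof (rule integral_mono_AE')
      show "AE v::'a in lborel. heat_kernel v 1 * (norm (sqrt t *\<^sub>R v) * wt (sqrt t *\<^sub>R v) ^ j) \<le> heat_kernel v 1 * wt v ^ Suc j * sqrt t"
      proof (rule AE_I2)
        fix v :: 'a
        have "norm (sqrt t *\<^sub>R v) * wt (sqrt t *\<^sub>R v) ^ j \<le> (sqrt t * wt v) * wt v ^ j"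
          using t by (intro mult_mono power_mono s wt_nonneg) (auto simp: norm_le_wt wt_nonneg)
        then have "heat_kernel v 1 * (norm (sqrt t *\<^sub>R v) * wt (sqrt t *\<^sub>R v) ^ j) \<le> heat_kernel v 1 * ((sqrt t * wt v) * wt v ^ j)"
          by (intro mult_left_mono heat_kernel_nonneg)
        then show "heat_kernel v 1 * (norm (sqrt t *\<^sub>R v) * wt (sqrt t *\<^sub>R v) ^ j) \<le> heat_kernel v 1 * wt v ^ Suc j * sqrt t"
          by (simp add: mult_ac)
      qed
    qed (use t in \<open>auto intro!: AE_I2 Bochner_Integration.integrable_mult_left integrable_heat_kernel_wt simp: heat_kernel_nonneg wt_nonneg simp del: power_Suc\<close>)
    also have "\<dots> = ?C * sqrt t" by simp
    finally show ?thesis .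
  qed
  have "(LBINT v::'a. heat_kernel v t * wt v ^ j) \<le> ?C + 1" "(LBINT v::'a. heat_kernel v t * (norm v * wt v ^ j)) \<le> (?C + 1) * sqrt t"
    if t: "0 < t" "t \<le> 1" for t
  proof -
    have "?C * sqrt t \<le> (?C + 1) * sqrt t" using t by (intro mult_right_mono) auto
    then show "(LBINT v::'a. heat_kernel v t * (norm v * wt v ^ j)) \<le> (?C + 1) * sqrt t"
      using 2[OF t] by (rule order_trans[rotated])
  qed (use 1[OF t] in linarith)
  then show ?thesis using pos by (intro exI[of _ "?C + 1"]) auto
qed

section \<open>Extension across the boundary and differentiation of a convolution\<close>

lemma antiderivative_real:
  fixes g :: "real \<Rightarrow> real"
  assumes "continuous_on UNIV g"
  shows "\<exists>G. \<forall>x. (G has_real_derivative g x) (at x)"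
proof (intro exI allI)
  fix x :: real
  let ?b = "\<bar>x\<bar> + 1"
  have "((\<lambda>u. LBINT y=ereal 0..ereal u. g y) has_vector_derivative g x) (at x within {-?b..?b})"
    by (rule interval_integral_FTC2) (auto intro!: continuous_on_subset[OF assms])
  then have "((\<lambda>u. LBINT y=ereal 0..ereal u. g y) has_vector_derivative g x) (at x within {-?b<..<?b})"
    by (rule has_vector_derivative_within_subset) auto
  then show "((\<lambda>u. LBINT y=ereal 0..ereal u. g y) has_real_derivative g x) (at x)"
    unfolding has_real_derivative_iff_has_vector_derivative
    by (subst (asm) has_vector_derivative_within_open) auto
qed

text \<open>The second derivative is frozen at its boundary value for z < 0 and integrated twice;
  both constants of integration are fixed on the open half-line, and continuity carries the identity
  to z = 0. In this way a one-sided derivative of f at 0 exists without being assumed, and Leibniz'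
  rule on the whole line becomes applicable.\<close>

lemma half_line_C2_extension:
  fixes f f' g :: "real \<Rightarrow> real"
  assumes f: "continuous_on {0..} f" and g: "continuous_on {0..} g"
    and f': "\<And>z. z > 0 \<Longrightarrow> (f has_real_derivative f' z) (at z)"
    and f'': "\<And>z. z > 0 \<Longrightarrow> (f' has_real_derivative g z) (at z)"
  shows "\<exists>F F1. (\<forall>z. (F has_real_derivative F1 z) (at z)) \<and>
    (\<forall>z. (F1 has_real_derivative g (max 0 z)) (at z)) \<and> (\<forall>z\<ge>0. F z = f z)"
proof -
  have gc: "continuous_on UNIV (\<lambda>z. g (max 0 z))"
    by (intro continuous_on_compose2[OF g] continuous_intros) auto
  obtain G where G: "\<And>z. (G has_real_derivative g (max 0 z)) (at z)"
    using antiderivative_real[OF gc] by blast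
  have "\<exists>c. \<forall>z\<in>{0<..}. f' z - G z = c"
  proof (rule has_field_derivative_zero_constant)
    show "((\<lambda>z. f' z - G z) has_real_derivative 0) (at z within {0<..})" if "z \<in> {0<..}" for z
      using DERIV_diff[OF f''[of z] G[of z]] that by (auto simp: max_def intro: DERIV_subset)
  qed simp
  then obtain c where c: "\<And>z. z > 0 \<Longrightarrow> f' z - G z = c" by auto
  define F1 where "F1 z = c + G z" for z
  have F1: "(F1 has_real_derivative g (max 0 z)) (at z)" for z
    unfolding F1_def using DERIV_add[OF DERIV_const G[of z], of c] by simp
  have "continuous_on UNIV F1"
    using F1 by (meson DERIV_isCont continuous_at_imp_continuous_on)
  then obtain F0 where F0: "\<And>z. (F0 has_real_derivative F1 z) (at z)"
    using antiderivative_real by blast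
  have "\<exists>e. \<forall>z\<in>{0<..}. f z - F0 z = e"
  proof (rule has_field_derivative_zero_constant)
    show "((\<lambda>z. f z - F0 z) has_real_derivative 0) (at z within {0<..})" if "z \<in> {0<..}" for z
      using DERIV_diff[OF f'[of z] F0[of z]] that c[of z] by (auto simp: F1_def intro: DERIV_subset)
  qed simp
  then obtain e where e: "\<And>z. z > 0 \<Longrightarrow> f z - F0 z = e" by auto
  have cont: "continuous_on {0..} (\<lambda>z. f z - F0 z)"
    using F0 by (intro continuous_intros f) (meson DERIV_isCont continuous_at_imp_continuous_on)
  have "f z - F0 z = e" if "z \<ge> 0" for z
  proof (rule continuous_constant_on_closure[of "{0<..}" "\<lambda>z. f z - F0 z" e z])
    show "continuous_on (closure {0<..}) (\<lambda>z. f z - F0 z)" using cont by simp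
  qed (use e that in auto)
  moreover have "((\<lambda>z. e + F0 z) has_real_derivative F1 z) (at z)" for z
    using DERIV_add[OF DERIV_const F0[of z], of e] by simp
  ultimately show ?thesis using F1
    by (intro exI[of _ "\<lambda>z. e + F0 z"] exI[of _ F1]) (auto simp: algebra_simps)
qed

text \<open>The integrand and the upper limit both depend on x. They are separated into two
  variables, the function of the pair is shown to be differentiable from its partial derivatives,
  and the chain rule is applied along the diagonal.\<close>

lemma convolution_has_real_derivative:
  fixes \<gamma> H H' :: "real \<Rightarrow> real"
  assumes \<gamma>: "continuous_on UNIV \<gamma>" and H: "\<And>x. (H has_real_derivative H' x) (at x)"
    and H': "continuous_on UNIV H'" and x: "x > 0"
  shows "((\<lambda>x. integral {0..x} (\<lambda>z. \<gamma> z * H (x - z))) has_real_derivative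
     \<gamma> x * H 0 + integral {0..x} (\<lambda>z. \<gamma> z * H' (x - z))) (at x)"
proof -
  have Hc: "continuous_on UNIV H"
    using H by (meson DERIV_isCont continuous_at_imp_continuous_on)
  note c = continuous_on_compose2[OF \<gamma>] continuous_on_compose2[OF Hc] continuous_on_compose2[OF H']
  let ?f = "\<lambda>x b. integral {0..b} (\<lambda>z. \<gamma> z * H (x - z))"
  let ?D = "integral {0..x} (\<lambda>z. \<gamma> z * H' (x - z))"
  have 1: "((\<lambda>y. ?f y x) has_derivative (*) ?D) (at x within UNIV)"
  proof -
    have "((\<lambda>y. integral (cbox 0 x) (\<lambda>z. \<gamma> z * H (y - z))) has_field_derivative
        integral (cbox 0 x) (\<lambda>z. \<gamma> z * H' (x - z))) (at x within UNIV)"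
    proof (rule leibniz_rule_field_derivative)
      show "((\<lambda>y. \<gamma> z * H (y - z)) has_real_derivative \<gamma> z * H' (y - z)) (at y within UNIV)" for y z
      proof -
        have "((\<lambda>y. H (y - z)) has_real_derivative H' (y - z) * 1) (at y)"
          by (rule DERIV_chain2[OF H]) (auto intro!: derivative_eq_intros)
        then show ?thesis by (auto intro!: DERIV_cmult)
      qed
      show "(\<lambda>z. \<gamma> z * H (y - z)) integrable_on cbox 0 x" for y
        by (intro integrable_continuous continuous_intros c) auto
      show "continuous_on (UNIV \<times> cbox 0 x) (\<lambda>(y, z). \<gamma> z * H' (y - z))"
        unfolding case_prod_beta by (intro continuous_intros c) auto
    qed auto
    then show ?thesis by (simp add: has_field_derivative_def)
  qed
  \<comment> \<open>The interval {0..2*x} is chosen so that x lies in its interior; the derivative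
    within it is a full derivative at x.\<close>
  have 2: "((\<lambda>b. ?f y b) has_derivative blinfun_apply (blinfun_mult_right (\<gamma> b * H (y - b)))) (at b within {0..2*x})"
    if "b \<in> {0..2*x}" for y b
  proof -
    have "((\<lambda>b. ?f y b) has_real_derivative \<gamma> b * H (y - b)) (at b within {0..2*x})"
      by (rule integral_has_real_derivative[OF _ that]) (intro continuous_intros c, auto)
    then show ?thesis by (simp add: has_field_derivative_def)
  qed
  have 3: "continuous (at (x, x) within UNIV \<times> {0..2*x}) (\<lambda>(y, b). blinfun_mult_right (\<gamma> b * H (y - b)))"
  proof -
    have "continuous_on UNIV (\<lambda>(y, b). blinfun_mult_right (\<gamma> b * H (y - b)))"
      unfolding case_prod_beta
      by (intro bounded_linear.continuous_on[OF bounded_linear_blinfun_mult_right] continuous_intros c) auto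
    then show ?thesis
      by (auto simp: continuous_on_eq_continuous_within intro: continuous_within_subset)
  qed
  have "((\<lambda>(y, b). ?f y b) has_derivative (\<lambda>(ty, tb). ?D * ty + blinfun_apply (blinfun_mult_right (\<gamma> x * H (x - x))) tb))
      (at (x, x) within UNIV \<times> {0..2*x})"
    using has_derivative_partialsI[where f="?f" and fy="\<lambda>y b. blinfun_mult_right (\<gamma> b * H (y - b))" and X=UNIV and Y="{0..2*x}", OF 1 2 3] x
    by auto
  then have "((\<lambda>(y, b). ?f y b) has_derivative (\<lambda>(ty, tb). ?D * ty + blinfun_apply (blinfun_mult_right (\<gamma> x * H (x - x))) tb))
      (at ((\<lambda>y. (y, y)) x) within (\<lambda>y. (y, y)) ` {0<..<2*x})"
    by (rule has_derivative_subset) auto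
  moreover have "((\<lambda>y. (y, y)) has_derivative (\<lambda>h. (h, h))) (at x within {0<..<2*x})"
    by (auto intro!: derivative_eq_intros)
  ultimately have "((\<lambda>y. ?f y y) has_derivative (\<lambda>h. ?D * h + (\<gamma> x * H 0) * h)) (at x within {0<..<2*x})"
    using has_derivative_in_compose[of "\<lambda>y. (y, y)" "\<lambda>h. (h, h)" x "{0<..<2*x}" "\<lambda>(y, b). ?f y b"
        "\<lambda>(ty, tb). ?D * ty + blinfun_apply (blinfun_mult_right (\<gamma> x * H (x - x))) tb"] by simp
  then have "((\<lambda>y. ?f y y) has_derivative (\<lambda>h. ?D * h + (\<gamma> x * H 0) * h)) (at x)"
    using at_within_open[of x "{0<..<2*x}"] x by simp
  moreover have "(\<lambda>h. ?D * h + (\<gamma> x * H 0) * h) = (*) (\<gamma> x * H 0 + ?D)"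
    by (auto simp: fun_eq_iff algebra_simps)
  ultimately show ?thesis
    by (simp add: has_field_derivative_def)
qed

subsection \<open>The one-dimensional heat kernel\<close>

text \<open>\<open>hk1\<close>, \<open>hk2\<close> and \<open>hk3\<close> are the closed forms of
  the first three spatial derivatives of the one-dimensional Gaussian. For t \<le> 0 they vanish
  together with \<open>heat_kernel\<close>.\<close>

definition hk1 :: "real \<Rightarrow> real \<Rightarrow> real" where
  "hk1 x t = - x / (2 * t) * heat_kernel x t"

definition hk2 :: "real \<Rightarrow> real \<Rightarrow> real" where
  "hk2 x t = (x\<^sup>2 / (4 * t\<^sup>2) - 1 / (2 * t)) * heat_kernel x t"

definition hk3 :: "real \<Rightarrow> real \<Rightarrow> real" where
  "hk3 x t = (3 * x / (4 * t\<^sup>2) - x ^ 3 / (8 * t ^ 3)) * heat_kernel x t"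

lemma DERIV_heat_kernel: "((\<lambda>x. heat_kernel x t) has_real_derivative hk1 x t) (at x)" for x :: real
  using has_real_derivative_heat_kernel[of 0 "1::real" t x] by (simp add: hk1_def)

lemma DERIV_hk1: "((\<lambda>x. hk1 x t) has_real_derivative hk2 x t) (at x)"
proof -
  have "((\<lambda>x. (- 1 / (2 * t)) * (x * heat_kernel x t)) has_real_derivative
      (- 1 / (2 * t)) * (1 * heat_kernel x t + hk1 x t * x)) (at x)"
    by (intro DERIV_cmult DERIV_mult DERIV_ident DERIV_heat_kernel)
  moreover have "(\<lambda>x. (- 1 / (2 * t)) * (x * heat_kernel x t)) = (\<lambda>x. hk1 x t)"
    by (simp add: hk1_def fun_eq_iff)
  moreover have "(- 1 / (2 * t)) * (1 * heat_kernel x t + hk1 x t * x) = hk2 x t"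
    by (cases "t = 0") (simp_all add: hk1_def hk2_def field_simps power2_eq_square)
  ultimately show ?thesis by simp
qed

lemma DERIV_hk2: "((\<lambda>x. hk2 x t) has_real_derivative hk3 x t) (at x)"
proof -
  have "((\<lambda>x. (1 / (4 * t\<^sup>2)) * (x\<^sup>2 * heat_kernel x t) - (1 / (2 * t)) * heat_kernel x t) has_real_derivative
      (1 / (4 * t\<^sup>2)) * (2 * x * heat_kernel x t + hk1 x t * x\<^sup>2) - (1 / (2 * t)) * hk1 x t) (at x)"
    by (intro DERIV_diff DERIV_cmult DERIV_mult DERIV_heat_kernel) (auto intro!: derivative_eq_intros)
  moreover have "(\<lambda>x. (1 / (4 * t\<^sup>2)) * (x\<^sup>2 * heat_kernel x t) - (1 / (2 * t)) * heat_kernel x t) = (\<lambda>x. hk2 x t)"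
    by (simp add: hk2_def fun_eq_iff left_diff_distrib)
  moreover have "(1 / (4 * t\<^sup>2)) * (2 * x * heat_kernel x t + hk1 x t * x\<^sup>2) - (1 / (2 * t)) * hk1 x t = hk3 x t"
    by (cases "t = 0") (simp_all add: hk1_def hk3_def field_simps power2_eq_square power3_eq_cube)
  ultimately show ?thesis by simp
qed

lemma heat_kernel_real: "t > 0 \<Longrightarrow> heat_kernel x t = exp (- x\<^sup>2 / (4 * t)) / sqrt (4 * pi * t)" for x :: real
  by (simp add: heat_kernel_pos powr_minus powr_half_sqrt divide_simps)

text \<open>The one-dimensional heat equation: the second spatial derivative reappears as the time
  derivative.\<close>

lemma DERIV_heat_kernel_time:
  fixes x :: real
  assumes "t > 0"
  shows "((\<lambda>t. heat_kernel x t) has_real_derivative hk2 x t) (at t)"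
proof -
  have "((\<lambda>t. exp (- x\<^sup>2 / (4 * t)) / sqrt (4 * pi * t)) has_real_derivative hk2 x t) (at t)"
  proof -
    have s: "sqrt (4 * pi * t) * sqrt (4 * pi * t) = 4 * pi * t" "sqrt (4 * pi * t) > 0" using assms by auto
    have "((\<lambda>t. exp (- x\<^sup>2 / (4 * t)) / sqrt (4 * pi * t)) has_real_derivative
       (exp (- x\<^sup>2 / (4 * t)) * (x\<^sup>2 / (4 * t\<^sup>2)) * sqrt (4 * pi * t) - exp (- x\<^sup>2 / (4 * t)) * (inverse (sqrt (4 * pi * t)) / 2 * (4 * pi))) / (sqrt (4 * pi * t) * sqrt (4 * pi * t))) (at t)"
    proof (rule DERIV_divide)
      show "((\<lambda>t. exp (- x\<^sup>2 / (4 * t))) has_real_derivative exp (- x\<^sup>2 / (4 * t)) * (x\<^sup>2 / (4 * t\<^sup>2))) (at t)"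
        using assms by (auto intro!: derivative_eq_intros simp: power2_eq_square)
      show "((\<lambda>t. sqrt (4 * pi * t)) has_real_derivative inverse (sqrt (4 * pi * t)) / 2 * (4 * pi)) (at t)"
        using assms by (auto intro!: derivative_eq_intros simp: mult_less_0_iff)
    qed (use s(2) assms in simp)
    also have "(exp (- x\<^sup>2 / (4 * t)) * (x\<^sup>2 / (4 * t\<^sup>2)) * sqrt (4 * pi * t) - exp (- x\<^sup>2 / (4 * t)) * (inverse (sqrt (4 * pi * t)) / 2 * (4 * pi))) / (sqrt (4 * pi * t) * sqrt (4 * pi * t))
      = hk2 x t"
    proof -
      let ?e = "exp (- x\<^sup>2 / (4 * t))" and ?s = "sqrt (4 * pi * t)"
      have *: "(e * X * S - e * (inverse S / 2 * (4 * P))) / (S * S) = (X - 4 * P / (2 * (S * S))) * (e / S)"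
        if "S > 0" for e X S P :: real
        using that by (simp add: field_simps)
      have "4 * pi / (2 * (4 * pi * t)) = 1 / (2 * t)" using pi_gt_zero by simp
      then show ?thesis
        unfolding hk2_def heat_kernel_real[OF assms] by (subst *[OF s(2)], subst s(1)) simp
    qed
    finally show ?thesis .
  qed
  moreover have "\<forall>\<^sub>F t in nhds t. heat_kernel x t = exp (- x\<^sup>2 / (4 * t)) / sqrt (4 * pi * t)"
    using eventually_nhds_in_open[of "{0<..}" t] assms
    by (auto elim!: eventually_mono simp: heat_kernel_real)
  ultimately show ?thesis by (subst DERIV_cong_ev[OF refl _ refl])
qed

text \<open>The exponent 7 is 3 + 4: a prefactor of degree up to 3 in x / sqrt t is absorbed in the
  bounds for the derivatives, and a fourth power must remain to cancel t^(-2) away from x = 0. The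
  constant exp 49 is exp(N^2) with N = 7 at the rescaled time 1.\<close>

lemma heat_kernel_real_le:
  fixes x :: real
  assumes "t > 0"
  shows "heat_kernel x t \<le> exp 49 / (sqrt t * wt (x / sqrt t) ^ 7)"
proof -
  have "exp (- (norm (x / sqrt t))\<^sup>2 / (4 * 1)) \<le> exp (real 7 ^ 2 * 1) / wt (x / sqrt t) ^ 7"
    by (rule exp_norm_sq_le) simp
  then have e: "exp (- x\<^sup>2 / (4 * t)) \<le> exp 49 / wt (x / sqrt t) ^ 7"
    using assms by (simp add: power_divide mult.commute)
  have "1 \<le> sqrt (4 * pi)" using pi_gt3 by (intro real_le_rsqrt) auto
  then have "sqrt t * 1 \<le> sqrt t * sqrt (4 * pi)" using assms by (intro mult_left_mono) auto
  then have s: "sqrt t \<le> sqrt (4 * pi * t)" by (simp add: real_sqrt_mult mult_ac)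
  have "heat_kernel x t \<le> (exp 49 / wt (x / sqrt t) ^ 7) / sqrt t"
    unfolding heat_kernel_real[OF assms]
    by (intro frac_le e s) (use assms wt_nonneg[of "x / sqrt t"] in auto)
  then show ?thesis by (simp add: mult.commute)
qed

lemma abs_le_sqrt_wt: "t > 0 \<Longrightarrow> \<bar>x\<bar> \<le> sqrt t * wt (x / sqrt t)" for x :: real
  by (simp add: wt_def algebra_simps abs_divide)

text \<open>With w the weight of x / sqrt t, each factor x in the polynomial prefactor costs at most
  sqrt t * w, and each spatial derivative costs t^(-1/2).\<close>

lemma hk_bounds:
  fixes x :: real
  assumes t: "t > 0"
  defines "w \<equiv> wt (x / sqrt t)"
  shows "\<bar>hk1 x t\<bar> \<le> exp 49 / (t * w ^ 4)"
    and "\<bar>hk2 x t\<bar> \<le> exp 49 / (t * sqrt t * w ^ 4)"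
    and "\<bar>hk3 x t\<bar> \<le> exp 49 / (t\<^sup>2 * w ^ 4)"
proof -
  obtain s where s: "s > 0" "t = s\<^sup>2" "sqrt t = s" using t by (intro that[of "sqrt t"]) auto
  have w: "w \<ge> 1" "w > 0" using wt_ge_1 wt_pos by (auto simp: w_def)
  have k: "0 \<le> heat_kernel x t" "heat_kernel x t \<le> exp 49 / (s * w ^ 7)"
    using heat_kernel_real_le[OF t, of x] by (auto simp: heat_kernel_nonneg w_def s(3))
  have x: "\<bar>x\<bar> \<le> s * w" using abs_le_sqrt_wt[OF t, of x] by (simp add: w_def s(3))
  have x2: "x\<^sup>2 \<le> (s * w)\<^sup>2" using power_mono[OF x, of 2] by simp
  have x3: "\<bar>x ^ 3\<bar> \<le> (s * w) ^ 3" using power_mono[OF x, of 3] by (simp add: power_abs)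
  have step: "\<bar>c * heat_kernel x t\<bar> \<le> C * (exp 49 / (s * w ^ 7))" if "\<bar>c\<bar> \<le> C" for c C
    unfolding abs_mult using that k by (intro mult_mono) auto
  have "\<bar>- x / (2 * t)\<bar> \<le> s * w / (2 * s\<^sup>2)"
    using x s by (simp add: abs_divide divide_right_mono)
  from step[OF this] have "\<bar>hk1 x t\<bar> \<le> s * w / (2 * s\<^sup>2) * (exp 49 / (s * w ^ 7))"
    by (simp add: hk1_def)
  also have "\<dots> = exp 49 / (s\<^sup>2 * w ^ 6) / 2"
    using s w by (simp add: field_simps eval_nat_numeral)
  also have "\<dots> \<le> exp 49 / (s\<^sup>2 * w ^ 6)"
  proof -
    have half: "E / 2 \<le> E" if "0 \<le> E" for E :: real using that by simp
    show ?thesis by (rule half) (use w in simp)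
  qed
  also have "\<dots> \<le> exp 49 / (s\<^sup>2 * w ^ 4)"
    using s w by (intro divide_left_mono mult_left_mono power_increasing) auto
  finally show "\<bar>hk1 x t\<bar> \<le> exp 49 / (t * w ^ 4)" by (simp add: s)
  have "\<bar>x\<^sup>2 / (4 * t\<^sup>2) - 1 / (2 * t)\<bar> \<le> x\<^sup>2 / (4 * t\<^sup>2) + 1 / (2 * t)"
    using t by (intro abs_leI) (auto simp: field_simps)
  also have "\<dots> \<le> (s * w)\<^sup>2 / (4 * t\<^sup>2) + 1 / (2 * t)"
    using x2 t by (intro add_right_mono divide_right_mono) auto
  also have "\<dots> = (w\<^sup>2 / 4 + 1 / 2) / s\<^sup>2"
    using s by (simp add: field_simps eval_nat_numeral)
  also have "\<dots> \<le> w\<^sup>2 / s\<^sup>2"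
  proof (intro divide_right_mono)
    have "1 \<le> w\<^sup>2" using w by (intro one_le_power)
    then show "w\<^sup>2 / 4 + 1 / 2 \<le> w\<^sup>2" by linarith
  qed (use s in simp)
  finally have b: "\<bar>x\<^sup>2 / (4 * t\<^sup>2) - 1 / (2 * t)\<bar> \<le> w\<^sup>2 / s\<^sup>2" .
  from step[OF b] have "\<bar>hk2 x t\<bar> \<le> w\<^sup>2 / s\<^sup>2 * (exp 49 / (s * w ^ 7))"
    unfolding hk2_def .
  also have "\<dots> = exp 49 / (s\<^sup>2 * s * w ^ 5)"
    using s w by (simp add: field_simps eval_nat_numeral)
  also have "\<dots> \<le> exp 49 / (s\<^sup>2 * s * w ^ 4)"
    using s w by (intro divide_left_mono mult_left_mono power_increasing) auto
  finally show "\<bar>hk2 x t\<bar> \<le> exp 49 / (t * sqrt t * w ^ 4)" unfolding s(3) by (simp add: s(2))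
  have "\<bar>3 * x / (4 * t\<^sup>2) - x ^ 3 / (8 * t ^ 3)\<bar> \<le> \<bar>3 * x / (4 * t\<^sup>2)\<bar> + \<bar>x ^ 3 / (8 * t ^ 3)\<bar>"
    by (rule abs_triangle_ineq4)
  also have "\<dots> = 3 * \<bar>x\<bar> / (4 * t\<^sup>2) + \<bar>x ^ 3\<bar> / (8 * t ^ 3)"
    using t by (simp add: abs_divide abs_mult)
  also have "\<dots> \<le> 3 * (s * w) / (4 * t\<^sup>2) + (s * w) ^ 3 / (8 * t ^ 3)"
    using x x3 t by (intro add_mono divide_right_mono mult_left_mono) auto
  also have "\<dots> = (3 / 4 * w + w ^ 3 / 8) / s ^ 3"
    using s by (simp add: field_simps eval_nat_numeral)
  also have "\<dots> \<le> w ^ 3 / s ^ 3"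
  proof -
    have "w ^ 1 \<le> w ^ 3" using w by (intro power_increasing) auto
    then show ?thesis using s w by (intro divide_right_mono) auto
  qed
  finally have b: "\<bar>3 * x / (4 * t\<^sup>2) - x ^ 3 / (8 * t ^ 3)\<bar> \<le> w ^ 3 / s ^ 3" .
  from step[OF b] have "\<bar>hk3 x t\<bar> \<le> w ^ 3 / s ^ 3 * (exp 49 / (s * w ^ 7))"
    unfolding hk3_def .
  also have "\<dots> = exp 49 / ((s\<^sup>2)\<^sup>2 * w ^ 4)"
    using s w by (simp add: field_simps eval_nat_numeral)
  finally show "\<bar>hk3 x t\<bar> \<le> exp 49 / (t\<^sup>2 * w ^ 4)" by (simp add: s)
qed

lemma hk_bounds_simple:
  assumes "t > 0"
  shows "heat_kernel x t \<le> exp 49 / sqrt t"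
    and "\<bar>hk1 x t\<bar> \<le> exp 49 / t" and "\<bar>hk2 x t\<bar> \<le> exp 49 / (t * sqrt t)" and "\<bar>hk3 x t\<bar> \<le> exp 49 / t\<^sup>2"
proof -
  have w: "1 \<le> wt (x / sqrt t) ^ k" for k by (intro one_le_power wt_ge_1)
  have le: "E / (c * wt (x / sqrt t) ^ k) \<le> E / c" if "c > 0" "E > 0" for E c :: real and k
  proof (rule divide_left_mono)
    show "c \<le> c * wt (x / sqrt t) ^ k" using mult_left_mono[OF w, of c k] that by simp
    have "0 < wt (x / sqrt t) ^ k" using w[of k] by linarith
    then show "0 < c * wt (x / sqrt t) ^ k * c" using that by simp
  qed (use that in auto)
  show "heat_kernel x t \<le> exp 49 / sqrt t" "\<bar>hk1 x t\<bar> \<le> exp 49 / t" "\<bar>hk2 x t\<bar> \<le> exp 49 / (t * sqrt t)" "\<bar>hk3 x t\<bar> \<le> exp 49 / t\<^sup>2"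
    using assms by (auto intro!: order_trans[OF heat_kernel_real_le] order_trans[OF hk_bounds(1)] order_trans[OF hk_bounds(2)]
        order_trans[OF hk_bounds(3)] le)
qed

text \<open>Since the weight of x / sqrt t is at least x1 / sqrt t, its fourth power provides t^2 /
  x1^4, which cancels the worst singularity t^(-2). These bounds are not uniform as x1 tends to 0;
  they supply majorants for differentiation.\<close>

lemma hk_bounds_away:
  assumes t: "0 < t" "t \<le> 1" and x: "0 < x1" "x1 \<le> x"
  shows "\<bar>hk1 x t\<bar> \<le> exp 49 / x1 ^ 4" and "\<bar>hk2 x t\<bar> \<le> exp 49 / x1 ^ 4" and "\<bar>hk3 x t\<bar> \<le> exp 49 / x1 ^ 4"
proof -
  obtain s where s: "s > 0" "t = s\<^sup>2" "sqrt t = s" using t by (intro that[of "sqrt t"]) auto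
  have s1: "s \<le> 1" using t s by (metis real_sqrt_le_1_iff)
  have "x1 / s \<le> wt (x / s)" using x s by (auto simp: wt_def intro: order_trans[OF divide_right_mono, of x1 x])
  then have "(x1 / s) ^ 4 \<le> wt (x / s) ^ 4" using x s by (intro power_mono) auto
  then have w: "x1 ^ 4 \<le> s ^ 4 * wt (x / s) ^ 4" using s by (simp add: power_divide field_simps)
  have le: "exp 49 / (c * wt (x / s) ^ 4) \<le> exp 49 / x1 ^ 4" if "s ^ 4 \<le> c" for c :: real
  proof (rule divide_left_mono)
    have "s ^ 4 * wt (x / s) ^ 4 \<le> c * wt (x / s) ^ 4"
      using that wt_nonneg[of "x / s"] by (intro mult_right_mono) auto
    then show "x1 ^ 4 \<le> c * wt (x / s) ^ 4" using w by linarith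
    then have "0 < c * wt (x / s) ^ 4" using x zero_less_power[of x1 4] by linarith
    then show "0 < c * wt (x / s) ^ 4 * x1 ^ 4" using x by simp
  qed simp
  have p: "s ^ 4 \<le> s ^ k" if "k \<le> 4" for k using that s s1 by (intro power_decreasing) auto
  have "s ^ 4 \<le> t" "s ^ 4 \<le> t * s" "s ^ 4 \<le> t\<^sup>2"
    using p[of 2] p[of 3] by (auto simp: s(2) power3_eq_cube power2_eq_square power4_eq_xxxx mult_ac)
  from this[THEN le] have "exp 49 / (t * wt (x / s) ^ 4) \<le> exp 49 / x1 ^ 4"
    "exp 49 / (t * s * wt (x / s) ^ 4) \<le> exp 49 / x1 ^ 4"
    "exp 49 / (t\<^sup>2 * wt (x / s) ^ 4) \<le> exp 49 / x1 ^ 4"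
    by auto
  then show "\<bar>hk1 x t\<bar> \<le> exp 49 / x1 ^ 4" "\<bar>hk2 x t\<bar> \<le> exp 49 / x1 ^ 4" "\<bar>hk3 x t\<bar> \<le> exp 49 / x1 ^ 4"
    using hk_bounds[OF t(1), of x] unfolding s(3) by linarith+
qed

lemma continuous_on_hk1 [continuous_intros]: "continuous_on S f \<Longrightarrow> continuous_on S (\<lambda>x. hk1 (f x) t)"
  unfolding hk1_def by (cases "t = 0") (auto intro!: continuous_intros)

lemma borel_measurable_hk [measurable]:
  assumes [measurable]: "f \<in> borel_measurable M" "g \<in> borel_measurable M"
  shows "(\<lambda>x. hk1 (f x) (g x)) \<in> borel_measurable M" "(\<lambda>x. hk2 (f x) (g x)) \<in> borel_measurable M"
    "(\<lambda>x. hk3 (f x) (g x)) \<in> borel_measurable M"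
  unfolding hk1_def hk2_def hk3_def by measurable

text \<open>\<open>hk1\<close> has constant sign on the half-line, so its absolute integral
  telescopes to a difference of heat kernel values. The result is of order t^(-1/2) for every length
  x, while the pointwise bound would give x / t.\<close>

lemma integral_abs_hk1_le:
  assumes t: "t > 0" and x: "x \<ge> 0" and g: "continuous_on {0..x} g" and B: "\<And>z. z \<in> {0..x} \<Longrightarrow> \<bar>g z\<bar> \<le> B"
  shows "\<bar>integral {0..x} (\<lambda>z. hk1 z t * g z)\<bar> \<le> B * (exp 49 / sqrt t)"
proof -
  have B0: "0 \<le> B" using B[of 0] x abs_ge_zero order_trans by (metis atLeastAtMost_iff order_refl)
  have i: "((\<lambda>z. - hk1 z t) has_integral (- heat_kernel x t - (- heat_kernel (0::real) t))) {0..x}"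
    by (rule fundamental_theorem_of_calculus[where f="\<lambda>z. - heat_kernel z t", OF x])
       (auto simp: has_real_derivative_iff_has_vector_derivative[symmetric] intro!: DERIV_subset[OF DERIV_heat_kernel] DERIV_minus)
  have "norm (integral {0..x} (\<lambda>z. hk1 z t * g z)) \<le> integral {0..x} (\<lambda>z. - hk1 z t * B)"
  proof (rule integral_norm_bound_integral)
    show "(\<lambda>z. hk1 z t * g z) integrable_on {0..x}"
      by (intro integrable_continuous_real continuous_intros g)
    show "(\<lambda>z. - hk1 z t * B) integrable_on {0..x}"
      by (intro integrable_continuous_real continuous_intros)
    fix z assume z: "z \<in> {0..x}"
    have e: "\<bar>hk1 z t\<bar> = - hk1 z t" using z t by (simp add: hk1_def heat_kernel_nonneg abs_mult abs_divide)
    then have nn: "0 \<le> - hk1 z t" using abs_ge_zero[of "hk1 z t"] by linarith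
    show "norm (hk1 z t * g z) \<le> - hk1 z t * B"
      unfolding real_norm_def abs_mult e by (rule mult_left_mono[OF B[OF z] nn])
  qed
  also have "\<dots> = (heat_kernel (0::real) t - heat_kernel x t) * B"
    using integral_unique[OF has_integral_mult_left[OF i, of B]] by simp
  also have "\<dots> \<le> (exp 49 / sqrt t) * B"
    using hk_bounds_simple(1)[OF t, of 0] heat_kernel_nonneg[of x t] B0 by (intro mult_right_mono) auto
  finally show ?thesis by (simp add: mult.commute)
qed

section \<open>Height convolutions integrated against the time profile\<close>

lemma integrable_powr_unit:
  assumes "a > (0::real)"
  shows "integrable lborel (\<lambda>t. indicator {0<..1} t * t powr (a - 1))"
    and "(LBINT t. indicator {0<..1} t * t powr (a - 1)) = 1 / a"
proof -
  have "((\<lambda>t. t powr (a - 1)) has_integral (1 powr (a - 1 + 1) / (a - 1 + 1))) {0..1}"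
    by (rule has_integral_powr_from_0) (use assms in auto)
  then have h: "((\<lambda>t. t powr (a - 1)) has_integral 1 / a) {0..1}" by simp
  have hb: "has_bochner_integral lborel (\<lambda>t. indicator {0..1} t * t powr (a - 1)) (1 / a)"
  proof (rule has_bochner_integral_nn_integral)
    show "(\<lambda>t. indicator {0..1} t * t powr (a - 1)) \<in> borel_measurable lborel" by measurable
    show "(\<integral>\<^sup>+ t. ennreal (indicator {0..1} t * t powr (a - 1)) \<partial>lborel) = ennreal (1 / a)"
    proof (rule nn_integral_has_integral_lborel)
      have "(\<lambda>t. indicator {0..1} t * t powr (a - 1)) = (\<lambda>t. if t \<in> {0..1} then t powr (a - 1) else 0)"
        by (auto simp: fun_eq_iff indicator_def)
      then show "((\<lambda>t. indicator {0..1} t * t powr (a - 1)) has_integral 1 / a) UNIV"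
        using h by (simp only: has_integral_restrict_UNIV)
    qed auto
  qed (use assms in auto)
  have "indicator {0..1} t * t powr (a - 1) = indicator {0<..1} t * t powr (a - 1)" for t :: real
    by (auto simp: indicator_def)
  with hb show "integrable lborel (\<lambda>t. indicator {0<..1} t * t powr (a - 1))"
    "(LBINT t. indicator {0<..1} t * t powr (a - 1)) = 1 / a"
    by (auto simp: has_bochner_integral_iff)
qed

lemma LBINT_Ioo_eq_integral:
  fixes f g :: "real \<Rightarrow> real"
  assumes "a \<le> b" and f: "continuous_on {a..b} f" and eq: "\<And>z. z \<in> {a<..<b} \<Longrightarrow> g z = f z"
  shows "(LBINT z. indicator {a<..<b} z * g z) = integral {a..b} f"
proof -
  have "(LBINT z. indicator {a<..<b} z * g z) = (LBINT z. indicator {a<..<b} z * f z)"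
    by (intro Bochner_Integration.integral_cong) (auto simp: indicator_def eq)
  also have "\<dots> = (LBINT z=ereal a..ereal b. f z)"
    using \<open>a \<le> b\<close> by (simp add: interval_lebesgue_integral_def set_lebesgue_integral_def)
  also have "\<dots> = integral {a..b} f"
    by (rule interval_integral_eq_integral[OF \<open>a \<le> b\<close> borel_integrable_atLeastAtMost'[OF f]])
  finally show ?thesis .
qed

text \<open>The remainder on the left of the last inequality stays bounded as \<open>x \<rightarrow> 0\<close> because \<open>h(\<cdot>,t)\<close> and its second derivative being bounded
  forces \<open>\<partial>\<^sub>z h(0+,t)\<close> to be bounded as well, so that the boundary value of the normal derivative
  never has to be computed.\<close>

lemma time_convolution_second_derivative:
  fixes \<phi> :: "real \<Rightarrow> real" and h h2 :: "real \<Rightarrow> real \<Rightarrow> real" and a c A B :: real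
  defines "v \<equiv> \<lambda>x t. LBINT z. indicator {0<..<x} z * (hk1 z t * h (x - z) t)"
  assumes a: "0 < a" and c: "0 \<le> c"
    and \<phi>m [measurable]: "\<phi> \<in> borel_measurable borel"
    and \<phi>b: "\<And>t. 0 < t \<Longrightarrow> t \<le> 1 \<Longrightarrow> \<bar>\<phi> t\<bar> \<le> c * t powr a"
    and \<phi>0: "\<And>t. \<not> (0 < t \<and> t \<le> 1) \<Longrightarrow> \<phi> t = 0"
    and hc: "\<And>t. 0 < t \<Longrightarrow> t \<le> 1 \<Longrightarrow> continuous_on {0..} (\<lambda>z. h z t)"
    and h2c: "\<And>t. 0 < t \<Longrightarrow> t \<le> 1 \<Longrightarrow> continuous_on {0..} (\<lambda>z. h2 z t)"
    and hder: "\<And>t. 0 < t \<Longrightarrow> t \<le> 1 \<Longrightarrow> \<exists>h1. \<forall>z>0. ((\<lambda>z. h z t) has_real_derivative h1 z) (at z) \<and>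
        (h1 has_real_derivative h2 z t) (at z)"
    and hb: "\<And>z t. 0 \<le> z \<Longrightarrow> 0 < t \<Longrightarrow> t \<le> 1 \<Longrightarrow> \<bar>h z t\<bar> \<le> B"
    and h2b: "\<And>z t. 0 \<le> z \<Longrightarrow> 0 < t \<Longrightarrow> t \<le> 1 \<Longrightarrow> \<bar>h2 z t\<bar> \<le> B"
    and hA: "\<And>t. 0 < t \<Longrightarrow> t \<le> 1 \<Longrightarrow> \<bar>h 0 t - A\<bar> \<le> B * sqrt t"
    and meas: "\<And>x. 0 < x \<Longrightarrow> v x \<in> borel_measurable borel"
  shows "\<exists>U1 U2. \<forall>x>0. ((\<lambda>x. LBINT t. \<phi> t * v x t) has_real_derivative U1 x) (at x) \<and>
     (U1 has_real_derivative U2 x) (at x) \<and> integrable lborel (\<lambda>t. \<phi> t * v x t) \<and>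
     integrable lborel (\<lambda>t. \<phi> t * hk2 x t) \<and>
     \<bar>U2 x - A * (LBINT t. \<phi> t * hk2 x t)\<bar> \<le> 5 * exp 49 * c * B / a"
proof -
  let ?E = "exp 49 :: real"
  let ?p = "\<lambda>t. indicator {0<..1} t * t powr (a - 1)"
  have B: "0 \<le> B" using hb[of 0 1] by linarith
  have "\<forall>t. \<exists>F F1. 0 < t \<and> t \<le> 1 \<longrightarrow> (\<forall>z. (F has_real_derivative F1 z) (at z)) \<and>
    (\<forall>z. (F1 has_real_derivative h2 (max 0 z) t) (at z)) \<and> (\<forall>z\<ge>0. F z = h z t)"
  proof
    fix t
    show "\<exists>F F1. 0 < t \<and> t \<le> 1 \<longrightarrow> (\<forall>z. (F has_real_derivative F1 z) (at z)) \<and>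
      (\<forall>z. (F1 has_real_derivative h2 (max 0 z) t) (at z)) \<and> (\<forall>z\<ge>0. F z = h z t)"
    proof (cases "0 < t \<and> t \<le> 1")
      case True
      then obtain h1 where h1: "\<And>z. z > 0 \<Longrightarrow> ((\<lambda>z. h z t) has_real_derivative h1 z) (at z)"
        "\<And>z. z > 0 \<Longrightarrow> (h1 has_real_derivative h2 z t) (at z)" using hder by blast
      show ?thesis
        using half_line_C2_extension[OF hc h2c h1] True by blast
    qed auto
  qed
  then obtain F F1 where FF: "\<forall>t. 0 < t \<and> t \<le> 1 \<longrightarrow> (\<forall>z. (F t has_real_derivative F1 t z) (at z)) \<and>
    (\<forall>z. (F1 t has_real_derivative h2 (max 0 z) t) (at z)) \<and> (\<forall>z\<ge>0. F t z = h z t)"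
    by metis
  have F: "(F t has_real_derivative F1 t z) (at z)" "(F1 t has_real_derivative h2 (max 0 z) t) (at z)"
    if "0 < t" "t \<le> 1" for t z using FF that by auto
  have Fh: "F t z = h z t" if "0 < t" "t \<le> 1" "z \<ge> 0" for t z using FF that by auto
  have Fc: "continuous_on UNIV (F t)" "continuous_on UNIV (F1 t)" "continuous_on UNIV (\<lambda>z. h2 (max 0 z) t)"
    if "0 < t" "t \<le> 1" for t
    using F[OF that] by (meson DERIV_isCont continuous_at_imp_continuous_on)
      (use F[OF that] in \<open>meson DERIV_isCont continuous_at_imp_continuous_on\<close>,
       intro continuous_on_compose2[OF h2c[OF that]] continuous_intros, auto)
  \<comment> \<open>The mean value theorem on [0,1] produces a point where the derivative is at most
    2 B; moving from there to z costs at most (|z| + 1) B because the second derivative is bounded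
    by B.\<close>
  have F1b: "\<bar>F1 t z\<bar> \<le> (3 + \<bar>z\<bar>) * B" if t: "0 < t" "t \<le> 1" for t z
  proof -
    obtain \<xi> where \<xi>: "0 < \<xi>" "\<xi> < 1" "F t 1 - F t 0 = (1 - 0) * F1 t \<xi>"
      using MVT2[of 0 1 "F t" "F1 t"] F(1)[OF t] by auto
    have 1: "\<bar>F1 t \<xi>\<bar> \<le> 2 * B"
      using \<xi>(3) hb[of 0 t] hb[of 1 t] Fh[OF t, of 0] Fh[OF t, of 1] t by simp
    have "norm (F1 t z - F1 t \<xi>) \<le> B * norm (z - \<xi>)"
      by (rule field_differentiable_bound[of UNIV _ "\<lambda>z. h2 (max 0 z) t"]) (use F(2)[OF t] h2b t in auto)
    also have "\<dots> \<le> B * (\<bar>z\<bar> + 1)" using B \<xi> by (intro mult_left_mono) auto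
    finally show ?thesis using 1 by (simp add: algebra_simps)
  qed
  \<comment> \<open>In the integral every x-derivative falls on the extension \<open>F\<close>. The
    kernel is differentiated only in the boundary term at z = x, so \<open>hk2\<close> occurs just
    once, multiplied by the value of h at height 0.\<close>
  define V0 where "V0 x t = integral {0..x} (\<lambda>z. hk1 z t * F t (x - z))" for x t
  define V1 where "V1 x t = hk1 x t * F t 0 + integral {0..x} (\<lambda>z. hk1 z t * F1 t (x - z))" for x t
  define V2 where "V2 x t = hk2 x t * F t 0 + (hk1 x t * F1 t 0 + integral {0..x} (\<lambda>z. hk1 z t * h2 (max 0 (x - z)) t))" for x t
  have vV: "v x t = V0 x t" if "x > 0" "0 < t" "t \<le> 1" for x t
    unfolding v_def V0_def
    by (rule LBINT_Ioo_eq_integral)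
       (use that in \<open>auto simp: Fh intro!: continuous_intros continuous_on_compose2[OF Fc(1)]\<close>)
  have D1: "((\<lambda>x. V0 x t) has_real_derivative V1 x t) (at x)" if "x > 0" "0 < t" "t \<le> 1" for x t
    unfolding V0_def V1_def using that
    by (intro convolution_has_real_derivative F Fc continuous_intros) auto
  have D2: "((\<lambda>x. V1 x t) has_real_derivative V2 x t) (at x)" if "x > 0" "0 < t" "t \<le> 1" for x t
    unfolding V1_def V2_def using that
    by (intro DERIV_add convolution_has_real_derivative F Fc continuous_intros DERIV_cmult_right DERIV_hk1) auto
  have sq: "1 / sqrt t \<le> 1 / t" "0 < sqrt t" if "0 < t" "t \<le> 1" for t
  proof -
    have "t * t \<le> t * 1" using that by (intro mult_left_mono) auto
    then have "t \<le> sqrt t" by (intro real_le_rsqrt) (simp add: power2_eq_square)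
    then show "1 / sqrt t \<le> 1 / t" "0 < sqrt t" using that by (auto intro!: divide_left_mono)
  qed
  have conv: "\<bar>integral {0..x} (\<lambda>z. hk1 z t * G (x - z))\<bar> \<le> M * ?E / t"
    if "x > 0" "0 < t" "t \<le> 1" and G: "continuous_on UNIV G" and M: "\<And>z. 0 \<le> z \<Longrightarrow> z \<le> x \<Longrightarrow> \<bar>G z\<bar> \<le> M" for x t G M
  proof -
    have "0 \<le> M" using M[of 0] \<open>x > 0\<close> by linarith
    have "\<bar>integral {0..x} (\<lambda>z. hk1 z t * G (x - z))\<bar> \<le> M * (?E / sqrt t)"
      using that by (intro integral_abs_hk1_le continuous_on_compose2[OF G] continuous_intros) auto
    also have "\<dots> \<le> M * (?E / t)"
      using sq(1)[OF that(2,3)] mult_left_mono[OF sq(1)[OF that(2,3)], of "M * ?E"] \<open>0 \<le> M\<close> by simp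
    finally show ?thesis by simp
  qed
  \<comment> \<open>The common majorant of the proof: whatever is of order 1/t becomes t^(a-1) after
    multiplication by the profile, and this is integrable because a > 0.\<close>
  have dom: "\<bar>\<phi> t * X\<bar> \<le> c * M * ?p t" if "0 < t \<Longrightarrow> t \<le> 1 \<Longrightarrow> \<bar>X\<bar> \<le> M / t" for t X M
  proof (cases "0 < t \<and> t \<le> 1")
    case True
    then have t: "0 < t" "t \<le> 1" by auto
    have "\<bar>\<phi> t * X\<bar> \<le> (c * t powr a) * (M / t)"
      unfolding abs_mult using \<phi>b[OF t] that[OF t] c by (intro mult_mono) auto
    also have "\<dots> = c * M * t powr (a - 1)" using t by (simp add: powr_diff)
    finally show ?thesis using t by simp
  qed (use \<phi>0 in auto)
  have pint: "integrable lborel (\<lambda>t. C * ?p t)" for C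
    by (intro Bochner_Integration.integrable_mult_right integrable_powr_unit(1) a)
  have V0b: "\<bar>V0 x t\<bar> \<le> B * ?E / t" if "x > 0" "0 < t" "t \<le> 1" for x t
    unfolding V0_def using that hb by (intro conv Fc) (auto simp: Fh)
  \<comment> \<open>\<open>?M1\<close> and \<open>?M2\<close> depend on x and blow up as x tends to
    0. They only justify differentiation near a fixed x; the estimate uniform in x is
    \<open>err\<close>.\<close>
  let ?M1 = "\<lambda>x. ?E / (x/2) ^ 4 * B + (3 + 2 * x) * B * ?E"
  have V1b: "\<bar>V1 y t\<bar> \<le> ?M1 x / t" if x: "x > 0" and t: "0 < t" "t \<le> 1" and y: "\<bar>y - x\<bar> < x / 2" for x y t
  proof -
    have y': "y > 0" "x / 2 \<le> y" "y \<le> 2 * x" using y by (auto simp: abs_if split: if_splits)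
    have "\<bar>integral {0..y} (\<lambda>z. hk1 z t * F1 t (y - z))\<bar> \<le> (3 + 2 * x) * B * ?E / t"
    proof (rule conv)
      show "\<bar>F1 t z\<bar> \<le> (3 + 2 * x) * B" if "0 \<le> z" "z \<le> y" for z
        by (rule order_trans[OF F1b[OF t]]) (use that y' B in \<open>auto intro!: mult_right_mono\<close>)
    qed (use t y' Fc in auto)
    moreover have "\<bar>hk1 y t * F t 0\<bar> \<le> ?E / (x/2) ^ 4 * B"
      unfolding abs_mult using hk_bounds_away(1)[OF t, of "x/2" y] x y' hb[of 0 t] t
      by (intro mult_mono) (auto simp: Fh)
    moreover have "?E / (x/2) ^ 4 * B \<le> ?E / (x/2) ^ 4 * B / t"
      using t x B by (simp add: le_divide_eq mult_left_le)
    ultimately show ?thesis unfolding V1_def add_divide_distrib by linarith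
  qed
  let ?M2 = "\<lambda>x. ?E / (x/2) ^ 4 * B + ?E / (x/2) ^ 4 * (3 * B) + B * ?E"
  have V2b: "\<bar>V2 y t\<bar> \<le> ?M2 x / t" if x: "x > 0" and t: "0 < t" "t \<le> 1" and y: "\<bar>y - x\<bar> < x / 2" for x y t
  proof -
    have y': "y > 0" "x / 2 \<le> y" using y by (auto simp: abs_if split: if_splits)
    have "\<bar>integral {0..y} (\<lambda>z. hk1 z t * h2 (max 0 (y - z)) t)\<bar> \<le> B * ?E / t"
      using t y' Fc(3)[OF t] h2b by (intro conv[where G="\<lambda>z. h2 (max 0 z) t"]) auto
    moreover have "\<bar>hk2 y t * F t 0\<bar> \<le> ?E / (x/2) ^ 4 * B"
      unfolding abs_mult using hk_bounds_away(2)[OF t, of "x/2" y] x y' hb[of 0 t] t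
      by (intro mult_mono) (auto simp: Fh)
    moreover have "\<bar>hk1 y t * F1 t 0\<bar> \<le> ?E / (x/2) ^ 4 * (3 * B)"
      unfolding abs_mult using hk_bounds_away(1)[OF t, of "x/2" y] x y' F1b[OF t, of 0]
      by (intro mult_mono) auto
    moreover have "?E / (x/2) ^ 4 * B \<le> ?E / (x/2) ^ 4 * B / t" "?E / (x/2) ^ 4 * (3 * B) \<le> ?E / (x/2) ^ 4 * (3 * B) / t"
      using t x B by (auto simp: le_divide_eq mult_left_le)
    moreover have "\<bar>p + (q + r)\<bar> \<le> P' + Q' + R" if "\<bar>r\<bar> \<le> R" "\<bar>p\<bar> \<le> P" "\<bar>q\<bar> \<le> Q" "P \<le> P'" "Q \<le> Q'"
      for p q r P Q P' Q' R :: real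
      using that by linarith
    ultimately show ?thesis unfolding V2_def add_divide_distrib by blast
  qed
  have vphi: "\<phi> t * v x t = \<phi> t * V0 x t" if "x > 0" for x t
    using vV[OF that, of t] \<phi>0[of t] by (cases "0 < t \<and> t \<le> 1") auto
  have I0: "integrable lborel (\<lambda>t. \<phi> t * v x t)" if "x > 0" for x
  proof (rule Bochner_Integration.integrable_bound[OF pint[of "c * (B * ?E)"]])
    have [measurable]: "v x \<in> borel_measurable borel" by (rule meas[OF that])
    show "(\<lambda>t. \<phi> t * v x t) \<in> borel_measurable lborel" by measurable
    show "AE t in lborel. norm (\<phi> t * v x t) \<le> norm (c * (B * ?E) * ?p t)"
      unfolding vphi[OF that] real_norm_def
      by (intro AE_I2 order_trans[OF dom abs_ge_self] V0b that)
  qed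
  have I0': "integrable lborel (\<lambda>t. \<phi> t * V0 x t)" if "x > 0" for x
    using I0[OF that] unfolding vphi[OF that] .
  have step1: "integrable lborel (\<lambda>t. \<phi> t * V1 x t)"
    "((\<lambda>x. LBINT t. \<phi> t * V0 x t) has_real_derivative (LBINT t. \<phi> t * V1 x t)) (at x)" if x: "x > 0" for x
  proof -
    have pos: "y > 0" if "\<bar>y - x\<bar> < x / 2" for y using that x by (auto simp: abs_if split: if_splits)
    have D: "((\<lambda>x. \<phi> t * V0 x t) has_real_derivative \<phi> t * V1 y t) (at y)" if "\<bar>y - x\<bar> < x / 2" for t y
      using D1[OF pos[OF that], of t] \<phi>0[of t] by (cases "0 < t \<and> t \<le> 1") (auto intro!: DERIV_cmult)
    note L = has_real_derivative_lebesgue_integral[where f="\<lambda>x t. \<phi> t * V0 x t" and f'="\<lambda>x t. \<phi> t * V1 x t"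
        and d="x/2" and x=x and M=lborel and g="\<lambda>t. c * ?M1 x * ?p t"]
    have d: "0 < x / 2" using x by simp
    have bn: "\<bar>\<phi> t * V1 y t\<bar> \<le> c * ?M1 x * ?p t" if "\<bar>y - x\<bar> < x / 2" for y t
      by (rule dom[OF V1b[OF x _ _ that]])
    show "integrable lborel (\<lambda>t. \<phi> t * V1 x t)"
      by (rule L(1)[OF d I0'[OF pos] D bn pint])
    show "((\<lambda>x. LBINT t. \<phi> t * V0 x t) has_real_derivative (LBINT t. \<phi> t * V1 x t)) (at x)"
      by (rule L(2)[OF d I0'[OF pos] D bn pint])
  qed
  have step2: "integrable lborel (\<lambda>t. \<phi> t * V2 x t)"
    "((\<lambda>x. LBINT t. \<phi> t * V1 x t) has_real_derivative (LBINT t. \<phi> t * V2 x t)) (at x)" if x: "x > 0" for x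
  proof -
    have pos: "y > 0" if "\<bar>y - x\<bar> < x / 2" for y using that x by (auto simp: abs_if split: if_splits)
    have D: "((\<lambda>x. \<phi> t * V1 x t) has_real_derivative \<phi> t * V2 y t) (at y)" if "\<bar>y - x\<bar> < x / 2" for t y
      using D2[OF pos[OF that], of t] \<phi>0[of t] by (cases "0 < t \<and> t \<le> 1") (auto intro!: DERIV_cmult)
    note L = has_real_derivative_lebesgue_integral[where f="\<lambda>x t. \<phi> t * V1 x t" and f'="\<lambda>x t. \<phi> t * V2 x t"
        and d="x/2" and x=x and M=lborel and g="\<lambda>t. c * ?M2 x * ?p t"]
    have d: "0 < x / 2" using x by simp
    have bn: "\<bar>\<phi> t * V2 y t\<bar> \<le> c * ?M2 x * ?p t" if "\<bar>y - x\<bar> < x / 2" for y t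
      by (rule dom[OF V2b[OF x _ _ that]])
    show "integrable lborel (\<lambda>t. \<phi> t * V2 x t)"
      by (rule L(1)[OF d step1(1)[OF pos] D bn pint])
    show "((\<lambda>x. LBINT t. \<phi> t * V1 x t) has_real_derivative (LBINT t. \<phi> t * V2 x t)) (at x)"
      by (rule L(2)[OF d step1(1)[OF pos] D bn pint])
  qed
  have step1': "((\<lambda>x. LBINT t. \<phi> t * v x t) has_real_derivative (LBINT t. \<phi> t * V1 x t)) (at x)" if x: "x > 0" for x
  proof -
    have "\<forall>\<^sub>F x in nhds x. (LBINT t. \<phi> t * v x t) = (LBINT t. \<phi> t * V0 x t)"
      using eventually_nhds_in_open[of "{0<..}" x] x
      by (auto elim!: eventually_mono simp: vphi)
    then show ?thesis using step1(2)[OF x] by (subst DERIV_cong_ev[OF refl _ refl])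
  qed
  have I2: "integrable lborel (\<lambda>t. \<phi> t * hk2 x t)" if x: "x > 0" for x
  proof (rule Bochner_Integration.integrable_bound[OF pint[of "c * (?E / x ^ 4)"]])
    show "AE t in lborel. norm (\<phi> t * hk2 x t) \<le> norm (c * (?E / x ^ 4) * ?p t)"
      unfolding real_norm_def
    proof (intro AE_I2 order_trans[OF dom abs_ge_self])
      fix t :: real assume t: "0 < t" "t \<le> 1"
      have "\<bar>hk2 x t\<bar> \<le> ?E / x ^ 4" by (rule hk_bounds_away(2)[OF t x order_refl])
      also have "\<dots> \<le> ?E / x ^ 4 / t" using t x by (simp add: le_divide_eq mult_left_le)
      finally show "\<bar>hk2 x t\<bar> \<le> ?E / x ^ 4 / t" .
    qed
  qed measurable
  have err: "\<bar>(LBINT t. \<phi> t * V2 x t) - A * (LBINT t. \<phi> t * hk2 x t)\<bar> \<le> 5 * ?E * c * B / a" if x: "x > 0" for x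
  proof -
    have "(LBINT t. \<phi> t * V2 x t) - A * (LBINT t. \<phi> t * hk2 x t) = (LBINT t. \<phi> t * (V2 x t - A * hk2 x t))"
      using step2(1)[OF x] I2[OF x] by (simp add: right_diff_distrib mult.left_commute)
    also have "\<bar>\<dots>\<bar> \<le> (LBINT t. c * (5 * ?E * B) * ?p t)"
    proof (rule order_trans[OF integral_norm_bound[where 'a=real, unfolded real_norm_def]], rule integral_mono)
      have "integrable lborel (\<lambda>t. \<phi> t * V2 x t - A * (\<phi> t * hk2 x t))"
        using step2(1)[OF x] I2[OF x] by auto
      then show "integrable lborel (\<lambda>t. \<bar>\<phi> t * (V2 x t - A * hk2 x t)\<bar>)"
        by (intro integrable_abs) (simp add: right_diff_distrib mult.left_commute)
      show "integrable lborel (\<lambda>t. c * (5 * ?E * B) * ?p t)" by (rule pint)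
      show "\<bar>\<phi> t * (V2 x t - A * hk2 x t)\<bar> \<le> c * (5 * ?E * B) * ?p t" for t
      proof (rule dom)
        assume t: "0 < t" "t \<le> 1"
        \<comment> \<open>Here the rate B * sqrt t at which h(0,t) approaches A lowers the
          singularity of \<open>hk2\<close> from t^(-3/2) to t^(-1).\<close>
        have 1: "\<bar>hk2 x t * (F t 0 - A)\<bar> \<le> ?E * B / t"
        proof -
          have "\<bar>hk2 x t * (F t 0 - A)\<bar> \<le> (?E / (t * sqrt t)) * (B * sqrt t)"
            unfolding abs_mult using hk_bounds_simple(3)[OF t(1), of x] hA[OF t] t
            by (intro mult_mono) (auto simp: Fh)
          also have "\<dots> = ?E * B / t" using t by simp
          finally show ?thesis .
        qed
        have 2: "\<bar>hk1 x t * F1 t 0\<bar> \<le> 3 * (?E * B / t)"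
        proof -
          have "\<bar>hk1 x t * F1 t 0\<bar> \<le> (?E / t) * (3 * B)"
            unfolding abs_mult using hk_bounds_simple(2)[OF t(1), of x] F1b[OF t, of 0] t
            by (intro mult_mono) auto
          then show ?thesis by (simp add: mult_ac)
        qed
        have 3: "\<bar>integral {0..x} (\<lambda>z. hk1 z t * h2 (max 0 (x - z)) t)\<bar> \<le> ?E * B / t"
          using conv[where G="\<lambda>z. h2 (max 0 z) t", OF x t Fc(3)[OF t], of B] h2b t by (simp add: mult.commute)
        have "V2 x t - A * hk2 x t = hk2 x t * (F t 0 - A) + hk1 x t * F1 t 0 + integral {0..x} (\<lambda>z. hk1 z t * h2 (max 0 (x - z)) t)"
          by (simp add: V2_def algebra_simps)
        moreover have "5 * ?E * B / t = ?E * B / t + 3 * (?E * B / t) + ?E * B / t" by (simp add: field_simps)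
        ultimately show "\<bar>V2 x t - A * hk2 x t\<bar> \<le> 5 * ?E * B / t" using 1 2 3 by linarith
      qed
    qed
    also have "\<dots> = c * (5 * ?E * B) * (1 / a)"
      using integrable_powr_unit(2)[OF a] by simp
    finally show ?thesis by (simp add: mult_ac)
  qed
  show ?thesis
    by (intro exI[of _ "\<lambda>x. LBINT t. \<phi> t * V1 x t"] exI[of _ "\<lambda>x. LBINT t. \<phi> t * V2 x t"])
       (use step1' step2(2) I0 I2 err in auto)
qed

subsection \<open>The Laplace kernel\<close>

text \<open>The argument is a type token that carries the dimension of the space.\<close>

definition lapc :: "'b::euclidean_space itself \<Rightarrow> real" where
  "lapc _ = 1 / (real DIM('b) * (real DIM('b) - 2) * measure lborel (ball (0::'b) 1))"

lemma lapc_pos: "DIM('b::euclidean_space) \<ge> 3 \<Longrightarrow> 0 < lapc TYPE('b)"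
  using content_ball_pos[of 1 "0::'b"] by (simp add: lapc_def)

lemma laplace_kernel_eq:
  assumes "DIM('b::euclidean_space) \<ge> 3"
  shows "laplace_kernel x = lapc TYPE('b) * (1 / norm (x::'b) ^ (DIM('b) - 2))"
proof -
  have "2 - int DIM('b) = - int (DIM('b) - 2)" using assms by simp
  then show ?thesis
    unfolding laplace_kernel_def lapc_def by (simp only: power_int_minus power_int_of_nat inverse_eq_divide)
qed

text \<open>The power of the norm is rewritten as a real power of the squared norm, which along a
  line is a quadratic polynomial in s.\<close>

lemma DERIV_inverse_norm_power:
  fixes x b :: "'b::euclidean_space"
  assumes k: "k > 0" and x: "x + s *\<^sub>R b \<noteq> 0"
  shows "((\<lambda>s. 1 / norm (x + s *\<^sub>R b) ^ k) has_real_derivative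
     - real k * ((x + s *\<^sub>R b) \<bullet> b) / norm (x + s *\<^sub>R b) ^ (k + 2)) (at s)"
proof -
  let ?q = "\<lambda>s. x \<bullet> x + 2 * s * (x \<bullet> b) + s\<^sup>2 * (b \<bullet> b)"
  have q: "(norm (x + s *\<^sub>R b))\<^sup>2 = ?q s" for s
    unfolding power2_norm_eq_inner by (simp add: inner_simps inner_commute power2_eq_square algebra_simps)
  have qp: "?q s > 0" unfolding q[symmetric] using x by simp
  \<comment> \<open>At y = 0 the right side is 0 by the convention for \<open>powr\<close>, and so
    is the left side when j > 0; for j = 0 the left side would be 1. The disjunction permits the
    identity at every s for the function being differentiated.\<close>
  have e: "1 / norm y ^ j = ((norm y)\<^sup>2) powr (- real j / 2)" if "j > 0 \<or> y \<noteq> 0" for y :: 'b and j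
  proof (cases "y = 0")
    case False
    then have "((norm y)\<^sup>2) powr (- real j / 2) = (norm y powr 2) powr (- real j / 2)" by simp
    also have "\<dots> = norm y powr (- real j)" by (simp only: powr_powr) simp
    finally have "((norm y)\<^sup>2) powr (- real j / 2) = norm y powr (- real j)" .
    then show ?thesis using False by (simp add: powr_minus_divide powr_realpow)
  qed (use that in auto)
  have d: "((\<lambda>s. ?q s powr (- real k / 2)) has_real_derivative
      (- real k / 2) * ?q s powr (- real k / 2 - 1) * (2 * (x \<bullet> b) + 2 * s * (b \<bullet> b))) (at s)"
  proof -
    have "(?q has_real_derivative 2 * (x \<bullet> b) + 2 * s * (b \<bullet> b)) (at s)"
      by (auto intro!: derivative_eq_intros)
    from DERIV_fun_powr[OF this qp, of "- real k / 2"] show ?thesis by simp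
  qed
  have p: "?q s powr (- real k / 2 - 1) = 1 / norm (x + s *\<^sub>R b) ^ (k + 2)"
  proof -
    have "- real (k + 2) / 2 = - real k / 2 - 1" by (simp add: add_divide_distrib)
    then show ?thesis using e[OF disjI2[OF x], of "k + 2"] by (simp only: q)
  qed
  have f: "(\<lambda>s. ?q s powr (- real k / 2)) = (\<lambda>s. 1 / norm (x + s *\<^sub>R b) ^ k)"
    by (rule ext) (simp only: e[OF disjI1[OF k]] q)
  have gen: "(- K / 2) * (1 / N) * (2 * X + 2 * s * S) = - K * (X + s * S) / N" for K N X S :: real
  proof -
    have g: "(- K / 2) * (1 / N) * (2 * Y) = - K * Y / N" for Y by simp
    show ?thesis using g[of "X + s * S"] by (simp only: distrib_left mult.assoc)
  qed
  from DERIV_cong[OF d[unfolded p f] gen] show ?thesis by (simp only: inner_add_left inner_scaleR_left)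
qed

text \<open>\<open>lap1 b\<close> and \<open>lap2 b\<close> are the first and second derivatives of
  the Laplace kernel along b. The prefactor (n-2) * \<open>lapc\<close> equals 1 / (n
  |B_1|).\<close>

definition lap1 :: "'b::euclidean_space \<Rightarrow> 'b \<Rightarrow> real" where
  "lap1 b x = - (real DIM('b) - 2) * lapc TYPE('b) * ((x \<bullet> b) / norm x ^ DIM('b))"

definition lap2 :: "'b::euclidean_space \<Rightarrow> 'b \<Rightarrow> real" where
  "lap2 b x = (real DIM('b) - 2) * lapc TYPE('b) *
     (real DIM('b) * (x \<bullet> b)\<^sup>2 / norm x ^ (DIM('b) + 2) - (b \<bullet> b) / norm x ^ DIM('b))"

lemma DERIV_laplace_kernel:
  fixes x b :: "'b::euclidean_space"
  assumes n: "DIM('b) \<ge> 3" and x: "x + s *\<^sub>R b \<noteq> 0"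
  shows "((\<lambda>s. laplace_kernel (x + s *\<^sub>R b)) has_real_derivative lap1 b (x + s *\<^sub>R b)) (at s)"
proof -
  obtain k where k: "DIM('b) = k + 2" "k > 0" using n by (intro that[of "DIM('b) - 2"]) auto
  show ?thesis
    unfolding laplace_kernel_eq[OF n] lap1_def
    using DERIV_cmult[OF DERIV_inverse_norm_power[OF k(2) x], of "lapc TYPE('b)"] by (simp add: k mult_ac)
qed

lemma DERIV_lap1:
  fixes x b :: "'b::euclidean_space"
  assumes n: "DIM('b) \<ge> 3" and x: "x + s *\<^sub>R b \<noteq> 0"
  shows "((\<lambda>s. lap1 b (x + s *\<^sub>R b)) has_real_derivative lap2 b (x + s *\<^sub>R b)) (at s)"
proof -
  let ?y = "x + s *\<^sub>R b" and ?n = "DIM('b)"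
  have "((\<lambda>s. (x + s *\<^sub>R b) \<bullet> b) has_real_derivative b \<bullet> b) (at s)"
    unfolding inner_simps by (auto intro!: derivative_eq_intros)
  from DERIV_mult[OF this DERIV_inverse_norm_power[OF DIM_positive x]]
  have "((\<lambda>s. (x + s *\<^sub>R b) \<bullet> b * (1 / norm (x + s *\<^sub>R b) ^ ?n)) has_real_derivative
     (b \<bullet> b) * (1 / norm ?y ^ ?n) + (- real ?n * (?y \<bullet> b) / norm ?y ^ (?n + 2)) * (?y \<bullet> b)) (at s)" .
  note d = DERIV_cmult[OF this, of "- (real ?n - 2) * lapc TYPE('b)"]
  have gen: "- (N - 2) * C * (B * (1 / P) + (- N * Y / R) * Y) = (N - 2) * C * (N * Y\<^sup>2 / R - B / P)"
    for N C B P Y R :: real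
    by (simp add: divide_inverse algebra_simps power2_eq_square)
  from DERIV_cong[OF d gen] show ?thesis
    unfolding lap1_def lap2_def by (simp only: times_divide_eq_right mult_1_right)
qed

text \<open>Harmonicity of the Laplace kernel off the origin: the squared coordinates sum to the
  squared norm, so the two terms of \<open>lap2\<close> balance.\<close>

lemma lap2_sum_eq_0:
  fixes x :: "'b::euclidean_space"
  assumes "x \<noteq> 0"
  shows "(\<Sum>b\<in>Basis. lap2 b x) = 0"
proof -
  have e: "(\<Sum>b\<in>Basis. (x \<bullet> b)\<^sup>2) = (norm x)\<^sup>2"
    unfolding power2_norm_eq_inner using euclidean_inner[of x x] by (simp add: power2_eq_square)
  have "(\<Sum>b\<in>Basis. real DIM('b) * (x \<bullet> b)\<^sup>2 / norm x ^ (DIM('b) + 2) - (b \<bullet> b) / norm x ^ DIM('b))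
     = real DIM('b) * (\<Sum>b\<in>Basis. (x \<bullet> b)\<^sup>2) / norm x ^ (DIM('b) + 2) - real DIM('b) / norm x ^ DIM('b)"
    by (simp add: sum_subtractf sum_distrib_left sum_divide_distrib)
  also have "\<dots> = 0" unfolding e using assms by (simp add: power_add power2_eq_square)
  finally show ?thesis unfolding lap2_def by (simp add: sum_distrib_left[symmetric])
qed

lemma lap1_bound: "DIM('b) \<ge> 3 \<Longrightarrow> \<bar>lap1 b x\<bar> \<le> (real DIM('b) - 2) * lapc TYPE('b) * norm b * (1 / norm x ^ (DIM('b) - 1))"
  for x b :: "'b::euclidean_space"
proof -
  assume n: "DIM('b) \<ge> 3"
  show ?thesis
  proof (cases "x = 0")
    case False
    obtain k where k: "DIM('b) = Suc k" using n by (cases "DIM('b)") auto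
    have "\<bar>x \<bullet> b\<bar> / norm x ^ DIM('b) \<le> (norm x * norm b) / norm x ^ DIM('b)"
      by (intro divide_right_mono Cauchy_Schwarz_ineq2) auto
    also have "\<dots> = norm b * (1 / norm x ^ (DIM('b) - 1))" using False by (simp add: k)
    finally have "((real DIM('b) - 2) * lapc TYPE('b)) * (\<bar>x \<bullet> b\<bar> / norm x ^ DIM('b))
        \<le> ((real DIM('b) - 2) * lapc TYPE('b)) * (norm b * (1 / norm x ^ (DIM('b) - 1)))"
      using n lapc_pos[OF n] by (intro mult_left_mono) auto
    moreover have "\<bar>lap1 b x\<bar> = ((real DIM('b) - 2) * lapc TYPE('b)) * (\<bar>x \<bullet> b\<bar> / norm x ^ DIM('b))"
      using n lapc_pos[OF n] by (simp add: lap1_def abs_mult)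
    ultimately show ?thesis by (simp only: mult.assoc)
  qed (use n lapc_pos[OF n] in \<open>auto simp: lap1_def\<close>)
qed

lemma lap2_bound: "DIM('b) \<ge> 3 \<Longrightarrow>
    \<bar>lap2 b x\<bar> \<le> (real DIM('b) - 2) * lapc TYPE('b) * (real DIM('b) + 1) * (norm b)\<^sup>2 * (1 / norm x ^ DIM('b))"
  for x b :: "'b::euclidean_space"
proof -
  assume n: "DIM('b) \<ge> 3"
  show ?thesis
  proof (cases "x = 0")
    case False
    have "(x \<bullet> b)\<^sup>2 \<le> (norm x * norm b)\<^sup>2"
      using Cauchy_Schwarz_ineq2[of x b] by (metis abs_ge_zero power2_abs power_mono)
    then have "real DIM('b) * (x \<bullet> b)\<^sup>2 / norm x ^ (DIM('b) + 2) \<le> real DIM('b) * (norm x * norm b)\<^sup>2 / norm x ^ (DIM('b) + 2)"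
      by (intro divide_right_mono mult_left_mono) auto
    also have "\<dots> = real DIM('b) * (norm b)\<^sup>2 * (1 / norm x ^ DIM('b))"
      using False by (simp add: power_add power_mult_distrib power2_eq_square)
    finally have 1: "real DIM('b) * (x \<bullet> b)\<^sup>2 / norm x ^ (DIM('b) + 2) \<le> real DIM('b) * (norm b)\<^sup>2 * (1 / norm x ^ DIM('b))" .
    have 2: "(b \<bullet> b) / norm x ^ DIM('b) = (norm b)\<^sup>2 * (1 / norm x ^ DIM('b))" by (simp add: power2_norm_eq_inner)
    have 3: "0 \<le> real DIM('b) * (x \<bullet> b)\<^sup>2 / norm x ^ (DIM('b) + 2)" "0 \<le> (norm b)\<^sup>2 * (1 / norm x ^ DIM('b))" by auto
    have "\<bar>real DIM('b) * (x \<bullet> b)\<^sup>2 / norm x ^ (DIM('b) + 2) - (b \<bullet> b) / norm x ^ DIM('b)\<bar>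
        \<le> real DIM('b) * (norm b)\<^sup>2 * (1 / norm x ^ DIM('b)) + (norm b)\<^sup>2 * (1 / norm x ^ DIM('b))"
      unfolding 2 using 1 3 by linarith
    also have "\<dots> = (real DIM('b) + 1) * (norm b)\<^sup>2 * (1 / norm x ^ DIM('b))" by (simp add: algebra_simps)
    finally have "(real DIM('b) - 2) * lapc TYPE('b) * \<bar>real DIM('b) * (x \<bullet> b)\<^sup>2 / norm x ^ (DIM('b) + 2) - (b \<bullet> b) / norm x ^ DIM('b)\<bar>
        \<le> (real DIM('b) - 2) * lapc TYPE('b) * ((real DIM('b) + 1) * (norm b)\<^sup>2 * (1 / norm x ^ DIM('b)))"
      using n lapc_pos[OF n] by (intro mult_left_mono) auto
    then show ?thesis unfolding lap2_def abs_mult using n lapc_pos[OF n] by (simp add: mult.assoc)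
  qed (use n lapc_pos[OF n] in \<open>auto simp: lap2_def zero_power\<close>)
qed

lemma borel_measurable_lap [measurable]:
  fixes f :: "'c \<Rightarrow> 'b::euclidean_space"
  assumes [measurable]: "f \<in> borel_measurable M"
  shows "DIM('b) \<ge> 3 \<Longrightarrow> (\<lambda>x. laplace_kernel (f x)) \<in> borel_measurable M"
    and "(\<lambda>x. lap1 b (f x)) \<in> borel_measurable M" and "(\<lambda>x. lap2 b (f x)) \<in> borel_measurable M"
  by (simp_all add: laplace_kernel_eq lap1_def[abs_def] lap2_def[abs_def])

lemma continuous_on_lap:
  fixes f :: "'c::topological_space \<Rightarrow> 'b::euclidean_space"
  assumes "continuous_on S f" "\<And>x. x \<in> S \<Longrightarrow> f x \<noteq> 0"
  shows "DIM('b) \<ge> 3 \<Longrightarrow> continuous_on S (\<lambda>x. laplace_kernel (f x))"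
    and "continuous_on S (\<lambda>x. lap1 b (f x))" and "continuous_on S (\<lambda>x. lap2 b (f x))"
proof -
  have p: "norm (f x) ^ k \<noteq> 0" if "x \<in> S" for x k using assms(2)[OF that] by simp
  show "continuous_on S (\<lambda>x. laplace_kernel (f x))" if "DIM('b) \<ge> 3"
    unfolding laplace_kernel_eq[OF that] by (intro continuous_intros assms ballI p)
  have i: "continuous_on S (\<lambda>x. f x \<bullet> b)" by (intro continuous_intros assms(1))
  have k: "continuous_on S (\<lambda>x. norm (f x) ^ k)" for k by (intro continuous_intros assms(1))
  show "continuous_on S (\<lambda>x. lap1 b (f x))"
    unfolding lap1_def by (intro continuous_on_mult continuous_on_const continuous_on_divide i k ballI p)
  show "continuous_on S (\<lambda>x. lap2 b (f x))"
    unfolding lap2_def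
    by (intro continuous_on_mult continuous_on_diff continuous_on_power continuous_on_const continuous_on_divide i k ballI p)
qed

subsection \<open>Potentials of functions on the boundary hyperplane\<close>

lemma laplace_kernel_le:
  fixes w :: "'a::euclidean_space" and z :: real
  assumes m: "DIM('a) \<ge> 2"
  shows "0 \<le> laplace_kernel (w, z)"
    and "w \<noteq> 0 \<Longrightarrow> laplace_kernel (w, z) \<le> lapc TYPE('a \<times> real) * (1 / norm w ^ (DIM('a) - 1))"
    and "z \<noteq> 0 \<Longrightarrow> laplace_kernel (w, z) \<le> lapc TYPE('a \<times> real) * (1 / \<bar>z\<bar> ^ (DIM('a) - 1))"
proof -
  have n: "DIM('a \<times> real) \<ge> 3" using m by simp
  have e: "laplace_kernel (w, z) = lapc TYPE('a \<times> real) * (1 / norm (w, z) ^ (DIM('a) - 1))"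
    using laplace_kernel_eq[OF n, of "(w, z)"] by simp
  note c = lapc_pos[OF n]
  show "0 \<le> laplace_kernel (w, z)" unfolding e using c by simp
  show "laplace_kernel (w, z) \<le> lapc TYPE('a \<times> real) * (1 / norm w ^ (DIM('a) - 1))" if "w \<noteq> 0"
    unfolding e using c norm_fst_le[of w z] that
    by (intro mult_left_mono divide_left_mono power_mono) (auto simp: norm_eq_zero[of "(w, z)"] zero_prod_def)
  show "laplace_kernel (w, z) \<le> lapc TYPE('a \<times> real) * (1 / \<bar>z\<bar> ^ (DIM('a) - 1))" if "z \<noteq> 0"
    unfolding e using c norm_snd_le[of z w] that
    by (intro mult_left_mono divide_left_mono power_mono) (auto simp: norm_eq_zero[of "(w, z)"] zero_prod_def)
qed

text \<open>Boundedness and support in the open unit ball are encoded in one inequality, so that M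
  times an indicator is an integrable majorant. M enters later bounds linearly.\<close>

definition ball_bounded :: "real \<Rightarrow> ('a::euclidean_space \<Rightarrow> real) \<Rightarrow> bool" where
  "ball_bounded M D \<longleftrightarrow> D \<in> borel_measurable borel \<and> (\<forall>y. \<bar>D y\<bar> \<le> M * indicator (ball 0 1) y)"

lemma ball_boundedD:
  assumes "ball_bounded M D"
  shows "D \<in> borel_measurable borel" and "\<bar>D y\<bar> \<le> M * indicator (ball 0 1) y" and "0 \<le> M" and "\<bar>D y\<bar> \<le> M"
proof -
  show 1: "D \<in> borel_measurable borel" "\<bar>D y\<bar> \<le> M * indicator (ball 0 1) y" for y
    using assms by (auto simp: ball_bounded_def)
  show M: "0 \<le> M" using 1(2)[of 0] by simp
  show "\<bar>D y\<bar> \<le> M" using 1(2)[of y] M by (cases "norm y < 1") auto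
qed

lemma integrable_indicator_ball: "integrable lborel (\<lambda>y::'a::euclidean_space. indicator (ball 0 1) y :: real)"
  using emeasure_lborel_ball_finite[of "0::'a" 1] by (intro integrable_real_indicator) auto

lemma integrable_ball_bounded_mult:
  assumes D: "ball_bounded M D" and f: "f \<in> borel_measurable borel" and K: "\<And>y. \<bar>f y\<bar> \<le> K"
  shows "integrable lborel (\<lambda>y::'a::euclidean_space. D y * f y)"
    and "\<bar>D y * f y\<bar> \<le> M * K * indicator (ball 0 1) y"
proof -
  note [measurable] = ball_boundedD(1)[OF D] f
  have K0: "0 \<le> K" using K[of 0] by linarith
  show b: "\<bar>D y * f y\<bar> \<le> M * K * indicator (ball 0 1) y" for y
  proof -
    have "\<bar>D y * f y\<bar> \<le> (M * indicator (ball 0 1) y) * K"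
      unfolding abs_mult using ball_boundedD(2,3)[OF D] K by (intro mult_mono) auto
    then show ?thesis by (simp add: mult_ac)
  qed
  show "integrable lborel (\<lambda>y::'a::euclidean_space. D y * f y)"
    by (rule Bochner_Integration.integrable_bound[OF Bochner_Integration.integrable_mult_right[OF integrable_indicator_ball, of "M * K"]])
       (use b in \<open>auto intro!: AE_I2 order_trans[OF b abs_ge_self]\<close>)
qed

text \<open>The harmonic function in the upper half-space with density D on the hyperplane. For D =
  \<partial>_i \<partial>_k gS this is the F of the overview. With m = DIM('a) the kernel at z = 0
  is a multiple of |w-y|^(1-m), still locally integrable in dimension m.\<close>

definition potential :: "('a::euclidean_space \<Rightarrow> real) \<Rightarrow> 'a \<Rightarrow> real \<Rightarrow> real" where
  "potential D w z = (LBINT y. D y * laplace_kernel (w - y, z))"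

lemma borel_measurable_potential [measurable]:
  fixes D :: "'a::euclidean_space \<Rightarrow> real" and f :: "'c \<Rightarrow> 'a"
  assumes m: "DIM('a) \<ge> 2" and [measurable]: "D \<in> borel_measurable borel" "f \<in> borel_measurable M" "g \<in> borel_measurable M"
  shows "(\<lambda>x. potential D (f x) (g x)) \<in> borel_measurable M"
proof -
  have n: "DIM('a \<times> real) \<ge> 3" using m by simp
  note [measurable] = borel_measurable_lap(1)[OF _ n]
  show ?thesis unfolding potential_def by measurable
qed

text \<open>For w near the ball the bound is the uniform integral of the singular model kernel, for
  w far away the kernel is bounded pointwise on the ball. The constant covers all heights z
  including 0, because |(w,z)| \<ge> |w|.\<close>

lemma ball_potential_bound:
  assumes m: "DIM('a::euclidean_space) \<ge> 2"
  shows "integrable lborel (\<lambda>y::'a. indicator (ball 0 1) y * laplace_kernel (w - y, z :: real))"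
    and "\<exists>C>0. \<forall>(w::'a) (z::real). (LBINT y. indicator (ball 0 1) y * laplace_kernel (w - y, z)) \<le> C / wt w ^ (DIM('a) - 1)"
proof -
  let ?c = "lapc TYPE('a \<times> real)" and ?m = "DIM('a)"
  have n: "DIM('a \<times> real) \<ge> 3" using m by simp
  note [measurable] = borel_measurable_lap(1)[OF _ n]
  have c: "0 < ?c" by (rule lapc_pos[OF n])
  \<comment> \<open>Since w - (w - y) is y, the weight is that of y and is at most 2 on the ball,
    which explains the power of 2. In this form the reflection y = w - u produces the uniformly
    bounded model integral.\<close>
  let ?g = "\<lambda>w y. 2 ^ (?m + 1) * ?c * (1 / wt (w - (w - y)) ^ (?m + 1) * (1 / norm (w - y) ^ (?m - 1)))"
  have g: "integrable lborel (?g w)" for w :: 'a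
    by (intro Bochner_Integration.integrable_mult_right integrable_lborel_translate(2)[OF integrable_wt_norm[OF m, of w]])
  have le: "AE y in lborel. indicator (ball 0 1) y * laplace_kernel (w - y, z) \<le> ?g w y" for w :: 'a and z :: real
  proof -
    have "AE y in lborel. y \<noteq> w" by (rule AE_lborel_singleton)
    then show ?thesis
    proof eventually_elim
      fix y assume y: "y \<noteq> w"
      have g0: "0 \<le> ?g w y" using c by (simp add: wt_nonneg)
      show "indicator (ball 0 1) y * laplace_kernel (w - y, z) \<le> ?g w y"
      proof (cases "norm y < 1")
        case True
        then have "wt y ^ (?m + 1) \<le> 2 ^ (?m + 1)" by (intro power_mono wt_nonneg) (simp add: wt_def)
        then have "1 \<le> 2 ^ (?m + 1) * (1 / wt y ^ (?m + 1))" using wt_pos[of y] by (simp add: field_simps)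
        then have "1 * (?c * (1 / norm (w - y) ^ (?m - 1))) \<le> (2 ^ (?m + 1) * (1 / wt y ^ (?m + 1))) * (?c * (1 / norm (w - y) ^ (?m - 1)))"
          using c by (intro mult_right_mono) auto
        then show ?thesis using laplace_kernel_le(2)[OF m, of "w - y" z] True y by (simp add: mult_ac)
      qed (use g0 in simp)
    qed
  qed
  show I: "integrable lborel (\<lambda>y. indicator (ball 0 1) y * laplace_kernel (w - y, z))" for w :: 'a and z :: real
  proof (rule Bochner_Integration.integrable_bound[OF g[of w]])
    show "(\<lambda>y. indicator (ball 0 1) y * laplace_kernel (w - y, z)) \<in> borel_measurable lborel"
    proof -
      have [measurable]: "ball (0::'a) 1 \<in> sets borel" by simp
      show ?thesis by measurable
    qed
    show "AE y in lborel. norm (indicator (ball 0 1) y * laplace_kernel (w - y, z)) \<le> norm (?g w y)"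
      using le[of w z]
    proof eventually_elim
      case (elim y)
      have "0 \<le> indicator (ball 0 1) y * laplace_kernel (w - y, z)" using laplace_kernel_le(1)[OF m] by simp
      then show ?case using elim unfolding real_norm_def by linarith
    qed
  qed
  obtain C0 where C0: "C0 > 0" "\<And>x. (LBINT w::'a. 1 / wt (x - w) ^ (?m + 1) * (1 / norm w ^ (?m - 1))) \<le> C0"
    using integral_wt_norm_bound[OF m] by blast
  let ?Q = "\<lambda>w z. LBINT y. indicator (ball 0 1) y * laplace_kernel (w - y, z)"
  have near: "?Q w z \<le> 2 ^ (?m + 1) * ?c * C0" for w :: 'a and z :: real
  proof -
    have "?Q w z \<le> (LBINT y. ?g w y)"
      by (rule integral_mono_AE[OF I g le])
    also have "\<dots> = 2 ^ (?m + 1) * ?c * (LBINT u. 1 / wt (w - u) ^ (?m + 1) * (1 / norm u ^ (?m - 1)))"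
      unfolding integral_mult_right_zero
      by (subst integral_reflect[of "\<lambda>u. 1 / wt (w - u) ^ (?m + 1) * (1 / norm u ^ (?m - 1))" w]) simp
    also have "\<dots> \<le> 2 ^ (?m + 1) * ?c * C0" using c C0 by (intro mult_left_mono) auto
    finally show ?thesis .
  qed
  let ?V = "measure lborel (ball (0::'a) 1)"
  let ?C = "3 ^ (?m - 1) * (2 ^ (?m + 1) * ?c * C0) + 3 ^ (?m - 1) * ?c * ?V"
  have "?Q w z \<le> ?C / wt w ^ (?m - 1)" for w :: 'a and z :: real
  proof (cases "norm w < 2")
    case True
    then have "wt w ^ (?m - 1) \<le> 3 ^ (?m - 1)" by (intro power_mono wt_nonneg) (simp add: wt_def)
    then have "1 \<le> 3 ^ (?m - 1) * (1 / wt w ^ (?m - 1))" using wt_pos[of w] by (simp add: field_simps)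
    then have "(2 ^ (?m + 1) * ?c * C0) * 1 \<le> (2 ^ (?m + 1) * ?c * C0) * (3 ^ (?m - 1) * (1 / wt w ^ (?m - 1)))"
      using c C0 by (intro mult_left_mono) auto
    moreover have "0 \<le> 3 ^ (?m - 1) * ?c * ?V / wt w ^ (?m - 1)" using c wt_nonneg[of w] by simp
    ultimately show ?thesis using near[of w z] by (simp add: add_divide_distrib mult_ac)
  next
    case False
    have "?Q w z \<le> (LBINT y. indicator (ball (0::'a) 1) y * (3 ^ (?m - 1) * ?c / wt w ^ (?m - 1)))"
    proof (rule integral_mono[OF I])
      show "integrable lborel (\<lambda>y. indicator (ball (0::'a) 1) y * (3 ^ (?m - 1) * ?c / wt w ^ (?m - 1)))"
        by (intro Bochner_Integration.integrable_mult_left integrable_indicator_ball)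
      fix y :: 'a
      show "indicator (ball 0 1) y * laplace_kernel (w - y, z) \<le> indicator (ball 0 1) y * (3 ^ (?m - 1) * ?c / wt w ^ (?m - 1))"
      proof (cases "norm y < 1")
        case True
        have "norm w \<le> norm (w - y) + norm y" using norm_triangle_ineq[of "w - y" y] by simp
        \<comment> \<open>From |w - y| > |w| - 1 and |w| \<ge> 2 one has 3 |w - y| \<ge> 1 +
          |w|.\<close>
        then have 1: "wt w / 3 \<le> norm (w - y)" using True False by (simp add: wt_def)
        have wp: "0 < wt w / 3" using wt_pos[of w] by simp
        have "laplace_kernel (w - y, z) \<le> ?c * (1 / norm (w - y) ^ (?m - 1))"
          using 1 wp by (intro laplace_kernel_le(2)[OF m]) auto
        also have "\<dots> \<le> ?c * (1 / (wt w / 3) ^ (?m - 1))"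
        proof -
          have "0 < norm (w - y)" using 1 wp by linarith
          from zero_less_power[OF this, of "?m - 1"] zero_less_power[OF wp, of "?m - 1"] show ?thesis
            using 1 wp c by (intro mult_left_mono divide_left_mono power_mono mult_pos_pos) auto
        qed
        also have "\<dots> = 3 ^ (?m - 1) * ?c / wt w ^ (?m - 1)" by (simp add: power_divide)
        finally show ?thesis using True by simp
      qed simp
    qed
    also have "\<dots> = 3 ^ (?m - 1) * ?c * ?V / wt w ^ (?m - 1)" by simp
    also have "\<dots> \<le> ?C / wt w ^ (?m - 1)"
      using c C0 wt_nonneg[of w] by (intro divide_right_mono) auto
    finally show ?thesis .
  qed
  moreover have "0 < ?C" using c C0 content_ball_pos[of 1 "0::'a"] by (intro add_nonneg_pos mult_pos_pos) auto
  ultimately have "0 < ?C \<and> (\<forall>(w::'a) (z::real). ?Q w z \<le> ?C / wt w ^ (DIM('a) - 1))" by simp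
  then show "\<exists>C>0. \<forall>(w::'a) (z::real). ?Q w z \<le> C / wt w ^ (DIM('a) - 1)"
    by (rule exI)
qed

lemma integrable_potential:
  assumes m: "DIM('a::euclidean_space) \<ge> 2" and D: "ball_bounded M D"
  shows "integrable lborel (\<lambda>y::'a. D y * laplace_kernel (w - y, z :: real))"
proof (rule Bochner_Integration.integrable_bound[OF Bochner_Integration.integrable_mult_right[OF ball_potential_bound(1)[OF m, of w z], of M]])
  have n: "DIM('a \<times> real) \<ge> 3" using m by simp
  note [measurable] = borel_measurable_lap(1)[OF _ n] ball_boundedD(1)[OF D]
  show "(\<lambda>y::'a. D y * laplace_kernel (w - y, z)) \<in> borel_measurable lborel" by measurable
  show "AE y in lborel. norm (D y * laplace_kernel (w - y, z)) \<le> norm (M * (indicator (ball 0 1) y * laplace_kernel (w - y, z)))"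
  proof (rule AE_I2)
    fix y
    have "norm (D y * laplace_kernel (w - y, z)) \<le> (M * indicator (ball 0 1) y) * laplace_kernel (w - y, z)"
      unfolding real_norm_def abs_mult using ball_boundedD(2)[OF D, of y] laplace_kernel_le(1)[OF m, of "w - y" z]
      by (simp add: mult_right_mono)
    also have "\<dots> \<le> norm (M * (indicator (ball 0 1) y * laplace_kernel (w - y, z)))"
      by (simp only: mult.assoc real_norm_def abs_ge_self)
    finally show "norm (D y * laplace_kernel (w - y, z)) \<le> norm (M * (indicator (ball 0 1) y * laplace_kernel (w - y, z)))" .
  qed
qed

lemma potential_bound:
  assumes m: "DIM('a::euclidean_space) \<ge> 2"
  shows "\<exists>C>0. \<forall>M D (w::'a) z. ball_bounded M D \<longrightarrow> \<bar>potential D w z\<bar> \<le> C * M / wt w ^ (DIM('a) - 1)"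
proof -
  obtain C where C: "C > 0" "\<forall>(w::'a) (z::real). (LBINT y. indicator (ball 0 1) y * laplace_kernel (w - y, z)) \<le> C / wt w ^ (DIM('a) - 1)"
    using ball_potential_bound(2)[OF m] by (elim exE conjE)
  have "\<bar>potential D w z\<bar> \<le> C * M / wt w ^ (DIM('a) - 1)" if D: "ball_bounded M D" for M D and w :: 'a and z
  proof -
    have "\<bar>potential D w z\<bar> \<le> (LBINT y. \<bar>D y * laplace_kernel (w - y, z)\<bar>)"
      unfolding potential_def using integral_norm_bound[of lborel "\<lambda>y. D y * laplace_kernel (w - y, z)"] by simp
    also have "\<dots> \<le> (LBINT y. M * (indicator (ball 0 1) y * laplace_kernel (w - y, z)))"
    proof (rule integral_mono)
      show "\<bar>D y * laplace_kernel (w - y, z)\<bar> \<le> M * (indicator (ball 0 1) y * laplace_kernel (w - y, z))" for y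
        unfolding abs_mult mult.assoc[symmetric] using ball_boundedD(2)[OF D, of y] laplace_kernel_le(1)[OF m, of "w - y" z]
        by (simp add: mult_right_mono)
    qed (intro integrable_abs integrable_potential[OF m D] Bochner_Integration.integrable_mult_right ball_potential_bound(1)[OF m])+
    also have "\<dots> \<le> M * (C / wt w ^ (DIM('a) - 1))"
      using mult_left_mono[OF C(2)[rule_format, of w z] ball_boundedD(3)[OF D]] by simp
    finally show ?thesis by (simp add: mult.commute)
  qed
  with C(1) show ?thesis by blast
qed

lemma laplace_kernel_le_boundary:
  fixes u :: "'a::euclidean_space"
  assumes m: "DIM('a) \<ge> 2" and u: "u \<noteq> 0"
  shows "laplace_kernel (u, z :: real) \<le> laplace_kernel (u, 0 :: real)"
proof -
  have n: "DIM('a \<times> real) \<ge> 3" using m by simp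
  have "laplace_kernel (u, 0 :: real) = lapc TYPE('a \<times> real) * (1 / norm u ^ (DIM('a) - 1))"
    using laplace_kernel_eq[OF n, of "(u, 0)"] by (simp add: norm_Pair)
  then show ?thesis using laplace_kernel_le(2)[OF m u, of z] by simp
qed

text \<open>Along each vertical line the kernel is largest on the hyperplane, so its value at height
  0 is an integrable majorant for all heights. Only the point y = w has to be discarded. Continuity
  down to z = 0 is what later transfers estimates from z > 0 to the boundary.\<close>

lemma continuous_on_potential:
  fixes w :: "'a::euclidean_space"
  assumes m: "DIM('a) \<ge> 2" and D: "ball_bounded M D"
  shows "continuous_on {0..} (potential D w)"
  unfolding potential_def
proof (rule continuous_on_lebesgue_integral[where g="\<lambda>y. M * (indicator (ball 0 1) y * laplace_kernel (w - y, 0 :: real))"])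
  have n: "DIM('a \<times> real) \<ge> 3" using m by simp
  note [measurable] = borel_measurable_lap(1)[OF _ n] ball_boundedD(1)[OF D]
  show "(\<lambda>y. D y * laplace_kernel (w - y, z)) \<in> borel_measurable lborel" for z :: real by measurable
  show "integrable lborel (\<lambda>y. M * (indicator (ball 0 1) y * laplace_kernel (w - y, 0 :: real)))"
    by (intro Bochner_Integration.integrable_mult_right ball_potential_bound(1)[OF m])
  have "AE y in lborel. y \<noteq> w" by (rule AE_lborel_singleton)
  then show "AE y in lborel. continuous_on {0::real..} (\<lambda>z. D y * laplace_kernel (w - y, z)) \<and>
      (\<forall>z\<in>{0::real..}. \<bar>D y * laplace_kernel (w - y, z)\<bar> \<le> M * (indicator (ball 0 1) y * laplace_kernel (w - y, 0 :: real)))"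
  proof eventually_elim
    case (elim y)
    have "\<bar>D y * laplace_kernel (w - y, z)\<bar> \<le> (M * indicator (ball 0 1) y) * laplace_kernel (w - y, 0 :: real)" for z :: real
      unfolding abs_mult using ball_boundedD(2)[OF D, of y] ball_boundedD(3)[OF D] laplace_kernel_le(1)[OF m, of "w - y" z]
        laplace_kernel_le_boundary[OF m, of "w - y" z] elim
      by (intro mult_mono) auto
    moreover have "continuous_on {0::real..} (\<lambda>z. D y * laplace_kernel (w - y, z))"
      using elim by (intro continuous_on_mult continuous_on_const continuous_on_lap(1)[OF _ _ n] continuous_on_Pair continuous_on_id)
         (auto simp: zero_prod_def)
    ultimately show ?case by (simp add: mult.assoc)
  qed
qed

lemma lap_bound_away:
  fixes u :: "'a::euclidean_space" and b :: "'a \<times> real"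
  assumes m: "DIM('a) \<ge> 2" and z1: "0 < z1"
  shows "\<exists>K. \<forall>(u::'a) z. z1 \<le> z \<longrightarrow> laplace_kernel (u, z) \<le> K \<and> \<bar>lap1 b (u, z)\<bar> \<le> K \<and> \<bar>lap2 b (u, z)\<bar> \<le> K"
proof -
  have n: "DIM('a \<times> real) \<ge> 3" using m by simp
  let ?c = "lapc TYPE('a \<times> real)" and ?n = "DIM('a \<times> real)"
  let ?a1 = "(real ?n - 2) * ?c * norm b" and ?a2 = "(real ?n - 2) * ?c * (real ?n + 1) * (norm b)\<^sup>2"
  have a: "0 \<le> ?a1" "0 \<le> ?a2" "0 < ?c" using lapc_pos[OF n] m by auto
  have le: "1 / norm (u, z) ^ k \<le> 1 / z1 ^ k" if "z1 \<le> z" for u :: 'a and z k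
  proof -
    have "z1 \<le> norm (u, z)" using that norm_snd_le[of z u] by simp
    then show ?thesis using z1 by (intro divide_left_mono power_mono mult_pos_pos zero_less_power) auto
  qed
  have "laplace_kernel (u, z) \<le> ?c * (1 / z1 ^ (?n - 2)) + ?a1 * (1 / z1 ^ (?n - 1)) + ?a2 * (1 / z1 ^ ?n) \<and>
     \<bar>lap1 b (u, z)\<bar> \<le> ?c * (1 / z1 ^ (?n - 2)) + ?a1 * (1 / z1 ^ (?n - 1)) + ?a2 * (1 / z1 ^ ?n) \<and>
     \<bar>lap2 b (u, z)\<bar> \<le> ?c * (1 / z1 ^ (?n - 2)) + ?a1 * (1 / z1 ^ (?n - 1)) + ?a2 * (1 / z1 ^ ?n)"
    if z: "z1 \<le> z" for u :: 'a and z
  proof -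
    have "laplace_kernel (u, z) \<le> ?c * (1 / z1 ^ (?n - 2))"
      unfolding laplace_kernel_eq[OF n] using le[OF z, of u] a by (intro mult_left_mono) auto
    moreover have "\<bar>lap1 b (u, z)\<bar> \<le> ?a1 * (1 / z1 ^ (?n - 1))"
      by (rule order_trans[OF lap1_bound[OF n]]) (intro mult_left_mono le z a)
    moreover have "\<bar>lap2 b (u, z)\<bar> \<le> ?a2 * (1 / z1 ^ ?n)"
      by (rule order_trans[OF lap2_bound[OF n]]) (intro mult_left_mono le z a)
    moreover have "0 \<le> ?c * (1 / z1 ^ (?n - 2))" "0 \<le> ?a1 * (1 / z1 ^ (?n - 1))" "0 \<le> ?a2 * (1 / z1 ^ ?n)"
      using a z1 by (auto intro!: mult_nonneg_nonneg)
    ultimately show ?thesis by (intro conjI) linarith+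
  qed
  then show ?thesis by blast
qed

definition potential1 :: "('a::euclidean_space \<Rightarrow> real) \<Rightarrow> 'a \<Rightarrow> real \<Rightarrow> real" where
  "potential1 D w z = (LBINT y. D y * lap1 (0, 1) (w - y, z))"

lemma borel_measurable_potential1 [measurable]:
  fixes D :: "'a::euclidean_space \<Rightarrow> real" and f :: "'c \<Rightarrow> 'a"
  assumes [measurable]: "D \<in> borel_measurable borel" "f \<in> borel_measurable M" "g \<in> borel_measurable M"
  shows "(\<lambda>x. potential1 D (f x) (g x)) \<in> borel_measurable M"
  unfolding potential1_def by measurable

lemma DERIV_potential:
  fixes w :: "'a::euclidean_space"
  assumes m: "DIM('a) \<ge> 2" and D: "ball_bounded M D" and z: "z > 0"
  shows "((\<lambda>z. potential D w z) has_real_derivative potential1 D w z) (at z)"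
    and "((\<lambda>z. potential1 D w z) has_real_derivative (LBINT y. D y * lap2 (0, 1) (w - y, z))) (at z)"
    and "\<exists>K. \<forall>(w::'a) t. z / 2 \<le> t \<longrightarrow> \<bar>potential1 D w t\<bar> \<le> K"
proof -
  have n: "DIM('a \<times> real) \<ge> 3" using m by simp
  note [measurable] = borel_measurable_lap(1)[OF _ n] ball_boundedD(1)[OF D]
  obtain K where K: "\<And>(u::'a) t. z / 2 \<le> t \<Longrightarrow> laplace_kernel (u, t) \<le> K \<and> \<bar>lap1 (0, 1) (u, t)\<bar> \<le> K \<and> \<bar>lap2 (0, 1) (u, t)\<bar> \<le> K"
    using lap_bound_away[OF m, of "z / 2" "(0, 1)"] z by auto
  have t: "z / 2 \<le> t" "t > 0" if "\<bar>t - z\<bar> < z / 2" for t using that by (auto simp: abs_if split: if_splits)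
  have b0: "\<bar>laplace_kernel (u, t)\<bar> \<le> K" "\<bar>lap1 (0, 1) (u, t)\<bar> \<le> K" "\<bar>lap2 (0, 1) (u, t)\<bar> \<le> K" if "z / 2 \<le> t" for u :: 'a and t
    using K[OF that, of u] laplace_kernel_le(1)[OF m, of u t] by auto
  have e: "(u, t) = (u, 0) + t *\<^sub>R (0, 1)" for u :: 'a and t :: real by simp
  have d0: "((\<lambda>t. laplace_kernel (u, t)) has_real_derivative lap1 (0, 1) (u, t)) (at t)" if "t > 0" for u :: 'a and t
    using DERIV_laplace_kernel[OF n, of "(u, 0)" t "(0, 1)"] that unfolding e[symmetric] by (simp add: zero_prod_def)
  have d1: "((\<lambda>t. lap1 (0, 1) (u, t)) has_real_derivative lap2 (0, 1) (u, t)) (at t)" if "t > 0" for u :: 'a and t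
    using DERIV_lap1[OF n, of "(u, 0)" t "(0, 1)"] that unfolding e[symmetric] by (simp add: zero_prod_def)
  have I: "integrable lborel (\<lambda>y. M * K * indicator (ball (0::'a) 1) y)"
    by (intro Bochner_Integration.integrable_mult_right integrable_indicator_ball)
  have m0: "(\<lambda>y. laplace_kernel (w - y, t)) \<in> borel_measurable borel" for t :: real by measurable
  have m1: "(\<lambda>y. lap1 (0, 1) (w - y, t)) \<in> borel_measurable borel" "(\<lambda>y. lap2 (0, 1) (w - y, t)) \<in> borel_measurable borel" for t :: real and w :: 'a by measurable
  show "((\<lambda>z. potential D w z) has_real_derivative potential1 D w z) (at z)"
    unfolding potential_def potential1_def
    by (rule has_real_derivative_lebesgue_integral(2)[where d="z/2" and g="\<lambda>y. M * K * indicator (ball (0::'a) 1) y"])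
       (use z t in \<open>auto intro!: integrable_potential[OF m D] DERIV_cmult d0 I integrable_ball_bounded_mult(2)[OF D m1(1)] b0 simp: integrable_indicator_ball\<close>)
  show "((\<lambda>z. potential1 D w z) has_real_derivative (LBINT y. D y * lap2 (0, 1) (w - y, z))) (at z)"
    unfolding potential1_def
    by (rule has_real_derivative_lebesgue_integral(2)[where d="z/2" and g="\<lambda>y. M * K * indicator (ball (0::'a) 1) y"])
       (use z t in \<open>auto intro!: integrable_ball_bounded_mult(1)[OF D m1(1), where K=K] DERIV_cmult d1 I integrable_ball_bounded_mult(2)[OF D m1(2)] b0 simp: integrable_indicator_ball\<close>)
  have "\<bar>potential1 D w t\<bar> \<le> M * K * measure lborel (ball (0::'a) 1)" if "z / 2 \<le> t" for w :: 'a and t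
  proof -
    have "\<bar>potential1 D w t\<bar> \<le> (LBINT y. \<bar>D y * lap1 (0, 1) (w - y, t)\<bar>)"
      unfolding potential1_def using integral_norm_bound[of lborel "\<lambda>y. D y * lap1 (0, 1) (w - y, t)"] by simp
    also have "\<dots> \<le> (LBINT y. M * K * indicator (ball (0::'a) 1) y)"
      by (rule integral_mono) (intro integrable_abs integrable_ball_bounded_mult[OF D m1(1), where K=K] b0 that I)+
    finally show ?thesis by simp
  qed
  then show "\<exists>K. \<forall>(w::'a) t. z / 2 \<le> t \<longrightarrow> \<bar>potential1 D w t\<bar> \<le> K" by blast
qed

text \<open>At positive height the kernel is smooth in y, and one integration by parts moves a
  tangential derivative from it to the density. The sign of the integration by parts cancels the
  sign from differentiating at w - y.\<close>

lemma potential_tangential_derivatives: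
  fixes w l :: "'a::euclidean_space"
  assumes m: "DIM('a) \<ge> 2" and z: "z > 0"
    and D: "ball_bounded M D" "continuous_on UNIV D" and D': "ball_bounded M' D'" "continuous_on UNIV D'"
    and der: "\<And>y. ((\<lambda>s. D (y + s *\<^sub>R l)) has_real_derivative D' y) (at 0)"
  shows "(LBINT y. D y * lap1 (l, 0) (w - y, z)) = potential D' w z"
    and "(LBINT y. D y * lap2 (l, 0) (w - y, z)) = (LBINT y. D' y * lap1 (l, 0) (w - y, z))"
proof -
  have n: "DIM('a \<times> real) \<ge> 3" using m by simp
  note [measurable] = borel_measurable_lap(1)[OF _ n]
  obtain K where K: "\<And>(u::'a). laplace_kernel (u, z) \<le> K \<and> \<bar>lap1 (l, 0) (u, z)\<bar> \<le> K \<and> \<bar>lap2 (l, 0) (u, z)\<bar> \<le> K"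
    using lap_bound_away[OF m z, of "(l, 0)"] by auto
  have b0: "\<bar>laplace_kernel (u, z)\<bar> \<le> K" "\<bar>lap1 (l, 0) (u, z)\<bar> \<le> K" "\<bar>lap2 (l, 0) (u, z)\<bar> \<le> K" for u :: 'a
    using K[of u] laplace_kernel_le(1)[OF m, of u z] by auto
  have m0: "(\<lambda>y::'a. laplace_kernel (w - y, z)) \<in> borel_measurable borel" "(\<lambda>y. lap1 (l, 0) (w - y, z)) \<in> borel_measurable borel"
     "(\<lambda>y. lap2 (l, 0) (w - y, z)) \<in> borel_measurable borel" by measurable
  have nz: "(w - y, z) \<noteq> 0" for y using z by (simp add: zero_prod_def)
  have e: "(w - (y + s *\<^sub>R l), z) = (w - y, z) + s *\<^sub>R (- l, 0)" for y s by simp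
  have neg: "lap1 (- l, 0) x = - lap1 (l, 0) x" "lap2 (- l, 0) x = lap2 (l, 0) x" for x :: "'a \<times> real"
    by (cases x; simp add: lap1_def lap2_def)+
  have d0: "((\<lambda>s. laplace_kernel (w - (y + s *\<^sub>R l), z)) has_real_derivative - lap1 (l, 0) (w - y, z)) (at 0)" for y
    unfolding e using DERIV_laplace_kernel[OF n, of "(w - y, z)" 0 "(- l, 0)"] nz by (simp add: neg)
  have d1: "((\<lambda>s. lap1 (l, 0) (w - (y + s *\<^sub>R l), z)) has_real_derivative - lap2 (l, 0) (w - y, z)) (at 0)" for y
    unfolding e using DERIV_minus[OF DERIV_lap1[OF n, of "(w - y, z)" 0 "(- l, 0)"]] nz by (simp add: neg)
  have c: "continuous_on UNIV (\<lambda>y. laplace_kernel (w - y, z))" "continuous_on UNIV (\<lambda>y. lap1 (l, 0) (w - y, z))"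
     "continuous_on UNIV (\<lambda>y. lap2 (l, 0) (w - y, z))"
    by (intro continuous_on_lap n continuous_intros nz)+
  have c': "continuous_on UNIV (\<lambda>y. - lap1 (l, 0) (w - y, z))" "continuous_on UNIV (\<lambda>y. - lap2 (l, 0) (w - y, z))"
    using c by (auto intro: continuous_intros)
  have i: "integrable lborel (\<lambda>y. X y * laplace_kernel (w - y, z))" "integrable lborel (\<lambda>y. X y * lap1 (l, 0) (w - y, z))"
    "integrable lborel (\<lambda>y. X y * lap2 (l, 0) (w - y, z))" if "ball_bounded N X" for X N
    by (rule integrable_ball_bounded_mult(1)[OF that m0(1), where K=K] integrable_ball_bounded_mult(1)[OF that m0(2), where K=K]
        integrable_ball_bounded_mult(1)[OF that m0(3), where K=K], rule b0)+
  show "(LBINT y. D y * lap1 (l, 0) (w - y, z)) = potential D' w z"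
    using integral_by_parts_directional[where f=D and df=D' and b=l, OF i(1)[OF D(1)] i(1)[OF D'(1)] _ der d0 D(2) c(1) D'(2) c'(1)]
      i(2)[OF D(1)] by (simp add: potential_def)
  show "(LBINT y. D y * lap2 (l, 0) (w - y, z)) = (LBINT y. D' y * lap1 (l, 0) (w - y, z))"
    using integral_by_parts_directional[where f=D and df=D' and b=l, OF i(2)[OF D(1)] i(2)[OF D'(1)] _ der d1 D(2) c(2) D'(2) c'(2)]
      i(3)[OF D(1)] by simp
qed

text \<open>Harmonicity of the kernel trades the second normal derivative for the tangential
  Laplacian, which then moves to the density. The right side involves only the undifferentiated
  kernel, hence stays bounded down to z = 0, unlike the kernel on the left.\<close>

lemma potential_harmonic:
  fixes w :: "'a::euclidean_space"
  assumes m: "DIM('a) \<ge> 2" and z: "z > 0"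
    and D: "ball_bounded M D" "continuous_on UNIV D"
    and D1: "\<And>l. l \<in> Basis \<Longrightarrow> ball_bounded M (D1 l)" "\<And>l. l \<in> Basis \<Longrightarrow> continuous_on UNIV (D1 l)"
    and D2: "\<And>l. l \<in> Basis \<Longrightarrow> ball_bounded M (D2 l)" "\<And>l. l \<in> Basis \<Longrightarrow> continuous_on UNIV (D2 l)"
    and der1: "\<And>l y. l \<in> Basis \<Longrightarrow> ((\<lambda>s. D (y + s *\<^sub>R l)) has_real_derivative D1 l y) (at 0)"
    and der2: "\<And>l y. l \<in> Basis \<Longrightarrow> ((\<lambda>s. D1 l (y + s *\<^sub>R l)) has_real_derivative D2 l y) (at 0)"
  shows "(LBINT y. D y * lap2 (0, 1) (w - y, z)) = - (\<Sum>l\<in>Basis. potential (D2 l) w z)"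
proof -
  have i: "integrable lborel (\<lambda>y. D y * lap2 b (w - y, z))" for b :: "'a \<times> real"
  proof -
    obtain K where "\<And>(u::'a). \<bar>lap2 b (u, z)\<bar> \<le> K" using lap_bound_away[OF m z, of b] by blast
    then show ?thesis by (intro integrable_ball_bounded_mult(1)[OF D(1), where K=K]) measurable
  qed
  have B: "(Basis :: ('a \<times> real) set) = (\<lambda>l. (l, 0)) ` Basis \<union> {(0, 1)}" by (simp add: Basis_prod_def)
  have S: "(\<Sum>b\<in>Basis. f b) = (\<Sum>l\<in>Basis. f (l, 0)) + f (0, 1)" for f :: "'a \<times> real \<Rightarrow> real"
    unfolding B by (subst sum.union_disjoint) (auto simp: sum.reindex inj_on_def)
  have "(LBINT y. (\<Sum>b\<in>Basis. D y * lap2 b (w - y, z))) = 0"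
    using z by (simp add: sum_distrib_left[symmetric] lap2_sum_eq_0 zero_prod_def)
  then have "(\<Sum>l\<in>Basis. LBINT y. D y * lap2 (l, 0) (w - y, z)) + (LBINT y. D y * lap2 (0, 1) (w - y, z)) = 0"
    by (simp add: Bochner_Integration.integral_sum i S)
  moreover have "(LBINT y. D y * lap2 (l, 0) (w - y, z)) = potential (D2 l) w z" if l: "l \<in> Basis" for l
    using potential_tangential_derivatives(2)[OF m z D D1(1,2)[OF l] der1[OF l]]
      potential_tangential_derivatives(1)[OF m z D1(1,2)[OF l] D2(1,2)[OF l] der2[OF l]] by simp
  ultimately show ?thesis by simp
qed

text \<open>The variable is changed so that the shift acts on D instead of on the singular kernel.
  The difference of D is at most L |v| and lives on the union of two unit balls; both balls have
  potentials of the required decay, the shifted one by Peetre's inequality.\<close>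

lemma potential_Lipschitz:
  assumes m: "DIM('a::euclidean_space) \<ge> 2"
  shows "\<exists>C>0. \<forall>M L D (w::'a) v z. ball_bounded M D \<longrightarrow> (\<forall>x y. \<bar>D x - D y\<bar> \<le> L * norm (x - y)) \<longrightarrow>
    \<bar>potential D (w - v) z - potential D w z\<bar> \<le> C * L * (norm v * wt v ^ (DIM('a) - 1)) / wt w ^ (DIM('a) - 1)"
proof -
  have n: "DIM('a \<times> real) \<ge> 3" using m by simp
  note [measurable] = borel_measurable_lap(1)[OF _ n]
  have [measurable]: "ball (0::'a) 1 \<in> sets borel" by simp
  let ?m = "DIM('a) - 1"
  let ?Q = "\<lambda>(w::'a) (z::real). LBINT y. indicator (ball 0 1) y * laplace_kernel (w - y, z)"
  obtain C where C: "C > 0" "\<forall>(w::'a) (z::real). ?Q w z \<le> C / wt w ^ ?m"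
    using ball_potential_bound(2)[OF m] by (elim exE conjE)
  have refl: "(LBINT y. X y * laplace_kernel (w - y, z)) = (LBINT u. X (w - u) * laplace_kernel (u, z))" for X and w :: 'a and z :: real
    using integral_reflect[of "\<lambda>y. X y * laplace_kernel (w - y, z)" w] by simp
  have reflI: "integrable lborel (\<lambda>u. X (w - u) * laplace_kernel (u, z))"
    if "integrable lborel (\<lambda>y. X y * laplace_kernel (w - y, z))" for X and w :: 'a and z :: real
    using integrable_lborel_translate(2)[OF that, of w] by simp
  have "\<bar>potential D (w - v) z - potential D w z\<bar> \<le> (2 * C) * L * (norm v * wt v ^ ?m) / wt w ^ ?m"
    if D: "ball_bounded M D" and L: "\<And>x y. \<bar>D x - D y\<bar> \<le> L * norm (x - y)" for M L D and w v :: 'a and z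
  proof -
    have L0: "0 \<le> L"
    proof -
      obtain b :: 'a where "b \<in> Basis" using nonempty_Basis by blast
      then show ?thesis using L[of b 0] norm_Basis[of b] abs_ge_zero order_trans by fastforce
    qed
    have i: "integrable lborel (\<lambda>u. D (x - u) * laplace_kernel (u, z))" for x :: 'a
      by (rule reflI[OF integrable_potential[OF m D]])
    have j: "integrable lborel (\<lambda>u. indicator (ball 0 1) (x - u) * laplace_kernel (u, z))" for x :: 'a
      by (rule reflI[OF ball_potential_bound(1)[OF m]])
    have "potential D (w - v) z - potential D w z = (LBINT u. (D (w - v - u) - D (w - u)) * laplace_kernel (u, z))"
      unfolding potential_def refl using i by (simp add: left_diff_distrib)
    also have "\<bar>\<dots>\<bar> \<le> (LBINT u. \<bar>(D (w - v - u) - D (w - u)) * laplace_kernel (u, z)\<bar>)"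
      using integral_norm_bound[of lborel "\<lambda>u. (D (w - v - u) - D (w - u)) * laplace_kernel (u, z)"] by simp
    also have "\<dots> \<le> (LBINT u. L * norm v * (indicator (ball 0 1) (w - v - u) * laplace_kernel (u, z) + indicator (ball 0 1) (w - u) * laplace_kernel (u, z)))"
    proof (rule integral_mono)
      show "integrable lborel (\<lambda>u. \<bar>(D (w - v - u) - D (w - u)) * laplace_kernel (u, z)\<bar>)"
        using i by (intro integrable_abs) (simp add: left_diff_distrib)
      show "integrable lborel (\<lambda>u. L * norm v * (indicator (ball 0 1) (w - v - u) * laplace_kernel (u, z) + indicator (ball 0 1) (w - u) * laplace_kernel (u, z)))"
        by (intro Bochner_Integration.integrable_mult_right Bochner_Integration.integrable_add j)
      fix u
      have "\<bar>D (w - v - u) - D (w - u)\<bar> \<le> L * norm v * (indicator (ball 0 1) (w - v - u) + indicator (ball 0 1) (w - u))"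
      proof (cases "w - v - u \<in> ball 0 1 \<or> w - u \<in> ball 0 1")
        case True
        then have "1 \<le> (indicator (ball 0 1) (w - v - u) + indicator (ball 0 1) (w - u) :: real)" by (auto simp: indicator_def)
        from mult_left_mono[OF this, of "L * norm v"] show ?thesis
          using L[of "w - v - u" "w - u"] L0 by simp
      next
        case False
        then have "indicator (ball 0 1) (w - v - u) = (0::real)" "indicator (ball 0 1) (w - u) = (0::real)" by auto
        then show ?thesis using ball_boundedD(2)[OF D, of "w - v - u"] ball_boundedD(2)[OF D, of "w - u"] by simp
      qed
      then show "\<bar>(D (w - v - u) - D (w - u)) * laplace_kernel (u, z)\<bar>
        \<le> L * norm v * (indicator (ball 0 1) (w - v - u) * laplace_kernel (u, z) + indicator (ball 0 1) (w - u) * laplace_kernel (u, z))"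
        unfolding distrib_right[symmetric] mult.assoc[symmetric] abs_mult abs_of_nonneg[OF laplace_kernel_le(1)[OF m]]
        by (intro mult_right_mono laplace_kernel_le(1)[OF m])
    qed
    also have "\<dots> = L * norm v * (?Q (w - v) z + ?Q w z)"
      unfolding refl using j by simp
    also have "\<dots> \<le> L * norm v * (C / wt w ^ ?m * wt v ^ ?m + C / wt w ^ ?m * wt v ^ ?m)"
    proof (intro mult_left_mono add_mono)
      have "?Q (w - v) z \<le> C * (1 / wt (w - v) ^ ?m)" using C(2) by simp
      also have "\<dots> \<le> C * (wt v ^ ?m * (1 / wt w ^ ?m))"
        using C(1) by (intro mult_left_mono wt_inverse_power_shift) auto
      finally show "?Q (w - v) z \<le> C / wt w ^ ?m * wt v ^ ?m" by simp
      have "C / wt w ^ ?m * 1 \<le> C / wt w ^ ?m * wt v ^ ?m"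
        using C(1) wt_nonneg[of w] by (intro mult_left_mono one_le_power wt_ge_1) auto
      then show "?Q w z \<le> C / wt w ^ ?m * wt v ^ ?m" using C(2)[rule_format, of w z] by simp
    qed (use L0 in simp)
    finally show ?thesis by (simp add: mult_ac)
  qed
  then show ?thesis using C(1) by (intro exI[of _ "2 * C"]) auto
qed

subsection \<open>Heat flow of the potential\<close>

text \<open>The function h(z,t) of the overview: the tangential heat semigroup applied to the
  potential at fixed height z.\<close>

definition heat_flow :: "('a::euclidean_space \<Rightarrow> real) \<Rightarrow> 'a \<Rightarrow> real \<Rightarrow> real \<Rightarrow> real" where
  "heat_flow D w z t = (LBINT v. heat_kernel v t * potential D (w - v) z)"

lemma borel_measurable_heat_flow [measurable]:
  fixes D :: "'a::euclidean_space \<Rightarrow> real"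
  assumes m: "DIM('a) \<ge> 2" and [measurable]: "D \<in> borel_measurable borel" "f \<in> borel_measurable M" "g \<in> borel_measurable M"
  shows "(\<lambda>x. heat_flow D w (f x) (g x)) \<in> borel_measurable M"
proof -
  note [measurable] = borel_measurable_potential[OF m]
  show ?thesis unfolding heat_flow_def by measurable
qed

lemma integrable_heat_flow:
  fixes w :: "'a::euclidean_space"
  assumes m: "DIM('a) \<ge> 2" and D: "ball_bounded M D" and t: "t > 0"
  shows "integrable lborel (\<lambda>v. heat_kernel v t * potential D (w - v) z)"
    and "\<exists>K\<ge>0. \<forall>(w::'a) z. \<bar>potential D w z\<bar> \<le> K"
proof -
  note [measurable] = borel_measurable_potential[OF m] ball_boundedD(1)[OF D]
  obtain C where C: "C > 0" "\<And>M D (w::'a) z. ball_bounded M D \<Longrightarrow> \<bar>potential D w z\<bar> \<le> C * M / wt w ^ (DIM('a) - 1)"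
    using potential_bound[OF m] by (elim exE conjE) simp
  have b: "\<bar>potential D w z\<bar> \<le> C * M" for w :: 'a and z
  proof -
    have "C * M / wt w ^ (DIM('a) - 1) \<le> C * M / 1"
      using C(1) ball_boundedD(3)[OF D] wt_ge_1[of w] by (intro divide_left_mono one_le_power) auto
    then show ?thesis using C(2)[OF D, of w z] by simp
  qed
  show "integrable lborel (\<lambda>v. heat_kernel v t * potential D (w - v) z)"
  proof (rule Bochner_Integration.integrable_bound[OF Bochner_Integration.integrable_mult_left[OF integrable_heat_kernel[OF t], of "C * M"]])
    show "AE v in lborel. norm (heat_kernel v t * potential D (w - v) z) \<le> norm (heat_kernel v t * (C * M))"
      using b by (intro AE_I2) (auto simp: abs_mult heat_kernel_nonneg intro!: mult_left_mono order_trans[OF b abs_ge_self[of "C * M", unfolded abs_mult]])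
  qed measurable
  show "\<exists>K\<ge>0. \<forall>(w::'a) z. \<bar>potential D w z\<bar> \<le> K"
    using b C(1) ball_boundedD(3)[OF D] by (intro exI[of _ "C * M"]) auto
qed

text \<open>Averaging over the heat kernel preserves the decay of the potential: Peetre's inequality
  shifts the weight from w - v to w, and the leftover power of the weight of v is a moment bounded
  for t \<le> 1.\<close>

lemma heat_flow_bound:
  assumes m: "DIM('a::euclidean_space) \<ge> 2"
  shows "\<exists>C>0. \<forall>M D (w::'a) z t. ball_bounded M D \<longrightarrow> 0 < t \<longrightarrow> t \<le> 1 \<longrightarrow>
    \<bar>heat_flow D w z t\<bar> \<le> C * M / wt w ^ (DIM('a) - 1)"
proof -
  let ?m = "DIM('a) - 1"
  obtain C where C: "C > 0" "\<And>M D (w::'a) z. ball_bounded M D \<Longrightarrow> \<bar>potential D w z\<bar> \<le> C * M / wt w ^ ?m"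
    using potential_bound[OF m] by (elim exE conjE) simp
  obtain C' where C': "C' > 0" "\<And>t. 0 < t \<Longrightarrow> t \<le> 1 \<Longrightarrow> (LBINT v::'a. heat_kernel v t * wt v ^ ?m) \<le> C'"
    using heat_moment_bound[where 'a='a, of ?m] by (elim exE conjE) simp
  have "\<bar>heat_flow D w z t\<bar> \<le> (C * C') * M / wt w ^ ?m" if D: "ball_bounded M D" and t: "0 < t" "t \<le> 1" for M D and w :: 'a and z t
  proof -
    have M: "0 \<le> M" by (rule ball_boundedD(3)[OF D])
    have "\<bar>heat_flow D w z t\<bar> \<le> (LBINT v. \<bar>heat_kernel v t * potential D (w - v) z\<bar>)"
      unfolding heat_flow_def using integral_norm_bound[of lborel "\<lambda>v. heat_kernel v t * potential D (w - v) z"] by simp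
    also have "\<dots> \<le> (LBINT v::'a. (heat_kernel v t * wt v ^ ?m) * (C * M / wt w ^ ?m))"
    proof (rule integral_mono)
      show "integrable lborel (\<lambda>v. \<bar>heat_kernel v t * potential D (w - v) z\<bar>)"
        by (intro integrable_abs integrable_heat_flow(1)[OF m D t(1)])
      show "integrable lborel (\<lambda>v::'a. (heat_kernel v t * wt v ^ ?m) * (C * M / wt w ^ ?m))"
        by (intro Bochner_Integration.integrable_mult_left integrable_heat_kernel_wt t)
      fix v :: 'a
      have "\<bar>potential D (w - v) z\<bar> \<le> (C * M) * (1 / wt (w - v) ^ ?m)" using C(2)[OF D, of "w - v" z] by simp
      also have "\<dots> \<le> (C * M) * (wt v ^ ?m * (1 / wt w ^ ?m))"
        using C(1) M by (intro mult_left_mono wt_inverse_power_shift) auto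
      finally have "heat_kernel v t * \<bar>potential D (w - v) z\<bar> \<le> heat_kernel v t * ((C * M) * (wt v ^ ?m * (1 / wt w ^ ?m)))"
        by (intro mult_left_mono heat_kernel_nonneg)
      then show "\<bar>heat_kernel v t * potential D (w - v) z\<bar> \<le> (heat_kernel v t * wt v ^ ?m) * (C * M / wt w ^ ?m)"
        by (simp add: abs_mult heat_kernel_nonneg mult_ac)
    qed
    also have "\<dots> = (LBINT v::'a. heat_kernel v t * wt v ^ ?m) * (C * M / wt w ^ ?m)" by simp
    also have "\<dots> \<le> C' * (C * M / wt w ^ ?m)"
      using C'(2)[OF t] C(1) M wt_nonneg[of w] by (intro mult_right_mono) auto
    finally show ?thesis by (simp add: mult_ac)
  qed
  then show ?thesis using C(1) C'(1) by (intro exI[of _ "C * C'"]) auto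
qed

lemma continuous_on_heat_flow:
  fixes w :: "'a::euclidean_space"
  assumes m: "DIM('a) \<ge> 2" and D: "ball_bounded M D" and t: "t > 0"
  shows "continuous_on {0..} (\<lambda>z. heat_flow D w z t)"
proof -
  note [measurable] = borel_measurable_potential[OF m] ball_boundedD(1)[OF D]
  obtain K where K: "0 \<le> K" "\<And>(w::'a) z. \<bar>potential D w z\<bar> \<le> K"
    using integrable_heat_flow(2)[OF m D t] by blast
  show ?thesis unfolding heat_flow_def
  proof (rule continuous_on_lebesgue_integral[where g="\<lambda>v. heat_kernel v t * K"])
    show "AE v in lborel. continuous_on {0..} (\<lambda>z. heat_kernel v t * potential D (w - v) z) \<and>
        (\<forall>z\<in>{0..}. \<bar>heat_kernel v t * potential D (w - v) z\<bar> \<le> heat_kernel v t * K)"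
      using K(2) by (intro AE_I2 conjI ballI continuous_on_mult continuous_on_const continuous_on_potential[OF m D])
        (auto simp: abs_mult heat_kernel_nonneg intro!: mult_left_mono)
  qed (use t in \<open>auto intro!: Bochner_Integration.integrable_mult_left integrable_heat_kernel\<close>)
qed

text \<open>Both differentiations pass under the heat integral by bounds on the potential that are
  uniform in its tangential argument. The second derivative is again a sum of heat flows, so the
  bounds for heat flows apply to it without further work.\<close>

lemma heat_flow_second_derivative:
  fixes w :: "'a::euclidean_space"
  assumes m: "DIM('a) \<ge> 2" and t: "t > 0"
    and D: "ball_bounded M D" "continuous_on UNIV D"
    and D1: "\<And>l. l \<in> Basis \<Longrightarrow> ball_bounded M (D1 l)" "\<And>l. l \<in> Basis \<Longrightarrow> continuous_on UNIV (D1 l)"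
    and D2: "\<And>l. l \<in> Basis \<Longrightarrow> ball_bounded M (D2 l)" "\<And>l. l \<in> Basis \<Longrightarrow> continuous_on UNIV (D2 l)"
    and der1: "\<And>l y. l \<in> Basis \<Longrightarrow> ((\<lambda>s. D (y + s *\<^sub>R l)) has_real_derivative D1 l y) (at 0)"
    and der2: "\<And>l y. l \<in> Basis \<Longrightarrow> ((\<lambda>s. D1 l (y + s *\<^sub>R l)) has_real_derivative D2 l y) (at 0)"
  shows "\<exists>h1. \<forall>z>0. ((\<lambda>z. heat_flow D w z t) has_real_derivative h1 z) (at z) \<and>
    (h1 has_real_derivative - (\<Sum>l\<in>Basis. heat_flow (D2 l) w z t)) (at z)"
proof -
  note [measurable] = borel_measurable_potential[OF m] ball_boundedD(1)[OF D(1)]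
  let ?h1 = "\<lambda>z. LBINT v. heat_kernel v t * potential1 D (w - v) z"
  have hk: "\<bar>heat_kernel v t * X\<bar> \<le> heat_kernel v t * K" if "\<bar>X\<bar> \<le> K" for v :: 'a and X K
    using that by (simp add: abs_mult heat_kernel_nonneg mult_left_mono)
  have I: "integrable lborel (\<lambda>v::'a. heat_kernel v t * K)" for K
    by (intro Bochner_Integration.integrable_mult_left integrable_heat_kernel t)
  have *: "((\<lambda>z. heat_flow D w z t) has_real_derivative ?h1 z) (at z) \<and>
    (?h1 has_real_derivative - (\<Sum>l\<in>Basis. heat_flow (D2 l) w z t)) (at z)" if z: "z > 0" for z
  proof
    obtain K where K: "\<And>(w::'a) t. z / 2 \<le> t \<Longrightarrow> \<bar>potential1 D w t\<bar> \<le> K"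
      using DERIV_potential(3)[OF m D(1) z] by blast
    have s: "z / 2 \<le> s" "s > 0" if "\<bar>s - z\<bar> < z / 2" for s using that by (auto simp: abs_if split: if_splits)
    show "((\<lambda>z. heat_flow D w z t) has_real_derivative ?h1 z) (at z)"
      unfolding heat_flow_def
    proof (rule has_real_derivative_lebesgue_integral(2)[where d="z/2" and g="\<lambda>v. heat_kernel v t * K"])
      show "((\<lambda>s. heat_kernel v t * potential D (w - v) s) has_real_derivative heat_kernel v t * potential1 D (w - v) s) (at s)"
        if "\<bar>s - z\<bar> < z / 2" for s v
        by (intro DERIV_cmult DERIV_potential(1)[OF m D(1)] s(2)[OF that])
      show "\<bar>heat_kernel v t * potential1 D (w - v) s\<bar> \<le> heat_kernel v t * K" if "\<bar>s - z\<bar> < z / 2" for s v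
        by (intro hk K s(1)[OF that])
    qed (use z in \<open>auto intro: integrable_heat_flow(1)[OF m D(1) t] simp: integrable_heat_kernel[OF t]\<close>)
    have "\<exists>K2\<ge>0. \<forall>(w::'a) z. \<bar>potential (D2 l) w z\<bar> \<le> K2" if "l \<in> Basis" for l
      by (rule integrable_heat_flow(2)[OF m D2(1)[OF that] t])
    then obtain K2 where K2: "\<And>l (w::'a) z. l \<in> Basis \<Longrightarrow> \<bar>potential (D2 l) w z\<bar> \<le> K2 l" by metis
    have "(?h1 has_real_derivative (LBINT v. heat_kernel v t * - (\<Sum>l\<in>Basis. potential (D2 l) (w - v) z))) (at z)"
    proof (rule has_real_derivative_lebesgue_integral(2)[where d="z/2" and g="\<lambda>v. heat_kernel v t * (\<Sum>l\<in>Basis. K2 l)"])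
      show "((\<lambda>s. heat_kernel v t * potential1 D (w - v) s) has_real_derivative
          heat_kernel v t * - (\<Sum>l\<in>Basis. potential (D2 l) (w - v) s)) (at s)" if "\<bar>s - z\<bar> < z / 2" for s v
        using DERIV_potential(2)[OF m D(1) s(2)[OF that], of "w - v"]
          potential_harmonic[OF m s(2)[OF that] D D1 D2 der1 der2, of "w - v"] by (intro DERIV_cmult) simp
      show "integrable lborel (\<lambda>v. heat_kernel v t * potential1 D (w - v) s)" if "\<bar>s - z\<bar> < z / 2" for s
        by (rule Bochner_Integration.integrable_bound[OF I[of K]])
           (use K[OF s(1)[OF that]] in \<open>auto intro!: AE_I2 order_trans[OF hk abs_ge_self]\<close>)
      show "\<bar>heat_kernel v t * - (\<Sum>l\<in>Basis. potential (D2 l) (w - v) s)\<bar> \<le> heat_kernel v t * (\<Sum>l\<in>Basis. K2 l)" for v s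
        by (rule hk) (auto intro!: order_trans[OF sum_abs] sum_mono K2)
    qed (use z I in auto)
    also have "(LBINT v. heat_kernel v t * - (\<Sum>l\<in>Basis. potential (D2 l) (w - v) z)) = - (\<Sum>l\<in>Basis. heat_flow (D2 l) w z t)"
      unfolding heat_flow_def
      using integrable_heat_flow(1)[OF m D2(1) t] by (simp add: sum_distrib_left Bochner_Integration.integral_sum)
    finally show "(?h1 has_real_derivative - (\<Sum>l\<in>Basis. heat_flow (D2 l) w z t)) (at z)" .
  qed
  show ?thesis by (intro exI[of _ ?h1] allI impI *)
qed

text \<open>The Lipschitz bound for the potential contributes a factor |v|, whose heat moment is of
  order sqrt t. Lipschitz continuity is inherited from the density, although the kernel at height 0
  is singular.\<close>

lemma heat_flow_initial:
  assumes m: "DIM('a::euclidean_space) \<ge> 2"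
  shows "\<exists>C>0. \<forall>M L D (w::'a) z t. ball_bounded M D \<longrightarrow> (\<forall>x y. \<bar>D x - D y\<bar> \<le> L * norm (x - y)) \<longrightarrow> 0 < t \<longrightarrow> t \<le> 1 \<longrightarrow>
    \<bar>heat_flow D w z t - (LBINT v::'a. heat_kernel v 1) * potential D w z\<bar> \<le> C * L / wt w ^ (DIM('a) - 1) * sqrt t"
proof -
  let ?m = "DIM('a) - 1"
  obtain C where C: "C > 0" "\<And>M L D (w::'a) v z. ball_bounded M D \<Longrightarrow> (\<forall>x y. \<bar>D x - D y\<bar> \<le> L * norm (x - y)) \<Longrightarrow>
    \<bar>potential D (w - v) z - potential D w z\<bar> \<le> C * L * (norm v * wt v ^ ?m) / wt w ^ ?m"
    using potential_Lipschitz[OF m] by (elim exE conjE) blast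
  obtain C' where C': "C' > 0" "\<And>t. 0 < t \<Longrightarrow> t \<le> 1 \<Longrightarrow> (LBINT v::'a. heat_kernel v t * (norm v * wt v ^ ?m)) \<le> C' * sqrt t"
    using heat_moment_bound[where 'a='a, of ?m] by (elim exE conjE) simp
  have "\<bar>heat_flow D w z t - (LBINT v::'a. heat_kernel v 1) * potential D w z\<bar> \<le> (C * C') * L / wt w ^ ?m * sqrt t"
    if D: "ball_bounded M D" and L: "\<forall>x y. \<bar>D x - D y\<bar> \<le> L * norm (x - y)" and t: "0 < t" "t \<le> 1" for M L D and w :: 'a and z t
  proof -
    have L0: "0 \<le> L"
    proof -
      obtain b :: 'a where "b \<in> Basis" using nonempty_Basis by blast
      then show ?thesis using L[rule_format, of b 0] norm_Basis[of b] abs_ge_zero order_trans by fastforce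
    qed
    have i2: "integrable lborel (\<lambda>v::'a. heat_kernel v t * (norm v * wt v ^ ?m))"
    proof (rule Bochner_Integration.integrable_bound[OF integrable_heat_kernel_wt[OF t(1), of "Suc ?m"]])
      show "AE v::'a in lborel. norm (heat_kernel v t * (norm v * wt v ^ ?m)) \<le> norm (heat_kernel v t * wt v ^ Suc ?m)"
      proof (rule AE_I2)
        fix v :: 'a
        have "heat_kernel v t * (norm v * wt v ^ ?m) \<le> heat_kernel v t * (wt v * wt v ^ ?m)"
          by (intro mult_left_mono mult_right_mono norm_le_wt heat_kernel_nonneg zero_le_power wt_nonneg)
        moreover have "0 \<le> heat_kernel v t * (norm v * wt v ^ ?m)" by (simp add: heat_kernel_nonneg wt_nonneg)
        ultimately show "norm (heat_kernel v t * (norm v * wt v ^ ?m)) \<le> norm (heat_kernel v t * wt v ^ Suc ?m)"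
          by (simp only: real_norm_def power_Suc)
      qed
    qed measurable
    have i: "integrable lborel (\<lambda>v. heat_kernel v t * potential D (w - v) z)" "integrable lborel (\<lambda>v::'a. heat_kernel v t * potential D w z)"
      using t by (auto intro!: integrable_heat_flow(1)[OF m D] integrable_heat_kernel)
    have "heat_flow D w z t - (LBINT v::'a. heat_kernel v 1) * potential D w z = (LBINT v. heat_kernel v t * (potential D (w - v) z - potential D w z))"
      unfolding heat_flow_def right_diff_distrib using i integral_heat_kernel[OF t(1), where 'a='a] by simp
    also have "\<bar>\<dots>\<bar> \<le> (LBINT v. \<bar>heat_kernel v t * (potential D (w - v) z - potential D w z)\<bar>)"
      using integral_norm_bound[of lborel "\<lambda>v. heat_kernel v t * (potential D (w - v) z - potential D w z)"] by simp
    also have "\<dots> \<le> (LBINT v::'a. (heat_kernel v t * (norm v * wt v ^ ?m)) * (C * L / wt w ^ ?m))"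
    proof (rule integral_mono)
      show "integrable lborel (\<lambda>v. \<bar>heat_kernel v t * (potential D (w - v) z - potential D w z)\<bar>)"
        using i by (intro integrable_abs) (simp add: right_diff_distrib)
      show "integrable lborel (\<lambda>v::'a. (heat_kernel v t * (norm v * wt v ^ ?m)) * (C * L / wt w ^ ?m))"
        by (intro Bochner_Integration.integrable_mult_left i2)
      fix v :: 'a
      have "heat_kernel v t * \<bar>potential D (w - v) z - potential D w z\<bar> \<le> heat_kernel v t * (C * L * (norm v * wt v ^ ?m) / wt w ^ ?m)"
        by (intro mult_left_mono heat_kernel_nonneg C(2)[OF D L])
      then show "\<bar>heat_kernel v t * (potential D (w - v) z - potential D w z)\<bar> \<le> (heat_kernel v t * (norm v * wt v ^ ?m)) * (C * L / wt w ^ ?m)"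
        by (simp add: abs_mult heat_kernel_nonneg mult_ac)
    qed
    also have "\<dots> = (LBINT v::'a. heat_kernel v t * (norm v * wt v ^ ?m)) * (C * L / wt w ^ ?m)" by simp
    also have "\<dots> \<le> C' * sqrt t * (C * L / wt w ^ ?m)"
      using C'(2)[OF t] C(1) L0 wt_nonneg[of w] by (intro mult_right_mono) auto
    finally show ?thesis by (simp add: mult_ac)
  qed
  then show ?thesis using C(1) C'(1) by (intro exI[of _ "C * C'"] conjI allI impI) auto
qed

subsection \<open>The Golovkin tensor integrated against the data\<close>

definition hkd :: "'a::euclidean_space \<Rightarrow> 'a \<Rightarrow> real \<Rightarrow> real" where
  "hkd l v t = - (v \<bullet> l) / (2 * t) * heat_kernel v t"

definition hkd2 :: "'a::euclidean_space \<Rightarrow> 'a \<Rightarrow> 'a \<Rightarrow> real \<Rightarrow> real" where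
  "hkd2 l k v t = ((v \<bullet> l) * (v \<bullet> k) / (4 * t\<^sup>2) - (l \<bullet> k) / (2 * t)) * heat_kernel v t"

lemma DERIV_hkd:
  fixes v l k :: "'a::euclidean_space"
  shows "((\<lambda>s. heat_kernel (v + s *\<^sub>R k) t) has_real_derivative hkd k (v + s *\<^sub>R k) t) (at s)"
    and "((\<lambda>s. hkd l (v + s *\<^sub>R k) t) has_real_derivative hkd2 l k (v + s *\<^sub>R k) t) (at s)"
proof -
  show 1: "((\<lambda>s. heat_kernel (v + s *\<^sub>R k) t) has_real_derivative hkd k (v + s *\<^sub>R k) t) (at s)"
    using has_real_derivative_heat_kernel[of v k t s] by (simp add: hkd_def)
  have "((\<lambda>s. - ((v + s *\<^sub>R k) \<bullet> l) / (2 * t)) has_real_derivative - (l \<bullet> k) / (2 * t)) (at s)"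
    unfolding inner_simps by (cases "t = 0") (auto intro!: derivative_eq_intros simp: inner_commute)
  from DERIV_mult[OF this 1]
  show "((\<lambda>s. hkd l (v + s *\<^sub>R k) t) has_real_derivative hkd2 l k (v + s *\<^sub>R k) t) (at s)"
    unfolding hkd_def[of l]
    by (rule DERIV_cong) (cases "t = 0"; simp add: hkd_def hkd2_def field_simps power2_eq_square)
qed

lemma borel_measurable_hkd [measurable]:
  fixes f :: "'c \<Rightarrow> 'a::euclidean_space"
  assumes [measurable]: "f \<in> borel_measurable M"
  shows "(\<lambda>x. hkd l (f x) t) \<in> borel_measurable M" "(\<lambda>x. hkd2 l k (f x) t) \<in> borel_measurable M"
  unfolding hkd_def hkd2_def by measurable

lemma continuous_on_hkd:
  fixes f :: "'c::topological_space \<Rightarrow> 'a::euclidean_space"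
  assumes "continuous_on S f" "t \<noteq> 0"
  shows "continuous_on S (\<lambda>x. hkd l (f x) t)" "continuous_on S (\<lambda>x. hkd2 l k (f x) t)"
  unfolding hkd_def hkd2_def using assms by (auto intro!: continuous_intros)

lemma hkd_minus: "hkd (- l) v t = - hkd l v t" "hkd2 l (- k) v t = - hkd2 l k v t" "hkd l (- v) t = - hkd l v t"
  by (simp_all add: hkd_def hkd2_def heat_kernel_minus algebra_simps diff_divide_distrib)

text \<open>The constant depends on t. The lemma serves at fixed times, to justify exchanging
  integrals and derivatives; the bounds uniform in t come from the heat moments.\<close>

lemma hkd_bound:
  assumes t: "t > 0"
  shows "\<exists>C>0. \<forall>v::'a::euclidean_space. heat_kernel v t \<le> C * (1 / wt v ^ N) \<and> \<bar>hkd l v t\<bar> \<le> C * (1 / wt v ^ N) \<and> \<bar>hkd2 l k v t\<bar> \<le> C * (1 / wt v ^ N)"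
proof -
  obtain C where C: "C > 0" "\<forall>v::'a. wt v ^ 2 * heat_kernel v t \<le> C / wt v ^ N"
    using heat_kernel_le_wt_mult[OF t, of 2 N] by (elim exE conjE)
  define a1 a2 where "a1 = norm l / (2 * t)" and "a2 = norm l * norm k * (1 / (4 * t\<^sup>2) + 1 / (2 * t))"
  have a: "0 \<le> a1" "0 \<le> a2" using t by (auto simp: a1_def a2_def)
  let ?K = "(1 + a1 + a2) * C"
  have *: "\<bar>X\<bar> * heat_kernel v t \<le> ?K * (1 / wt v ^ N)" if X: "\<bar>X\<bar> \<le> A * wt v ^ 2" and A: "A = 1 \<or> A = a1 \<or> A = a2" for X A and v :: 'a
  proof -
    have A0: "0 \<le> A" "A \<le> 1 + a1 + a2" using A a by auto
    have "\<bar>X\<bar> * heat_kernel v t \<le> A * (wt v ^ 2 * heat_kernel v t)"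
      using mult_right_mono[OF X heat_kernel_nonneg[of v t]] by (simp add: mult.assoc)
    also have "\<dots> \<le> A * (C / wt v ^ N)" using C(2) A0 by (intro mult_left_mono) auto
    also have "\<dots> \<le> (1 + a1 + a2) * (C / wt v ^ N)" using A0 C(1) wt_nonneg[of v] by (intro mult_right_mono) auto
    finally show ?thesis by simp
  qed
  have w: "1 \<le> wt v ^ 2" "norm v \<le> wt v ^ 2" "(norm v)\<^sup>2 \<le> wt v ^ 2" for v :: 'a
  proof -
    show "1 \<le> wt v ^ 2" by (intro one_le_power wt_ge_1)
    have "wt v * 1 \<le> wt v * wt v" by (intro mult_left_mono wt_ge_1 wt_nonneg)
    then show "norm v \<le> wt v ^ 2" using norm_le_wt[of v] by (simp add: power2_eq_square)
    show "(norm v)\<^sup>2 \<le> wt v ^ 2" by (intro power_mono norm_le_wt) auto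
  qed
  have "heat_kernel v t \<le> ?K * (1 / wt v ^ N)" for v :: 'a
    using *[of 1 1 v] w(1)[of v] by simp
  moreover have "\<bar>hkd l v t\<bar> \<le> ?K * (1 / wt v ^ N)" for v :: 'a
  proof -
    have "\<bar>v \<bullet> l\<bar> \<le> wt v ^ 2 * norm l"
      by (rule order_trans[OF Cauchy_Schwarz_ineq2]) (intro mult_right_mono w norm_ge_zero)
    then have "\<bar>- (v \<bullet> l) / (2 * t)\<bar> \<le> a1 * wt v ^ 2"
      using t by (simp add: a1_def abs_divide divide_right_mono mult.commute)
    from *[OF this] show ?thesis by (simp add: hkd_def abs_mult heat_kernel_nonneg)
  qed
  moreover have "\<bar>hkd2 l k v t\<bar> \<le> ?K * (1 / wt v ^ N)" for v :: 'a
  proof -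
    have "\<bar>(v \<bullet> l) * (v \<bullet> k)\<bar> \<le> (norm v * norm l) * (norm v * norm k)"
      unfolding abs_mult by (intro mult_mono Cauchy_Schwarz_ineq2) auto
    also have "\<dots> = (norm v)\<^sup>2 * (norm l * norm k)" by (simp add: power2_eq_square mult_ac)
    also have "\<dots> \<le> wt v ^ 2 * (norm l * norm k)" by (intro mult_right_mono w) auto
    finally have 1: "\<bar>(v \<bullet> l) * (v \<bullet> k) / (4 * t\<^sup>2)\<bar> \<le> wt v ^ 2 * (norm l * norm k) / (4 * t\<^sup>2)"
      using t by (simp add: abs_divide divide_right_mono)
    have "\<bar>l \<bullet> k\<bar> \<le> norm l * norm k" by (rule Cauchy_Schwarz_ineq2)
    also have "\<dots> \<le> wt v ^ 2 * (norm l * norm k)" using mult_right_mono[OF w(1)[of v], of "norm l * norm k"] by simp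
    finally have 2: "\<bar>(l \<bullet> k) / (2 * t)\<bar> \<le> wt v ^ 2 * (norm l * norm k) / (2 * t)"
      using t by (simp add: abs_divide divide_right_mono)
    have 3: "a2 * wt v ^ 2 = wt v ^ 2 * (norm l * norm k) / (4 * t\<^sup>2) + wt v ^ 2 * (norm l * norm k) / (2 * t)"
      by (simp add: a2_def algebra_simps)
    have "\<bar>(v \<bullet> l) * (v \<bullet> k) / (4 * t\<^sup>2) - (l \<bullet> k) / (2 * t)\<bar> \<le> a2 * wt v ^ 2"
      unfolding 3 using 1 2 by linarith
    from *[OF this] show ?thesis by (simp add: hkd2_def abs_mult heat_kernel_nonneg)
  qed
  moreover have "0 < ?K" using C(1) a by (intro mult_pos_pos) auto
  ultimately show ?thesis by (intro exI[of _ ?K] conjI allI) auto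
qed

lemma wt_translate_bound:
  fixes x y k :: "'a::euclidean_space"
  assumes "norm k \<le> 1" "\<bar>s\<bar> < 1"
  shows "1 / wt (x + s *\<^sub>R k - y) ^ N \<le> 2 ^ N * (1 / wt (x - y) ^ N)"
proof -
  have "1 / wt ((x - y) - (- (s *\<^sub>R k))) ^ N \<le> wt (- (s *\<^sub>R k)) ^ N * (1 / wt (x - y) ^ N)"
    by (rule wt_inverse_power_shift)
  also have "\<dots> \<le> 2 ^ N * (1 / wt (x - y) ^ N)"
  proof (intro mult_right_mono power_mono)
    have "\<bar>s\<bar> * norm k \<le> 1 * 1" using assms by (intro mult_mono) auto
    then show "wt (- (s *\<^sub>R k)) \<le> 2" by (simp add: wt_def)
  qed (auto simp: wt_nonneg)
  finally show ?thesis by (simp add: algebra_simps)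
qed

lemma integrable_dominated:
  fixes f g :: "'a \<Rightarrow> real"
  assumes g: "integrable M g" and "f \<in> borel_measurable M" and le: "AE x in M. \<bar>f x\<bar> \<le> g x"
  shows "integrable M f"
proof (rule Bochner_Integration.integrable_bound[OF g])
  show "AE x in M. norm (f x) \<le> norm (g x)" using le by eventually_elim simp
qed fact

lemma integrable_decay_mult:
  fixes X Y :: "'a::euclidean_space \<Rightarrow> real"
  assumes [measurable]: "X \<in> borel_measurable borel" "Y \<in> borel_measurable borel"
    and X: "\<And>w. \<bar>X w\<bar> \<le> C * (1 / wt (x - w) ^ (DIM('a) + 1))" and Y: "\<And>w. \<bar>Y w\<bar> \<le> K"
  shows "integrable lborel (\<lambda>w. X w * Y w)"
    and "\<bar>X w * Y w\<bar> \<le> C * K * (1 / wt (x - w) ^ (DIM('a) + 1))"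
    and "integrable lborel (\<lambda>w::'a. C * K * (1 / wt (x - w) ^ (DIM('a) + 1)))"
proof -
  have K: "0 \<le> K" using Y[of 0] by linarith
  show b: "\<bar>X w * Y w\<bar> \<le> C * K * (1 / wt (x - w) ^ (DIM('a) + 1))" for w
  proof -
    have "0 \<le> C * (1 / wt (x - w) ^ (DIM('a) + 1))" using X[of w] by linarith
    then have "\<bar>X w * Y w\<bar> \<le> (C * (1 / wt (x - w) ^ (DIM('a) + 1))) * K"
      unfolding abs_mult using X[of w] Y[of w] by (intro mult_mono) auto
    then show ?thesis by (simp only: mult_ac)
  qed
  show i: "integrable lborel (\<lambda>w::'a. C * K * (1 / wt (x - w) ^ (DIM('a) + 1)))"
    by (intro Bochner_Integration.integrable_mult_right integrable_lborel_translate(2)[OF integrable_wt])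
  show "integrable lborel (\<lambda>w. X w * Y w)"
    by (rule integrable_dominated[OF i _ AE_I2[OF b]]) measurable
qed

lemma laplace_kernel_bounded:
  assumes "DIM('a::euclidean_space) \<ge> 2" "z > (0::real)"
  shows "\<exists>K. \<forall>u::'a. \<bar>laplace_kernel (u, z)\<bar> \<le> K \<and> \<bar>lap1 b (u, z)\<bar> \<le> K"
  using lap_bound_away[OF assms, of b] laplace_kernel_le(1)[OF assms(1)] by (metis abs_of_nonneg order_refl)

text \<open>Tangential convolution of X with the Laplace kernel at height z; at z = 0 this is, up to
  a constant, the Riesz potential of order 1. With X a derivative of the heat kernel it is the inner
  integral of \<open>C_fun\<close> after the derivative has left the Laplace kernel.\<close>

definition riesz_heat :: "('a::euclidean_space \<Rightarrow> real) \<Rightarrow> 'a \<Rightarrow> real \<Rightarrow> real" where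
  "riesz_heat X x z = (LBINT w. X (x - w) * laplace_kernel (w, z))"

text \<open>Because the undifferentiated Laplace kernel is paired with X, the bound does not
  deteriorate as z tends to 0, and constants become admissible majorants for the integral over the
  height.\<close>

lemma riesz_heat_bound:
  fixes X :: "'a::euclidean_space \<Rightarrow> real"
  assumes m: "DIM('a) \<ge> 2" and [measurable]: "X \<in> borel_measurable borel"
    and X: "\<And>v. \<bar>X v\<bar> \<le> C * (1 / wt v ^ (DIM('a) + 1))"
  shows "\<exists>K. \<forall>x z. \<bar>riesz_heat X x z\<bar> \<le> K"
proof -
  have n: "DIM('a \<times> real) \<ge> 3" using m by simp
  note [measurable] = borel_measurable_lap(1)[OF _ n]
  let ?c = "lapc TYPE('a \<times> real)"
  have c: "0 < ?c" by (rule lapc_pos[OF n])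
  obtain C0 where C0: "C0 > 0" "\<forall>x. (LBINT w::'a. 1 / wt (x - w) ^ (DIM('a) + 1) * (1 / norm w ^ (DIM('a) - 1))) \<le> C0"
    using integral_wt_norm_bound[OF m] by (elim exE conjE)
  have C: "0 \<le> C" using X[of 0] by (simp add: wt_def)
  have "\<bar>riesz_heat X x z\<bar> \<le> C * ?c * C0" for x z
  proof -
    let ?g = "\<lambda>w::'a. C * ?c * (1 / wt (x - w) ^ (DIM('a) + 1) * (1 / norm w ^ (DIM('a) - 1)))"
    have g: "integrable lborel ?g" by (intro Bochner_Integration.integrable_mult_right integrable_wt_norm[OF m])
    have "AE w in lborel. w \<noteq> (0::'a)" by (rule AE_lborel_singleton)
    then have le: "AE w in lborel. \<bar>X (x - w) * laplace_kernel (w, z)\<bar> \<le> ?g w"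
    proof eventually_elim
      case (elim w)
      have "\<bar>X (x - w) * laplace_kernel (w, z)\<bar> \<le> (C * (1 / wt (x - w) ^ (DIM('a) + 1))) * (?c * (1 / norm w ^ (DIM('a) - 1)))"
        unfolding abs_mult using X[of "x - w"] laplace_kernel_le(1,2)[OF m, of w z] elim C wt_nonneg[of "x - w"]
        by (intro mult_mono) (auto intro!: mult_nonneg_nonneg divide_nonneg_nonneg zero_le_power)
      then show ?case by (simp only: mult_ac)
    qed
    have "integrable lborel (\<lambda>w. X (x - w) * laplace_kernel (w, z))"
      by (rule integrable_dominated[OF g _ le]) measurable
    then have i: "integrable lborel (\<lambda>w. \<bar>X (x - w) * laplace_kernel (w, z)\<bar>)" by (rule integrable_abs)
    have "\<bar>riesz_heat X x z\<bar> \<le> (LBINT w. \<bar>X (x - w) * laplace_kernel (w, z)\<bar>)"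
      unfolding riesz_heat_def using integral_norm_bound[of lborel "\<lambda>w. X (x - w) * laplace_kernel (w, z)"] by simp
    also have "(LBINT w. \<bar>X (x - w) * laplace_kernel (w, z)\<bar>) \<le> (LBINT w. ?g w)"
      by (rule integral_mono_AE[OF i g le])
    also have "\<dots> \<le> C * ?c * C0"
      using C0 C c unfolding integral_mult_right_zero by (intro mult_left_mono) auto
    finally show ?thesis .
  qed
  then show ?thesis by blast
qed

lemma borel_measurable_riesz_heat [measurable]:
  fixes X :: "'a::euclidean_space \<Rightarrow> real"
  assumes m: "DIM('a) \<ge> 2" and [measurable]: "X \<in> borel_measurable borel" "f \<in> borel_measurable M" "g \<in> borel_measurable M"
  shows "(\<lambda>x. riesz_heat X (f x) (g x)) \<in> borel_measurable M"
proof -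
  have n: "DIM('a \<times> real) \<ge> 3" using m by simp
  note [measurable] = borel_measurable_lap(1)[OF _ n]
  show ?thesis unfolding riesz_heat_def by measurable
qed

lemma DERIV_riesz_heat:
  fixes x l k :: "'a::euclidean_space"
  assumes m: "DIM('a) \<ge> 2" and t: "t > 0" and z: "z > 0" and k: "norm k \<le> 1"
  shows "((\<lambda>s. riesz_heat (\<lambda>v. hkd l v t) (x + s *\<^sub>R k) z) has_real_derivative riesz_heat (\<lambda>v. hkd2 l k v t) (x + s *\<^sub>R k) z) (at s)"
proof -
  have n: "DIM('a \<times> real) \<ge> 3" using m by simp
  note [measurable] = borel_measurable_lap(1)[OF _ n]
  obtain C where C: "C > 0" "\<forall>v::'a. heat_kernel v t \<le> C * (1 / wt v ^ (DIM('a) + 1)) \<and> \<bar>hkd l v t\<bar> \<le> C * (1 / wt v ^ (DIM('a) + 1)) \<and> \<bar>hkd2 l k v t\<bar> \<le> C * (1 / wt v ^ (DIM('a) + 1))"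
    using hkd_bound[OF t, of "DIM('a) + 1" l k] by (elim exE conjE)
  obtain K where K: "\<forall>u::'a. \<bar>laplace_kernel (u, z)\<bar> \<le> K \<and> \<bar>lap1 (0, 1) (u, z)\<bar> \<le> K"
    using laplace_kernel_bounded[OF m z, of "(0, 1)"] by (elim exE)
  let ?y = "x + s *\<^sub>R k"
  have m1: "(\<lambda>w. hkd l (y - w) t) \<in> borel_measurable borel" "(\<lambda>w. hkd2 l k (y - w) t) \<in> borel_measurable borel"
    "(\<lambda>w::'a. laplace_kernel (w, z)) \<in> borel_measurable borel" for y :: 'a by measurable
  have "((\<lambda>s'. LBINT w. hkd l (x + s' *\<^sub>R k - w) t * laplace_kernel (w, z)) has_real_derivative
      (LBINT w. hkd2 l k (x + s *\<^sub>R k - w) t * laplace_kernel (w, z))) (at s)"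
  proof (rule has_real_derivative_lebesgue_integral(2)[where d=1 and g="\<lambda>w. (C * 2 ^ (DIM('a) + 1)) * K * (1 / wt (?y - w) ^ (DIM('a) + 1))"])
    fix s' w
    have "((\<lambda>s. hkd l (x - w + s *\<^sub>R k) t) has_real_derivative hkd2 l k (x - w + s' *\<^sub>R k) t) (at s')" by (rule DERIV_hkd)
    then have "((\<lambda>s. hkd l (x + s *\<^sub>R k - w) t) has_real_derivative hkd2 l k (x + s' *\<^sub>R k - w) t) (at s')" by (simp add: algebra_simps)
    then show "((\<lambda>s. hkd l (x + s *\<^sub>R k - w) t * laplace_kernel (w, z)) has_real_derivative hkd2 l k (x + s' *\<^sub>R k - w) t * laplace_kernel (w, z)) (at s')"
      by (rule DERIV_cmult_right)
  next
    show "integrable lborel (\<lambda>w. hkd l (x + s' *\<^sub>R k - w) t * laplace_kernel (w, z))" for s'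
      by (rule integrable_decay_mult(1)[OF m1(1,3), where C=C and K=K]) (use C K in auto)
    show "\<bar>hkd2 l k (x + s' *\<^sub>R k - w) t * laplace_kernel (w, z)\<bar> \<le> C * 2 ^ (DIM('a) + 1) * K * (1 / wt (?y - w) ^ (DIM('a) + 1))"
      if "\<bar>s' - s\<bar> < 1" for s' w
    proof (rule integrable_decay_mult(2)[OF m1(2,3)])
      fix w
      have "\<bar>hkd2 l k (?y + (s' - s) *\<^sub>R k - w) t\<bar> \<le> C * (1 / wt (?y + (s' - s) *\<^sub>R k - w) ^ (DIM('a) + 1))"
        using C(2) by blast
      also have "\<dots> \<le> C * (2 ^ (DIM('a) + 1) * (1 / wt (?y - w) ^ (DIM('a) + 1)))"
        using C(1) by (intro mult_left_mono wt_translate_bound k that) auto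
      finally show "\<bar>hkd2 l k (x + s' *\<^sub>R k - w) t\<bar> \<le> C * 2 ^ (DIM('a) + 1) * (1 / wt (?y - w) ^ (DIM('a) + 1))"
        by (simp add: algebra_simps del: power_Suc)
    qed (use K in auto)
    show "integrable lborel (\<lambda>w. C * 2 ^ (DIM('a) + 1) * K * (1 / wt (?y - w) ^ (DIM('a) + 1)))"
      by (intro Bochner_Integration.integrable_mult_right integrable_lborel_translate(2)[OF integrable_wt])
  qed auto
  then show ?thesis unfolding riesz_heat_def .
qed

text \<open>The tangential derivative of the Laplace kernel becomes singular as z tends to 0; it is
  exchanged for a derivative of the heat kernel, which is smooth at fixed t > 0.\<close>

lemma heat_kernel_lap1_by_parts:
  fixes x l :: "'a::euclidean_space"
  assumes m: "DIM('a) \<ge> 2" and t: "t > 0" and z: "z > 0"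
  shows "(LBINT w. heat_kernel (x - w) t * lap1 (l, 0) (w, z)) = riesz_heat (\<lambda>v. hkd l v t) x z"
proof -
  have n: "DIM('a \<times> real) \<ge> 3" using m by simp
  note [measurable] = borel_measurable_lap(1)[OF _ n]
  obtain C where C: "C > 0" "\<forall>v::'a. heat_kernel v t \<le> C * (1 / wt v ^ (DIM('a) + 1)) \<and> \<bar>hkd l v t\<bar> \<le> C * (1 / wt v ^ (DIM('a) + 1)) \<and> \<bar>hkd2 l l v t\<bar> \<le> C * (1 / wt v ^ (DIM('a) + 1))"
    using hkd_bound[OF t, of "DIM('a) + 1" l l] by (elim exE conjE)
  obtain K where K: "\<forall>u::'a. \<bar>laplace_kernel (u, z)\<bar> \<le> K \<and> \<bar>lap1 (l, 0) (u, z)\<bar> \<le> K"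
    using laplace_kernel_bounded[OF m z, of "(l, 0)"] by (elim exE)
  have m1: "(\<lambda>w. hkd l (x - w) t) \<in> borel_measurable borel" "(\<lambda>w. heat_kernel (x - w) t) \<in> borel_measurable borel"
    "(\<lambda>w::'a. laplace_kernel (w, z)) \<in> borel_measurable borel" "(\<lambda>w::'a. lap1 (l, 0) (w, z)) \<in> borel_measurable borel" by measurable
  have hb: "\<bar>heat_kernel v t\<bar> \<le> C * (1 / wt v ^ (DIM('a) + 1))" for v :: 'a using C(2) by (simp add: heat_kernel_nonneg)
  have i: "integrable lborel (\<lambda>w. heat_kernel (x - w) t * laplace_kernel (w, z))"
    "integrable lborel (\<lambda>w. heat_kernel (x - w) t * lap1 (l, 0) (w, z))"
    "integrable lborel (\<lambda>w. hkd l (x - w) t * laplace_kernel (w, z))"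
    by (rule integrable_decay_mult(1)[OF m1(2,3), where C=C and K=K] integrable_decay_mult(1)[OF m1(2,4), where C=C and K=K]
        integrable_decay_mult(1)[OF m1(1,3), where C=C and K=K]; use C K hb in auto)+
  have nz: "(w, z) \<noteq> (0 :: 'a \<times> real)" for w using z by (simp add: zero_prod_def)
  have d0: "((\<lambda>s. laplace_kernel (w + s *\<^sub>R l, z)) has_real_derivative lap1 (l, 0) (w, z)) (at 0)" for w
    using DERIV_laplace_kernel[OF n, of "(w, z)" 0 "(l, 0)"] nz by simp
  have d1: "((\<lambda>s. heat_kernel (x - (w + s *\<^sub>R l)) t) has_real_derivative - hkd l (x - w) t) (at 0)" for w
    using DERIV_hkd(1)[of "x - w" "- l" t 0] by (simp add: hkd_minus algebra_simps)
  have "(LBINT w. lap1 (l, 0) (w, z) * heat_kernel (x - w) t) = - (LBINT w. laplace_kernel (w, z) * - hkd l (x - w) t)"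
    by (rule integral_by_parts_directional[where b=l, OF _ _ _ d0 d1])
       (use i nz t in \<open>auto intro!: continuous_on_lap n continuous_intros continuous_on_hkd simp: mult.commute\<close>)
  then show ?thesis by (simp add: riesz_heat_def mult.commute)
qed

lemma DERIV_potential_tangential:
  fixes w l :: "'a::euclidean_space"
  assumes m: "DIM('a) \<ge> 2" and z: "z > 0"
    and D: "ball_bounded M D" "continuous_on UNIV D" and D': "ball_bounded M' D'" "continuous_on UNIV D'"
    and der: "\<And>y. ((\<lambda>s. D (y + s *\<^sub>R l)) has_real_derivative D' y) (at 0)"
  shows "((\<lambda>s. potential D (w + s *\<^sub>R l) z) has_real_derivative potential D' (w + s *\<^sub>R l) z) (at s)"
proof -
  have n: "DIM('a \<times> real) \<ge> 3" using m by simp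
  note [measurable] = borel_measurable_lap(1)[OF _ n]
  obtain K where K: "\<forall>u::'a. \<bar>laplace_kernel (u, z)\<bar> \<le> K \<and> \<bar>lap1 (l, 0) (u, z)\<bar> \<le> K"
    using laplace_kernel_bounded[OF m z, of "(l, 0)"] by (elim exE)
  have m1: "(\<lambda>y. lap1 (l, 0) (x - y, z)) \<in> borel_measurable borel" for x :: 'a by measurable
  have "((\<lambda>s. LBINT y. D y * laplace_kernel (w + s *\<^sub>R l - y, z)) has_real_derivative
      (LBINT y. D y * lap1 (l, 0) (w + s *\<^sub>R l - y, z))) (at s)"
  proof (rule has_real_derivative_lebesgue_integral(2)[where d=1 and g="\<lambda>y. M * K * indicator (ball (0::'a) 1) y"])
    fix s' y
    have "(w - y, z) + s' *\<^sub>R (l, 0) \<noteq> 0" using z by (simp add: zero_prod_def)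
    from DERIV_laplace_kernel[OF n this]
    have "((\<lambda>s. laplace_kernel (w + s *\<^sub>R l - y, z)) has_real_derivative lap1 (l, 0) (w + s' *\<^sub>R l - y, z)) (at s')"
      by (simp add: algebra_simps)
    then show "((\<lambda>s. D y * laplace_kernel (w + s *\<^sub>R l - y, z)) has_real_derivative D y * lap1 (l, 0) (w + s' *\<^sub>R l - y, z)) (at s')"
      by (rule DERIV_cmult)
    show "\<bar>D y * lap1 (l, 0) (w + s' *\<^sub>R l - y, z)\<bar> \<le> M * K * indicator (ball 0 1) y"
      by (rule integrable_ball_bounded_mult(2)[OF D(1) m1]) (use K in auto)
  qed (auto intro!: integrable_potential[OF m D(1)] simp: integrable_indicator_ball)
  then show ?thesis
    unfolding potential_tangential_derivatives(1)[OF m z D D' der] by (simp add: potential_def)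
qed

lemma continuous_on_potential_tangential:
  fixes D :: "'a::euclidean_space \<Rightarrow> real"
  assumes m: "DIM('a) \<ge> 2" and z: "z > 0" and D: "ball_bounded M D"
  shows "continuous_on UNIV (\<lambda>w. potential D w z)"
proof -
  have n: "DIM('a \<times> real) \<ge> 3" using m by simp
  note [measurable] = borel_measurable_lap(1)[OF _ n] ball_boundedD(1)[OF D]
  obtain K where K: "\<forall>u::'a. \<bar>laplace_kernel (u, z)\<bar> \<le> K \<and> \<bar>lap1 (0, 1) (u, z)\<bar> \<le> K"
    using laplace_kernel_bounded[OF m z, of "(0, 1)"] by (elim exE)
  have m1: "(\<lambda>y. laplace_kernel (x - y, z)) \<in> borel_measurable borel" for x :: 'a by measurable
  show ?thesis unfolding potential_def
  proof (rule continuous_on_lebesgue_integral[where g="\<lambda>y. M * K * indicator (ball (0::'a) 1) y"])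
    show "AE y in lborel. continuous_on UNIV (\<lambda>w. D y * laplace_kernel (w - y, z)) \<and>
        (\<forall>w\<in>UNIV. \<bar>D y * laplace_kernel (w - y, z)\<bar> \<le> M * K * indicator (ball 0 1) y)"
      using K z by (intro AE_I2 conjI ballI integrable_ball_bounded_mult(2)[OF D m1] continuous_on_mult continuous_on_const
          continuous_on_lap(1)[OF _ _ n] continuous_intros) (auto simp: zero_prod_def)
  qed (auto simp: integrable_indicator_ball)
qed

text \<open>The derivatives parked on the heat kernel are passed on, one at a time, to the density
  of the potential. Applied with k and then with i, the two statements turn \<open>hkd2\<close>
  acting on the potential of gS into the heat flow of \<partial>_i \<partial>_k gS.\<close>

lemma heat_potential_by_parts:
  fixes x l k :: "'a::euclidean_space"
  assumes m: "DIM('a) \<ge> 2" and t: "t > 0" and z: "z > 0"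
    and D: "ball_bounded M D" "continuous_on UNIV D" and D': "ball_bounded M' D'" "continuous_on UNIV D'"
    and der: "\<And>y. ((\<lambda>s. D (y + s *\<^sub>R k)) has_real_derivative D' y) (at 0)"
  shows "(LBINT v. hkd k v t * potential D (x - v) z) = heat_flow D' x z t"
    and "(LBINT v. hkd2 l k v t * potential D (x - v) z) = (LBINT v. hkd l v t * potential D' (x - v) z)"
proof -
  note [measurable] = borel_measurable_potential[OF m] ball_boundedD(1)[OF D(1)] ball_boundedD(1)[OF D'(1)]
  obtain C where C: "C > 0" "\<forall>v::'a. heat_kernel v t \<le> C * (1 / wt v ^ (DIM('a) + 1)) \<and> \<bar>hkd l v t\<bar> \<le> C * (1 / wt v ^ (DIM('a) + 1)) \<and> \<bar>hkd2 l k v t\<bar> \<le> C * (1 / wt v ^ (DIM('a) + 1))"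
    using hkd_bound[OF t, of "DIM('a) + 1" l k] by (elim exE conjE)
  obtain C' where C': "C' > 0" "\<forall>v::'a. heat_kernel v t \<le> C' * (1 / wt v ^ (DIM('a) + 1)) \<and> \<bar>hkd k v t\<bar> \<le> C' * (1 / wt v ^ (DIM('a) + 1)) \<and> \<bar>hkd2 k k v t\<bar> \<le> C' * (1 / wt v ^ (DIM('a) + 1))"
    using hkd_bound[OF t, of "DIM('a) + 1" k k] by (elim exE conjE)
  obtain K where K: "0 \<le> K" "\<forall>(w::'a) z. \<bar>potential D w z\<bar> \<le> K"
    using integrable_heat_flow(2)[OF m D(1) t] by (elim exE conjE)
  obtain K' where K': "0 \<le> K'" "\<forall>(w::'a) z. \<bar>potential D' w z\<bar> \<le> K'"
    using integrable_heat_flow(2)[OF m D'(1) t] by (elim exE conjE)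
  have I: "integrable lborel (\<lambda>v. X v * potential D (x - v) z)" "integrable lborel (\<lambda>v. X v * potential D' (x - v) z)"
    if [measurable]: "X \<in> borel_measurable borel" and X: "\<And>v. \<bar>X v\<bar> \<le> A * (1 / wt v ^ (DIM('a) + 1))" for X and A :: real
    by (rule integrable_decay_mult(1)[where x=0 and C=A and K=K] integrable_decay_mult(1)[where x=0 and C=A and K=K'];
        use X K K' in \<open>simp add: wt_minus[of v, simplified] del: power_Suc\<close>; fail)+
  have c: "continuous_on UNIV (\<lambda>v. potential D (x - v) z)" "continuous_on UNIV (\<lambda>v. - potential D' (x - v) z)"
    by (intro continuous_intros continuous_on_compose2[OF continuous_on_potential_tangential[OF m z D(1)]]
        continuous_on_compose2[OF continuous_on_potential_tangential[OF m z D'(1)]]; simp)+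
  have dg: "((\<lambda>s. potential D (x - (v + s *\<^sub>R k)) z) has_real_derivative - potential D' (x - v) z) (at 0)" for v
  proof -
    have "((\<lambda>s. potential D (x - v + s *\<^sub>R k) z) has_real_derivative potential D' (x - v + 0 *\<^sub>R k) z) (at 0)"
      by (rule DERIV_potential_tangential[OF m z D D' der])
    then have "((\<lambda>s. potential D (x - v + s *\<^sub>R k) z) has_real_derivative potential D' (x - v) z) (at (- 0))" by simp
    from DERIV_chain2[OF this DERIV_minus[OF DERIV_ident]] show ?thesis by (simp add: algebra_simps)
  qed
  have df: "((\<lambda>s. heat_kernel (v + s *\<^sub>R k) t) has_real_derivative hkd k v t) (at 0)"
    "((\<lambda>s. hkd l (v + s *\<^sub>R k) t) has_real_derivative hkd2 l k v t) (at 0)" for v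
    using DERIV_hkd(1)[where v=v and k=k and t=t and s=0] DERIV_hkd(2)[where v=v and k=k and t=t and s=0 and l=l] by auto
  have hb: "\<bar>heat_kernel v t\<bar> \<le> C * (1 / wt v ^ (DIM('a) + 1))" for v :: 'a using C(2) by (simp add: heat_kernel_nonneg)
  have i1: "integrable lborel (\<lambda>v. heat_kernel v t * potential D (x - v) z)" "integrable lborel (\<lambda>v. heat_kernel v t * potential D' (x - v) z)"
    using I[where X="\<lambda>v. heat_kernel v t", OF _ hb] by auto
  have i2: "integrable lborel (\<lambda>v. hkd l v t * potential D (x - v) z)" "integrable lborel (\<lambda>v. hkd l v t * potential D' (x - v) z)"
    using I[where X="\<lambda>v. hkd l v t" and A=C] C(2) by auto
  have i3: "integrable lborel (\<lambda>v. hkd k v t * potential D (x - v) z)"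
    using I(1)[where X="\<lambda>v. hkd k v t" and A=C'] C'(2) by auto
  have i4: "integrable lborel (\<lambda>v. hkd2 l k v t * potential D (x - v) z)"
    using I(1)[where X="\<lambda>v. hkd2 l k v t" and A=C] C(2) by auto
  have ch: "continuous_on UNIV (\<lambda>v::'a. heat_kernel v t)" "continuous_on UNIV (\<lambda>v::'a. hkd k v t)" "continuous_on UNIV (\<lambda>v::'a. hkd l v t)" "continuous_on UNIV (\<lambda>v::'a. hkd2 l k v t)"
    using t by (auto intro!: continuous_intros continuous_on_hkd)
  show "(LBINT v. hkd k v t * potential D (x - v) z) = heat_flow D' x z t"
    using integral_by_parts_directional[where b=k, OF i1(1) i3 _ df(1) dg ch(1) c(1) ch(2) c(2)] i1(2) by (simp add: heat_flow_def)
  show "(LBINT v. hkd2 l k v t * potential D (x - v) z) = (LBINT v. hkd l v t * potential D' (x - v) z)"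
    using integral_by_parts_directional[where b=k, OF i2(1) i4 _ df(2) dg ch(3) c(1) ch(4) c(2)] i2(2) by simp
qed

text \<open>Associativity of convolution: the density is convolved with the Laplace kernel before
  the heat kernel derivative acts.\<close>

lemma riesz_heat_convolution:
  fixes x l k :: "'a::euclidean_space"
  assumes m: "DIM('a) \<ge> 2" and t: "t > 0" and z: "z > 0" and D: "ball_bounded M D"
  shows "(LBINT y. D y * riesz_heat (\<lambda>v. hkd2 l k v t) (x - y) z) = (LBINT v. hkd2 l k v t * potential D (x - v) z)"
proof -
  have n: "DIM('a \<times> real) \<ge> 3" using m by simp
  note [measurable] = borel_measurable_lap(1)[OF _ n] ball_boundedD(1)[OF D]
  obtain C where C: "C > 0" "\<forall>v::'a. heat_kernel v t \<le> C * (1 / wt v ^ (DIM('a) + 1)) \<and> \<bar>hkd l v t\<bar> \<le> C * (1 / wt v ^ (DIM('a) + 1)) \<and> \<bar>hkd2 l k v t\<bar> \<le> C * (1 / wt v ^ (DIM('a) + 1))"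
    using hkd_bound[OF t, of "DIM('a) + 1" l k] by (elim exE conjE)
  obtain K where K: "\<forall>u::'a. \<bar>laplace_kernel (u, z)\<bar> \<le> K \<and> \<bar>lap1 (0, 1) (u, z)\<bar> \<le> K"
    using laplace_kernel_bounded[OF m z, of "(0, 1)"] by (elim exE)
  have refl: "riesz_heat (\<lambda>v. hkd2 l k v t) y z = (LBINT v. hkd2 l k v t * laplace_kernel (y - v, z))" for y
    unfolding riesz_heat_def
    using integral_reflect[of "\<lambda>v. hkd2 l k v t * laplace_kernel (y - v, z)" y] by simp
  have "(LBINT y. D y * riesz_heat (\<lambda>v. hkd2 l k v t) (x - y) z) = (LBINT y. LBINT v. D y * (hkd2 l k v t * laplace_kernel (x - y - v, z)))"
    unfolding refl by simp
  also have "\<dots> = (LBINT v. LBINT y. D y * (hkd2 l k v t * laplace_kernel (x - y - v, z)))"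
  proof (rule Fubini_bound)
    show "integrable lborel (\<lambda>y. M * indicator (ball (0::'a) 1) y)"
      by (intro Bochner_Integration.integrable_mult_right integrable_indicator_ball)
    show "integrable lborel (\<lambda>v::'a. C * K * (1 / wt v ^ (DIM('a) + 1)))"
      by (intro Bochner_Integration.integrable_mult_right integrable_wt)
    fix y v :: 'a
    have "\<bar>hkd2 l k v t * laplace_kernel (x - y - v, z)\<bar> \<le> (C * (1 / wt v ^ (DIM('a) + 1))) * K"
      unfolding abs_mult using C K wt_nonneg[of v] by (intro mult_mono) auto
    then have h: "\<bar>hkd2 l k v t * laplace_kernel (x - y - v, z)\<bar> \<le> C * K * (1 / wt v ^ (DIM('a) + 1))"
      by (simp only: mult_ac)
    have "0 \<le> M * indicator (ball 0 1) y" using ball_boundedD(2)[OF D, of y] abs_ge_zero order_trans by blast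
    then show "\<bar>D y * (hkd2 l k v t * laplace_kernel (x - y - v, z))\<bar> \<le> (M * indicator (ball 0 1) y) * (C * K * (1 / wt v ^ (DIM('a) + 1)))"
      unfolding abs_mult[of "D y"] by (intro mult_mono ball_boundedD(2)[OF D] h) auto
  qed measurable
  also have "\<dots> = (LBINT v. hkd2 l k v t * potential D (x - v) z)"
  proof (intro Bochner_Integration.integral_cong refl)
    fix v :: 'a
    have "D y * (hkd2 l k v t * laplace_kernel (x - y - v, z)) = hkd2 l k v t * (D y * laplace_kernel (x - v - y, z))" for y
    proof -
      have e: "x - y - v = x - v - y" by (simp add: algebra_simps)
      show ?thesis unfolding e by simp
    qed
    then have "(LBINT y. D y * (hkd2 l k v t * laplace_kernel (x - y - v, z))) = (LBINT y. hkd2 l k v t * (D y * laplace_kernel (x - v - y, z)))"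
      by (simp only:)
    then show "(LBINT y. D y * (hkd2 l k v t * laplace_kernel (x - y - v, z))) = hkd2 l k v t * potential D (x - v) z"
      by (simp add: potential_def)
  qed simp
  finally show ?thesis .
qed

section \<open>Reduction of the Golovkin tensor to heat flows\<close>

lemma pd_heat_kernel_normal:
  "pd e_nrm (\<lambda>w. heat_kernel w t) ((x, xn) :: (real ^ 'm::finite) \<times> real) = heat_kernel x t * hk1 xn t"
proof -
  have "((\<lambda>h. heat_kernel (x, xn + h) t) has_real_derivative heat_kernel x t * hk1 xn t) (at 0)"
    unfolding heat_kernel_Pair
    using DERIV_shift[of "\<lambda>h. heat_kernel h t" "hk1 xn t" 0 xn] DERIV_heat_kernel[of t xn]
    by (intro DERIV_cmult) (simp add: add.commute)
  then show ?thesis unfolding pd_def e_nrm_def by (intro DERIV_imp_deriv) simp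
qed

text \<open>The Gaussian factors into a tangential and a normal part. The normal derivative touches
  only the latter, which leaves the inner integral, and the tangential integral is integrated by
  parts at each height z > 0.\<close>

lemma C_fun_eq:
  fixes x :: "real ^ 'm::finite"
  assumes m: "CARD('m) \<ge> 2" and t: "t > 0" and xn: "xn > 0"
  shows "C_fun (e_tan i) (x, xn) t =
    (LBINT z. indicator {0<..<xn} z * (hk1 (xn - z) t * riesz_heat (\<lambda>v. hkd (axis i 1) v t) x z))"
proof -
  have m': "DIM(real ^ 'm) \<ge> 2" using m by simp
  have n: "DIM((real ^ 'm) \<times> real) \<ge> 3" using m by simp
  have inner: "(LBINT w. pd e_nrm (\<lambda>w. heat_kernel w t) ((x, xn) - (w, z)) * pd (e_tan i) laplace_kernel (w, z))
      = hk1 (xn - z) t * riesz_heat (\<lambda>v. hkd (axis i 1) v t) x z" if z: "z > 0" for z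
  proof -
    have "pd (e_tan i) laplace_kernel (w, z) = lap1 (axis i 1, 0) (w, z)" for w :: "real ^ 'm"
    proof -
      have "(w, z) + 0 *\<^sub>R (axis i 1, 0) \<noteq> (0 :: (real ^ 'm) \<times> real)" using z by (simp add: zero_prod_def)
      from DERIV_laplace_kernel[OF n this] show ?thesis
        unfolding pd_def e_tan_def by (intro DERIV_imp_deriv) simp
    qed
    then have "(LBINT w. pd e_nrm (\<lambda>w. heat_kernel w t) ((x, xn) - (w, z)) * pd (e_tan i) laplace_kernel (w, z))
      = (LBINT w. hk1 (xn - z) t * (heat_kernel (x - w) t * lap1 (axis i 1, 0) (w, z)))"
      by (simp add: pd_heat_kernel_normal mult_ac)
    then show ?thesis using heat_kernel_lap1_by_parts[OF m' t z, of x "axis i 1"] by simp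
  qed
  have "C_fun (e_tan i) (x, xn) t = (LBINT z. indicator {0<..<xn} z *
      (LBINT w. pd e_nrm (\<lambda>w. heat_kernel w t) ((x, xn) - (w, z)) * pd (e_tan i) laplace_kernel (w, z)))"
    unfolding C_fun_def interval_lebesgue_integral_def zero_ereal_def
    using xn by (simp add: set_lebesgue_integral_def)
  also have "\<dots> = (LBINT z. indicator {0<..<xn} z * (hk1 (xn - z) t * riesz_heat (\<lambda>v. hkd (axis i 1) v t) x z))"
  proof (intro Bochner_Integration.integral_cong refl)
    fix z
    show "indicator {0<..<xn} z * (LBINT w. pd e_nrm (\<lambda>w. heat_kernel w t) ((x, xn) - (w, z)) * pd (e_tan i) laplace_kernel (w, z))
       = indicator {0<..<xn} z * (hk1 (xn - z) t * riesz_heat (\<lambda>v. hkd (axis i 1) v t) x z)"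
      by (cases "0 < z") (simp only: inner, simp add: indicator_def)
  qed
  finally show ?thesis .
qed

lemma integrable_indicator_interval_mult:
  fixes Y :: "real \<Rightarrow> real"
  assumes [measurable]: "Y \<in> borel_measurable borel" and K: "\<And>z. z \<in> {a<..<b} \<Longrightarrow> \<bar>Y z\<bar> \<le> K"
  shows "integrable lborel (\<lambda>z. indicator {a<..<b} z * Y z)"
    and "\<bar>indicator {a<..<b} z * Y z\<bar> \<le> K * indicator {a<..<b} z"
    and "integrable lborel (\<lambda>z::real. K * indicator {a<..<b} z)"
proof -
  show b: "\<bar>indicator {a<..<b} z * Y z\<bar> \<le> K * indicator {a<..<b} z" for z using K[of z] by (simp add: indicator_def)
  show i: "integrable lborel (\<lambda>z::real. K * indicator {a<..<b} z)"
    by (cases "a \<le> b") (auto intro!: Bochner_Integration.integrable_mult_right integrable_real_indicator)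
  show "integrable lborel (\<lambda>z. indicator {a<..<b} z * Y z)"
    by (rule integrable_dominated[OF i _ AE_I2[OF b]]) measurable
qed

text \<open>The formula for \<open>C_fun\<close> is valid at the same height xn after a tangential
  shift, so differentiation acts only on the tangential factor. The bounds on the Riesz type factors
  are uniform in z and give constant majorants on (0, xn).\<close>

lemma pd_C_fun:
  fixes x :: "real ^ 'm::finite"
  assumes m: "CARD('m) \<ge> 2" and t: "t > 0" and xn: "xn > 0"
  shows "pd (e_tan k) (\<lambda>w. C_fun (e_tan i) w t) (x, xn) =
    (LBINT z. indicator {0<..<xn} z * (hk1 (xn - z) t * riesz_heat (\<lambda>v. hkd2 (axis i 1) (axis k 1) v t) x z))"
proof -
  have m': "DIM(real ^ 'm) \<ge> 2" using m by simp
  note [measurable] = borel_measurable_riesz_heat[OF m']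
  let ?i = "axis i 1 :: real ^ 'm" and ?k = "axis k 1 :: real ^ 'm" and ?E = "exp 49 / t :: real"
  obtain C where C: "C > 0" "\<forall>v::real ^ 'm. heat_kernel v t \<le> C * (1 / wt v ^ (DIM(real ^ 'm) + 1)) \<and> \<bar>hkd ?i v t\<bar> \<le> C * (1 / wt v ^ (DIM(real ^ 'm) + 1)) \<and> \<bar>hkd2 ?i ?k v t\<bar> \<le> C * (1 / wt v ^ (DIM(real ^ 'm) + 1))"
    using hkd_bound[OF t, of "DIM(real ^ 'm) + 1" ?i ?k] by (elim exE conjE)
  have "\<exists>K. \<forall>x z. \<bar>riesz_heat (\<lambda>v. hkd ?i v t) x z\<bar> \<le> K"
    using C by (intro riesz_heat_bound[OF m', where C=C]) auto
  then obtain K1 where K1: "\<And>x z. \<bar>riesz_heat (\<lambda>v. hkd ?i v t) x z\<bar> \<le> K1" by blast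
  have "\<exists>K. \<forall>x z. \<bar>riesz_heat (\<lambda>v. hkd2 ?i ?k v t) x z\<bar> \<le> K"
    using C by (intro riesz_heat_bound[OF m', where C=C]) auto
  then obtain K2 where K2: "\<And>x z. \<bar>riesz_heat (\<lambda>v. hkd2 ?i ?k v t) x z\<bar> \<le> K2" by blast
  have b: "\<bar>hk1 y t * X\<bar> \<le> ?E * K" if "\<bar>X\<bar> \<le> K" for y X K
    unfolding abs_mult using hk_bounds_simple(2)[OF t, of y] t that by (intro mult_mono) auto
  have "((\<lambda>h. LBINT z. indicator {0<..<xn} z * (hk1 (xn - z) t * riesz_heat (\<lambda>v. hkd ?i v t) (x + h *\<^sub>R ?k) z))
     has_real_derivative (LBINT z. indicator {0<..<xn} z * (hk1 (xn - z) t * riesz_heat (\<lambda>v. hkd2 ?i ?k v t) (x + 0 *\<^sub>R ?k) z))) (at 0)"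
  proof (rule has_real_derivative_lebesgue_integral(2)[where d=1 and g="\<lambda>z. (?E * K2) * indicator {0<..<xn} z"
      and f'="\<lambda>h z. indicator {0<..<xn} z * (hk1 (xn - z) t * riesz_heat (\<lambda>v. hkd2 ?i ?k v t) (x + h *\<^sub>R ?k) z)"])
    show "integrable lborel (\<lambda>z. indicator {0<..<xn} z * (hk1 (xn - z) t * riesz_heat (\<lambda>v. hkd ?i v t) (x + h *\<^sub>R ?k) z))" for h
      by (rule integrable_indicator_interval_mult(1)[where K="?E * K1"]) (measurable, intro b K1)
    show "((\<lambda>h. indicator {0<..<xn} z * (hk1 (xn - z) t * riesz_heat (\<lambda>v. hkd ?i v t) (x + h *\<^sub>R ?k) z)) has_real_derivative
        indicator {0<..<xn} z * (hk1 (xn - z) t * riesz_heat (\<lambda>v. hkd2 ?i ?k v t) (x + h *\<^sub>R ?k) z)) (at h)" for h z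
    proof (cases "0 < z \<and> z < xn")
      case True
      then show ?thesis by (intro DERIV_cmult DERIV_riesz_heat[OF m' t]) auto
    qed (auto simp: indicator_def)
    show "\<bar>indicator {0<..<xn} z * (hk1 (xn - z) t * riesz_heat (\<lambda>v. hkd2 ?i ?k v t) (x + h *\<^sub>R ?k) z)\<bar> \<le> ?E * K2 * indicator {0<..<xn} z" for h z
      using b[OF K2] by (simp add: indicator_def)
    show "integrable lborel (\<lambda>z::real. (?E * K2) * indicator {0<..<xn} z)"
      using xn by (intro Bochner_Integration.integrable_mult_right integrable_real_indicator) auto
  qed simp
  then have "((\<lambda>h. C_fun (e_tan i) ((x, xn) + h *\<^sub>R e_tan k) t) has_real_derivative
      (LBINT z. indicator {0<..<xn} z * (hk1 (xn - z) t * riesz_heat (\<lambda>v. hkd2 ?i ?k v t) x z))) (at 0)"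
    by (simp add: e_tan_def[of k] C_fun_eq[OF m t xn])
  then show ?thesis unfolding pd_def by (rule DERIV_imp_deriv)
qed

lemma integrable_heat_ball_bounded:
  fixes x :: "'a::euclidean_space"
  assumes t: "t > 0" and D: "ball_bounded M D"
  shows "integrable lborel (\<lambda>y. heat_kernel (x - y) t * D y)"
proof -
  obtain C where C: "C > 0" "\<forall>v::'a. heat_kernel v t \<le> C / wt v ^ 0"
    using heat_kernel_le_wt[OF t, of 0] by (elim exE conjE)
  have "integrable lborel (\<lambda>y. D y * heat_kernel (x - y) t)"
    by (rule integrable_ball_bounded_mult(1)[OF D, where K=C]) (use C in \<open>auto simp: heat_kernel_nonneg\<close>)
  then show ?thesis by (simp add: mult.commute)
qed

text \<open>The datum meets the tensor: heights and boundary points are exchanged by Fubini, the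
  convolutions are reassociated, and both tangential derivatives of the tensor end on the datum.
  Only the diagonal term with the plain Gaussian keeps the datum undifferentiated.\<close>

lemma golovkin_reg_convolution:
  fixes x :: "real ^ 'm::finite"
  assumes m: "CARD('m) \<ge> 2" and t: "t > 0" and xn: "xn > 0"
    and D: "ball_bounded M D" "continuous_on UNIV D" and D1: "ball_bounded M1 D1" "continuous_on UNIV D1"
    and D2: "ball_bounded M2 D2" "continuous_on UNIV D2"
    and der1: "\<And>y. ((\<lambda>s. D (y + s *\<^sub>R axis k 1)) has_real_derivative D1 y) (at 0)"
    and der2: "\<And>y. ((\<lambda>s. D1 (y + s *\<^sub>R axis i 1)) has_real_derivative D2 y) (at 0)"
  shows "(LBINT y. golovkin_reg (e_tan i) (e_tan k) ((x, xn) - (y, 0)) t * D y) =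
    - 2 * (if i = k then 1 else 0) * (hk1 xn t * (LBINT y. heat_kernel (x - y) t * D y))
    - 4 * (LBINT z. indicator {0<..<xn} z * (hk1 z t * heat_flow D2 x (xn - z) t))"
proof -
  have m': "DIM(real ^ 'm) \<ge> 2" using m by simp
  note [measurable] = borel_measurable_riesz_heat[OF m'] ball_boundedD(1)[OF D(1)]
  let ?i = "axis i 1 :: real ^ 'm" and ?k = "axis k 1 :: real ^ 'm" and ?E = "exp 49 / t :: real"
  let ?R = "riesz_heat (\<lambda>v. hkd2 ?i ?k v t)" and ?\<delta> = "if i = k then 1 else 0 :: real"
  obtain C where C: "C > 0" "\<forall>v::real ^ 'm. heat_kernel v t \<le> C * (1 / wt v ^ (DIM(real ^ 'm) + 1)) \<and> \<bar>hkd ?i v t\<bar> \<le> C * (1 / wt v ^ (DIM(real ^ 'm) + 1)) \<and> \<bar>hkd2 ?i ?k v t\<bar> \<le> C * (1 / wt v ^ (DIM(real ^ 'm) + 1))"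
    using hkd_bound[OF t, of "DIM(real ^ 'm) + 1" ?i ?k] by (elim exE conjE)
  have "\<exists>K. \<forall>x z. \<bar>?R x z\<bar> \<le> K"
    using C by (intro riesz_heat_bound[OF m', where C=C]) auto
  then obtain K where K: "\<And>x z. \<bar>?R x z\<bar> \<le> K" by blast
  have b: "\<bar>hk1 y t * X\<bar> \<le> ?E * K" if "\<bar>X\<bar> \<le> K" for y X
    unfolding abs_mult using hk_bounds_simple(2)[OF t, of y] t that by (intro mult_mono) auto
  let ?F = "\<lambda>y z. D y * (indicator {0<..<xn} z * (hk1 (xn - z) t * ?R (x - y) z))"
  have fm: "case_prod ?F \<in> borel_measurable (lborel \<Otimes>\<^sub>M lborel)" by measurable
  have g1: "integrable lborel (\<lambda>y. M * indicator (ball (0::real ^ 'm) 1) y)"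
    by (intro Bochner_Integration.integrable_mult_right integrable_indicator_ball)
  have g2: "integrable lborel (\<lambda>z::real. (?E * K) * indicator {0<..<xn} z)"
    using xn by (intro Bochner_Integration.integrable_mult_right integrable_real_indicator) auto
  have fb: "\<bar>?F y z\<bar> \<le> (M * indicator (ball 0 1) y) * ((?E * K) * indicator {0<..<xn} z)" for y z
  proof -
    have "0 \<le> M * indicator (ball 0 1) y" using ball_boundedD(2)[OF D(1), of y] abs_ge_zero order_trans by blast
    moreover have "\<bar>indicator {0<..<xn} z * (hk1 (xn - z) t * ?R (x - y) z)\<bar> \<le> (?E * K) * indicator {0<..<xn} z"
      using b[OF K] by (simp add: indicator_def)
    ultimately show ?thesis unfolding abs_mult[of "D y"] by (intro mult_mono ball_boundedD(2)[OF D(1)]) auto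
  qed
  have Fi: "integrable lborel (\<lambda>y. LBINT z. ?F y z)"
    by (rule lborel_pair.integrable_fst[OF integrable_prod_bound[OF fm g1 g2 fb]])
  have e: "e_tan i = (e_tan k :: (real ^ 'm) \<times> real) \<longleftrightarrow> i = k" by (simp add: e_tan_def axis_eq_axis)
  have "golovkin_reg (e_tan i) (e_tan k) ((x, xn) - (y, 0)) t * D y
      = - 2 * ?\<delta> * hk1 xn t * (heat_kernel (x - y) t * D y) - 4 * (LBINT z. ?F y z)" for y
    unfolding golovkin_reg_def e by (simp add: pd_heat_kernel_normal pd_C_fun[OF m t xn] algebra_simps)
  then have "(LBINT y. golovkin_reg (e_tan i) (e_tan k) ((x, xn) - (y, 0)) t * D y)
      = - 2 * ?\<delta> * hk1 xn t * (LBINT y. heat_kernel (x - y) t * D y) - 4 * (LBINT y. LBINT z. ?F y z)"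
    using integrable_heat_ball_bounded[OF t D(1), of x] Fi by (simp del: mult_minus_left)
  also have "(LBINT y. LBINT z. ?F y z) = (LBINT z. LBINT y. ?F y z)"
    by (rule Fubini_bound[OF fm g1 g2 fb])
  also have "\<dots> = (LBINT z. indicator {0<..<xn} z * (hk1 (xn - z) t * heat_flow D2 x z t))"
  proof (intro Bochner_Integration.integral_cong refl)
    fix z
    show "(LBINT y. ?F y z) = indicator {0<..<xn} z * (hk1 (xn - z) t * heat_flow D2 x z t)"
    proof (cases "0 < z \<and> z < xn")
      case True
      then have z: "z > 0" by simp
      have "(LBINT y. ?F y z) = indicator {0<..<xn} z * (hk1 (xn - z) t * (LBINT y. D y * ?R (x - y) z))"
        by (simp add: mult.left_commute[of "D _"] del: mult_cancel_left)
      also have "(LBINT y. D y * ?R (x - y) z) = heat_flow D2 x z t"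
        unfolding riesz_heat_convolution[OF m' t z D(1)] heat_potential_by_parts(2)[OF m' t z D D1 der1]
        by (rule heat_potential_by_parts(1)[OF m' t z D1 D2 der2])
      finally show ?thesis .
    qed (auto simp: indicator_def)
  qed
  \<comment> \<open>The reflection of z puts the singular kernel at z and the smooth factor at xn -
    z, the form in which x-derivatives act on the smooth factor.\<close>
  also have "\<dots> = (LBINT z. indicator {0<..<xn} z * (hk1 z t * heat_flow D2 x (xn - z) t))"
    using integral_reflect[of "\<lambda>z. indicator {0<..<xn} z * (hk1 z t * heat_flow D2 x (xn - z) t)" xn]
    by (simp add: indicator_def cong: conj_cong)
       (simp add: conj_commute)
  finally show ?thesis by (simp add: mult.assoc)
qed

text \<open>Only the component j = k of the datum survives, and for it the part of the tensor
  carrying the Dirac delta vanishes, as that part is supported on the normal index. Reversing time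
  turns the endpoint s = 1 into t = 0.\<close>

lemma golovkin_solution_eq:
  fixes x :: "real ^ 'm::finite" and g :: "real ^ 'm \<Rightarrow> real \<Rightarrow> (real ^ 'm) \<times> real"
  assumes m: "CARD('m) \<ge> 2" and xn: "xn > 0"
    and D: "ball_bounded M D" "continuous_on UNIV D" and D1: "ball_bounded M1 D1" "continuous_on UNIV D1"
    and D2: "ball_bounded M2 D2" "continuous_on UNIV D2"
    and der1: "\<And>y. ((\<lambda>s. D (y + s *\<^sub>R axis k 1)) has_real_derivative D1 y) (at 0)"
    and der2: "\<And>y. ((\<lambda>s. D1 (y + s *\<^sub>R axis i 1)) has_real_derivative D2 y) (at 0)"
    and g_k: "\<And>y s. g y s \<bullet> e_tan k = D y * gT s"
    and g_j: "\<And>y s j. j \<in> Basis \<Longrightarrow> j \<noteq> e_tan k \<Longrightarrow> g y s \<bullet> j = 0"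
    and gT: "\<And>t. \<not> (0 < t \<and> t \<le> 1) \<Longrightarrow> gT (1 - t) = 0"
  shows "golovkin_solution g (e_tan i) (x, xn) 1 = (LBINT t. gT (1 - t) *
    (- 2 * (if i = k then 1 else 0) * (hk1 xn t * (LBINT y. heat_kernel (x - y) t * D y))
    - 4 * (LBINT z. indicator {0<..<xn} z * (hk1 z t * heat_flow D2 x (xn - z) t))))"
proof -
  let ?I = "\<lambda>j. (LBINT s. (LBINT y'. golovkin_reg (e_tan i) j ((x, xn) - (y', 0)) (1 - s) * (g y' s \<bullet> j)))
      + (LBINT y'. golovkin_sing (e_tan i) j ((x, xn) - (y', 0)) * (g y' 1 \<bullet> j))"
  have kB: "(e_tan k :: (real ^ 'm) \<times> real) \<in> Basis"
    by (auto simp: e_tan_def Basis_prod_def Basis_vec_def)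
  have "golovkin_solution g (e_tan i) (x, xn) 1 = (\<Sum>j\<in>Basis. if j = e_tan k then ?I j else 0)"
    unfolding golovkin_solution_def by (intro sum.cong refl) (auto simp: g_j)
  also have "\<dots> = ?I (e_tan k)" using kB by simp
  also have "\<dots> = (LBINT s. (LBINT y. golovkin_reg (e_tan i) (e_tan k) ((x, xn) - (y, 0)) (1 - s) * (D y * gT s)))"
  proof -
    have "(e_tan k :: (real ^ 'm) \<times> real) \<noteq> e_nrm" by (simp add: e_tan_def e_nrm_def)
    then show ?thesis by (simp add: golovkin_sing_def g_k)
  qed
  also have "\<dots> = (LBINT t. (LBINT y. golovkin_reg (e_tan i) (e_tan k) ((x, xn) - (y, 0)) t * (D y * gT (1 - t))))"
    using integral_reflect[of "\<lambda>t. LBINT y. golovkin_reg (e_tan i) (e_tan k) ((x, xn) - (y, 0)) t * (D y * gT (1 - t))" 1] by simp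
  also have "\<dots> = (LBINT t. gT (1 - t) * (LBINT y. golovkin_reg (e_tan i) (e_tan k) ((x, xn) - (y, 0)) t * D y))"
    by (intro Bochner_Integration.integral_cong refl) (subst integral_mult_right_zero[symmetric], simp add: mult_ac)
  also have "\<dots> = (LBINT t. gT (1 - t) *
    (- 2 * (if i = k then 1 else 0) * (hk1 xn t * (LBINT y. heat_kernel (x - y) t * D y))
    - 4 * (LBINT z. indicator {0<..<xn} z * (hk1 z t * heat_flow D2 x (xn - z) t))))"
  proof (intro Bochner_Integration.integral_cong refl)
    fix t
    show "gT (1 - t) * (LBINT y. golovkin_reg (e_tan i) (e_tan k) ((x, xn) - (y, 0)) t * D y) = gT (1 - t) *
      (- 2 * (if i = k then 1 else 0) * (hk1 xn t * (LBINT y. heat_kernel (x - y) t * D y))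
      - 4 * (LBINT z. indicator {0<..<xn} z * (hk1 z t * heat_flow D2 x (xn - z) t)))"
    proof (cases "0 < t \<and> t \<le> 1")
      case True
      then show ?thesis using golovkin_reg_convolution[OF m _ xn D D1 D2 der1 der2, of t x] by simp
    qed (simp add: gT)
  qed
  finally show ?thesis .
qed

subsection \<open>Derivatives of the spatial profile\<close>

text \<open>With e read as a multi-index, this is the partial derivative of order e of the tensor
  product of copies of G. Keeping e explicit makes every derivative of the datum an instance of one
  family.\<close>

definition pprod :: "(real \<Rightarrow> real) \<Rightarrow> ('m::finite \<Rightarrow> nat) \<Rightarrow> real ^ 'm \<Rightarrow> real" where
  "pprod G e y = (\<Prod>j\<in>UNIV. (deriv ^^ e j) G (y $ j))"

definition incr :: "'m \<Rightarrow> ('m \<Rightarrow> nat) \<Rightarrow> 'm \<Rightarrow> nat" where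
  "incr l e = e(l := Suc (e l))"

lemma pprod_remove:
  "pprod G e y = (deriv ^^ e l) G (y $ l) * (\<Prod>j\<in>UNIV - {l}. (deriv ^^ e j) G (y $ j))"
  unfolding pprod_def by (rule prod.remove) auto

context
  fixes G :: "real \<Rightarrow> real"
  assumes smooth: "\<And>m. (deriv ^^ m) G differentiable_on UNIV"
begin

lemma DERIV_funpow_deriv: "((deriv ^^ m) G has_real_derivative (deriv ^^ Suc m) G x) (at x)"
  using smooth[of m] by (auto simp: differentiable_on_def DERIV_deriv_iff_real_differentiable)

lemma continuous_on_funpow_deriv: "continuous_on S ((deriv ^^ m) G)"
  using DERIV_funpow_deriv by (meson DERIV_isCont continuous_at_imp_continuous_on)

lemma continuous_on_pprod: "continuous_on S (pprod G e)"
  unfolding pprod_def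
  by (intro continuous_on_prod continuous_on_compose2[OF continuous_on_funpow_deriv[of UNIV]] continuous_intros) auto

lemma DERIV_pprod:
  "((\<lambda>s. pprod G e (y + s *\<^sub>R axis l 1)) has_real_derivative pprod G (incr l e) y) (at 0)"
proof -
  have a: "(y + s *\<^sub>R axis l 1) $ j = (if j = l then y $ l + s else y $ j)" for s j
    by (simp add: axis_def)
  have "pprod G e (y + s *\<^sub>R axis l 1) = (deriv ^^ e l) G (y $ l + s) * (\<Prod>j\<in>UNIV - {l}. (deriv ^^ e j) G (y $ j))" for s
    unfolding pprod_remove[of G e _ l] a by simp
  moreover have "pprod G (incr l e) y = (deriv ^^ Suc (e l)) G (y $ l) * (\<Prod>j\<in>UNIV - {l}. (deriv ^^ e j) G (y $ j))"
    unfolding pprod_remove[of G "incr l e" _ l] by (simp add: incr_def)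
  moreover have "((\<lambda>s. (deriv ^^ e l) G (y $ l + s)) has_real_derivative (deriv ^^ Suc (e l)) G (y $ l)) (at 0)"
    using DERIV_funpow_deriv[of "e l" "y $ l"] DERIV_shift[of "(deriv ^^ e l) G" _ 0 "y $ l"]
    by (simp add: add.commute)
  ultimately show ?thesis by (simp add: DERIV_cmult_right del: funpow.simps)
qed

lemma has_derivative_pprod:
  "(pprod G e has_derivative (\<lambda>h. \<Sum>l\<in>UNIV. h $ l * pprod G (incr l e) y)) (at y)"
proof -
  have "((\<lambda>y. (deriv ^^ e j) G (y $ j)) has_derivative (\<lambda>h. (deriv ^^ Suc (e j)) G (y $ j) * h $ j)) (at y)" for j
    by (rule has_derivative_compose[OF _ DERIV_funpow_deriv[unfolded has_field_derivative_def]])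
       (rule bounded_linear_imp_has_derivative[OF bounded_linear_vec_nth])
  from has_derivative_prod[of UNIV "\<lambda>j y. (deriv ^^ e j) G (y $ j)", OF this]
  have "((\<lambda>y. pprod G e y) has_derivative (\<lambda>h. \<Sum>l\<in>UNIV. ((deriv ^^ Suc (e l)) G (y $ l) * h $ l) * (\<Prod>j\<in>UNIV - {l}. (deriv ^^ e j) G (y $ j)))) (at y)"
    unfolding pprod_def .
  moreover have "((deriv ^^ Suc (e l)) G (y $ l) * h) * (\<Prod>j\<in>UNIV - {l}. (deriv ^^ e j) G (y $ j)) = h * pprod G (incr l e) y" for l h
    unfolding pprod_remove[of G "incr l e" y l] by (simp add: incr_def)
  ultimately show ?thesis by (simp only:)
qed

context
  fixes r :: real
  assumes supp: "supp G \<subseteq> {- r<..<r}"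
begin

text \<open>Induction on the order: the complement of the closed support is open, so vanishing near
  a point passes to the derivative.\<close>

lemma funpow_deriv_eq_0:
  assumes "\<bar>x\<bar> \<ge> r"
  shows "(deriv ^^ m) G x = 0"
proof -
  have "(deriv ^^ m) G x = 0" if "x \<notin> supp G" for x
    using that
  proof (induction m arbitrary: x)
    case 0
    then show ?case using closure_subset[of "{x. G x \<noteq> 0}"] by (auto simp: supp_def)
  next
    case (Suc m)
    have "open (- supp G)" unfolding supp_def by (intro open_Compl closed_closure)
    from eventually_nhds_in_open[OF this, of x] have "\<forall>\<^sub>F y in nhds x. (deriv ^^ m) G y = 0"
      using Suc by (auto elim!: eventually_mono)
    then have "((deriv ^^ m) G has_real_derivative 0) (at x)"
      by (subst DERIV_cong_ev[OF refl _ refl]) auto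
    then show ?case by (simp add: DERIV_imp_deriv)
  qed
  then show ?thesis using assms supp by fastforce
qed

text \<open>The cube of half side r has half diagonal r * sqrt m = 4/5, where m = CARD('m). The gap
  between 4/5 and 1 keeps the support inside the open unit ball.\<close>

lemma pprod_eq_0:
  assumes r: "r = 4 / (5 * sqrt (real CARD('m)))" and y: "norm (y :: real ^ 'm::finite) \<ge> 4 / 5"
  shows "pprod G e y = 0"
proof -
  have c: "0 < real CARD('m)" by simp
  have r0: "0 < r" using r by simp
  have "\<exists>j. \<bar>y $ j\<bar> \<ge> r"
  proof (rule ccontr)
    assume "\<not> ?thesis"
    then have "(y $ j)\<^sup>2 < r\<^sup>2" for j
      using power_strict_mono[of "\<bar>y $ j\<bar>" r 2] by (simp add: not_le)
    then have "(\<Sum>j\<in>UNIV. (y $ j)\<^sup>2) < (\<Sum>j\<in>(UNIV::'m set). r\<^sup>2)"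
      by (intro sum_strict_mono) auto
    also have "\<dots> = (4 / 5)\<^sup>2" using c by (simp add: r power_mult_distrib power_divide)
    finally have "(norm y)\<^sup>2 < (4 / 5)\<^sup>2" by (simp add: norm_vec_def L2_set_def sum_nonneg)
    then have "norm y < 4 / 5" by (rule power_less_imp_less_base) simp
    then show False using y by simp
  qed
  then obtain j where "\<bar>y $ j\<bar> \<ge> r" by blast
  then show ?thesis unfolding pprod_def using funpow_deriv_eq_0 by (intro prod_zero) auto
qed

lemma ball_bounded_pprod:
  assumes r: "r = 4 / (5 * sqrt (real CARD('m)))"
  shows "\<exists>M. ball_bounded M (pprod G e :: real ^ 'm::finite \<Rightarrow> real)"
proof -
  have "compact (pprod G e ` cball (0::real ^ 'm) 1)"
    by (intro compact_continuous_image continuous_on_pprod compact_cball)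
  from compact_imp_bounded[OF this]
  obtain M where "\<forall>v\<in>pprod G e ` cball (0::real ^ 'm) 1. norm v \<le> M" unfolding bounded_iff by blast
  then have M: "\<bar>pprod G e y\<bar> \<le> M" if "y \<in> cball (0::real ^ 'm) 1" for y using that by auto
  have "\<bar>pprod G e y\<bar> \<le> M * indicator (ball 0 1) y" for y :: "real ^ 'm"
    using M[of y] pprod_eq_0[OF r, of y e] by (cases "norm y < 1") auto
  then show ?thesis
    using borel_measurable_continuous_onI[OF continuous_on_pprod[of UNIV e]]
    by (auto simp: ball_bounded_def)
qed

lemma ball_bounded_pprod_uniform:
  assumes r: "r = 4 / (5 * sqrt (real CARD('m)))" and A: "finite A"
  shows "\<exists>M. \<forall>e\<in>A. ball_bounded M (pprod G e :: real ^ 'm::finite \<Rightarrow> real)"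
proof -
  obtain M where M: "\<And>e. ball_bounded (M e) (pprod G e :: real ^ 'm \<Rightarrow> real)"
    using ball_bounded_pprod[OF r] by metis
  have "ball_bounded (\<Sum>e\<in>A. M e) (pprod G e :: real ^ 'm \<Rightarrow> real)" if "e \<in> A" for e
  proof -
    have "M e \<le> (\<Sum>e\<in>A. M e)" using A that ball_boundedD(3)[OF M] by (intro member_le_sum) auto
    then have "M e * indicator (ball 0 1) y \<le> (\<Sum>e\<in>A. M e) * indicator (ball 0 1) y" for y :: "real ^ 'm"
      by (intro mult_right_mono) auto
    then show ?thesis using ball_boundedD(1,2)[OF M[of e]] unfolding ball_bounded_def by (meson order_trans)
  qed
  then show ?thesis by blast
qed

lemma pprod_Lipschitz:
  assumes r: "r = 4 / (5 * sqrt (real CARD('m)))"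
  shows "\<exists>L. \<forall>x y. \<bar>pprod G e x - pprod G e (y :: real ^ 'm::finite)\<bar> \<le> L * norm (x - y)"
proof -
  obtain M where M: "\<And>l. ball_bounded M (pprod G (incr l e) :: real ^ 'm \<Rightarrow> real)"
    using ball_bounded_pprod_uniform[OF r, of "range (\<lambda>l. incr l e)"] by auto
  have "norm (pprod G e x - pprod G e y) \<le> (real CARD('m) * M) * norm (x - y)" for x y :: "real ^ 'm"
  proof (rule differentiable_bound)
    show "(pprod G e has_derivative (\<lambda>h. \<Sum>l\<in>UNIV. h $ l * pprod G (incr l e) z)) (at z within UNIV)" for z :: "real ^ 'm"
      by (rule has_derivative_pprod)
    show "onorm (\<lambda>h. \<Sum>l\<in>UNIV. h $ l * pprod G (incr l e) z) \<le> real CARD('m) * M" for z :: "real ^ 'm"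
    proof (rule onorm_le)
      fix h :: "real ^ 'm"
      have "norm (\<Sum>l\<in>UNIV. h $ l * pprod G (incr l e) z) \<le> (\<Sum>l\<in>(UNIV::'m set). norm h * M)"
        by (rule order_trans[OF norm_sum sum_mono])
           (use component_le_norm_cart[of h] ball_boundedD(4)[OF M] in \<open>auto simp: abs_mult intro!: mult_mono\<close>)
      then show "norm (\<Sum>l\<in>UNIV. h $ l * pprod G (incr l e) z) \<le> real CARD('m) * M * norm h" by (simp add: mult_ac)
    qed
  qed auto
  then show ?thesis by auto
qed

end
end

lemma Basis_vec_axis: "l \<in> (Basis :: (real ^ 'm::finite) set) \<longleftrightarrow> (\<exists>i. l = axis i 1)"
  unfolding Basis_vec_def Basis_real_def by blast

text \<open>The family \<^term>\<open>pprod G e\<close> is closed under tangential derivatives, so the second normal derivative of its heat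
  flow, minus the tangential Laplacian, is a sum of heat flows of the same kind.\<close>

lemma heat_flow_pprod:
  fixes G :: "real \<Rightarrow> real" and e :: "'m::finite \<Rightarrow> nat"
  assumes m: "CARD('m) \<ge> 2" and smooth: "\<And>m. (deriv ^^ m) G differentiable_on UNIV"
    and r: "r = 4 / (5 * sqrt (real CARD('m)))" and supp: "supp G \<subseteq> {- r<..<r}"
  shows "\<exists>B>0. \<forall>x :: real ^ 'm. \<exists>h2 :: real \<Rightarrow> real \<Rightarrow> real. \<forall>t. 0 < t \<longrightarrow> t \<le> 1 \<longrightarrow>
      continuous_on {0..} (\<lambda>z. heat_flow (pprod G e) x z t) \<and> continuous_on {0..} (\<lambda>z. h2 z t) \<and>
      (\<exists>h1. \<forall>z>0. ((\<lambda>z. heat_flow (pprod G e) x z t) has_real_derivative h1 z) (at z) \<and> (h1 has_real_derivative h2 z t) (at z)) \<and>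
      (\<forall>z\<ge>0. \<bar>heat_flow (pprod G e) x z t\<bar> \<le> B / wt x ^ (CARD('m) - 1) \<and> \<bar>h2 z t\<bar> \<le> B / wt x ^ (CARD('m) - 1)) \<and>
      \<bar>heat_flow (pprod G e) x 0 t - (LBINT v::real ^ 'm. heat_kernel v 1) * potential (pprod G e) x 0\<bar> \<le> B / wt x ^ (CARD('m) - 1) * sqrt t"
proof -
  let ?m = "CARD('m) - 1" and ?D = "pprod G e :: real ^ 'm \<Rightarrow> real"
  \<comment> \<open>The heat flow lemmas index directions by basis vectors, the family
    \<open>pprod\<close> by coordinates; \<open>ax\<close> recovers the coordinate from the
    vector.\<close>
  define ax where "ax l = (SOME i. l = axis i (1::real))" for l :: "real ^ 'm"
  have ax: "l = axis (ax l) 1" if "l \<in> Basis" for l :: "real ^ 'm"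
  proof -
    have "\<exists>i. l = axis i (1::real)" using that Basis_vec_axis by blast
    from someI_ex[OF this] show ?thesis unfolding ax_def .
  qed
  define D1 D2 where "D1 l = (pprod G (incr (ax l) e) :: real ^ 'm \<Rightarrow> real)"
    and "D2 l = (pprod G (incr (ax l) (incr (ax l) e)) :: real ^ 'm \<Rightarrow> real)" for l :: "real ^ 'm"
  have m': "DIM(real ^ 'm) \<ge> 2" and dm: "DIM(real ^ 'm) - 1 = ?m" using m by auto
  have "finite (insert e (range (\<lambda>l. incr l e) \<union> range (\<lambda>l. incr l (incr l e))))" by simp
  from ball_bounded_pprod_uniform[OF smooth supp r this]
  obtain M where M: "ball_bounded M ?D" "\<And>l. ball_bounded M (D1 l)" "\<And>l. ball_bounded M (D2 l)"
    unfolding D1_def D2_def by auto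
  obtain L where L: "\<forall>x y. \<bar>?D x - ?D y\<bar> \<le> L * norm (x - y)"
    using pprod_Lipschitz[OF smooth supp r] by blast
  obtain C where C: "C > 0" "\<And>M D (w::real ^ 'm) z t. ball_bounded M D \<Longrightarrow> 0 < t \<Longrightarrow> t \<le> 1 \<Longrightarrow> \<bar>heat_flow D w z t\<bar> \<le> C * M / wt w ^ ?m"
    using heat_flow_bound[OF m'] unfolding dm by (elim exE conjE) simp
  obtain C' where C': "C' > 0" "\<And>M L D (w::real ^ 'm) z t. ball_bounded M D \<Longrightarrow> (\<forall>x y. \<bar>D x - D y\<bar> \<le> L * norm (x - y)) \<Longrightarrow> 0 < t \<Longrightarrow> t \<le> 1 \<Longrightarrow>
    \<bar>heat_flow D w z t - (LBINT v::real ^ 'm. heat_kernel v 1) * potential D w z\<bar> \<le> C' * L / wt w ^ ?m * sqrt t"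
    using heat_flow_initial[OF m'] unfolding dm by (elim exE conjE) blast
  have M0: "0 \<le> M" by (rule ball_boundedD(3)[OF M(1)])
  define B where "B = 1 + C * M + (\<Sum>l\<in>(Basis :: (real ^ 'm) set). C * M) + C' * \<bar>L\<bar>"
  have s0: "0 \<le> (\<Sum>l\<in>(Basis :: (real ^ 'm) set). C * M)" using C(1) M0 by (intro sum_nonneg) auto
  have p: "0 \<le> C * M" "0 \<le> C' * \<bar>L\<bar>" using C(1) C'(1) M0 by auto
  have B: "C * M \<le> B" "(\<Sum>l\<in>(Basis :: (real ^ 'm) set). C * M) \<le> B" "C' * L \<le> B" "0 < B"
  proof -
    have "C' * L \<le> C' * \<bar>L\<bar>" using C'(1) by (intro mult_left_mono) auto
    then show "C * M \<le> B" "(\<Sum>l\<in>(Basis :: (real ^ 'm) set). C * M) \<le> B" "C' * L \<le> B" "0 < B"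
      using s0 p unfolding B_def by linarith+
  qed
  have "\<exists>h2 :: real \<Rightarrow> real \<Rightarrow> real. \<forall>t. 0 < t \<longrightarrow> t \<le> 1 \<longrightarrow>
      continuous_on {0..} (\<lambda>z. heat_flow ?D x z t) \<and> continuous_on {0..} (\<lambda>z. h2 z t) \<and>
      (\<exists>h1. \<forall>z>0. ((\<lambda>z. heat_flow ?D x z t) has_real_derivative h1 z) (at z) \<and> (h1 has_real_derivative h2 z t) (at z)) \<and>
      (\<forall>z\<ge>0. \<bar>heat_flow ?D x z t\<bar> \<le> B / wt x ^ ?m \<and> \<bar>h2 z t\<bar> \<le> B / wt x ^ ?m) \<and>
      \<bar>heat_flow ?D x 0 t - (LBINT v::real ^ 'm. heat_kernel v 1) * potential ?D x 0\<bar> \<le> B / wt x ^ ?m * sqrt t" for x :: "real ^ 'm"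
  proof (intro exI[of _ "\<lambda>z t. - (\<Sum>l\<in>Basis. heat_flow (D2 l) x z t)"] allI impI conjI)
    fix t :: real assume t: "0 < t" "t \<le> 1"
    show "continuous_on {0..} (\<lambda>z. heat_flow ?D x z t)" by (rule continuous_on_heat_flow[OF m' M(1) t(1)])
    show "continuous_on {0..} (\<lambda>z. - (\<Sum>l\<in>Basis. heat_flow (D2 l) x z t))"
      by (intro continuous_on_minus continuous_on_sum continuous_on_heat_flow[OF m' M(3) t(1)])
    show "\<exists>h1. \<forall>z>0. ((\<lambda>z. heat_flow ?D x z t) has_real_derivative h1 z) (at z) \<and>
        (h1 has_real_derivative - (\<Sum>l\<in>Basis. heat_flow (D2 l) x z t)) (at z)"
    proof (rule heat_flow_second_derivative[where D="?D" and ?D1.0=D1 and M=M, OF m' t(1) M(1)])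
      fix l y :: "real ^ 'm" assume l: "l \<in> Basis"
      show "((\<lambda>s. ?D (y + s *\<^sub>R l)) has_real_derivative D1 l y) (at 0)"
        using DERIV_pprod[OF smooth, of e y "ax l"] ax[OF l] by (simp add: D1_def)
      show "((\<lambda>s. D1 l (y + s *\<^sub>R l)) has_real_derivative D2 l y) (at 0)"
        using DERIV_pprod[OF smooth, of "incr (ax l) e" y "ax l"] ax[OF l] by (simp add: D1_def D2_def)
    qed (use M in \<open>auto simp: D1_def D2_def intro!: continuous_on_pprod[OF smooth]\<close>)
    have w: "0 < wt x ^ ?m" using wt_pos[of x] by simp
    fix z :: real assume "0 \<le> z"
    show "\<bar>heat_flow ?D x z t\<bar> \<le> B / wt x ^ ?m"
      by (rule order_trans[OF C(2)[OF M(1) t]]) (use B(1) w in \<open>simp add: divide_right_mono\<close>)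
    have "\<bar>- (\<Sum>l\<in>Basis. heat_flow (D2 l) x z t)\<bar> \<le> (\<Sum>l\<in>(Basis :: (real ^ 'm) set). C * M / wt x ^ ?m)"
      unfolding abs_minus_cancel by (intro order_trans[OF sum_abs] sum_mono C(2)[OF M(3) t])
    also have "\<dots> = (\<Sum>l\<in>(Basis :: (real ^ 'm) set). C * M) / wt x ^ ?m" by (simp only: sum_divide_distrib)
    also have "\<dots> \<le> B / wt x ^ ?m" using B(2) w by (simp add: divide_right_mono del: sum_constant)
    finally show "\<bar>- (\<Sum>l\<in>Basis. heat_flow (D2 l) x z t)\<bar> \<le> B / wt x ^ ?m" .
  next
    fix t :: real assume t: "0 < t" "t \<le> 1"
    have w: "0 < wt x ^ ?m" using wt_pos[of x] by simp
    show "\<bar>heat_flow ?D x 0 t - (LBINT v::real ^ 'm. heat_kernel v 1) * potential ?D x 0\<bar> \<le> B / wt x ^ ?m * sqrt t"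
      by (rule order_trans[OF C'(2)[OF M(1) L t]]) (use B(3) w t in \<open>auto intro!: mult_right_mono divide_right_mono\<close>)
  qed
  with B(4) show ?thesis by blast
qed

subsection \<open>Lower bounds for the potential of the datum\<close>

definition flip :: "'a::euclidean_space \<Rightarrow> 'a \<Rightarrow> 'a" where
  "flip b x = x - (2 * (x \<bullet> b)) *\<^sub>R b"

text \<open>The reflection as a diagonal map with entries 1 and -1, the shape whose effect on
  Lebesgue measure is known; its Jacobian has modulus 1.\<close>

lemma flip_eq_sum:
  fixes b :: "'a::euclidean_space"
  assumes "b \<in> Basis"
  shows "flip b = (\<lambda>x. 0 + (\<Sum>j\<in>Basis. ((if j = b then - 1 else 1) * (x \<bullet> j)) *\<^sub>R j))"
proof
  fix x :: 'a
  have "(if j = b then - 1 else 1) * (x \<bullet> j) = flip b x \<bullet> j" if "j \<in> Basis" for j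
    using assms that by (auto simp: flip_def inner_simps inner_Basis)
  then show "flip b x = 0 + (\<Sum>j\<in>Basis. ((if j = b then - 1 else 1) * (x \<bullet> j)) *\<^sub>R j)"
    by (simp add: euclidean_representation cong: sum.cong)
qed

lemma borel_measurable_flip [measurable]: "flip b \<in> borel_measurable borel"
  unfolding flip_def[abs_def] by measurable

lemma lborel_flip:
  fixes b :: "'a::euclidean_space"
  assumes "b \<in> Basis"
  shows "distr lborel borel (flip b) = lborel"
proof -
  have "lborel = density (distr lborel borel (\<lambda>x. 0 + (\<Sum>j\<in>Basis. ((if j = b then - 1 else 1) * (x \<bullet> j)) *\<^sub>R j)))
      (\<lambda>_. ennreal (\<Prod>j\<in>(Basis::'a set). \<bar>if j = b then - 1 else 1\<bar>))"
    by (rule lborel_affine_euclidean) auto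
  moreover have "(\<Prod>j\<in>(Basis::'a set). \<bar>if j = b then - 1 else 1 :: real\<bar>) = 1" by (rule prod.neutral) auto
  ultimately show ?thesis unfolding flip_eq_sum[OF assms] by (simp add: density_1)
qed

lemma integral_flip:
  fixes f :: "'a::euclidean_space \<Rightarrow> real"
  assumes b: "b \<in> Basis" and f: "integrable lborel f"
  shows "integrable lborel (\<lambda>y. f (flip b y))" and "(LBINT y. f (flip b y)) = (LBINT y. f y)"
proof -
  have [measurable]: "f \<in> borel_measurable borel" using f by auto
  show "integrable lborel (\<lambda>y. f (flip b y))"
    using integrable_distr_eq[of "flip b" lborel borel f] f unfolding lborel_flip[OF b] by simp
  show "(LBINT y. f (flip b y)) = (LBINT y. f y)"
    using integral_distr[of "flip b" lborel borel f] unfolding lborel_flip[OF b] by simp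
qed

lemma norm_flip: "b \<in> Basis \<Longrightarrow> (norm (flip b x))\<^sup>2 = (norm x)\<^sup>2"
  unfolding power2_norm_eq_inner flip_def by (simp add: inner_simps inner_commute algebra_simps)

lemma norm_diff_sq: "(norm (x - y))\<^sup>2 = (norm x)\<^sup>2 + (norm y)\<^sup>2 - 2 * (x \<bullet> y)" for x y :: "'a::real_inner"
  unfolding power2_norm_eq_inner by (simp add: inner_simps inner_commute)

lemma norm_diff_flip_sq:
  assumes "b \<in> Basis"
  shows "(norm (x - flip b y))\<^sup>2 = (norm (x - y))\<^sup>2 + 4 * (x \<bullet> b) * (y \<bullet> b)"
  unfolding norm_diff_sq norm_flip[OF assms] by (simp add: flip_def inner_simps algebra_simps)

section \<open>Distinct indices: mixed second differences of the Laplace kernel\<close>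

text \<open>Two applications of the mean value theorem identify the mixed difference with 4 p q
  f''(\<eta>) for f(\<rho>) = \<rho>^(-s) and some 0 < \<eta> \<le> R. As f'' is decreasing, its
  value at R is a lower bound.\<close>

lemma mixed_difference_powr:
  fixes A p q R s :: real
  assumes s: "s > 0" and p: "p \<ge> 0" and q: "q \<ge> 0" and A: "A - p - q > 0" and R: "A + p + q \<le> R"
  shows "4 * p * q * (s * (s + 1) * R powr (- s - 2))
    \<le> (A - p - q) powr (- s) - (A + p - q) powr (- s) - (A - p + q) powr (- s) + (A + p + q) powr (- s)"
proof (cases "p = 0 \<or> q = 0")
  case False
  then have pq: "p > 0" "q > 0" using p q by auto
  let ?f = "\<lambda>x::real. x powr (- s)" and ?f1 = "\<lambda>x::real. - s * x powr (- s - 1)" and ?f2 = "\<lambda>x::real. s * (s + 1) * x powr (- s - 2)"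
  have d1: "(?f has_real_derivative ?f1 x) (at x)" if "x > 0" for x
    using that by (auto intro!: derivative_eq_intros)
  have d2: "(?f1 has_real_derivative ?f2 x) (at x)" if "x > 0" for x
  proof -
    have "(?f1 has_real_derivative - s * ((- s - 1) * x powr (- s - 1 - 1))) (at x)"
      using that by (auto intro!: derivative_eq_intros)
    then show ?thesis by (simp add: algebra_simps)
  qed
  have "\<exists>\<xi>>A - p. \<xi> < A + p \<and> (?f (A + p + q) - ?f (A + p - q)) - (?f (A - p + q) - ?f (A - p - q)) = (A + p - (A - p)) * (?f1 (\<xi> + q) - ?f1 (\<xi> - q))"
  proof (rule MVT2[where f="\<lambda>x. ?f (x + q) - ?f (x - q)" and f'="\<lambda>x. ?f1 (x + q) - ?f1 (x - q)", of "A - p" "A + p"])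
    fix x assume x: "A - p \<le> x" "x \<le> A + p"
    have "((\<lambda>x. ?f (x + q)) has_real_derivative ?f1 (x + q) * 1) (at x)" "((\<lambda>x. ?f (x - q)) has_real_derivative ?f1 (x - q) * 1) (at x)"
      by (rule DERIV_chain2[OF d1], use x A pq in \<open>auto intro!: derivative_eq_intros\<close>)+
    from DERIV_diff[OF this]
    show "((\<lambda>x. ?f (x + q) - ?f (x - q)) has_real_derivative ?f1 (x + q) - ?f1 (x - q)) (at x)" by simp
  qed (use pq in simp)
  then obtain \<xi> where \<xi>: "A - p < \<xi>" "\<xi> < A + p"
    "(?f (A + p + q) - ?f (A + p - q)) - (?f (A - p + q) - ?f (A - p - q)) = 2 * p * (?f1 (\<xi> + q) - ?f1 (\<xi> - q))" by auto
  have "\<exists>\<eta>>\<xi> - q. \<eta> < \<xi> + q \<and> ?f1 (\<xi> + q) - ?f1 (\<xi> - q) = (\<xi> + q - (\<xi> - q)) * ?f2 \<eta>"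
    by (rule MVT2) (use pq \<xi> A d2 in auto)
  then obtain \<eta> where \<eta>: "\<xi> - q < \<eta>" "\<eta> < \<xi> + q" "?f1 (\<xi> + q) - ?f1 (\<xi> - q) = 2 * q * ?f2 \<eta>" by auto
  have \<eta>p: "0 < \<eta>" "\<eta> \<le> R" using \<xi> \<eta> A R by linarith+
  have "?f2 R \<le> ?f2 \<eta>" using \<eta>p s by (intro mult_left_mono powr_mono2') auto
  moreover have "0 \<le> 4 * p * q" using pq by simp
  ultimately have "4 * p * q * ?f2 R \<le> 4 * p * q * ?f2 \<eta>" by (rule mult_left_mono)
  also have "\<dots> = (?f (A + p + q) - ?f (A + p - q)) - (?f (A - p + q) - ?f (A - p - q))"
    unfolding \<xi>(3) \<eta>(3) by simp
  finally show ?thesis by linarith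
qed auto

text \<open>The bracket is odd in p and odd in q, so it equals its value at the absolute values
  times the sign of p q. The factor d has the same sign as p q, which makes the product
  nonnegative.\<close>

lemma mixed_difference_powr_sign:
  fixes A p q R s d :: real
  defines "br \<equiv> \<lambda>p q. (A - p - q) powr (- s) - (A + p - q) powr (- s) - (A - p + q) powr (- s) + (A + p + q) powr (- s)"
  assumes s: "s > 0" and A: "A - \<bar>p\<bar> - \<bar>q\<bar> > 0" and R: "A + \<bar>p\<bar> + \<bar>q\<bar> \<le> R" and d: "0 \<le> d * (p * q)"
  shows "4 * (d * (p * q)) * (s * (s + 1) * R powr (- s - 2)) \<le> d * br p q"
proof -
  let ?K = "s * (s + 1) * R powr (- s - 2)"
  have b: "4 * \<bar>p\<bar> * \<bar>q\<bar> * ?K \<le> br \<bar>p\<bar> \<bar>q\<bar>"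
    unfolding br_def by (rule mixed_difference_powr[OF s _ _ A R]) auto
  have b': "br p q = sgn p * sgn q * br \<bar>p\<bar> \<bar>q\<bar>"
    by (cases p "0::real" rule: linorder_cases; cases q "0::real" rule: linorder_cases) (auto simp: br_def)
  have d': "d * (p * q) = \<bar>d\<bar> * (\<bar>p\<bar> * \<bar>q\<bar>)" using d by (simp add: abs_mult[symmetric])
  show ?thesis
  proof (cases "p * q = 0")
    case True
    then show ?thesis unfolding b' by (auto simp: sgn_real_def)
  next
    case False
    have "d * (sgn p * sgn q) = \<bar>d\<bar>"
      using d False
      by (cases p "0::real" rule: linorder_cases; cases q "0::real" rule: linorder_cases)
         (auto simp: zero_le_mult_iff mult_le_0_iff)
    then have "d * br p q = \<bar>d\<bar> * br \<bar>p\<bar> \<bar>q\<bar>" unfolding b' by (metis mult.assoc)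
    moreover have "\<bar>d\<bar> * (4 * \<bar>p\<bar> * \<bar>q\<bar> * ?K) \<le> \<bar>d\<bar> * br \<bar>p\<bar> \<bar>q\<bar>" by (intro mult_left_mono b) auto
    ultimately show ?thesis unfolding d' by (simp add: mult_ac)
  qed
qed

lemma integral_pos_of_continuous:
  fixes f :: "'a::euclidean_space \<Rightarrow> real"
  assumes c: "continuous_on UNIV f" and nn: "\<And>x. 0 \<le> f x" and pos: "0 < f a" and i: "integrable lborel f"
  shows "0 < (LBINT x. f x)"
proof -
  have "open {x. f a / 2 < f x}" by (intro open_Collect_less continuous_intros c)
  moreover have "a \<in> {x. f a / 2 < f x}" using pos by simp
  ultimately obtain e where e: "e > 0" "ball a e \<subseteq> {x. f a / 2 < f x}"
    by (rule openE)
  have "0 < (LBINT x. indicator (ball a e) x * (f a / 2))"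
    using content_ball_pos[OF e(1), of a] pos by simp
  also have "\<dots> \<le> (LBINT x. f x)"
  proof (rule integral_mono)
    show "integrable lborel (\<lambda>x. indicator (ball a e) x * (f a / 2))"
      using emeasure_lborel_ball_finite[of a e] by (intro Bochner_Integration.integrable_mult_left integrable_real_indicator) auto
    show "indicator (ball a e) x * (f a / 2) \<le> f x" for x
      using e(2) nn[of x] by (auto simp: indicator_def less_imp_le)
  qed (rule i)
  finally show ?thesis .
qed

context
  fixes G :: "real \<Rightarrow> real" and r :: real and m :: "'m::finite itself"
  assumes smooth: "\<And>m. (deriv ^^ m) G differentiable_on UNIV"
    and even: "\<And>x. G (- x) = G x"
    and supp: "supp G \<subseteq> {- r<..<r}"
    and r: "r = 4 / (5 * sqrt (real CARD('m)))"
    and G0: "G 0 = 1"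
    and decr: "\<And>x. x > 0 \<Longrightarrow> deriv G x \<le> 0"
    and nonneg: "\<And>x. 0 \<le> G x"
    and m2: "CARD('m) \<ge> 2"
begin

lemma deriv_odd: "deriv G (- x) = - deriv G x"
proof -
  have d: "(G has_real_derivative deriv G x) (at x)" for x
    using DERIV_funpow_deriv[OF smooth, of 0 x] by simp
  have "((\<lambda>x. G (- x)) has_real_derivative deriv G (- x) * - 1) (at x)"
    by (rule DERIV_chain2[OF d]) (auto intro!: derivative_eq_intros)
  then have "(G has_real_derivative - deriv G (- x)) (at x)" by (simp add: even)
  from DERIV_unique[OF this d] show ?thesis by simp
qed

lemma deriv_mult_nonpos: "deriv G x * x \<le> 0"
proof (cases x "0::real" rule: linorder_cases)
  case less
  then have "deriv G (- x) \<le> 0" by (intro decr) simp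
  then show ?thesis using less by (simp add: deriv_odd mult_nonneg_nonpos)
next
  case greater
  then show ?thesis using decr[of x] by (simp add: mult_nonpos_nonneg)
qed auto

lemma deriv_neg_exists: "\<exists>\<xi>>0. deriv G \<xi> < 0"
proof -
  have r0: "0 < r" using r by simp
  have "\<exists>\<xi>. 0 < \<xi> \<and> \<xi> < r \<and> G r - G 0 = (r - 0) * deriv G \<xi>"
    by (rule MVT2[OF r0]) (use DERIV_funpow_deriv[OF smooth, of 0] in auto)
  then obtain \<xi> where \<xi>: "0 < \<xi>" "G r - G 0 = r * deriv G \<xi>" by auto
  have "G r = 0" using funpow_deriv_eq_0[OF smooth supp, of r 0] r0 by simp
  then have "deriv G \<xi> < 0" using \<xi>(2) r0 G0 by (metis diff_0 less_le_trans linorder_not_less mult_nonneg_nonneg neg_less_0_iff_less order_less_imp_le zero_less_one not_less)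
  then show ?thesis using \<xi>(1) by blast
qed

lemma pprod_mixed:
  fixes i k :: 'm and y :: "real ^ 'm"
  assumes ik: "i \<noteq> k"
  shows "pprod G (incr i (incr k (\<lambda>_. 0))) y = deriv G (y $ i) * (deriv G (y $ k) * (\<Prod>j\<in>UNIV - {i} - {k}. G (y $ j)))"
proof -
  have "pprod G (incr i (incr k (\<lambda>_. 0))) y = deriv G (y $ i) * (\<Prod>j\<in>UNIV - {i}. (deriv ^^ (incr i (incr k (\<lambda>_. 0))) j) G (y $ j))"
    unfolding pprod_remove[of G _ y i] using ik by (simp add: incr_def)
  also have "(\<Prod>j\<in>UNIV - {i}. (deriv ^^ (incr i (incr k (\<lambda>_. 0))) j) G (y $ j))
      = deriv G (y $ k) * (\<Prod>j\<in>UNIV - {i} - {k}. (deriv ^^ (incr i (incr k (\<lambda>_. 0))) j) G (y $ j))"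
    using ik by (subst prod.remove[of _ k]) (auto simp: incr_def)
  also have "(\<Prod>j\<in>UNIV - {i} - {k}. (deriv ^^ (incr i (incr k (\<lambda>_. 0))) j) G (y $ j)) = (\<Prod>j\<in>UNIV - {i} - {k}. G (y $ j))"
    by (intro prod.cong) (auto simp: incr_def)
  finally show ?thesis .
qed

text \<open>The density is odd in y_i and in y_k, so the potential is a quarter of the integral
  against an alternating sum of four reflected kernels. The squared distances of the four points are
  A \<plusminus> p \<plusminus> q with p and q proportional to x_i y_i and x_k y_k, and the density
  times y_i y_k is nonnegative.\<close>

lemma potential_mixed_lower:
  fixes i k :: 'm
  assumes ik: "i \<noteq> k"
  shows "\<exists>C>0. \<forall>x::real ^ 'm. norm x \<ge> 3 \<longrightarrow> 0 < x $ i \<longrightarrow> 0 < x $ k \<longrightarrow>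
    C * (x $ i * x $ k) / norm x ^ (CARD('m) + 3) \<le> potential (pprod G (incr i (incr k (\<lambda>_. 0)))) x 0"
proof -
  let ?e = "incr i (incr k (\<lambda>_. 0))" and ?m = "CARD('m)"
  let ?D = "pprod G ?e :: real ^ 'm \<Rightarrow> real" and ?c = "lapc TYPE((real ^ 'm) \<times> real)"
  let ?b = "axis i 1 :: real ^ 'm" and ?b' = "axis k 1 :: real ^ 'm"
  \<comment> \<open>In terms of the squared distance \<rho> the kernel on the hyperplane is a
    multiple of \<rho>^(-s), because its exponent in the distance is m - 1.\<close>
  define s where "s = real (?m - 1) / 2"
  have s: "s > 0" using m2 by (simp add: s_def)
  have m': "DIM(real ^ 'm) \<ge> 2" using m2 by simp
  have n: "DIM((real ^ 'm) \<times> real) \<ge> 3" using m2 by simp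
  have c: "0 < ?c" by (rule lapc_pos[OF n])
  have B: "?b \<in> Basis" "?b' \<in> Basis" by (auto simp: Basis_vec_axis)
  obtain M where M: "ball_bounded M ?D" using ball_bounded_pprod[OF smooth supp r] by blast
  let ?h = "\<lambda>y. ?D y * (y $ i * y $ k)"
  have hnn: "0 \<le> ?h y" for y
  proof -
    have e: "?h y = (deriv G (y $ i) * y $ i) * (deriv G (y $ k) * y $ k) * (\<Prod>j\<in>UNIV - {i} - {k}. G (y $ j))"
      unfolding pprod_mixed[OF ik] by (simp add: mult_ac)
    show ?thesis unfolding e
      by (intro mult_nonneg_nonneg[OF mult_nonpos_nonpos] deriv_mult_nonpos prod_nonneg ballI nonneg)
  qed
  have hz: "?h y = 0" "?D y = 0" if "\<not> norm y < 1" for y using pprod_eq_0[OF smooth supp r, of y ?e] that by auto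
  have hi: "integrable lborel ?h"
  proof (rule integrable_dominated[OF Bochner_Integration.integrable_mult_right[OF integrable_indicator_ball, of M] _ AE_I2])
    have [measurable]: "?D \<in> borel_measurable borel" by (rule ball_boundedD(1)[OF M])
    show "?h \<in> borel_measurable lborel" by measurable
    show "\<bar>?h y\<bar> \<le> M * indicator (ball 0 1) y" for y
    proof (cases "norm y < 1")
      case True
      have "\<bar>y $ i\<bar> \<le> 1" "\<bar>y $ k\<bar> \<le> 1" using component_le_norm_cart[of y i] component_le_norm_cart[of y k] True by linarith+
      then have "\<bar>y $ i * y $ k\<bar> \<le> 1" unfolding abs_mult by (intro mult_le_one) auto
      then have "\<bar>?D y\<bar> * \<bar>y $ i * y $ k\<bar> \<le> M * 1" using ball_boundedD(3,4)[OF M] by (intro mult_mono) auto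
      then show ?thesis using True by (simp add: abs_mult)
    qed (use hz in auto)
  qed
  have hpos: "0 < (LBINT y. ?h y)"
  proof -
    obtain \<xi> where \<xi>: "\<xi> > 0" "deriv G \<xi> < 0" using deriv_neg_exists by blast
    \<comment> \<open>The coordinates i and k sit where G' < 0, the others at 0 where G = 1, so the
      integrand is positive at this point.\<close>
    define y0 :: "real ^ 'm" where "y0 = (\<chi> j. if j = i \<or> j = k then \<xi> else 0)"
    have "?D y0 = deriv G \<xi> * deriv G \<xi>"
      unfolding pprod_mixed[OF ik] by (simp add: y0_def G0)
    then have "0 < ?h y0" using \<xi> by (simp add: y0_def mult_neg_neg)
    moreover have "continuous_on UNIV ?h" by (intro continuous_intros continuous_on_pprod smooth)
    ultimately show ?thesis using hnn hi by (intro integral_pos_of_continuous[of ?h y0]) auto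
  qed
  \<comment> \<open>The 4 is 16 / 4: p q carries a factor 4, the mixed difference another 4, and the
    symmetrised integral is four times the potential. The power of 2 comes from R = (2 |x|)^2 raised
    to -s-2.\<close>
  define C where "C = ?c * 4 * (s * (s + 1)) * (1 / 2 ^ (?m + 3)) * (LBINT y. ?h y)"
  have Cpos: "C > 0" unfolding C_def using c s hpos by (intro mult_pos_pos) auto
  have "C * (x $ i * x $ k) / norm x ^ (?m + 3) \<le> potential ?D x 0" if x: "norm x \<ge> 3" "0 < x $ i" "0 < x $ k" for x :: "real ^ 'm"
  proof -
    let ?R = "4 * (norm x)\<^sup>2" and ?f = "\<lambda>\<rho>::real. \<rho> powr (- s)"
    let ?K = "s * (s + 1) * ?R powr (- s - 2)"
    have Rp: "?R powr (- s - 2) = 1 / 2 ^ (?m + 3) * (1 / norm x ^ (?m + 3))"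
    proof -
      have "?R = (2 * norm x) powr 2" using x(1) by (simp add: powr_numeral power_mult_distrib)
      moreover have "2 * (- s - 2) = - real (?m + 3)" using m2 by (simp add: s_def of_nat_diff field_simps)
      ultimately have "?R powr (- s - 2) = (2 * norm x) powr (- real (?m + 3))"
        by (simp only: powr_powr)
      also have "\<dots> = 1 / (2 * norm x) ^ (?m + 3)"
        using x(1) by (subst powr_minus_divide, subst powr_realpow) auto
      finally show ?thesis by (simp add: power_mult_distrib)
    qed
    have E: "laplace_kernel (u, 0 :: real) = ?c * ?f ((norm u)\<^sup>2)" if "u \<noteq> 0" for u :: "real ^ 'm"
    proof -
      have ex: "2 * (- s) = - real (?m - 1)" using m2 by (simp add: s_def of_nat_diff field_simps)
      have "?f ((norm u)\<^sup>2) = (norm u powr 2) powr (- s)" using that by (simp add: powr_numeral)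
      also have "\<dots> = norm u powr (- real (?m - 1))" by (simp only: powr_powr ex)
      also have "\<dots> = 1 / norm u ^ (?m - 1)" using that by (subst powr_minus_divide, subst powr_realpow) auto
      finally show ?thesis using laplace_kernel_eq[OF n, of "(u, 0)"] by (simp add: norm_Pair)
    qed
    let ?E = "\<lambda>u. laplace_kernel (u, 0 :: real)"
    let ?F = "\<lambda>y. ?D y * ?E (x - y)"
    have Fi: "integrable lborel ?F" by (rule integrable_potential[OF m' M])
    have flc: "flip (axis l 1) y $ j = (if j = l then - y $ j else y $ j)" for l j and y :: "real ^ 'm"
    proof -
      have "y \<bullet> axis l 1 = y $ l" by (simp add: inner_axis)
      then show ?thesis unfolding flip_def by (simp add: axis_def)
    qed
    have odd: "?D (flip ?b y) = - ?D y" "?D (flip ?b' y) = - ?D y" for y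
    proof -
      have "(\<Prod>j\<in>UNIV - {i} - {k}. G (flip ?b y $ j)) = (\<Prod>j\<in>UNIV - {i} - {k}. G (y $ j))"
        "(\<Prod>j\<in>UNIV - {i} - {k}. G (flip ?b' y $ j)) = (\<Prod>j\<in>UNIV - {i} - {k}. G (y $ j))"
        by (auto intro!: prod.cong simp: flc)
      then show "?D (flip ?b y) = - ?D y" "?D (flip ?b' y) = - ?D y"
        unfolding pprod_mixed[OF ik] using ik by (simp_all add: flc deriv_odd)
    qed
    have F1: "integrable lborel (\<lambda>y. ?D y * ?E (x - flip ?b y))" "(LBINT y. ?D y * ?E (x - flip ?b y)) = - (LBINT y. ?F y)"
      using integral_flip[OF B(1) Fi] by (simp_all add: odd)
    have F2: "integrable lborel (\<lambda>y. ?D y * ?E (x - flip ?b' y))" "(LBINT y. ?D y * ?E (x - flip ?b' y)) = - (LBINT y. ?F y)"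
      using integral_flip[OF B(2) Fi] by (simp_all add: odd)
    have F3: "integrable lborel (\<lambda>y. ?D y * ?E (x - flip ?b (flip ?b' y)))" "(LBINT y. ?D y * ?E (x - flip ?b (flip ?b' y))) = (LBINT y. ?F y)"
      using integral_flip[OF B(2) F1(1)] F1(2) by (simp_all add: odd)
    have "4 * (LBINT y. ?F y) = (LBINT y. ?D y * (?E (x - y) - ?E (x - flip ?b y) - ?E (x - flip ?b' y) + ?E (x - flip ?b (flip ?b' y))))"
      using Fi F1 F2 F3 by (simp add: right_diff_distrib distrib_left)
    also have "\<dots> \<ge> (LBINT y. ?c * (16 * (x $ i * x $ k) * ?K) * ?h y)"
    proof (rule integral_mono)
      show "integrable lborel (\<lambda>y. ?c * (16 * (x $ i * x $ k) * ?K) * ?h y)"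
        by (intro Bochner_Integration.integrable_mult_right hi)
      show "integrable lborel (\<lambda>y. ?D y * (?E (x - y) - ?E (x - flip ?b y) - ?E (x - flip ?b' y) + ?E (x - flip ?b (flip ?b' y))))"
        unfolding right_diff_distrib distrib_left
        by (intro Bochner_Integration.integrable_add Bochner_Integration.integrable_diff Fi F1 F2 F3)
      fix y
      show "?c * (16 * (x $ i * x $ k) * ?K) * ?h y \<le> ?D y * (?E (x - y) - ?E (x - flip ?b y) - ?E (x - flip ?b' y) + ?E (x - flip ?b (flip ?b' y)))"
      proof (cases "norm y < 1")
        case True
        define p q A where "p = 2 * x $ i * y $ i" and "q = 2 * x $ k * y $ k" and "A = (norm (x - y))\<^sup>2 + p + q"
        have nf: "norm (flip b z) = norm z" if "b \<in> Basis" for b z :: "real ^ 'm"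
          using norm_flip[OF that, of z] by simp
        have small: "x - z \<noteq> 0" "0 < (norm (x - z))\<^sup>2" "(norm (x - z))\<^sup>2 \<le> ?R" if "norm z = norm y" for z
        proof -
          show nz: "x - z \<noteq> 0" using that True x(1) by auto
          then show "0 < (norm (x - z))\<^sup>2" by simp
          have "norm (x - z) \<le> 2 * norm x" using norm_triangle_ineq4[of x z] that True x(1) by linarith
          then have "(norm (x - z))\<^sup>2 \<le> (2 * norm x)\<^sup>2" by (intro power_mono) auto
          then show "(norm (x - z))\<^sup>2 \<le> ?R" by (simp add: power_mult_distrib)
        qed
        have e1: "(norm (x - y))\<^sup>2 = A - p - q" by (simp add: A_def)
        have e2: "(norm (x - flip ?b y))\<^sup>2 = A + p - q"
          unfolding norm_diff_flip_sq[OF B(1)] by (simp add: A_def p_def inner_axis)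
        have e3: "(norm (x - flip ?b' y))\<^sup>2 = A - p + q"
          unfolding norm_diff_flip_sq[OF B(2)] by (simp add: A_def q_def inner_axis)
        have e4: "(norm (x - flip ?b (flip ?b' y)))\<^sup>2 = A + p + q"
          unfolding norm_diff_flip_sq[OF B(1)] norm_diff_flip_sq[OF B(2)] using ik by (simp add: A_def p_def q_def inner_axis flc)
        note S = small[of y, unfolded e1] small[of "flip ?b y", unfolded e2] small[of "flip ?b' y", unfolded e3] small[of "flip ?b (flip ?b' y)", unfolded e4]
        \<comment> \<open>Whatever the signs of p and q, both quantities are among the four squared
          distances, which are positive since |x| > |y| and at most (2 |x|)^2.\<close>
        have Apq: "A - \<bar>p\<bar> - \<bar>q\<bar> > 0" "A + \<bar>p\<bar> + \<bar>q\<bar> \<le> ?R"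
          using S B by (auto simp: nf abs_if)
        have dpq: "?D y * (p * q) = 4 * (x $ i * x $ k) * ?h y" by (simp add: p_def q_def mult_ac)
        have "0 \<le> ?D y * (p * q)" unfolding dpq using x hnn[of y] by simp
        from mixed_difference_powr_sign[OF s Apq this]
        have "4 * (?D y * (p * q)) * ?K \<le> ?D y * (?f (A - p - q) - ?f (A + p - q) - ?f (A - p + q) + ?f (A + p + q))" .
        then have "?c * (4 * (?D y * (p * q)) * ?K) \<le> ?c * (?D y * (?f (A - p - q) - ?f (A + p - q) - ?f (A - p + q) + ?f (A + p + q)))"
          using c by (intro mult_left_mono) auto
        moreover have "?E (x - y) = ?c * ?f (A - p - q)" "?E (x - flip ?b y) = ?c * ?f (A + p - q)"
          "?E (x - flip ?b' y) = ?c * ?f (A - p + q)" "?E (x - flip ?b (flip ?b' y)) = ?c * ?f (A + p + q)"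
          using E small(1) B by (auto simp: nf e1 e2 e3 e4)
        ultimately show ?thesis unfolding dpq by (simp only:) (simp add: algebra_simps)
      qed (use hz in auto)
    qed
    finally have fin: "?c * (16 * (x $ i * x $ k) * ?K) * (LBINT y. ?h y) \<le> 4 * potential ?D x 0"
      unfolding potential_def by simp
    have gen: "c * (16 * X * (S * (\<alpha> * (1 / N)))) * H = 4 * ((c * 4 * S * \<alpha> * H) * X / N)" for c X S \<alpha> N H :: real
      by simp
    have "4 * (C * (x $ i * x $ k) / norm x ^ (?m + 3)) \<le> 4 * potential ?D x 0"
      using fin unfolding Rp gen C_def .
    then show ?thesis by simp
  qed
  with Cpos show ?thesis by blast
qed

section \<open>Equal indices: the sign of the second derivative of the Laplace kernel\<close>

lemma norm_vec_sq_split: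
  fixes w :: "real ^ 'm"
  shows "(norm w)\<^sup>2 = (w $ k)\<^sup>2 + (\<Sum>l\<in>UNIV - {k}. (w $ l)\<^sup>2)"
proof -
  have "(norm w)\<^sup>2 = (\<Sum>l\<in>UNIV. (w $ l)\<^sup>2)" by (simp add: norm_vec_def L2_set_def sum_nonneg)
  then show ?thesis by (simp add: sum.remove[of UNIV k])
qed

text \<open>On the support of the datum the second derivative \<open>\<partial>\<^sub>k\<^sup>2E(x - y)\<close> has a constant sign, in each of the
  two regions for \<open>x\<close>, because \<open>n w\<^sub>k\<^sup>2 - |w|\<^sup>2\<close> with \<open>w = x - y\<close> stays away from zero.\<close>

lemma quadratic_sign:
  fixes x y :: "real ^ 'm" and k :: 'm and z p :: real
  assumes p: "p = 1 / (2 * sqrt (real CARD('m)))" and x: "norm x \<ge> 3" and y: "norm y < 4 / 5" "\<bar>y $ k\<bar> < r" and z: "\<bar>z\<bar> \<le> 1"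
  shows "\<bar>x $ k\<bar> < p \<Longrightarrow> (real CARD('m) + 1) * (x $ k - y $ k)\<^sup>2 - ((norm (x - y))\<^sup>2 + z\<^sup>2) \<le> - 1"
    and "\<bar>x $ k\<bar> > r \<Longrightarrow> sqrt (\<Sum>l\<in>UNIV - {k}. (x $ l)\<^sup>2) < 3 / 2 \<Longrightarrow>
      1 \<le> (real CARD('m) + 1) * (x $ k - y $ k)\<^sup>2 - ((norm (x - y))\<^sup>2 + z\<^sup>2)"
proof -
  let ?M = "real CARD('m)"
  have M: "2 \<le> ?M" using m2 by simp
  have z2: "0 \<le> z\<^sup>2" "z\<^sup>2 \<le> 1" using z by (auto simp: abs_square_le_1)
  \<comment> \<open>3 - 4/5 = 11/5.\<close>
  have nw: "11 / 5 \<le> norm (x - y)" using norm_triangle_ineq2[of x y] x y by linarith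
  have nw2: "(11 / 5)\<^sup>2 \<le> (norm (x - y))\<^sup>2" using nw by (intro power_mono) auto
  show "(?M + 1) * (x $ k - y $ k)\<^sup>2 - ((norm (x - y))\<^sup>2 + z\<^sup>2) \<le> - 1" if A: "\<bar>x $ k\<bar> < p"
  proof -
    have "\<bar>x $ k - y $ k\<bar> \<le> p + r" using A y(2) by linarith
    then have "(x $ k - y $ k)\<^sup>2 \<le> (p + r)\<^sup>2" by (rule abs_le_square_iff[THEN iffD1, OF order_trans[OF _ abs_ge_self]])
    \<comment> \<open>1/2 + 4/5 = 13/10. With M \<ge> 2 the factor (M+1)/M is at most 3/2, so the
      first term stays below 507/200 = 2.535, against (11/5)^2 = 4.84.\<close>
    also have "p + r = (13 / 10) / sqrt ?M" using M by (simp add: p r field_simps)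
    also have "\<dots>\<^sup>2 = (169 / 100) / ?M" by (simp add: power_divide)
    finally have "(?M + 1) * (x $ k - y $ k)\<^sup>2 \<le> (?M + 1) * ((169 / 100) / ?M)" using M by (intro mult_left_mono) auto
    also have "\<dots> \<le> 507 / 200" using M by (simp add: field_simps)
    finally have "(?M + 1) * (x $ k - y $ k)\<^sup>2 \<le> 507 / 200" .
    moreover have "(11 / 5)\<^sup>2 = (121 / 25 :: real)" by (simp add: power2_eq_square)
    ultimately show ?thesis using nw2 z2(1) by linarith
  qed
  show "1 \<le> (?M + 1) * (x $ k - y $ k)\<^sup>2 - ((norm (x - y))\<^sup>2 + z\<^sup>2)"
    if B: "\<bar>x $ k\<bar> > r" "sqrt (\<Sum>l\<in>UNIV - {k}. (x $ l)\<^sup>2) < 3 / 2"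
  proof -
    let ?s = "\<lambda>w :: real ^ 'm. \<Sum>l\<in>UNIV - {k}. (w $ l)\<^sup>2"
    have sn: "0 \<le> ?s w" for w by (intro sum_nonneg) auto
    have "(sqrt (?s x))\<^sup>2 \<le> (3 / 2)\<^sup>2" using B(2) sn[of x] by (intro power_mono) auto
    then have sx: "?s x \<le> 9 / 4" using sn[of x] by (simp add: power2_eq_square)
    have "3\<^sup>2 \<le> (norm x)\<^sup>2" using x by (intro power_mono) auto
    \<comment> \<open>The squared norm leaves at least 9 - 9/4 = 6.75 for the k-th coordinate, and
      2.59^2 is just below this. Likewise r is at most 0.57, since r^2 \<le> 0.32.\<close>
    then have "(259 / 100)\<^sup>2 \<le> \<bar>x $ k\<bar>\<^sup>2" using sx norm_vec_sq_split[of x k] by (simp add: power2_eq_square)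
    then have xk: "259 / 100 \<le> \<bar>x $ k\<bar>" by (rule power2_le_imp_le) simp
    have "r\<^sup>2 = (16 / 25) / ?M" by (simp add: r power_divide power_mult_distrib)
    also have "\<dots> \<le> (57 / 100)\<^sup>2" using M by (simp add: field_simps power2_eq_square)
    finally have r57: "r \<le> 57 / 100" by (rule power2_le_imp_le) simp
    have "202 / 100 \<le> \<bar>x $ k - y $ k\<bar>" using xk r57 y(2) by linarith
    then have wk: "(202 / 100)\<^sup>2 \<le> (x $ k - y $ k)\<^sup>2" using power_mono[of "202 / 100" "\<bar>x $ k - y $ k\<bar>" 2] by simp
    have "L2_set (\<lambda>l. x $ l + - y $ l) (UNIV - {k}) \<le> L2_set (\<lambda>l. x $ l) (UNIV - {k}) + L2_set (\<lambda>l. - y $ l) (UNIV - {k})"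
      by (rule L2_set_triangle_ineq)
    then have "sqrt (?s (x - y)) \<le> sqrt (?s x) + sqrt (?s y)" by (simp add: L2_set_def)
    moreover have "sqrt (?s y) \<le> 4 / 5"
    proof -
      have "?s y \<le> (norm y)\<^sup>2" using norm_vec_sq_split[of y k] by simp
      then have "sqrt (?s y) \<le> norm y" by (intro real_le_lsqrt sn) auto
      then show ?thesis using y(1) by linarith
    qed
    ultimately have "sqrt (?s (x - y)) \<le> 23 / 10" using B(2) by linarith
    then have "(sqrt (?s (x - y)))\<^sup>2 \<le> (23 / 10)\<^sup>2" using sn[of "x - y"] by (intro power_mono) auto
    then have so: "?s (x - y) \<le> (23 / 10)\<^sup>2" using sn[of "x - y"] by simp
    \<comment> \<open>The quadratic form is M w_k^2 minus the other squared coordinates minus z^2.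
      Its value is at least 2 * 2.02^2 - 2.3^2 - 1, which exceeds 1; here 2.3 = 3/2 + 4/5.\<close>
    have "2 * (x $ k - y $ k)\<^sup>2 \<le> ?M * (x $ k - y $ k)\<^sup>2" using M by (intro mult_right_mono) auto
    moreover have "(norm (x - y))\<^sup>2 = (x $ k - y $ k)\<^sup>2 + ?s (x - y)" using norm_vec_sq_split[of "x - y" k] by simp
    ultimately show ?thesis using wk so z2 by (simp add: distrib_right power2_eq_square)
  qed
qed

text \<open>The two tangential derivatives return to the kernel only for z > 0. The lower bound
  found there does not depend on z in (0,1], and continuity of the potential up to the boundary
  delivers it at z = 0. The density is then gS itself, which is nonnegative with positive
  integral.\<close>

lemma potential_pure_lower:
  fixes k :: 'm
  assumes p: "p = 1 / (2 * sqrt (real CARD('m)))"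
  shows "\<exists>C>0. \<forall>x::real ^ 'm. norm x \<ge> 3 \<longrightarrow>
     (\<bar>x $ k\<bar> < p \<or> \<bar>x $ k\<bar> > r \<and> sqrt (\<Sum>l\<in>UNIV - {k}. (x $ l)\<^sup>2) < 3 / 2) \<longrightarrow>
     C / norm x ^ (CARD('m) + 3) \<le> \<bar>potential (pprod G (incr k (incr k (\<lambda>_. 0)))) x 0\<bar>"
proof -
  let ?S = "pprod G (\<lambda>_. 0) :: real ^ 'm \<Rightarrow> real" and ?D1 = "pprod G (incr k (\<lambda>_. 0)) :: real ^ 'm \<Rightarrow> real"
    and ?D = "pprod G (incr k (incr k (\<lambda>_. 0))) :: real ^ 'm \<Rightarrow> real" and ?m = "CARD('m)"
  let ?c = "(real DIM((real ^ 'm) \<times> real) - 2) * lapc TYPE((real ^ 'm) \<times> real)" and ?b = "axis k 1 :: real ^ 'm"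
  have m': "DIM(real ^ 'm) \<ge> 2" using m2 by simp
  have n: "DIM((real ^ 'm) \<times> real) \<ge> 3" and N: "DIM((real ^ 'm) \<times> real) = ?m + 1" using m2 by simp_all
  have c: "0 < ?c" using lapc_pos[OF n] n by simp
  obtain M0 M1 M2 where M: "ball_bounded M0 ?S" "ball_bounded M1 ?D1" "ball_bounded M2 ?D"
    using ball_bounded_pprod[OF smooth supp r] by meson
  have Snn: "0 \<le> ?S y" for y unfolding pprod_def using nonneg by (intro prod_nonneg) simp
  have Si: "integrable lborel ?S"
    using integrable_ball_bounded_mult(1)[OF M(1), of "\<lambda>_. 1" 1] by simp
  have Spos: "0 < (LBINT y. ?S y)"
    using Snn Si by (intro integral_pos_of_continuous[of ?S 0] continuous_on_pprod smooth) (auto simp: pprod_def G0)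
  define C where "C = ?c * (1 / 2 ^ (?m + 3)) * (LBINT y. ?S y)"
  have Cpos: "C > 0" unfolding C_def by (rule mult_pos_pos[OF mult_pos_pos[OF c] Spos]) simp
  \<comment> \<open>Over a common denominator of degree n + 2 the numerator of the second derivative
    is n w_k^2 - |(w,z)|^2, the form whose sign is controlled.\<close>
  have lap2_eq: "lap2 (?b, 0) (w, z) = ?c * (((real ?m + 1) * (w $ k)\<^sup>2 - ((norm w)\<^sup>2 + z\<^sup>2)) / norm (w, z) ^ (?m + 3))"
    if "z > 0" for w :: "real ^ 'm" and z
  proof -
    have nz: "norm (w, z) \<noteq> 0" using that by (simp add: zero_prod_def)
    have n2: "(norm (w, z))\<^sup>2 = (norm w)\<^sup>2 + z\<^sup>2" by (simp add: norm_Pair)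
    have e: "?m + 3 = DIM((real ^ 'm) \<times> real) + 2" by simp
    have q: "1 / norm (w, z) ^ DIM((real ^ 'm) \<times> real) = (norm (w, z))\<^sup>2 / norm (w, z) ^ (?m + 3)"
      unfolding e power_add using nz by simp
    have i: "(w, z) \<bullet> (?b, 0) = w $ k" "(?b, 0) \<bullet> (?b, 0 :: real) = 1" by (simp_all add: inner_axis inner_axis_axis)
    have d: "real DIM((real ^ 'm) \<times> real) = real ?m + 1" by simp
    show ?thesis unfolding lap2_def i q e[symmetric] by (simp only: d n2 diff_divide_distrib)
  qed
  \<comment> \<open>The sign \<sigma> allows one argument for both regions of x: it is -1 near the
    hyperplane x_k = 0 and 1 far from it.\<close>
  have main: "C / norm x ^ (?m + 3) \<le> \<sigma> * potential ?D x z"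
    if x: "norm x \<ge> 3" and z: "0 < z" "z \<le> 1" and sg: "\<And>y. norm y < 4 / 5 \<Longrightarrow> \<bar>y $ k\<bar> < r \<Longrightarrow>
      1 \<le> \<sigma> * ((real ?m + 1) * (x $ k - y $ k)\<^sup>2 - ((norm (x - y))\<^sup>2 + z\<^sup>2))" for x :: "real ^ 'm" and z \<sigma>
  proof -
    have "potential ?D x z = (LBINT y. ?S y * lap2 (?b, 0) (x - y, z))"
      using potential_tangential_derivatives(2)[where D="?S" and D'="?D1" and l="?b" and w=x, OF m' z(1) M(1)
          continuous_on_pprod[OF smooth] M(2) continuous_on_pprod[OF smooth] DERIV_pprod[OF smooth]]
        potential_tangential_derivatives(1)[where D="?D1" and D'="?D" and l="?b" and w=x, OF m' z(1) M(2)
          continuous_on_pprod[OF smooth] M(3) continuous_on_pprod[OF smooth] DERIV_pprod[OF smooth]] by (simp only:)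
    then have e: "\<sigma> * potential ?D x z = (LBINT y. ?S y * (\<sigma> * lap2 (?b, 0) (x - y, z)))" by (simp add: mult.left_commute)
    have "C / norm x ^ (?m + 3) = (LBINT y. ?S y * (?c * (1 / (2 * norm x) ^ (?m + 3))))"
      by (simp add: C_def power_mult_distrib mult_ac)
    also have "\<dots> \<le> (LBINT y. ?S y * (\<sigma> * lap2 (?b, 0) (x - y, z)))"
    proof (rule integral_mono)
      show "integrable lborel (\<lambda>y. ?S y * (?c * (1 / (2 * norm x) ^ (?m + 3))))" by (intro Bochner_Integration.integrable_mult_left Si)
      obtain K where K: "\<forall>(u::real ^ 'm) t. z \<le> t \<longrightarrow> laplace_kernel (u, t) \<le> K \<and> \<bar>lap1 (?b, 0) (u, t)\<bar> \<le> K \<and> \<bar>lap2 (?b, 0) (u, t)\<bar> \<le> K"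
        using lap_bound_away[OF m' z(1), of "(?b, 0)"] by (elim exE)
      have "integrable lborel (\<lambda>y. ?S y * lap2 (?b, 0) (x - y, z))"
        by (rule integrable_ball_bounded_mult(1)[OF M(1), where K=K]) (measurable, use K in blast)
      from Bochner_Integration.integrable_mult_right[OF this, of \<sigma>]
      show "integrable lborel (\<lambda>y. ?S y * (\<sigma> * lap2 (?b, 0) (x - y, z)))" by (simp add: mult.left_commute)
      fix y
      show "?S y * (?c * (1 / (2 * norm x) ^ (?m + 3))) \<le> ?S y * (\<sigma> * lap2 (?b, 0) (x - y, z))"
      proof (cases "?S y = 0")
        case False
        have y: "norm y < 4 / 5" using False pprod_eq_0[OF smooth supp r, of y] by force
        have yk: "\<bar>y $ k\<bar> < r"
        proof (rule ccontr)
          assume "\<not> ?thesis"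
          then have "G (y $ k) = 0" using funpow_deriv_eq_0[OF smooth supp, of "y $ k" 0] by simp
          then have "?S y = 0" unfolding pprod_def by (intro prod_zero) auto
          with False show False by simp
        qed
        let ?u = "(x - y, z)"
        have up: "0 < norm ?u" using z by (simp add: zero_prod_def)
        have "norm ?u \<le> norm (x - y) + norm z" by (rule norm_Pair_le)
        \<comment> \<open>Here |x - y| + z \<le> |x| + 4/5 + 1, and this is at most 2 |x| because
          |x| \<ge> 3. Hence the factor 2^(m+3) in \<open>C\<close>.\<close>
        then have ule: "norm ?u \<le> 2 * norm x" using norm_triangle_ineq4[of x y] x y z by simp
        have "?c * (1 / (2 * norm x) ^ (?m + 3)) \<le> ?c * (1 / norm ?u ^ (?m + 3))"
          using c up ule by (intro mult_left_mono divide_left_mono power_mono mult_pos_pos zero_less_power) auto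
        also have "\<dots> \<le> ?c * ((\<sigma> * ((real ?m + 1) * (x $ k - y $ k)\<^sup>2 - ((norm (x - y))\<^sup>2 + z\<^sup>2))) / norm ?u ^ (?m + 3))"
          using c up sg[OF y yk] by (intro mult_left_mono divide_right_mono) auto
        also have "\<dots> = \<sigma> * lap2 (?b, 0) ?u" unfolding lap2_eq[OF z(1)] by simp
        finally show ?thesis by (intro mult_left_mono Snn)
      qed simp
    qed
    finally show ?thesis unfolding e .
  qed
  have lim: "C / norm x ^ (?m + 3) \<le> \<sigma> * potential ?D x 0"
    if "\<And>z. 0 < z \<Longrightarrow> z \<le> 1 \<Longrightarrow> C / norm x ^ (?m + 3) \<le> \<sigma> * potential ?D x z" for x :: "real ^ 'm" and \<sigma>
  proof (rule LIMSEQ_le_const)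
    have "(\<lambda>j. inverse (real (Suc j))) \<longlonglongrightarrow> 0" by (rule LIMSEQ_inverse_real_of_nat)
    then have "(\<lambda>j. potential ?D x (inverse (real (Suc j)))) \<longlonglongrightarrow> potential ?D x 0"
      using continuous_on_potential[OF m' M(3), of x] unfolding continuous_on_sequentially o_def by auto
    then show "(\<lambda>j. \<sigma> * potential ?D x (inverse (real (Suc j)))) \<longlonglongrightarrow> \<sigma> * potential ?D x 0" by (rule tendsto_mult_left)
    show "\<exists>N. \<forall>j\<ge>N. C / norm x ^ (?m + 3) \<le> \<sigma> * potential ?D x (inverse (real (Suc j)))"
      using that by (intro exI[of _ 0]) (auto simp: inverse_le_1_iff)
  qed
  have "C / norm x ^ (?m + 3) \<le> \<bar>potential ?D x 0\<bar>"
    if x: "norm x \<ge> 3" and xk: "\<bar>x $ k\<bar> < p \<or> \<bar>x $ k\<bar> > r \<and> sqrt (\<Sum>l\<in>UNIV - {k}. (x $ l)\<^sup>2) < 3 / 2" for x :: "real ^ 'm"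
    using xk
  proof
    assume A: "\<bar>x $ k\<bar> < p"
    have "C / norm x ^ (?m + 3) \<le> - 1 * potential ?D x 0"
    proof (rule lim)
      fix z :: real assume z: "0 < z" "z \<le> 1"
      show "C / norm x ^ (?m + 3) \<le> - 1 * potential ?D x z"
      proof (rule main[OF x z])
        fix y :: "real ^ 'm" assume "norm y < 4 / 5" "\<bar>y $ k\<bar> < r"
        then show "1 \<le> - 1 * ((real ?m + 1) * (x $ k - y $ k)\<^sup>2 - ((norm (x - y))\<^sup>2 + z\<^sup>2))"
          using quadratic_sign(1)[OF p x _ _ _ A, where y=y and z=z] z by force
      qed
    qed
    then show ?thesis by linarith
  next
    assume B: "\<bar>x $ k\<bar> > r \<and> sqrt (\<Sum>l\<in>UNIV - {k}. (x $ l)\<^sup>2) < 3 / 2"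
    have "C / norm x ^ (?m + 3) \<le> 1 * potential ?D x 0"
    proof (rule lim)
      fix z :: real assume z: "0 < z" "z \<le> 1"
      show "C / norm x ^ (?m + 3) \<le> 1 * potential ?D x z"
      proof (rule main[OF x z])
        fix y :: "real ^ 'm" assume "norm y < 4 / 5" "\<bar>y $ k\<bar> < r"
        then show "1 \<le> 1 * ((real ?m + 1) * (x $ k - y $ k)\<^sup>2 - ((norm (x - y))\<^sup>2 + z\<^sup>2))"
          using quadratic_sign(2)[OF p x, where y=y and z=z and k=k] B z by force
      qed
    qed
    then show ?thesis by linarith
  qed
  with Cpos show ?thesis by blast
qed

end

subsection \<open>The singular time integral\<close>

text \<open>For x > 0 the Gaussian is O(t) as t tends to 0, so the value 0 assigned to it at t = 0
  by definition is its limit. The linear bound again spends the exponent 7: the seventh power of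
  sqrt t / x over sqrt t leaves t^3, more than needed.\<close>

lemma heat_kernel_time_continuous:
  fixes x a :: real
  assumes x: "x > 0" and a: "a > 0"
  shows "continuous_on {0..1/2} (\<lambda>t. t powr a * heat_kernel x t)"
proof -
  let ?F = "\<lambda>t. t powr a * heat_kernel x t"
  have pos: "isCont ?F t" if "t > 0" for t
    by (intro isCont_mult DERIV_isCont[OF DERIV_heat_kernel_time[OF that]] DERIV_isCont[OF has_real_derivative_powr[OF that]])
  have le: "\<bar>?F t\<bar> \<le> exp 49 / x ^ 7 * t" if t: "0 \<le> t" "t \<le> 1/2" for t
  proof (cases "t = 0")
    case False
    then have t0: "t > 0" using t by simp
    define s where "s = sqrt t"
    have s: "s > 0" "s\<^sup>2 = t" using t0 by (auto simp: s_def)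
    have "s\<^sup>2 \<le> 1\<^sup>2" using s(2) t by simp
    then have s1: "s \<le> 1" by (rule power2_le_imp_le) simp
    have "x / s \<le> wt (x / s)" using x s by (simp add: wt_def)
    then have "(x / s) ^ 7 \<le> wt (x / s) ^ 7" using x s by (intro power_mono) auto
    moreover have "0 < (x / s) ^ 7" using x s by simp
    ultimately have "exp 49 / (s * wt (x / s) ^ 7) \<le> exp 49 / (s * (x / s) ^ 7)"
      using s wt_pos[of "x / s"] by (intro divide_left_mono mult_left_mono mult_pos_pos) auto
    then have "heat_kernel x t \<le> exp 49 / (s * (x / s) ^ 7)"
      using heat_kernel_real_le[OF t0, of x] by (simp add: s_def)
    also have "\<dots> = exp 49 / x ^ 7 * s ^ 6" using s x by (simp add: power_divide field_simps eval_nat_numeral)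
    also have "\<dots> \<le> exp 49 / x ^ 7 * s\<^sup>2"
      using s s1 x by (intro mult_left_mono power_decreasing) auto
    finally have k: "heat_kernel x t \<le> exp 49 / x ^ 7 * t" by (simp add: s)
    have "t powr a \<le> 1" using t0 t a by (intro powr_le1) auto
    then have "t powr a * heat_kernel x t \<le> 1 * heat_kernel x t" by (intro mult_right_mono heat_kernel_nonneg)
    then show ?thesis using k by (simp add: abs_mult heat_kernel_nonneg)
  qed (simp add: heat_kernel_def)
  show ?thesis
    unfolding continuous_on_eq_continuous_within
  proof
    fix t :: real assume t: "t \<in> {0..1/2}"
    show "continuous (at t within {0..1/2}) ?F"
    proof (cases "t = 0")
      case False
      with t have "t > 0" by simp
      from continuous_at_imp_continuous_at_within[OF pos[OF this]] show ?thesis .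
    next
      case True
      have "(?F \<longlongrightarrow> 0) (at 0 within {0..1/2})"
      proof (rule Lim_null_comparison)
        show "\<forall>\<^sub>F t in at 0 within {0..1/2}. norm (?F t) \<le> exp 49 / x ^ 7 * t"
          unfolding eventually_at_filter real_norm_def
        proof (intro always_eventually allI impI)
          fix t :: real assume "t \<in> {0..1/2}"
          then show "\<bar>?F t\<bar> \<le> exp 49 / x ^ 7 * t" by (intro le) auto
        qed
        have "((\<lambda>t. exp 49 / x ^ 7 * t) \<longlongrightarrow> exp 49 / x ^ 7 * 0) (at 0 within {0..1/2})" by (intro tendsto_intros)
        then show "((\<lambda>t. exp 49 / x ^ 7 * t) \<longlongrightarrow> 0) (at 0 within {0..1/2})" by simp
      qed
      then show ?thesis using True by (simp add: continuous_within)
    qed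
  qed
qed

lemma integrable_time_pieces:
  fixes x a :: real
  assumes x: "x > 0" and a: "a > 0"
  shows "set_integrable lborel {0..1/2} (\<lambda>t. t powr a * hk2 x t)"
    and "set_integrable lborel {0..1/2} (\<lambda>t. t powr (a - 1) * heat_kernel x t)"
proof -
  have pint: "integrable lborel (\<lambda>t. C * (indicator {0<..1} t * t powr (a - 1)))" for C
    by (intro Bochner_Integration.integrable_mult_right integrable_powr_unit(1) a)
  have D: "set_integrable lborel {0..1/2} f"
    if [measurable]: "f \<in> borel_measurable borel" and f: "\<And>t. 0 < t \<Longrightarrow> t \<le> 1/2 \<Longrightarrow> \<bar>f t\<bar> \<le> C * t powr (a - 1)" and f0: "f 0 = 0" and C: "C \<ge> 0" for f C
    unfolding set_integrable_def
  proof (rule integrable_dominated[OF pint[of C] _ AE_I2])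
    show "\<bar>indicator {0..1/2} t *\<^sub>R f t\<bar> \<le> C * (indicator {0<..1} t * t powr (a - 1))" for t
      using f[of t] f0 C by (cases "t = 0") (auto simp: indicator_def)
  qed measurable
  have up: "heat_kernel x t \<le> exp 49 / x" if "t > 0" for t
  proof -
    have "heat_kernel x t \<le> exp 49 / (sqrt t * wt (x / sqrt t) ^ 7)" by (rule heat_kernel_real_le[OF that])
    also have "\<dots> \<le> exp 49 / x"
    proof (rule divide_left_mono)
      have "wt (x / sqrt t) ^ 1 \<le> wt (x / sqrt t) ^ 7" by (intro power_increasing wt_ge_1) simp
      then have "sqrt t * wt (x / sqrt t) \<le> sqrt t * wt (x / sqrt t) ^ 7" using that by (intro mult_left_mono) auto
      then show "x \<le> sqrt t * wt (x / sqrt t) ^ 7" using abs_le_sqrt_wt[OF that, of x] by linarith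
      then show "0 < sqrt t * wt (x / sqrt t) ^ 7 * x" using x by simp
    qed simp
    finally show ?thesis .
  qed
  show "set_integrable lborel {0..1/2} (\<lambda>t. t powr (a - 1) * heat_kernel x t)"
  proof (rule D[where C="exp 49 / x"])
    fix t :: real assume t: "0 < t" "t \<le> 1/2"
    have "t powr (a - 1) * heat_kernel x t \<le> t powr (a - 1) * (exp 49 / x)" by (intro mult_left_mono up t) simp
    then show "\<bar>t powr (a - 1) * heat_kernel x t\<bar> \<le> exp 49 / x * t powr (a - 1)"
      by (simp add: abs_mult heat_kernel_nonneg mult.commute)
  qed (use x in \<open>auto simp: heat_kernel_def[of x 0]\<close>)
  show "set_integrable lborel {0..1/2} (\<lambda>t. t powr a * hk2 x t)"
  proof (rule D[where C="exp 49 / x ^ 4"])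
    fix t :: real assume t: "0 < t" "t \<le> 1/2"
    have "t powr a \<le> t powr (a - 1)" using t by (intro powr_mono') auto
    moreover have "\<bar>hk2 x t\<bar> \<le> exp 49 / x ^ 4" using t x by (intro hk_bounds_away(2)) auto
    ultimately have "t powr a * \<bar>hk2 x t\<bar> \<le> t powr (a - 1) * (exp 49 / x ^ 4)" by (intro mult_mono) auto
    then show "\<bar>t powr a * hk2 x t\<bar> \<le> exp 49 / x ^ 4 * t powr (a - 1)" by (simp add: abs_mult mult.commute)
  qed (use x in \<open>auto simp: hk2_def\<close>)
qed

text \<open>The product rule for t^a times the Gaussian, with the heat equation for the second
  factor. The fundamental theorem is used in its interior form since t^a is not differentiable at 0
  for a < 1; the boundary term at 0 vanishes.\<close>

lemma time_integral_by_parts: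
  fixes x a :: real
  assumes x: "x > 0" and a: "a > 0"
  shows "(LBINT t:{0..1/2}. t powr a * hk2 x t) = (1/2) powr a * heat_kernel x (1/2) - a * (LBINT t:{0..1/2}. t powr (a - 1) * heat_kernel x t)"
proof -
  let ?F = "\<lambda>t. t powr a * heat_kernel x t"
  have "((\<lambda>t. a * (t powr (a - 1) * heat_kernel x t) + t powr a * hk2 x t) has_integral ?F (1/2) - ?F 0) {0..1/2}"
  proof (rule fundamental_theorem_of_calculus_interior)
    show "continuous_on {0..1/2} ?F" by (rule heat_kernel_time_continuous[OF x a])
    fix t :: real assume "t \<in> {0<..<1/2}"
    then have t: "t > 0" by simp
    have "(?F has_real_derivative (a * t powr (a - 1)) * heat_kernel x t + hk2 x t * t powr a) (at t)"
      using t by (intro DERIV_mult DERIV_heat_kernel_time) (auto intro!: derivative_eq_intros)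
    then show "(?F has_vector_derivative a * (t powr (a - 1) * heat_kernel x t) + t powr a * hk2 x t) (at t)"
      by (simp add: has_real_derivative_iff_has_vector_derivative[symmetric] mult_ac)
  qed simp
  moreover have "((\<lambda>t. a * (t powr (a - 1) * heat_kernel x t) + t powr a * hk2 x t) has_integral
      a * (LBINT t:{0..1/2}. t powr (a - 1) * heat_kernel x t) + (LBINT t:{0..1/2}. t powr a * hk2 x t)) {0..1/2}"
    using integrable_time_pieces[OF x a, THEN set_borel_integral_eq_integral(1)]
      integrable_time_pieces[OF x a, THEN set_borel_integral_eq_integral(2)]
    by (intro has_integral_add has_integral_mult_right) (simp_all add: has_integral_iff)
  ultimately have "?F (1/2) - ?F 0 = a * (LBINT t:{0..1/2}. t powr (a - 1) * heat_kernel x t) + (LBINT t:{0..1/2}. t powr a * hk2 x t)"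
    by (rule has_integral_unique)
  then show ?thesis by simp
qed

text \<open>The two growth laws of the statement under one name, so that everything between the time
  integral and the final bound is done once.\<close>

definition blowup :: "real \<Rightarrow> real \<Rightarrow> real" where
  "blowup a x = (if a = 1/2 then ln (2 / x) else 1 / x powr (1 - 2 * a))"

lemma blowup_nonneg: "0 < x \<Longrightarrow> x \<le> 1 \<Longrightarrow> 0 \<le> blowup a x"
  by (auto simp: blowup_def)

text \<open>The exponent is a - 1 from the profile and -1/2 from the Gaussian prefactor. The
  subtracted constant serves both cases: at a = 1/2 its fraction is a division by zero and equals 0,
  for a < 1/2 the logarithm is slack.\<close>

lemma powr_integral_lower:
  fixes x a :: real
  assumes x: "0 < x" "x \<le> 1" and a: "0 < a" "a \<le> 1/2"
  shows "(LBINT t:{x\<^sup>2/2..1/2}. t powr (a - 3/2)) \<ge> 2 * blowup a x - (2 * ln 2 + 2 powr (1/2 - a) / (1/2 - a))"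
    and "set_integrable lborel {x\<^sup>2/2..1/2} (\<lambda>t. t powr (a - 3/2))"
proof -
  have x2: "0 < x\<^sup>2 / 2" "x\<^sup>2 / 2 \<le> 1/2" using x by (auto simp: power_le_one)
  show si: "set_integrable lborel {x\<^sup>2/2..1/2} (\<lambda>t. t powr (a - 3/2))"
    by (intro borel_integrable_atLeastAtMost' continuous_intros) (use x2 in auto)
  have e: "(LBINT t:{x\<^sup>2/2..1/2}. t powr (a - 3/2)) = H (1/2) - H (x\<^sup>2/2)"
    if H: "\<And>t. t > 0 \<Longrightarrow> (H has_real_derivative t powr (a - 3/2)) (at t)" for H
  proof -
    have "((\<lambda>t. t powr (a - 3/2)) has_integral H (1/2) - H (x\<^sup>2/2)) {x\<^sup>2/2..1/2}"
    proof (rule fundamental_theorem_of_calculus[OF x2(2)])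
      fix t assume "t \<in> {x\<^sup>2/2..1/2}"
      then have "t > 0" using x2(1) by (meson atLeastAtMost_iff less_le_trans)
      then show "(H has_vector_derivative t powr (a - 3/2)) (at t within {x\<^sup>2/2..1/2})"
        unfolding has_real_derivative_iff_has_vector_derivative[symmetric] by (intro DERIV_subset[OF H]) auto
    qed
    then show ?thesis using set_borel_integral_eq_integral(2)[OF si] by (simp add: integral_unique)
  qed
  show "(LBINT t:{x\<^sup>2/2..1/2}. t powr (a - 3/2)) \<ge> 2 * blowup a x - (2 * ln 2 + 2 powr (1/2 - a) / (1/2 - a))"
  proof (cases "a = 1/2")
    case True
    have a3: "a - 3/2 = - 1" using True by simp
    have "(LBINT t:{x\<^sup>2/2..1/2}. t powr (a - 3/2)) = ln (1/2) - ln (x\<^sup>2/2)"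
      by (rule e) (unfold a3 powr_minus_divide, auto intro!: derivative_eq_intros)
    also have "\<dots> = 2 * ln (2 / x) - 2 * ln 2" using x by (simp add: ln_div ln_realpow)
    finally have "(LBINT t:{x\<^sup>2/2..1/2}. t powr (a - 3/2)) = 2 * ln (2 / x) - 2 * ln 2" .
    then show ?thesis unfolding True by (simp add: blowup_def)
  next
    case False
    then have b: "0 < 1/2 - a" using a by simp
    have "(LBINT t:{x\<^sup>2/2..1/2}. t powr (a - 3/2)) = - ((1/2) powr (a - 1/2)) / (1/2 - a) - - ((x\<^sup>2/2) powr (a - 1/2)) / (1/2 - a)"
    proof (rule e)
      fix t :: real assume t: "t > 0"
      have "((\<lambda>t. - (t powr (a - 1/2)) / (1/2 - a)) has_real_derivative - ((a - 1/2) * t powr (a - 1/2 - 1)) / (1/2 - a)) (at t)"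
        using t by (intro DERIV_cdivide DERIV_minus) (auto intro!: derivative_eq_intros)
      moreover have "- ((a - 1/2) * Z) / (1/2 - a) = Z" for Z using b by (simp add: field_simps)
      moreover have "a - 1/2 - 1 = a - 3/2" by simp
      ultimately show "((\<lambda>t. - (t powr (a - 1/2)) / (1/2 - a)) has_real_derivative t powr (a - 3/2)) (at t)" by simp
    qed
    moreover have "(x\<^sup>2/2) powr (a - 1/2) \<ge> 1 / x powr (1 - 2 * a)"
    proof -
      have "(x\<^sup>2/2) powr (a - 1/2) = (x powr 2) powr (a - 1/2) * (1/2) powr (a - 1/2)"
        using x by (simp add: powr_mult[symmetric])
      also have "(x powr 2) powr (a - 1/2) = x powr (- (1 - 2 * a))" by (simp only: powr_powr) (simp add: algebra_simps)
      also have "\<dots> = 1 / x powr (1 - 2 * a)" by (rule powr_minus_divide)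
      also have "(1/2::real) powr (a - 1/2) = 2 powr (1/2 - a)"
        by (simp add: powr_divide powr_minus_divide[symmetric])
      finally have "(x\<^sup>2/2) powr (a - 1/2) = 1 / x powr (1 - 2 * a) * 2 powr (1/2 - a)" .
      moreover have "1 \<le> (2::real) powr (1/2 - a)" using b by (intro ge_one_powr_ge_zero) auto
      ultimately show ?thesis using x mult_left_mono[of 1 "2 powr (1/2 - a)" "1 / x powr (1 - 2 * a)"] by simp
    qed
    moreover have "(1/2::real) powr (a - 1/2) = 2 powr (1/2 - a)"
      by (simp add: powr_divide powr_minus_divide[symmetric])
    moreover have "1 / x powr (1 - 2 * a) / (1/2 - a) \<le> (x\<^sup>2/2) powr (a - 1/2) / (1/2 - a)"
      using calculation(2) b by (intro divide_right_mono) auto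
    ultimately have "(LBINT t:{x\<^sup>2/2..1/2}. t powr (a - 3/2)) \<ge> blowup a x / (1/2 - a) - 2 powr (1/2 - a) / (1/2 - a)"
      using False by (simp add: blowup_def)
    moreover have "2 * blowup a x \<le> blowup a x / (1/2 - a)"
    proof -
      \<comment> \<open>The antiderivative brings 1 / (1/2 - a), which is at least 2; this matches
        the factor 2 of the logarithmic case.\<close>
      have "2 * (1/2 - a) \<le> 1" using a by simp
      from mult_left_mono[OF this blowup_nonneg[OF x, of a]]
      have "2 * blowup a x * (1/2 - a) \<le> blowup a x" by (simp only: mult_1_right mult_ac)
      then show ?thesis using b by (simp only: pos_le_divide_eq)
    qed
    moreover have "0 \<le> 2 * ln (2::real)" by simp
    ultimately show ?thesis by linarith
  qed
qed

text \<open>The time axis is split at 1/2: below it the profile is exactly t^a and integration by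
  parts applies, above it \<open>hk2\<close> is bounded uniformly in x. In the main part the
  Gaussian is bounded below on t \<ge> x^2/2, where its exponential no longer decays.\<close>

lemma singular_time_integral:
  fixes \<phi> :: "real \<Rightarrow> real"
  assumes a: "0 < a" "a \<le> 1/2" and c: "0 \<le> c"
    and \<phi>m [measurable]: "\<phi> \<in> borel_measurable borel"
    and \<phi>b: "\<And>t. 0 < t \<Longrightarrow> t \<le> 1 \<Longrightarrow> \<bar>\<phi> t\<bar> \<le> c * t powr a"
    and \<phi>0: "\<And>t. \<not> (0 < t \<and> t \<le> 1) \<Longrightarrow> \<phi> t = 0"
    and \<phi>eq: "\<And>t. 0 \<le> t \<Longrightarrow> t \<le> 1/2 \<Longrightarrow> \<phi> t = t powr a"
  shows "\<exists>C1>0. \<exists>C2>0. \<forall>x. 0 < x \<and> x \<le> 1 \<longrightarrow> \<bar>LBINT t. \<phi> t * hk2 x t\<bar> \<ge> C1 * blowup a x - C2"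
proof -
  \<comment> \<open>Product of the factor a from the integration by parts and a lower bound for the
    Gaussian times sqrt t on t \<ge> x^2/2.\<close>
  define g where "g = a * (exp (- 1/2) / sqrt (4 * pi))"
  have g: "g > 0" using a by (simp add: g_def)
  define K where "K = 2 * ln 2 + 2 powr (1/2 - a) / (1/2 - a)"
  have K: "0 \<le> K" unfolding K_def using a by (cases "a = 1/2") auto
  define C2 where "C2 = 1 + exp 49 * 4 + g * K + c * exp 49 * 4"
  have C2: "C2 > 0" using g K c by (simp add: C2_def add_pos_nonneg)
  have "\<bar>LBINT t. \<phi> t * hk2 x t\<bar> \<ge> (2 * g) * blowup a x - C2" if x: "0 < x" "x \<le> 1" for x
  proof -
    have big: "1 / (t * sqrt t) \<le> 4" if "1/2 \<le> t" for t
    proof -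
      have "1/2 \<le> sqrt t" using that by (intro real_le_rsqrt) (simp add: power2_eq_square)
      then have "1/2 * (1/2) \<le> t * sqrt t" using that by (intro mult_mono) auto
      then show ?thesis using divide_left_mono[of "1/4" "t * sqrt t" 1] that by simp
    qed
    have hk2b: "\<bar>hk2 x t\<bar> \<le> exp 49 * 4" if "1/2 \<le> t" for t
      using hk_bounds_simple(3)[of t x] mult_left_mono[OF big[OF that], of "exp 49"] that by simp
    let ?I = "LBINT t:{0..1/2}. t powr a * hk2 x t" and ?J = "LBINT t. indicator {1/2<..1} t * (\<phi> t * hk2 x t)"
    let ?L = "LBINT t:{0..1/2}. t powr (a - 1) * heat_kernel x t"
    have Jb: "\<bar>indicator {1/2<..1} t * (\<phi> t * hk2 x t)\<bar> \<le> c * exp 49 * 4 * indicator {1/2<..1} t" for t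
    proof (cases "1/2 < t \<and> t \<le> 1")
      case True
      have "t powr a \<le> 1" using True a by (intro powr_le1) auto
      then have "c * t powr a \<le> c * 1" using c by (intro mult_left_mono) auto
      then have "\<bar>\<phi> t\<bar> \<le> c" using \<phi>b[of t] True by auto
      then have "\<bar>\<phi> t * hk2 x t\<bar> \<le> c * (exp 49 * 4)" unfolding abs_mult using hk2b[of t] True c by (intro mult_mono) auto
      then show ?thesis using True by simp
    qed (auto simp: indicator_def)
    have Ji: "integrable lborel (\<lambda>t. c * exp 49 * 4 * indicator {1/2<..1::real} t)"
    proof (intro Bochner_Integration.integrable_mult_right integrable_real_indicator)
      have "emeasure lborel {1/2<..1::real} = ennreal (1 - 1/2)" by (rule emeasure_lborel_Ioc) simp
      then show "emeasure lborel {1/2<..1::real} < \<infinity>" by (simp only: infinity_ennreal_def ennreal_less_top)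
    qed simp
    have Ji': "integrable lborel (\<lambda>t. indicator {1/2<..1} t * (\<phi> t * hk2 x t))"
      by (rule integrable_dominated[OF Ji _ AE_I2[OF Jb]]) measurable
    have "\<bar>?J\<bar> \<le> (LBINT t. \<bar>indicator {1/2<..1} t * (\<phi> t * hk2 x t)\<bar>)"
      using integral_norm_bound[of lborel "\<lambda>t. indicator {1/2<..1} t * (\<phi> t * hk2 x t)"] by simp
    also have "\<dots> \<le> (LBINT t. c * exp 49 * 4 * indicator {1/2<..1::real} t)"
      by (intro integral_mono integrable_abs Ji' Ji Jb)
    also have "\<dots> \<le> c * exp 49 * 4" using c by simp
    finally have J: "\<bar>?J\<bar> \<le> c * exp 49 * 4" .
    have "(LBINT t. \<phi> t * hk2 x t) = (LBINT t. indicator {0..1/2} t *\<^sub>R (t powr a * hk2 x t) + indicator {1/2<..1} t * (\<phi> t * hk2 x t))"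
      using \<phi>eq \<phi>0 by (intro Bochner_Integration.integral_cong refl) (auto simp: indicator_def)
    also have "\<dots> = ?I + ?J"
      using integrable_time_pieces(1)[OF x(1) a(1)] Ji' by (simp add: set_integrable_def set_lebesgue_integral_def)
    finally have split: "(LBINT t. \<phi> t * hk2 x t) = ?I + ?J" .
    have I: "?I = (1/2) powr a * heat_kernel x (1/2) - a * ?L" by (rule time_integral_by_parts[OF x(1) a(1)])
    have b: "(1/2) powr a * heat_kernel x (1/2) \<le> exp 49 * 4"
    proof -
      have "(1/2) powr a * heat_kernel x (1/2) \<le> 1 * heat_kernel x (1/2)"
        using a by (intro mult_right_mono heat_kernel_nonneg powr_le1) auto
      also have "\<dots> \<le> exp 49 / sqrt (1/2)" using hk_bounds_simple(1)[of "1/2" x] by simp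
      also have "\<dots> \<le> exp 49 * 4"
      proof -
        have "1/4 \<le> sqrt (1/2)" by (intro real_le_rsqrt) (simp add: power2_eq_square)
        then show ?thesis by (simp add: field_simps)
      qed
      finally show ?thesis .
    qed
    have L: "a * ?L \<ge> g * (LBINT t:{x\<^sup>2/2..1/2}. t powr (a - 3/2))"
    proof -
      have "exp (- 1/2) / sqrt (4 * pi) * (LBINT t:{x\<^sup>2/2..1/2}. t powr (a - 3/2)) = (LBINT t:{x\<^sup>2/2..1/2}. exp (- 1/2) / sqrt (4 * pi) * t powr (a - 3/2))"
        by simp
      also have "\<dots> \<le> ?L"
        unfolding set_lebesgue_integral_def
      proof (rule integral_mono)
        show "integrable lborel (\<lambda>t. indicator {x\<^sup>2/2..1/2} t *\<^sub>R (exp (- 1/2) / sqrt (4 * pi) * t powr (a - 3/2)))"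
          using set_integrable_mult_right[OF powr_integral_lower(2)[OF x a], of "exp (- 1/2) / sqrt (4 * pi)"] by (simp add: set_integrable_def)
        show "integrable lborel (\<lambda>t. indicator {0..1/2} t *\<^sub>R (t powr (a - 1) * heat_kernel x t))"
          using integrable_time_pieces(2)[OF x(1) a(1)] by (simp add: set_integrable_def)
        fix t :: real
        show "indicator {x\<^sup>2/2..1/2} t *\<^sub>R (exp (- 1/2) / sqrt (4 * pi) * t powr (a - 3/2)) \<le> indicator {0..1/2} t *\<^sub>R (t powr (a - 1) * heat_kernel x t)"
        proof (cases "x\<^sup>2/2 \<le> t \<and> t \<le> 1/2")
          case True
          have x2: "0 < x\<^sup>2 / 2" using x by simp
          then have t: "t > 0" using True by linarith
          have "x\<^sup>2 \<le> 2 * t" using True by simp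
          then have "x\<^sup>2 / (4 * t) \<le> 1/2" using t by (simp add: divide_le_eq)
          then have "exp (- 1/2) \<le> exp (- x\<^sup>2 / (4 * t))" by simp
          then have "exp (- 1/2) / (sqrt (4 * pi) * sqrt t) \<le> exp (- x\<^sup>2 / (4 * t)) / (sqrt (4 * pi) * sqrt t)"
            using t by (intro divide_right_mono) auto
          also have "\<dots> = heat_kernel x t" using heat_kernel_real[OF t, of x] by (simp add: real_sqrt_mult)
          finally have "t powr (a - 1) * (exp (- 1/2) / (sqrt (4 * pi) * sqrt t)) \<le> t powr (a - 1) * heat_kernel x t"
            by (intro mult_left_mono) auto
          moreover have "t powr (a - 3/2) = t powr (a - 1) / sqrt t"
          proof -
            have "a - 3/2 = (a - 1) - 1/2" by simp
            then have "t powr (a - 3/2) = t powr (a - 1) / t powr (1/2)" by (metis powr_diff)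
            then show ?thesis using t by (simp add: powr_half_sqrt)
          qed
          ultimately show ?thesis using True t by (simp add: mult_ac)
        qed (auto simp: indicator_def heat_kernel_nonneg)
      qed
      finally have "exp (- 1/2) / sqrt (4 * pi) * (LBINT t:{x\<^sup>2/2..1/2}. t powr (a - 3/2)) \<le> ?L" .
      from mult_left_mono[OF this, of a] show ?thesis using a unfolding g_def by (simp only: mult.assoc less_imp_le)
    qed
    have "g * (LBINT t:{x\<^sup>2/2..1/2}. t powr (a - 3/2)) \<ge> g * (2 * blowup a x - K)"
      using powr_integral_lower(1)[OF x a] g unfolding K_def by (intro mult_left_mono) auto
    then have "a * ?L \<ge> 2 * g * blowup a x - g * K" using L by (simp add: right_diff_distrib)
    \<comment> \<open>The main part enters with a minus sign, so the absolute value is bounded below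
      through the negative of the integral.\<close>
    then have "- (?I + ?J) \<ge> 2 * g * blowup a x - g * K - exp 49 * 4 - c * exp 49 * 4" unfolding I using b J by linarith
    then show ?thesis unfolding split C2_def by linarith
  qed
  then show ?thesis using g C2 by (intro exI[of _ "2 * g"] conjI exI[of _ C2]) auto
qed

subsection \<open>The heat part of the solution\<close>

text \<open>Rescaling to time 1 and using decay of order d + 4 + N: the power d of sqrt t undoes the
  normalisation, 4 becomes t^2, and N pays for the decay in v, since |v| \<ge> 1.\<close>

lemma heat_kernel_small_time:
  "\<exists>C>0. \<forall>(v::'a::euclidean_space) t. 0 < t \<longrightarrow> t \<le> 1 \<longrightarrow> norm v \<ge> 1 \<longrightarrow> heat_kernel v t \<le> C * t\<^sup>2 / norm v ^ N"
proof -
  let ?d = "DIM('a)"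
  obtain C where C: "C > 0" "\<forall>v::'a. heat_kernel v 1 \<le> C / wt v ^ (?d + 4 + N)"
    using heat_kernel_le_wt[of 1 "?d + 4 + N"] by auto
  have "heat_kernel v t \<le> C * t\<^sup>2 / norm v ^ N" if t: "0 < t" "t \<le> 1" and v: "norm v \<ge> 1" for v :: 'a and t
  proof -
    define s where "s = sqrt t"
    have s: "0 < s" "s \<le> 1" "s\<^sup>2 = t" using t by (auto simp: s_def)
    define w where "w = (1 / s) *\<^sub>R v"
    have vw: "v = s *\<^sub>R w" using s by (simp add: w_def)
    have v0: "0 < norm v" using v by linarith
    then have nw: "0 < norm w" and nv: "norm v = s * norm w" using s(1) divide_pos_pos[OF v0 s(1)] by (simp_all add: w_def)
    have "s ^ ?d * heat_kernel v t = heat_kernel w 1"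
      using heat_kernel_scale[OF t(1), of w] unfolding s_def[symmetric] vw[symmetric] .
    also have "\<dots> \<le> C / wt w ^ (?d + 4 + N)" using C(2) by blast
    also have "\<dots> \<le> C / norm w ^ (?d + 4 + N)"
      using C(1) nw norm_le_wt[of w] by (intro divide_left_mono power_mono mult_pos_pos zero_less_power wt_pos) auto
    also have "\<dots> = C * s ^ (?d + 4 + N) / norm v ^ (?d + 4 + N)"
      unfolding nv using s nw by (simp add: power_mult_distrib)
    also have "\<dots> \<le> C * s ^ (?d + 4 + N) / norm v ^ N"
      using C(1) v v0 s by (intro divide_left_mono power_increasing mult_pos_pos zero_less_power) auto
    also have "\<dots> = s ^ ?d * (C * s ^ 4 * s ^ N / norm v ^ N)" by (simp add: power_add mult_ac)
    finally have "heat_kernel v t \<le> C * s ^ 4 * s ^ N / norm v ^ N"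
      using s by (simp only: mult_le_cancel_left_pos zero_less_power)
    also have "\<dots> \<le> C * s ^ 4 * 1 / norm v ^ N"
      using C(1) s by (intro divide_right_mono mult_left_mono power_le_one) auto
    also have "\<dots> = C * t\<^sup>2 / norm v ^ N" using s(3) by (simp add: power_mult[symmetric] flip: s(3))
    finally show ?thesis .
  qed
  with C(1) show ?thesis by blast
qed

text \<open>The datum lives in the unit ball, so for |x| \<ge> 3 all evaluation points x - y have
  norm at least |x|/2 and at least 1. This is Q(t) of the overview, with arbitrary polynomial decay
  in x.\<close>

lemma heat_convolution_far:
  fixes D :: "'a::euclidean_space \<Rightarrow> real"
  assumes D: "ball_bounded M D"
  shows "\<exists>C>0. \<forall>x t. norm x \<ge> 3 \<longrightarrow> 0 < t \<longrightarrow> t \<le> 1 \<longrightarrow> \<bar>LBINT y. heat_kernel (x - y) t * D y\<bar> \<le> C / norm x ^ N * t\<^sup>2"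
proof -
  obtain C where C: "C > 0" "\<And>(v::'a) t. 0 < t \<Longrightarrow> t \<le> 1 \<Longrightarrow> norm v \<ge> 1 \<Longrightarrow> heat_kernel v t \<le> C * t\<^sup>2 / norm v ^ N"
    using heat_kernel_small_time[of N] by blast
  let ?V = "LBINT y::'a. indicator (ball 0 1) y :: real"
  note M = ball_boundedD[OF D]
  have V: "0 \<le> ?V" by (intro integral_nonneg_AE AE_I2) simp
  have "\<bar>LBINT y. heat_kernel (x - y) t * D y\<bar> \<le> (C * 2 ^ N * M * ?V + 1) / norm x ^ N * t\<^sup>2"
    if x: "norm x \<ge> 3" and t: "0 < t" "t \<le> 1" for x t
  proof -
    let ?K = "C * t\<^sup>2 / (norm x / 2) ^ N * M"
    have i: "integrable lborel (\<lambda>y. heat_kernel (x - y) t * D y)" by (rule integrable_heat_ball_bounded[OF t(1) D])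
    have b: "\<bar>heat_kernel (x - y) t * D y\<bar> \<le> ?K * indicator (ball 0 1) y" for y
    proof (cases "norm y < 1")
      case True
      have n: "norm x / 2 \<le> norm (x - y)" "1 \<le> norm (x - y)" using norm_triangle_ineq2[of x y] x True by linarith+
      have "heat_kernel (x - y) t \<le> C * t\<^sup>2 / norm (x - y) ^ N" by (rule C(2)[OF t n(2)])
      also have "\<dots> \<le> C * t\<^sup>2 / (norm x / 2) ^ N"
        using n x t C(1) by (intro divide_left_mono power_mono mult_pos_pos zero_less_power) auto
      finally have "heat_kernel (x - y) t * \<bar>D y\<bar> \<le> C * t\<^sup>2 / (norm x / 2) ^ N * M"
        using C(1) by (intro mult_mono M(4)) auto
      then show ?thesis using True by (simp add: abs_mult heat_kernel_nonneg)
    next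
      case False
      then have "D y = 0" using M(2)[of y] by simp
      then show ?thesis using False by simp
    qed
    have "\<bar>LBINT y. heat_kernel (x - y) t * D y\<bar> \<le> (LBINT y. \<bar>heat_kernel (x - y) t * D y\<bar>)"
      using integral_norm_bound[of lborel "\<lambda>y. heat_kernel (x - y) t * D y"] by simp
    also have "\<dots> \<le> (LBINT y::'a. ?K * indicator (ball 0 1) y)"
    proof (rule integral_mono)
      show "integrable lborel (\<lambda>y. \<bar>heat_kernel (x - y) t * D y\<bar>)" by (intro integrable_abs i)
      show "integrable lborel (\<lambda>y::'a. ?K * indicator (ball 0 1) y)"
        by (intro Bochner_Integration.integrable_mult_right integrable_indicator_ball)
    qed (rule b)
    also have "\<dots> = C * 2 ^ N * M * ?V / norm x ^ N * t\<^sup>2"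
      by (subst integral_mult_right_zero) (simp add: power_divide mult_ac)
    also have "\<dots> \<le> (C * 2 ^ N * M * ?V + 1) / norm x ^ N * t\<^sup>2"
      by (intro mult_right_mono divide_right_mono) auto
    finally show ?thesis .
  qed
  moreover have "C * 2 ^ N * M * ?V + 1 > 0" using C(1) M(3) V by (intro add_nonneg_pos mult_nonneg_nonneg) auto
  ultimately show ?thesis by blast
qed

text \<open>Two derivatives of \<open>hk1\<close> give \<open>hk3\<close>, of order t^(-2), and the
  factor t^2 of S compensates exactly. The bound on the second derivative is therefore uniform down
  to x = 0, whereas the majorants for differentiation are local in x.\<close>

lemma time_convolution_heat:
  fixes \<phi> S :: "real \<Rightarrow> real"
  assumes [measurable]: "\<phi> \<in> borel_measurable borel" "S \<in> borel_measurable borel"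
    and \<phi>b: "\<And>t. 0 < t \<Longrightarrow> t \<le> 1 \<Longrightarrow> \<bar>\<phi> t\<bar> \<le> c" and \<phi>0: "\<And>t. \<not> (0 < t \<and> t \<le> 1) \<Longrightarrow> \<phi> t = 0"
    and S: "\<And>t. 0 < t \<Longrightarrow> t \<le> 1 \<Longrightarrow> \<bar>S t\<bar> \<le> K * t\<^sup>2"
  shows "\<exists>T1 T2. \<forall>x>0. integrable lborel (\<lambda>t. \<phi> t * (hk1 x t * S t)) \<and>
    ((\<lambda>x. LBINT t. \<phi> t * (hk1 x t * S t)) has_real_derivative T1 x) (at x) \<and> (T1 has_real_derivative T2 x) (at x) \<and>
    \<bar>T2 x\<bar> \<le> c * (exp 49 * K)"
proof -
  have c: "0 \<le> c" and K: "0 \<le> K" using \<phi>b[of 1] S[of 1] by auto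
  have Ii: "integrable lborel (\<lambda>t. C * indicator {0<..1::real} t)" for C :: real
  proof -
    have "emeasure lborel {0<..1::real} = ennreal (1 - 0)" by (rule emeasure_lborel_Ioc) simp
    then have "emeasure lborel {0<..1::real} < \<infinity>" by (simp only: infinity_ennreal_def ennreal_less_top)
    then show ?thesis by (intro Bochner_Integration.integrable_mult_right integrable_real_indicator) auto
  qed
  have bound: "\<bar>\<phi> t * (q * S t)\<bar> \<le> (c * (exp 49 / \<delta> ^ 4 * K)) * indicator {0<..1} t"
    if q: "0 < t \<Longrightarrow> t \<le> 1 \<Longrightarrow> \<bar>q\<bar> \<le> exp 49 / \<delta> ^ 4" for t q and \<delta> :: real
  proof (cases "0 < t \<and> t \<le> 1")
    case True
    have "t\<^sup>2 \<le> 1" using True by (simp add: power_le_one)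
    then have "K * t\<^sup>2 \<le> K" using K by (simp add: mult_left_le)
    then have "\<bar>S t\<bar> \<le> K" using S[of t] True by linarith
    then have "\<bar>\<phi> t * (q * S t)\<bar> \<le> c * (exp 49 / \<delta> ^ 4 * K)"
      unfolding abs_mult using \<phi>b[of t] q True c by (intro mult_mono) auto
    then show ?thesis using True by simp
  next
    case False
    then show ?thesis using \<phi>0[of t] by simp
  qed
  have away: "x / 2 \<le> t" if "\<bar>t - x\<bar> < x / 2" for t x :: real using that by linarith
  have i1: "integrable lborel (\<lambda>t. \<phi> t * (hk1 x t * S t))" and i2: "integrable lborel (\<lambda>t. \<phi> t * (hk2 x t * S t))" if x: "x > 0" for x
    by (rule integrable_dominated[OF Ii _ AE_I2[OF bound[where \<delta>=x]]], measurable, rule hk_bounds_away, use x in auto)+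
  have d1: "((\<lambda>x. LBINT t. \<phi> t * (hk1 x t * S t)) has_real_derivative (LBINT t. \<phi> t * (hk2 x t * S t))) (at x)" if x: "x > 0" for x
  proof (rule has_real_derivative_lebesgue_integral(2)[where d="x/2" and f'="\<lambda>x t. \<phi> t * (hk2 x t * S t)"
        and g="\<lambda>t. (c * (exp 49 / (x/2) ^ 4 * K)) * indicator {0<..1} t"])
    fix s t assume s: "\<bar>s - x\<bar> < x / 2"
    show "((\<lambda>s. \<phi> t * (hk1 s t * S t)) has_real_derivative \<phi> t * (hk2 s t * S t)) (at s)"
      by (intro DERIV_cmult DERIV_cmult_right DERIV_hk1)
    show "\<bar>\<phi> t * (hk2 s t * S t)\<bar> \<le> (c * (exp 49 / (x/2) ^ 4 * K)) * indicator {0<..1} t"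
      by (rule bound, rule hk_bounds_away(2)) (use x away[OF s] in auto)
  next
    fix s assume "\<bar>s - x\<bar> < x / 2"
    then show "integrable lborel (\<lambda>t. \<phi> t * (hk1 s t * S t))" using away[of s x] x by (intro i1) linarith
  qed (use x Ii in auto)
  have d2: "((\<lambda>x. LBINT t. \<phi> t * (hk2 x t * S t)) has_real_derivative (LBINT t. \<phi> t * (hk3 x t * S t))) (at x)" if x: "x > 0" for x
  proof (rule has_real_derivative_lebesgue_integral(2)[where d="x/2" and f'="\<lambda>x t. \<phi> t * (hk3 x t * S t)"
        and g="\<lambda>t. (c * (exp 49 / (x/2) ^ 4 * K)) * indicator {0<..1} t"])
    fix s t assume s: "\<bar>s - x\<bar> < x / 2"
    show "((\<lambda>s. \<phi> t * (hk2 s t * S t)) has_real_derivative \<phi> t * (hk3 s t * S t)) (at s)"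
      by (intro DERIV_cmult DERIV_cmult_right DERIV_hk2)
    show "\<bar>\<phi> t * (hk3 s t * S t)\<bar> \<le> (c * (exp 49 / (x/2) ^ 4 * K)) * indicator {0<..1} t"
      by (rule bound, rule hk_bounds_away(3)) (use x away[OF s] in auto)
  next
    fix s assume "\<bar>s - x\<bar> < x / 2"
    then show "integrable lborel (\<lambda>t. \<phi> t * (hk2 s t * S t))" using away[of s x] x by (intro i2) linarith
  qed (use x Ii in auto)
  have b3: "\<bar>LBINT t. \<phi> t * (hk3 x t * S t)\<bar> \<le> c * (exp 49 * K)" for x
  proof -
    have b: "\<bar>\<phi> t * (hk3 x t * S t)\<bar> \<le> c * (exp 49 * K) * indicator {0<..1} t" for t
    proof (cases "0 < t \<and> t \<le> 1")
      case True
      have "\<bar>hk3 x t * S t\<bar> \<le> exp 49 / t\<^sup>2 * (K * t\<^sup>2)"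
        unfolding abs_mult using True S[of t] hk_bounds_simple(4)[of t x] by (intro mult_mono) auto
      also have "\<dots> = exp 49 * K" using True by simp
      finally show ?thesis unfolding abs_mult[of "\<phi> t"] using \<phi>b[of t] True c by (auto intro!: mult_mono)
    next
      case False
      then show ?thesis using \<phi>0[of t] by simp
    qed
    have i: "integrable lborel (\<lambda>t. \<phi> t * (hk3 x t * S t))"
      by (rule integrable_dominated[OF Ii _ AE_I2[OF b]]) measurable
    have "\<bar>LBINT t. \<phi> t * (hk3 x t * S t)\<bar> \<le> (LBINT t. \<bar>\<phi> t * (hk3 x t * S t)\<bar>)"
      using integral_norm_bound[of lborel "\<lambda>t. \<phi> t * (hk3 x t * S t)"] by simp
    also have "\<dots> \<le> (LBINT t. c * (exp 49 * K) * indicator {0<..1::real} t)"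
      by (intro integral_mono integrable_abs i Ii b)
    also have "\<dots> = c * (exp 49 * K)" by simp
    finally show ?thesis .
  qed
  show ?thesis
    by (rule exI[of _ "\<lambda>x. LBINT t. \<phi> t * (hk2 x t * S t)"], rule exI[of _ "\<lambda>x. LBINT t. \<phi> t * (hk3 x t * S t)"])
       (use i1 d1 d2 b3 in blast)
qed

subsection \<open>The second normal derivative of the solution\<close>

text \<open>The derivatives are known only in the open half-space, hence \<open>pd\<close> is
  identified with U1 in a neighbourhood of h = 0 and the second derivative is transferred along this
  local equality.\<close>

lemma second_normal_derivative:
  fixes f :: "(real ^ 'm::finite) \<times> real \<Rightarrow> real"
  assumes U1: "\<And>s. s > 0 \<Longrightarrow> ((\<lambda>s. f (y, s)) has_real_derivative U1 s) (at s)"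
    and U2: "\<And>s. s > 0 \<Longrightarrow> (U1 has_real_derivative U2 s) (at s)" and s: "s > 0"
  shows "pd2_exists e_nrm f (y, s)" and "pd e_nrm (pd e_nrm f) (y, s) = U2 s"
proof -
  have e: "(y, t) + h *\<^sub>R e_nrm = (y, t + h)" for t h by (simp add: e_nrm_def)
  have d: "((\<lambda>\<tau>. f ((y, t) + \<tau> *\<^sub>R e_nrm)) has_real_derivative U1 (t + h)) (at h)" if "t + h > 0" for t h
    unfolding e using U1[OF that] DERIV_shift[of "\<lambda>s. f (y, s)" "U1 (t + h)" h t] by (simp add: add.commute)
  have p: "pd e_nrm f (y, t) = U1 t" if "t > 0" for t
    unfolding pd_def using DERIV_imp_deriv[OF d[of t 0]] that by simp
  have ev: "\<forall>\<^sub>F h in nhds 0. s + h > 0"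
    unfolding eventually_nhds_metric using s by (intro exI[of _ s]) (auto simp: dist_real_def)
  have U: "((\<lambda>h. U1 (s + h)) has_real_derivative U2 s) (at 0)"
    using U2[OF s] DERIV_shift[of U1 "U2 s" 0 s] by (simp add: add.commute)
  have "\<forall>\<^sub>F h in nhds 0. pd e_nrm f ((y, s) + h *\<^sub>R e_nrm) = U1 (s + h)"
    using ev by eventually_elim (simp add: e p)
  from DERIV_cong_ev[OF refl this refl] U have D: "((\<lambda>h. pd e_nrm f ((y, s) + h *\<^sub>R e_nrm)) has_real_derivative U2 s) (at 0)"
    by (rule iffD2)
  then show "pd e_nrm (pd e_nrm f) (y, s) = U2 s" unfolding pd_def[of _ "pd e_nrm f"] by (rule DERIV_imp_deriv)
  have "\<forall>\<^sub>F h in nhds 0. (\<lambda>\<tau>. f ((y, s) + \<tau> *\<^sub>R e_nrm)) differentiable (at h)"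
    using ev by eventually_elim (use d in \<open>auto simp: real_differentiable_def\<close>)
  then show "pd2_exists e_nrm f (y, s)" unfolding pd2_exists_def using D by (auto simp: real_differentiable_def)
qed

lemma boundary_profile:
  fixes gT :: "real \<Rightarrow> real"
  assumes a: "0 < a" "a \<le> 1/2" and cont: "continuous_on UNIV gT" and supp: "supp gT \<subseteq> {1/4..1}"
    and eq: "\<And>s. s \<in> {1/2..1} \<Longrightarrow> gT s = (1 - s) powr a"
  shows "\<exists>c\<ge>0. \<forall>t. 0 < t \<longrightarrow> t \<le> 1 \<longrightarrow> \<bar>gT (1 - t)\<bar> \<le> c * t powr a"
    and "\<not> (0 < t \<and> t \<le> 1) \<Longrightarrow> gT (1 - t) = 0"
    and "0 \<le> t \<Longrightarrow> t \<le> 1/2 \<Longrightarrow> gT (1 - t) = t powr a"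
proof -
  show half: "gT (1 - t) = t powr a" if "0 \<le> t" "t \<le> 1/2" for t using eq[of "1 - t"] that by simp
  \<comment> \<open>The point t = 0 is treated apart: s = 1 belongs to the interval containing the
    support, and the value there comes from 0 \<open>powr\<close> a = 0.\<close>
  show "gT (1 - t) = 0" if t: "\<not> (0 < t \<and> t \<le> 1)"
  proof (cases "t = 0")
    case False
    then have "1 - t \<notin> supp gT" using t supp by auto
    then show ?thesis using closure_subset[of "{x. gT x \<noteq> 0}"] unfolding supp_def by auto
  qed (use half[of 0] in simp)
  have "bounded (gT ` {0..1})"
    by (intro compact_imp_bounded compact_continuous_image continuous_on_subset[OF cont]) auto
  then obtain K where "\<forall>y\<in>gT ` {0..1}. norm y \<le> K" unfolding bounded_iff by blast
  then have K: "\<bar>gT s\<bar> \<le> K" if "s \<in> {0..1}" for s using that by simp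
  have K0: "0 \<le> K" using K[of 0] by simp
  have "\<bar>gT (1 - t)\<bar> \<le> (1 + 2 * K) * t powr a" if t: "0 < t" "t \<le> 1" for t
  proof (cases "t \<le> 1/2")
    case True
    have "1 * t powr a \<le> (1 + 2 * K) * t powr a" using K0 by (intro mult_right_mono) auto
    then show ?thesis using half[of t] t True by simp
  next
    case False
    \<comment> \<open>Beyond t = 1/2 the profile is merely bounded by K; since t^a \<ge> 1/2 there,
      2 K t^a is a sufficient majorant.\<close>
    have "t powr 1 \<le> t powr a" using a t by (intro powr_mono') auto
    then have "1/2 \<le> t powr a" using False t by simp
    then have "(1 + 2 * K) * (1/2) \<le> (1 + 2 * K) * t powr a" using K0 by (intro mult_left_mono) auto
    moreover have "\<bar>gT (1 - t)\<bar> \<le> K" using K[of "1 - t"] t by simp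
    ultimately show ?thesis by (simp add: field_simps)
  qed
  then show "\<exists>c\<ge>0. \<forall>t. 0 < t \<longrightarrow> t \<le> 1 \<longrightarrow> \<bar>gT (1 - t)\<bar> \<le> c * t powr a"
    using K0 by (intro exI[of _ "1 + 2 * K"]) auto
qed

section \<open>Second normal derivative of the solution and its lower bound\<close>

text \<open>The solution splits into the heat part, present for i = k only, and the potential part
  with factor -4. The singular contribution is carried to the left side, whence the plus sign; what
  remains inherits the decay |x|^(1-m) of the heat flow, with 1 - m = 2 - n.\<close>

lemma golovkin_second_normal_derivative:
  fixes G gT :: "real \<Rightarrow> real" and i k :: "'m::finite" and g :: "real ^ 'm \<Rightarrow> real \<Rightarrow> (real ^ 'm) \<times> real"
  assumes m: "CARD('m) \<ge> 2" and smooth: "\<And>m. (deriv ^^ m) G differentiable_on UNIV"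
    and r: "r = 4 / (5 * sqrt (real CARD('m)))" and supp: "supp G \<subseteq> {- r<..<r}"
    and a: "0 < a" "a \<le> 1" and c: "0 \<le> c" and gTm: "gT \<in> borel_measurable borel"
    and gTb: "\<And>t. 0 < t \<Longrightarrow> t \<le> 1 \<Longrightarrow> \<bar>gT (1 - t)\<bar> \<le> c * t powr a"
    and gT0: "\<And>t. \<not> (0 < t \<and> t \<le> 1) \<Longrightarrow> gT (1 - t) = 0"
    and g_k: "\<And>y s. g y s \<bullet> e_tan k = pprod G (\<lambda>_. 0) y * gT s"
    and g_j: "\<And>y s j. j \<in> Basis \<Longrightarrow> j \<noteq> e_tan k \<Longrightarrow> g y s \<bullet> j = 0"
  shows "\<exists>C>0. \<forall>x s. norm x \<ge> 3 \<longrightarrow> s > 0 \<longrightarrow>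
    pd2_exists e_nrm (\<lambda>x. golovkin_solution g (e_tan i) x 1) (x, s) \<and>
    \<bar>pd e_nrm (pd e_nrm (\<lambda>x. golovkin_solution g (e_tan i) x 1)) (x, s)
      + 4 * ((LBINT v::real ^ 'm. heat_kernel v 1) * potential (pprod G (incr i (incr k (\<lambda>_. 0)))) x 0) * (LBINT t. gT (1 - t) * hk2 s t)\<bar>
    \<le> C / norm x ^ (CARD('m) - 1)"
proof -
  let ?m = "CARD('m)" and ?f = "\<lambda>x. golovkin_solution g (e_tan i) x 1" and ?\<phi> = "\<lambda>t. gT (1 - t)"
  let ?S = "pprod G (\<lambda>_. 0) :: real ^ 'm \<Rightarrow> real" and ?D1 = "pprod G (incr k (\<lambda>_. 0)) :: real ^ 'm \<Rightarrow> real"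
    and ?D = "pprod G (incr i (incr k (\<lambda>_. 0))) :: real ^ 'm \<Rightarrow> real"
  let ?\<kappa> = "LBINT v::real ^ 'm. heat_kernel v 1"
  let ?\<delta> = "if i = k then 1 else 0 :: real"
  note [measurable] = gTm
  have m': "DIM(real ^ 'm) \<ge> 2" using m by simp
  obtain M M1 M2 where M: "ball_bounded M ?S" "ball_bounded M1 ?D1" "ball_bounded M2 ?D"
    using ball_bounded_pprod[OF smooth supp r] by meson
  note [measurable] = ball_boundedD(1)[OF M(1)] ball_boundedD(1)[OF M(3)]
  obtain B where B: "B > 0" "\<forall>x :: real ^ 'm. \<exists>h2 :: real \<Rightarrow> real \<Rightarrow> real. \<forall>t. 0 < t \<longrightarrow> t \<le> 1 \<longrightarrow>
      continuous_on {0..} (\<lambda>z. heat_flow ?D x z t) \<and> continuous_on {0..} (\<lambda>z. h2 z t) \<and>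
      (\<exists>h1. \<forall>z>0. ((\<lambda>z. heat_flow ?D x z t) has_real_derivative h1 z) (at z) \<and> (h1 has_real_derivative h2 z t) (at z)) \<and>
      (\<forall>z\<ge>0. \<bar>heat_flow ?D x z t\<bar> \<le> B / wt x ^ (?m - 1) \<and> \<bar>h2 z t\<bar> \<le> B / wt x ^ (?m - 1)) \<and>
      \<bar>heat_flow ?D x 0 t - ?\<kappa> * potential ?D x 0\<bar> \<le> B / wt x ^ (?m - 1) * sqrt t"
    using heat_flow_pprod[OF m smooth r supp, where e="incr i (incr k (\<lambda>_. 0))"] by (elim exE conjE)
  obtain C where C: "C > 0" "\<forall>x t. norm x \<ge> 3 \<longrightarrow> 0 < t \<longrightarrow> t \<le> 1 \<longrightarrow> \<bar>LBINT y. heat_kernel (x - y) t * ?S y\<bar> \<le> C / norm x ^ (?m - 1) * t\<^sup>2"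
    using heat_convolution_far[OF M(1)] by blast
  have gTc: "\<bar>?\<phi> t\<bar> \<le> c" if "0 < t" "t \<le> 1" for t
  proof -
    have "t powr a \<le> 1" using that a by (intro powr_le1) auto
    then have "c * t powr a \<le> c * 1" using c by (intro mult_left_mono) auto
    then show ?thesis using gTb[OF that] by simp
  qed
  \<comment> \<open>Four times the remainder of the potential part, twice that of the heat part, and
    1 to keep the constant positive when c = 0.\<close>
  define K where "K = 4 * (5 * exp 49 * c * B / a) + 2 * (c * (exp 49 * C)) + 1"
  have K: "K > 0" using c B(1) C(1) a by (simp add: K_def add_nonneg_pos)
  have main: "\<exists>U2. \<forall>s>0. pd2_exists e_nrm ?f (x, s) \<and> pd e_nrm (pd e_nrm ?f) (x, s) = U2 s \<and>
      \<bar>U2 s + 4 * (?\<kappa> * potential ?D x 0) * (LBINT t. ?\<phi> t * hk2 s t)\<bar> \<le> K / norm x ^ (?m - 1)"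
    if x: "norm x \<ge> 3" for x :: "real ^ 'm"
  proof -
    let ?v = "\<lambda>s t. LBINT z. indicator {0<..<s} z * (hk1 z t * heat_flow ?D x (s - z) t)"
    let ?Q = "\<lambda>t. LBINT y. heat_kernel (x - y) t * ?S y"
    let ?N = "norm x ^ (?m - 1)"
    have "norm x > 0" using x by linarith
    then have N: "?N > 0" by (rule zero_less_power)
    have Bw: "B / wt x ^ (?m - 1) \<le> B / ?N"
    proof (rule divide_left_mono)
      show "?N \<le> wt x ^ (?m - 1)" by (intro power_mono norm_le_wt) simp
      show "0 < wt x ^ (?m - 1) * ?N" by (intro mult_pos_pos N zero_less_power wt_pos)
    qed (use B in simp)
    obtain h2 where h2: "\<And>t. 0 < t \<Longrightarrow> t \<le> 1 \<Longrightarrow>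
      continuous_on {0..} (\<lambda>z. heat_flow ?D x z t) \<and> continuous_on {0..} (\<lambda>z. h2 z t) \<and>
      (\<exists>h1. \<forall>z>0. ((\<lambda>z. heat_flow ?D x z t) has_real_derivative h1 z) (at z) \<and> (h1 has_real_derivative h2 z t) (at z)) \<and>
      (\<forall>z\<ge>0. \<bar>heat_flow ?D x z t\<bar> \<le> B / wt x ^ (?m - 1) \<and> \<bar>h2 z t\<bar> \<le> B / wt x ^ (?m - 1)) \<and>
      \<bar>heat_flow ?D x 0 t - ?\<kappa> * potential ?D x 0\<bar> \<le> B / wt x ^ (?m - 1) * sqrt t"
      using B(2)[rule_format, of x] by blast
    have "\<exists>V1 V2. \<forall>s>0. ((\<lambda>s. LBINT t. ?\<phi> t * ?v s t) has_real_derivative V1 s) (at s) \<and>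
      (V1 has_real_derivative V2 s) (at s) \<and> integrable lborel (\<lambda>t. ?\<phi> t * ?v s t) \<and> integrable lborel (\<lambda>t. ?\<phi> t * hk2 s t) \<and>
      \<bar>V2 s - (?\<kappa> * potential ?D x 0) * (LBINT t. ?\<phi> t * hk2 s t)\<bar> \<le> 5 * exp 49 * c * (B / wt x ^ (?m - 1)) / a"
    proof (rule time_convolution_second_derivative[where h="\<lambda>z t. heat_flow ?D x z t" and ?h2.0=h2])
      show "?\<phi> \<in> borel_measurable borel" by measurable
      note [measurable] = borel_measurable_heat_flow[OF m']
      show "?v s \<in> borel_measurable borel" for s by measurable
      fix t :: real assume t: "0 < t" "t \<le> 1"
      note H = h2[OF t, THEN conjunct1] h2[OF t, THEN conjunct2, THEN conjunct1] h2[OF t, THEN conjunct2, THEN conjunct2, THEN conjunct1]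
        h2[OF t, THEN conjunct2, THEN conjunct2, THEN conjunct2, THEN conjunct1] h2[OF t, THEN conjunct2, THEN conjunct2, THEN conjunct2, THEN conjunct2]
      show "continuous_on {0..} (\<lambda>z. heat_flow ?D x z t)" "continuous_on {0..} (\<lambda>z. h2 z t)"
        "\<exists>h1. \<forall>z>0. ((\<lambda>z. heat_flow ?D x z t) has_real_derivative h1 z) (at z) \<and> (h1 has_real_derivative h2 z t) (at z)"
        "\<bar>heat_flow ?D x 0 t - ?\<kappa> * potential ?D x 0\<bar> \<le> B / wt x ^ (?m - 1) * sqrt t"
        by (fact H)+
      show "\<bar>heat_flow ?D x z t\<bar> \<le> B / wt x ^ (?m - 1)" "\<bar>h2 z t\<bar> \<le> B / wt x ^ (?m - 1)" if "0 \<le> z" for z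
        by (rule H(4)[rule_format, OF that, THEN conjunct1], rule H(4)[rule_format, OF that, THEN conjunct2])
    qed (fact a c gTb gT0)+
    then obtain V1 V2 where V: "\<And>s. s > 0 \<Longrightarrow> ((\<lambda>s. LBINT t. ?\<phi> t * ?v s t) has_real_derivative V1 s) (at s)"
      "\<And>s. s > 0 \<Longrightarrow> (V1 has_real_derivative V2 s) (at s)" "\<And>s. s > 0 \<Longrightarrow> integrable lborel (\<lambda>t. ?\<phi> t * ?v s t)"
      "\<And>s. s > 0 \<Longrightarrow> \<bar>V2 s - (?\<kappa> * potential ?D x 0) * (LBINT t. ?\<phi> t * hk2 s t)\<bar> \<le> 5 * exp 49 * c * (B / wt x ^ (?m - 1)) / a"
      by blast
    have "\<exists>T1 T2. \<forall>s>0. integrable lborel (\<lambda>t. ?\<phi> t * (hk1 s t * ?Q t)) \<and>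
      ((\<lambda>s. LBINT t. ?\<phi> t * (hk1 s t * ?Q t)) has_real_derivative T1 s) (at s) \<and> (T1 has_real_derivative T2 s) (at s) \<and>
      \<bar>T2 s\<bar> \<le> c * (exp 49 * (C / ?N))"
    proof (rule time_convolution_heat)
      show "?\<phi> \<in> borel_measurable borel" "?Q \<in> borel_measurable borel" by measurable
      show "\<bar>?Q t\<bar> \<le> C / ?N * t\<^sup>2" if "0 < t" "t \<le> 1" for t using C(2) x that by blast
    qed (fact gTc gT0)+
    then obtain T1 T2 where T: "\<And>s. s > 0 \<Longrightarrow> integrable lborel (\<lambda>t. ?\<phi> t * (hk1 s t * ?Q t))"
      "\<And>s. s > 0 \<Longrightarrow> ((\<lambda>s. LBINT t. ?\<phi> t * (hk1 s t * ?Q t)) has_real_derivative T1 s) (at s)"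
      "\<And>s. s > 0 \<Longrightarrow> (T1 has_real_derivative T2 s) (at s)" "\<And>s. s > 0 \<Longrightarrow> \<bar>T2 s\<bar> \<le> c * (exp 49 * (C / ?N))"
      by blast
    have f: "?f (x, s) = - 2 * ?\<delta> * (LBINT t. ?\<phi> t * (hk1 s t * ?Q t)) - 4 * (LBINT t. ?\<phi> t * ?v s t)" if s: "s > 0" for s
    proof -
      have "?f (x, s) = (LBINT t. ?\<phi> t * (- 2 * ?\<delta> * (hk1 s t * ?Q t) - 4 * ?v s t))"
        by (rule golovkin_solution_eq[where D="?S" and ?D1.0="?D1" and ?D2.0="?D" and M=M and ?M1.0=M1 and ?M2.0=M2 and k=k])
           (intro m s M continuous_on_pprod[OF smooth] DERIV_pprod[OF smooth] g_k g_j gT0; assumption)+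
      also have "\<dots> = (LBINT t. - 2 * ?\<delta> * (?\<phi> t * (hk1 s t * ?Q t)) - 4 * (?\<phi> t * ?v s t))"
        by (intro Bochner_Integration.integral_cong refl) (simp only: right_diff_distrib mult.left_commute)
      also have "\<dots> = (LBINT t. - 2 * ?\<delta> * (?\<phi> t * (hk1 s t * ?Q t))) - (LBINT t. 4 * (?\<phi> t * ?v s t))"
        by (intro Bochner_Integration.integral_diff Bochner_Integration.integrable_mult_right T(1) V(3) s)
      also have "\<dots> = - 2 * ?\<delta> * (LBINT t. ?\<phi> t * (hk1 s t * ?Q t)) - 4 * (LBINT t. ?\<phi> t * ?v s t)"
        by (simp only: integral_mult_right_zero)
      finally show ?thesis .
    qed
    define U1 where "U1 s = - 2 * ?\<delta> * T1 s - 4 * V1 s" for s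
    define U2 where "U2 s = - 2 * ?\<delta> * T2 s - 4 * V2 s" for s
    have d1: "((\<lambda>s. ?f (x, s)) has_real_derivative U1 s) (at s)" if s: "s > 0" for s
    proof -
      have "((\<lambda>s. - 2 * ?\<delta> * (LBINT t. ?\<phi> t * (hk1 s t * ?Q t)) - 4 * (LBINT t. ?\<phi> t * ?v s t)) has_real_derivative U1 s) (at s)"
        unfolding U1_def by (intro DERIV_diff DERIV_cmult T(2) V(1) s)
      then show ?thesis
        by (rule has_field_derivative_transform_within_open[where S="{0<..}"]) (use s f in auto)
    qed
    have d2: "(U1 has_real_derivative U2 s) (at s)" if s: "s > 0" for s
      unfolding U1_def[abs_def] U2_def by (intro DERIV_diff DERIV_cmult T(3) V(2) s)
    have "\<bar>U2 s + 4 * (?\<kappa> * potential ?D x 0) * (LBINT t. ?\<phi> t * hk2 s t)\<bar> \<le> K / ?N" if s: "s > 0" for s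
    proof -
      have "5 * exp 49 * c * (B / wt x ^ (?m - 1)) / a \<le> 5 * exp 49 * c * (B / ?N) / a"
        using Bw c a by (intro divide_right_mono mult_left_mono) auto
      then have 1: "\<bar>V2 s - (?\<kappa> * potential ?D x 0) * (LBINT t. ?\<phi> t * hk2 s t)\<bar> \<le> 5 * exp 49 * c * B / a / ?N"
        using V(4)[OF s] by (simp add: mult_ac)
      have 2: "\<bar>?\<delta> * T2 s\<bar> \<le> c * (exp 49 * C) / ?N" using T(4)[OF s] order_trans[OF abs_ge_zero T(4)[OF s]] by auto
      have 3: "K / ?N = 4 * (5 * exp 49 * c * B / a / ?N) + 2 * (c * (exp 49 * C) / ?N) + 1 / ?N"
        by (simp only: K_def add_divide_distrib times_divide_eq_right)
      have 4: "0 \<le> 1 / ?N" using N by simp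
      have "\<bar>- 2 * T - 4 * V + 4 * P * I\<bar> \<le> 4 * p + 2 * q + o'"
        if "\<bar>V - P * I\<bar> \<le> p" "\<bar>T\<bar> \<le> q" "0 \<le> o'" for T V P I p q o' :: real
        using that by (simp only: mult.assoc)
      from this[OF 1 2 4] show ?thesis unfolding U2_def 3 by (simp only: mult.assoc)
    qed
    then show ?thesis using second_normal_derivative[OF d1 d2] by (intro exI[of _ U2]) auto
  qed
  show ?thesis
  proof (intro exI[of _ K] conjI K allI impI)
    fix x :: "real ^ 'm" and s :: real assume x: "norm x \<ge> 3" and s: "s > 0"
    from main[OF x] obtain U2 where U2: "\<And>s. s > 0 \<Longrightarrow> pd2_exists e_nrm ?f (x, s) \<and> pd e_nrm (pd e_nrm ?f) (x, s) = U2 s \<and>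
      \<bar>U2 s + 4 * (?\<kappa> * potential ?D x 0) * (LBINT t. ?\<phi> t * hk2 s t)\<bar> \<le> K / norm x ^ (?m - 1)" by blast
    show "pd2_exists e_nrm ?f (x, s)"
      "\<bar>pd e_nrm (pd e_nrm ?f) (x, s) + 4 * (?\<kappa> * potential ?D x 0) * (LBINT t. ?\<phi> t * hk2 s t)\<bar> \<le> K / norm x ^ (?m - 1)"
      using U2[OF s] by simp_all
  qed
qed

text \<open>L stands for any nonnegative lower bound of |F(x',0)|, the only place where the two
  assertions of the theorem differ. The bounded error in the time integral is multiplied by |F|,
  whose upper bound decays like |x|^(1-m), so it joins the remainder.\<close>

lemma golovkin_blowup:
  fixes G gT :: "real \<Rightarrow> real" and i k :: "'m::finite" and g :: "real ^ 'm \<Rightarrow> real \<Rightarrow> (real ^ 'm) \<times> real"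
  assumes m: "CARD('m) \<ge> 2" and smooth: "\<And>m. (deriv ^^ m) G differentiable_on UNIV"
    and r: "r = 4 / (5 * sqrt (real CARD('m)))" and supp: "supp G \<subseteq> {- r<..<r}"
    and a: "0 < a" "a \<le> 1/2" and gT: "continuous_on UNIV gT" "supp gT \<subseteq> {1/4..1}" "\<And>s. s \<in> {1/2..1} \<Longrightarrow> gT s = (1 - s) powr a"
    and g_k: "\<And>y s. g y s \<bullet> e_tan k = pprod G (\<lambda>_. 0) y * gT s"
    and g_j: "\<And>y s j. j \<in> Basis \<Longrightarrow> j \<noteq> e_tan k \<Longrightarrow> g y s \<bullet> j = 0"
  shows "\<exists>C1>0. \<exists>C2>0. \<forall>x s L. norm x \<ge> 3 \<longrightarrow> s > 0 \<longrightarrow>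
    pd2_exists e_nrm (\<lambda>x. golovkin_solution g (e_tan i) x 1) (x, s) \<and>
    (s \<le> 1 \<longrightarrow> 0 \<le> L \<longrightarrow> L \<le> \<bar>potential (pprod G (incr i (incr k (\<lambda>_. 0)))) x 0\<bar> \<longrightarrow>
      C1 * (L * blowup a s) - C2 / norm x ^ (CARD('m) - 1) \<le> \<bar>pd e_nrm (pd e_nrm (\<lambda>x. golovkin_solution g (e_tan i) x 1)) (x, s)\<bar>)"
proof -
  let ?m = "CARD('m)" and ?f = "\<lambda>x. golovkin_solution g (e_tan i) x 1" and ?\<phi> = "\<lambda>t. gT (1 - t)"
  let ?D = "pprod G (incr i (incr k (\<lambda>_. 0))) :: real ^ 'm \<Rightarrow> real"
  let ?I = "\<lambda>s. LBINT t. ?\<phi> t * hk2 s t"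
  define \<kappa> where "\<kappa> = (LBINT v::real ^ 'm. heat_kernel v 1)"
  have \<kappa>: "\<kappa> > 0" unfolding \<kappa>_def by (rule integral_heat_kernel_pos)
  have gTm [measurable]: "gT \<in> borel_measurable borel" by (rule borel_measurable_continuous_onI[OF gT(1)])
  have \<phi>m: "?\<phi> \<in> borel_measurable borel" by measurable
  have "\<exists>c\<ge>0. \<forall>t. 0 < t \<longrightarrow> t \<le> 1 \<longrightarrow> \<bar>?\<phi> t\<bar> \<le> c * t powr a" by (rule boundary_profile(1)[OF a gT(1,2)]) (rule gT(3))
  then obtain c where c: "0 \<le> c" "\<And>t. 0 < t \<Longrightarrow> t \<le> 1 \<Longrightarrow> \<bar>?\<phi> t\<bar> \<le> c * t powr a" by blast
  have \<phi>0: "?\<phi> t = 0" if "\<not> (0 < t \<and> t \<le> 1)" for t by (rule boundary_profile(2)[OF a gT(1,2) _ that]) (rule gT(3))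
  have \<phi>eq: "?\<phi> t = t powr a" if "0 \<le> t" "t \<le> 1/2" for t by (rule boundary_profile(3)[OF a gT(1,2) _ that]) (rule gT(3))
  have a1: "a \<le> 1" using a by simp
  have "\<exists>C>0. \<forall>x s. norm x \<ge> 3 \<longrightarrow> s > 0 \<longrightarrow> pd2_exists e_nrm ?f (x, s) \<and>
    \<bar>pd e_nrm (pd e_nrm ?f) (x, s) + 4 * (\<kappa> * potential ?D x 0) * ?I s\<bar> \<le> C / norm x ^ (?m - 1)"
    unfolding \<kappa>_def by (rule golovkin_second_normal_derivative[OF m smooth r supp a(1) a1 c(1) gTm]) (fact c(2) \<phi>0 g_k g_j)+
  then obtain C where C: "C > 0" "\<And>x s. norm x \<ge> 3 \<Longrightarrow> s > 0 \<Longrightarrow> pd2_exists e_nrm ?f (x, s) \<and>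
    \<bar>pd e_nrm (pd e_nrm ?f) (x, s) + 4 * (\<kappa> * potential ?D x 0) * ?I s\<bar> \<le> C / norm x ^ (?m - 1)" by blast
  have "\<exists>I1>0. \<exists>I2>0. \<forall>s. 0 < s \<and> s \<le> 1 \<longrightarrow> \<bar>?I s\<bar> \<ge> I1 * blowup a s - I2"
    by (rule singular_time_integral[OF a c(1) \<phi>m]) (fact c(2) \<phi>0 \<phi>eq)+
  then obtain I1 I2 where I: "I1 > 0" "I2 > 0" "\<forall>s. 0 < s \<and> s \<le> 1 \<longrightarrow> \<bar>?I s\<bar> \<ge> I1 * blowup a s - I2"
    by (elim exE conjE)
  have m': "DIM(real ^ 'm) \<ge> 2" and dm: "DIM(real ^ 'm) - 1 = ?m - 1" using m by auto
  obtain M where M: "ball_bounded M ?D" using ball_bounded_pprod[OF smooth supp r] by blast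
  obtain P where P: "P > 0" "\<forall>M D (w::real ^ 'm) z. ball_bounded M D \<longrightarrow> \<bar>potential D w z\<bar> \<le> P * M / wt w ^ (?m - 1)"
    using potential_bound[OF m'] unfolding dm by (elim exE conjE)
  have M0: "0 \<le> M" by (rule ball_boundedD(3)[OF M])
  define C2 where "C2 = 4 * \<kappa> * (P * M) * I2 + C"
  have C2: "C2 > 0" using \<kappa> P(1) M0 I(2) C(1) by (simp add: C2_def add_nonneg_pos)
  have "4 * \<kappa> * I1 * (L * blowup a s) - C2 / norm x ^ (?m - 1) \<le> \<bar>pd e_nrm (pd e_nrm ?f) (x, s)\<bar>"
    if x: "norm x \<ge> 3" and s: "0 < s" "s \<le> 1" and L: "L \<le> \<bar>potential ?D x 0\<bar>" for x :: "real ^ 'm" and s L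
  proof -
    let ?N = "norm x ^ (?m - 1)" and ?P = "\<bar>potential ?D x 0\<bar>"
    have "norm x > 0" using x by linarith
    then have N: "?N > 0" by (rule zero_less_power)
    have "?P \<le> P * M / wt x ^ (?m - 1)" using P(2) M by blast
    also have "\<dots> \<le> P * M / ?N"
    proof (rule divide_left_mono)
      show "?N \<le> wt x ^ (?m - 1)" by (intro power_mono norm_le_wt) simp
      show "0 < wt x ^ (?m - 1) * ?N" by (intro mult_pos_pos N zero_less_power wt_pos)
    qed (use P(1) M0 in simp)
    finally have Pb: "?P * I2 \<le> P * M / ?N * I2" using I(2) by (intro mult_right_mono) auto
    have "L * (I1 * blowup a s) \<le> ?P * (I1 * blowup a s)"
      using I(1) blowup_nonneg[OF s, of a] by (intro mult_right_mono L) auto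
    moreover have "?P * (I1 * blowup a s - I2) \<le> ?P * \<bar>?I s\<bar>" using I(3) s by (intro mult_left_mono) auto
    ultimately have "L * (I1 * blowup a s) - P * M / ?N * I2 \<le> \<bar>potential ?D x 0 * ?I s\<bar>"
      using Pb by (simp only: abs_mult right_diff_distrib)
    then have "4 * \<kappa> * (L * (I1 * blowup a s) - P * M / ?N * I2) \<le> 4 * \<kappa> * \<bar>potential ?D x 0 * ?I s\<bar>"
      using \<kappa> by (intro mult_left_mono) auto
    also have "\<dots> = \<bar>4 * (\<kappa> * potential ?D x 0) * ?I s\<bar>" using \<kappa> by (simp add: abs_mult)
    also have "\<dots> \<le> \<bar>pd e_nrm (pd e_nrm ?f) (x, s)\<bar> + C / ?N" using C(2)[OF x s(1)] by linarith
    finally have "4 * \<kappa> * (L * (I1 * blowup a s) - P * M / ?N * I2) \<le> \<bar>pd e_nrm (pd e_nrm ?f) (x, s)\<bar> + C / ?N" .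
    moreover have "C2 / ?N = 4 * \<kappa> * (P * M / ?N * I2) + C / ?N"
      by (simp only: C2_def add_divide_distrib times_divide_eq_left times_divide_eq_right mult.assoc)
    moreover have "4 * \<kappa> * (L * (I1 * blowup a s) - P * M / ?N * I2) = 4 * \<kappa> * I1 * (L * blowup a s) - 4 * \<kappa> * (P * M / ?N * I2)"
      by (simp only: right_diff_distrib mult_ac)
    ultimately show ?thesis by linarith
  qed
  moreover have "4 * \<kappa> * I1 > 0" using \<kappa> I(1) by simp
  ultimately show ?thesis
    using C2 C(2) by (intro exI[of _ "4 * \<kappa> * I1"] conjI exI[of _ C2] allI impI) auto
qed

text \<open>For i = k the height is unrestricted. At heights above 1 the blow-up term is at most 1,
  so its contribution can be absorbed into the negative remainder.\<close>

lemma blowup_le_1: "1 \<le> s \<Longrightarrow> a \<le> 1/2 \<Longrightarrow> blowup a s \<le> 1"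
proof -
  assume s: "1 \<le> s" and a: "a \<le> 1/2"
  have "ln (2 / s) \<le> ln 2" using s by (simp add: divide_le_eq)
  also have "\<dots> \<le> 1" using ln_le_minus_one[of 2] by simp
  finally have "ln (2 / s) \<le> 1" .
  moreover have "1 / s powr (1 - 2 * a) \<le> 1"
    using ge_one_powr_ge_zero[of s "1 - 2 * a"] s a by (simp add: divide_le_eq)
  ultimately show ?thesis by (simp add: blowup_def)
qed

theorem theorem4:
  fixes n :: nat and k :: "'m::finite" and a p q r :: real
    and gS :: "real ^ 'm \<Rightarrow> real" and gT G :: "real \<Rightarrow> real"
    and g :: "real ^ 'm \<Rightarrow> real \<Rightarrow> (real ^ 'm) \<times> real"
    and u :: "(real ^ 'm) \<times> real \<Rightarrow> (real ^ 'm) \<times> real \<Rightarrow> real \<Rightarrow> real"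
  assumes n: "n = CARD('m) + 1" "n \<ge> 3"
    and a: "0 < a" "a \<le> 1/2"
    and p: "p = 1 / (2 * sqrt (real n - 1))"
    and q: "q = 13 / (20 * sqrt (real n - 1))"
    and r: "r = 4 / (5 * sqrt (real n - 1))"
    and g_k: "\<And>y' s. g y' s \<bullet> e_tan k = gS y' * gT s"
    and g_j: "\<And>y' s j. j \<in> Basis \<Longrightarrow> j \<noteq> e_tan k \<Longrightarrow> g y' s \<bullet> j = 0"
    and gS_nonneg: "\<And>y'. gS y' \<ge> 0"
    and gT_nonneg: "\<And>s. gT s \<ge> 0"
    and gS_C3: "C_k 3 gS" "compact (supp gS)" "supp gS \<subseteq> ball 0 1"
    and gT_Cc: "continuous_on UNIV gT" "compact (supp gT)"
    and gT_C1: "gT C1_differentiable_on {0<..<1}"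
    and gT_supp: "supp gT \<subseteq> {1/4..1}"
    and gT_eq: "\<And>s. s \<in> {1/2..1} \<Longrightarrow> gT s = (1 - s) powr a"
    and gS_eq: "\<And>y'. gS y' = (\<Prod>j\<in>UNIV. G (y' $ j))"
    and G_smooth: "\<And>m. (deriv ^^ m) G differentiable_on UNIV"
    and G_even: "\<And>x. G (- x) = G x"
    and G_supp: "supp G \<subseteq> {- r<..<r}"
    and G_one: "\<And>x. \<bar>x\<bar> < p \<Longrightarrow> G x = 1"
    and G_decr: "\<And>x. x > 0 \<Longrightarrow> deriv G x \<le> 0"
    and u: "u = golovkin_solution g"
  shows
    "(\<forall>i. i \<noteq> k \<longrightarrow>
       (\<exists>C\<^sub>1>0. \<exists>C\<^sub>2>0. \<forall>\<alpha>>0. \<forall>\<beta>>0. \<forall>x.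
          snd x > 0 \<and> norm (fst x) \<ge> 3 \<and> fst x $ i \<ge> \<alpha> \<and> fst x $ k \<ge> \<beta> \<and> snd x \<le> 1 \<longrightarrow>
          pd2_exists e_nrm (\<lambda>x. u (e_tan i) x 1) x \<and>
          \<bar>pd e_nrm (pd e_nrm (\<lambda>x. u (e_tan i) x 1)) x\<bar> \<ge>
            (if a = 1/2
             then C\<^sub>1 * \<alpha> * \<beta> / norm (fst x) ^ (n + 2) * ln (2 / snd x)
                    - C\<^sub>2 / norm (fst x) ^ (n - 2)
             else C\<^sub>1 * \<alpha> * \<beta> / (norm (fst x) ^ (n + 2) * snd x powr (1 - 2 * a))
                    - C\<^sub>2 / norm (fst x) ^ (n - 2))))
   \<and>
     (deriv (deriv G) q = 0 \<and>
      (\<forall>x\<in>{p..r}. deriv (deriv G) (2 * q - x) = - deriv (deriv G) x) \<and>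
      (\<forall>x \<in> {p<..<p + 1 / (20 * sqrt (real n - 1))} \<union> {q - 1 / (20 * sqrt (real n - 1))<..<q}.
          deriv (deriv G) x = 0) \<longrightarrow>
       (\<exists>C\<^sub>1>0. \<exists>C\<^sub>2>0. \<forall>x.
          snd x > 0 \<and> norm (fst x) \<ge> 3 \<and>
          (\<bar>fst x $ k\<bar> < p \<or>
           \<bar>fst x $ k\<bar> > r \<and> sqrt (\<Sum>l\<in>UNIV - {k}. (fst x $ l)\<^sup>2) < 3/2) \<longrightarrow>
          pd2_exists e_nrm (\<lambda>x. u (e_tan k) x 1) x \<and>
          \<bar>pd e_nrm (pd e_nrm (\<lambda>x. u (e_tan k) x 1)) x\<bar> \<ge>
            (if a = 1/2
             then C\<^sub>1 / norm (fst x) ^ (n + 2) * ln (2 / snd x)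
                    - C\<^sub>2 / norm (fst x) ^ (n - 2)
             else C\<^sub>1 / (norm (fst x) ^ (n + 2) * snd x powr (1 - 2 * a))
                    - C\<^sub>2 / norm (fst x) ^ (n - 2))))"
proof -
  have m: "CARD('m) \<ge> 2" and n2: "n - 2 = CARD('m) - 1" "n + 2 = CARD('m) + 3" and n1: "real n - 1 = real CARD('m)"
    using n by auto
  have p': "p = 1 / (2 * sqrt (real CARD('m)))" and r': "r = 4 / (5 * sqrt (real CARD('m)))"
    using p r unfolding n1 by auto
  have gS: "gS = pprod G (\<lambda>_. 0)" by (simp add: fun_eq_iff gS_eq pprod_def)
  have "p > 0" using m by (simp add: p')
  then have G0: "G 0 = 1" by (intro G_one) simp
  \<comment> \<open>The sign of G is read off from the product by testing it at a point whose other
    coordinates are 0, where G = 1.\<close>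
  have Gnn: "0 \<le> G s" for s
  proof -
    let ?y = "(\<chi> j. if j = k then s else 0) :: real ^ 'm"
    have "gS ?y = G s * (\<Prod>j\<in>UNIV - {k}. G (?y $ j))" unfolding gS_eq by (subst prod.remove[of _ k]) auto
    also have "(\<Prod>j\<in>UNIV - {k}. G (?y $ j)) = 1" by (intro prod.neutral) (simp add: G0)
    finally show ?thesis using gS_nonneg[of ?y] by simp
  qed
  have blow: "\<exists>C1>0. \<exists>C2>0. \<forall>x s L. norm x \<ge> 3 \<longrightarrow> s > 0 \<longrightarrow>
      pd2_exists e_nrm (\<lambda>x. u (e_tan i) x 1) (x, s) \<and>
      (s \<le> 1 \<longrightarrow> 0 \<le> L \<longrightarrow> L \<le> \<bar>potential (pprod G (incr i (incr k (\<lambda>_. 0)))) x 0\<bar> \<longrightarrow>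
        C1 * (L * blowup a s) - C2 / norm x ^ (CARD('m) - 1) \<le> \<bar>pd e_nrm (pd e_nrm (\<lambda>x. u (e_tan i) x 1)) (x, s)\<bar>)" for i
    unfolding u by (rule golovkin_blowup[OF m G_smooth r' G_supp a gT_Cc(1) gT_supp]) (use gT_eq g_k g_j gS in auto)
  have rhs: "(if a = 1/2 then C / N * ln (2 / s) - d else C / (N * s powr (1 - 2 * a)) - d) = C / N * blowup a s - d"
    for C N s d :: real by (simp add: blowup_def)
  show ?thesis
    unfolding n2 rhs
  proof (intro conjI allI impI)
    fix i :: 'm assume ik: "i \<noteq> k"
    have "\<exists>C>0. \<forall>x::real ^ 'm. norm x \<ge> 3 \<longrightarrow> 0 < x $ i \<longrightarrow> 0 < x $ k \<longrightarrow>
      C * (x $ i * x $ k) / norm x ^ (CARD('m) + 3) \<le> potential (pprod G (incr i (incr k (\<lambda>_. 0)))) x 0"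
      by (rule potential_mixed_lower[OF G_smooth G_even G_supp r' G0 _ Gnn m ik]) (rule G_decr)
    then obtain L where L: "L > 0" "\<And>x::real ^ 'm. norm x \<ge> 3 \<Longrightarrow> 0 < x $ i \<Longrightarrow> 0 < x $ k \<Longrightarrow>
      L * (x $ i * x $ k) / norm x ^ (CARD('m) + 3) \<le> potential (pprod G (incr i (incr k (\<lambda>_. 0)))) x 0"
      by blast
    obtain C1 C2 where C: "C1 > 0" "C2 > 0" "\<And>x s L. norm x \<ge> 3 \<Longrightarrow> s > 0 \<Longrightarrow>
      pd2_exists e_nrm (\<lambda>x. u (e_tan i) x 1) (x, s) \<and>
      (s \<le> 1 \<longrightarrow> 0 \<le> L \<longrightarrow> L \<le> \<bar>potential (pprod G (incr i (incr k (\<lambda>_. 0)))) x 0\<bar> \<longrightarrow>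
        C1 * (L * blowup a s) - C2 / norm x ^ (CARD('m) - 1) \<le> \<bar>pd e_nrm (pd e_nrm (\<lambda>x. u (e_tan i) x 1)) (x, s)\<bar>)"
      using blow[of i] by (elim exE conjE) blast
    show "\<exists>C\<^sub>1>0. \<exists>C\<^sub>2>0. \<forall>\<alpha>>0. \<forall>\<beta>>0. \<forall>x.
          snd x > 0 \<and> norm (fst x) \<ge> 3 \<and> fst x $ i \<ge> \<alpha> \<and> fst x $ k \<ge> \<beta> \<and> snd x \<le> 1 \<longrightarrow>
          pd2_exists e_nrm (\<lambda>x. u (e_tan i) x 1) x \<and>
          \<bar>pd e_nrm (pd e_nrm (\<lambda>x. u (e_tan i) x 1)) x\<bar> \<ge>
            C\<^sub>1 * \<alpha> * \<beta> / norm (fst x) ^ (CARD('m) + 3) * blowup a (snd x) - C\<^sub>2 / norm (fst x) ^ (CARD('m) - 1)"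
    proof (intro exI conjI allI impI; (elim conjE)?)
      show "C1 * L > 0" "C2 > 0" using C L by auto
      fix \<alpha> \<beta> :: real and x :: "(real ^ 'm) \<times> real"
      assume \<alpha>\<beta>: "\<alpha> > 0" "\<beta> > 0" and x: "snd x > 0" "norm (fst x) \<ge> 3" "fst x $ i \<ge> \<alpha>" "fst x $ k \<ge> \<beta>" "snd x \<le> 1"
      let ?N = "norm (fst x) ^ (CARD('m) + 3)"
      \<comment> \<open>The bound with x_i x_k is weakened to \<alpha> \<beta>, so the constants
        depend on neither parameter.\<close>
      have "L * (\<alpha> * \<beta>) / ?N \<le> L * (fst x $ i * fst x $ k) / ?N"
        using \<alpha>\<beta> x L(1) by (intro divide_right_mono mult_left_mono mult_mono) auto
      also have "\<dots> \<le> potential (pprod G (incr i (incr k (\<lambda>_. 0)))) (fst x) 0" using \<alpha>\<beta> x by (intro L(2)) auto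
      finally have "L * (\<alpha> * \<beta>) / ?N \<le> \<bar>potential (pprod G (incr i (incr k (\<lambda>_. 0)))) (fst x) 0\<bar>" by simp
      moreover have "0 \<le> L * (\<alpha> * \<beta>) / ?N" using L(1) \<alpha>\<beta> by simp
      ultimately show "C1 * L * \<alpha> * \<beta> / ?N * blowup a (snd x) - C2 / norm (fst x) ^ (CARD('m) - 1)
          \<le> \<bar>pd e_nrm (pd e_nrm (\<lambda>x. u (e_tan i) x 1)) x\<bar>"
        using C(3)[OF x(2,1), of "L * (\<alpha> * \<beta>) / ?N"] x(5) by (simp add: mult.assoc)
      show "pd2_exists e_nrm (\<lambda>x. u (e_tan i) x 1) x" using C(3)[OF x(2,1)] by simp
    qed
  next
    have "\<exists>C>0. \<forall>x::real ^ 'm. norm x \<ge> 3 \<longrightarrow>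
       (\<bar>x $ k\<bar> < p \<or> \<bar>x $ k\<bar> > r \<and> sqrt (\<Sum>l\<in>UNIV - {k}. (x $ l)\<^sup>2) < 3 / 2) \<longrightarrow>
       C / norm x ^ (CARD('m) + 3) \<le> \<bar>potential (pprod G (incr k (incr k (\<lambda>_. 0)))) x 0\<bar>"
      by (rule potential_pure_lower[OF G_smooth G_even G_supp r' G0 _ Gnn m p']) (rule G_decr)
    then obtain L where L: "L > 0" "\<And>x::real ^ 'm. norm x \<ge> 3 \<Longrightarrow>
       (\<bar>x $ k\<bar> < p \<or> \<bar>x $ k\<bar> > r \<and> sqrt (\<Sum>l\<in>UNIV - {k}. (x $ l)\<^sup>2) < 3 / 2) \<Longrightarrow>
       L / norm x ^ (CARD('m) + 3) \<le> \<bar>potential (pprod G (incr k (incr k (\<lambda>_. 0)))) x 0\<bar>"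
      by blast
    obtain C1 C2 where C: "C1 > 0" "C2 > 0" "\<And>x s L. norm x \<ge> 3 \<Longrightarrow> s > 0 \<Longrightarrow>
      pd2_exists e_nrm (\<lambda>x. u (e_tan k) x 1) (x, s) \<and>
      (s \<le> 1 \<longrightarrow> 0 \<le> L \<longrightarrow> L \<le> \<bar>potential (pprod G (incr k (incr k (\<lambda>_. 0)))) x 0\<bar> \<longrightarrow>
        C1 * (L * blowup a s) - C2 / norm x ^ (CARD('m) - 1) \<le> \<bar>pd e_nrm (pd e_nrm (\<lambda>x. u (e_tan k) x 1)) (x, s)\<bar>)"
      using blow[of k] by (elim exE conjE) blast
    show "\<exists>C\<^sub>1>0. \<exists>C\<^sub>2>0. \<forall>x.
          snd x > 0 \<and> norm (fst x) \<ge> 3 \<and>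
          (\<bar>fst x $ k\<bar> < p \<or>
           \<bar>fst x $ k\<bar> > r \<and> sqrt (\<Sum>l\<in>UNIV - {k}. (fst x $ l)\<^sup>2) < 3/2) \<longrightarrow>
          pd2_exists e_nrm (\<lambda>x. u (e_tan k) x 1) x \<and>
          \<bar>pd e_nrm (pd e_nrm (\<lambda>x. u (e_tan k) x 1)) x\<bar> \<ge>
            C\<^sub>1 / norm (fst x) ^ (CARD('m) + 3) * blowup a (snd x) - C\<^sub>2 / norm (fst x) ^ (CARD('m) - 1)"
    proof (intro exI conjI allI impI; (elim conjE)?)
      \<comment> \<open>Enlarging C2 by C1 * L makes the claimed lower bound at most 0 at heights
        above 1, because |x|^(-n-2) \<le> |x|^(2-n).\<close>
      show "C1 * L > 0" "C2 + C1 * L > 0" using C L by (auto simp: add_pos_pos)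
      fix x :: "(real ^ 'm) \<times> real"
      assume x: "snd x > 0" "norm (fst x) \<ge> 3" and xk: "\<bar>fst x $ k\<bar> < p \<or>
           \<bar>fst x $ k\<bar> > r \<and> sqrt (\<Sum>l\<in>UNIV - {k}. (fst x $ l)\<^sup>2) < 3/2"
      let ?N = "norm (fst x) ^ (CARD('m) + 3)" and ?N' = "norm (fst x) ^ (CARD('m) - 1)"
      have CL: "0 \<le> C1 * L" using C L by simp
      have N: "0 \<le> L / ?N" "0 \<le> C1 * L / ?N'" using L CL by auto
      have s: "(C2 + C1 * L) / ?N' = C2 / ?N' + C1 * L / ?N'" by (rule add_divide_distrib)
      show "pd2_exists e_nrm (\<lambda>x. u (e_tan k) x 1) x" using C(3)[OF x(2,1)] by simp
      show "C1 * L / ?N * blowup a (snd x) - (C2 + C1 * L) / ?N' \<le> \<bar>pd e_nrm (pd e_nrm (\<lambda>x. u (e_tan k) x 1)) x\<bar>"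
      proof (cases "snd x \<le> 1")
        case True
        have "C1 * (L / ?N * blowup a (snd x)) - C2 / ?N' \<le> \<bar>pd e_nrm (pd e_nrm (\<lambda>x. u (e_tan k) x 1)) x\<bar>"
          using C(3)[OF x(2,1), of "L / ?N"] True N(1) L(2)[OF x(2) xk] by simp
        moreover have "C1 * (L / ?N * blowup a (snd x)) = C1 * L / ?N * blowup a (snd x)" by simp
        ultimately show ?thesis using N(2) unfolding s by linarith
      next
        case False
        have "C1 * L / ?N * blowup a (snd x) \<le> C1 * L / ?N * 1"
          using CL False a by (intro mult_left_mono blowup_le_1) auto
        also have "\<dots> \<le> C1 * L / ?N'"
          using CL x(2) by (simp only: mult_1_right) (intro divide_left_mono power_increasing mult_pos_pos zero_less_power; linarith)
        also have "\<dots> \<le> (C2 + C1 * L) / ?N'" using C(2) by (intro divide_right_mono) auto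
        finally show ?thesis by linarith
      qed
    qed
  qed
qed

end
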